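(* Let $n\ge2$. (a) There exists a constant $c_n>0$ depending only on $n$ and a constant $A$ independent of $f$ and $r$ such that for every $r>n$ and every $f\in B^{n/r}_{r,n}$ with $0<|\operatorname{supp} f|<\infty$, $$\frac{1}{|\operatorname{supp} f|}\int_{\mathbb{R}^n}\Big[\exp\Big(\Big(c_n\frac{|f(x)|}{(1-\frac nr)^{1/n}\|f\|_{B^{n/r}_{r,n}}}\Big)^{n'}\Big)-1\Big]dx\le A.$$ (b) For every $r_0>n$ there is a constant $\tilde c>0$ depending only on $n$ and $r_0$ such that for every $r\in(n,r_0)$ and every $f\in W^1_n$ with $0<|\operatorname{supp}f|<\infty$, $$\int_{\mathbb{R}^n}\Big[\exp\Big(\Big(\tilde c\frac{|f(x)|}{\|\nabla f\|_{L^n}}\Big)^{n'}\Big)-1\Big]dx\le\int_{\mathbb{R}^n}\Big[\exp\Big(\Big(c_n\frac{|f(x)|}{(1-\frac nr)^{1/n}\|f\|_{B^{n/r}_{r,n}}}\Big)^{n'}\Big)-1\Big]dx.$$ (c) For every $f\in C^2_c(\mathbb{R}^n)$ not identically zero, $$\lim_{r\to n+}\int_{\mathbb{R}^n}\Big[\exp\Big(\Big(c_n\frac{|f(x)|}{(1-\frac nr)^{1/n}\|f\|_{B^{n/r}_{r,n}}}\Big)^{n'}\Big)-1\Big]dx=\int_{\mathbb{R}^n}\Big[\exp\Big(\Big(\frac{n^{1/n}c_n}{\gamma_n}\frac{|f(x)|}{\|\nabla f\|_{L^n}}\Big)^{n'}\Big)-1\Big]dx,$$ where $\gamma_n=\b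ig(\frac{\alpha_{n,n}}{2n\omega_n}\big)^{1/n}$.
   Context: $n'=n/(n-1)$, $\omega_n=|B^n|$, $\Delta_hf(x)=f(x+h)-f(x)$, $\omega(f,t)_p=\big(\frac{1}{t^n\omega_n}\int_{|h|<t}\|\Delta_hf\|_{L^p}^pdh\big)^{1/p}$, and $B^s_{p,q}$ is the set of $f\in L^p(\mathbb{R}^n)$ with $\|f\|_{B^s_{p,q}}=(\int_0^\infty t^{-sq}\omega(f,t)_p^q\frac{dt}{t})^{1/q}<\infty$. $\alpha_{n,p}=\int_{\mathbb{S}^{n-1}}|e\cdot\xi|^p\,d\sigma(\xi)$ for any $e\in\mathbb{S}^{n-1}$, $\sigma$ the surface measure on $\mathbb{S}^{n-1}$. *)

theory Defs
  imports "HOL-Analysis.Analysis"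
begin

definition Lp_pow :: "real \<Rightarrow> ('a::euclidean_space \<Rightarrow> real) \<Rightarrow> ennreal" where
  "Lp_pow p f = (\<integral>\<^sup>+ x. ennreal (\<bar>f x\<bar> powr p) \<partial>lebesgue)"

definition in_Lp :: "real \<Rightarrow> ('a::euclidean_space \<Rightarrow> real) \<Rightarrow> bool" where
  "in_Lp p f \<longleftrightarrow> f \<in> borel_measurable lebesgue \<and> Lp_pow p f < \<infinity>"

definition Lp_norm :: "real \<Rightarrow> ('a::euclidean_space \<Rightarrow> real) \<Rightarrow> real" where
  "Lp_norm p f = enn2real (Lp_pow p f) powr (1 / p)"

definition ball_vol :: "'a::euclidean_space itself \<Rightarrow> real" where
  "ball_vol _ = measure lborel (ball (0::'a) 1)"

definition diff_op :: "'a::euclidean_space \<Rightarrow> ('a \<Rightarrow> real) \<Rightarrow> 'a \<Rightarrow> real" where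
  "diff_op h f x = f (x + h) - f x"

definition modulus :: "real \<Rightarrow> ('a::euclidean_space \<Rightarrow> real) \<Rightarrow> real \<Rightarrow> real" where
  "modulus p f t =
     (1 / (t ^ DIM('a) * ball_vol TYPE('a)) *
      enn2real (\<integral>\<^sup>+ h \<in> ball (0::'a) t. ennreal (Lp_norm p (diff_op h f) powr p) \<partial>lebesgue))
     powr (1 / p)"

definition besov_pow :: "real \<Rightarrow> real \<Rightarrow> real \<Rightarrow> ('a::euclidean_space \<Rightarrow> real) \<Rightarrow> ennreal" where
  "besov_pow s p q f =
     (\<integral>\<^sup>+ t \<in> {0<..}. ennreal (t powr (- s * q) * modulus p f t powr q / t) \<partial>lborel)"

definition in_Besov :: "real \<Rightarrow> real \<Rightarrow> real \<Rightarrow> ('a::euclidean_space \<Rightarrow> real) \<Rightarrow> bool" where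
  "in_Besov s p q f \<longleftrightarrow> in_Lp p f \<and> besov_pow s p q f < \<infinity>"

definition besov_norm :: "real \<Rightarrow> real \<Rightarrow> real \<Rightarrow> ('a::euclidean_space \<Rightarrow> real) \<Rightarrow> real" where
  "besov_norm s p q f = enn2real (besov_pow s p q f) powr (1 / q)"

text \<open>classical gradient (unique where f is differentiable)\<close>
definition grad :: "('a::euclidean_space \<Rightarrow> real) \<Rightarrow> 'a \<Rightarrow> 'a" where
  "grad f x = (SOME v. (f has_derivative (\<lambda>h. v \<bullet> h)) (at x))"

fun Ck :: "nat \<Rightarrow> ('a::euclidean_space \<Rightarrow> real) set" where
  "Ck 0 = {f. continuous_on UNIV f}"
| "Ck (Suc k) = {f. (\<forall>x. f differentiable (at x)) \<and>
                    (\<forall>i\<in>Basis. (\<lambda>x. grad f x \<bullet> i) \<in> Ck k)}"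

definition smooth :: "('a::euclidean_space \<Rightarrow> real) \<Rightarrow> bool" where
  "smooth f \<longleftrightarrow> (\<forall>k. f \<in> Ck k)"

definition compact_supp :: "('a::euclidean_space \<Rightarrow> real) \<Rightarrow> bool" where
  "compact_supp f \<longleftrightarrow> compact (closure {x. f x \<noteq> 0})"

definition C2c :: "('a::euclidean_space \<Rightarrow> real) set" where
  "C2c = {f. f \<in> Ck 2 \<and> compact_supp f}"

definition weak_grad :: "('a::euclidean_space \<Rightarrow> real) \<Rightarrow> ('a \<Rightarrow> 'a) \<Rightarrow> bool" where
  "weak_grad f g \<longleftrightarrow>
     (\<forall>i\<in>Basis. \<forall>K. compact K \<longrightarrow> set_integrable lebesgue K (\<lambda>x. g x \<bullet> i)) \<and>
     (\<forall>\<phi>. smooth \<phi> \<and> compact_supp \<phi> \<longrightarrow>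
        (\<forall>i\<in>Basis. (LINT x|lebesgue. f x * (grad \<phi> x \<bullet> i))
                   = - (LINT x|lebesgue. (g x \<bullet> i) * \<phi> x)))"

definition in_W1 :: "real \<Rightarrow> ('a::euclidean_space \<Rightarrow> real) \<Rightarrow> bool" where
  "in_W1 p f \<longleftrightarrow> in_Lp p f \<and>
     (\<exists>g. weak_grad f g \<and> (\<integral>\<^sup>+ x. ennreal (norm (g x) powr p) \<partial>lebesgue) < \<infinity>)"

text \<open>L^p norm of the (weak) gradient; weak gradients agree a.e., so this is well defined\<close>
definition grad_norm :: "real \<Rightarrow> ('a::euclidean_space \<Rightarrow> real) \<Rightarrow> real" where
  "grad_norm p f = enn2real (\<integral>\<^sup>+ x. ennreal (norm ((SOME g. weak_grad f g) x) powr p) \<partial>lebesgue)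
                   powr (1 / p)"

text \<open>surface measure via the cone construction: sigma(A) = n * |{t xi : 0<t<=1, xi in A}|\<close>
definition sphere_measure :: "'a::euclidean_space measure" where
  "sphere_measure = scale_measure (of_nat DIM('a))
     (distr (restrict_space lebesgue (ball 0 1 - {0})) borel (\<lambda>x. x /\<^sub>R norm x))"

definition alpha :: "'a::euclidean_space itself \<Rightarrow> real \<Rightarrow> real" where
  "alpha _ p = (LINT \<xi>|(sphere_measure :: 'a measure). \<bar>(SOME e::'a. e \<in> Basis) \<bullet> \<xi>\<bar> powr p)"

definition gamma_const :: "'a::euclidean_space itself \<Rightarrow> real" where
  "gamma_const T = (alpha T (real DIM('a)) / (2 * real DIM('a) * ball_vol T)) powr (1 / real DIM('a))"

definition conj_exp :: "real \<Rightarrow> real" where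
  "conj_exp n = n / (n - 1)"

definition besov_MT :: "real \<Rightarrow> real \<Rightarrow> ('a::euclidean_space \<Rightarrow> real) \<Rightarrow> ennreal" where
  "besov_MT c r f = (let n = real DIM('a) in
     \<integral>\<^sup>+ x. ennreal (exp ((c * \<bar>f x\<bar> / ((1 - n / r) powr (1 / n) * besov_norm (n / r) r n f))
                         powr conj_exp n) - 1) \<partial>lebesgue)"

definition sobolev_MT :: "real \<Rightarrow> ('a::euclidean_space \<Rightarrow> real) \<Rightarrow> ennreal" where
  "sobolev_MT c f = (let n = real DIM('a) in
     \<integral>\<^sup>+ x. ennreal (exp ((c * \<bar>f x\<bar> / grad_norm n f) powr conj_exp n) - 1) \<partial>lebesgue)"

end

theory Submission
  imports Defs
begin

text \<open>
  Write \<open>N\<close> for the Besov norm. For (a), let \<open>\<lambda> k\<close> be the value above which \<open>\<bar>f\<bar>\<close> lies on a set of measure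
  \<open>2\<^bsup>-kn\<^esup>\<close> times that of the support. Slicing \<open>\<bar>f\<bar>\<close> at these levels, each slice lives on a set that is
  small compared with a ball of radius about \<open>2\<^bsup>-k\<^esup>\<close>, hence oscillates at that scale by its full
  height. Summing over scales with Hoelder weights gives
  \<open>\<Sum>k. (\<lambda> (k+1) - \<lambda> k)\<^bsup>n\<^esup> \<le> C (1 - n/r) N\<^bsup>n\<^esup>\<close>, so \<open>\<lambda> k \<le> C' k\<^bsup>1/n'\<^esup> (1 - n/r)\<^bsup>1/n\<^esup> N\<close>, which is
  the exponential integrability.

  For (b) it suffices that \<open>(1 - n/r) N\<^bsup>n\<^esup>\<close> is bounded by a constant times the integral of \<open>\<bar>\<nabla>f\<bar>\<^bsup>n\<^esup>\<close>. Differences of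
  \<open>f\<close> are dominated by ball averages of \<open>\<bar>\<nabla>f\<bar>\<close> over dyadically shrinking radii. At radius \<open>t\<close> the
  gradient is split into its largest values, carried by a set of measure \<open>t\<^bsup>n\<^esup>\<close>, for which the
  average is bounded from L1 to Lr, and the rest, for which averaging contracts Lr; integrating over
  \<open>t\<close> yields the factor \<open>1 / (1 - n/r)\<close>.

  For (c), dominated convergence shows that the modulus of continuity, divided by \<open>t\<close>, converges
  jointly as \<open>(r, t) \<rightarrow> (n, 0+)\<close>. The weight \<open>(1 - n/r) t\<^bsup>n(1 - n/r) - 1\<^esup>\<close> concentrates at \<open>t = 0\<close> with
  mass \<open>1/n\<close>, which identifies the limit of \<open>(1 - n/r) N\<^bsup>n\<^esup>\<close>; then dominated convergence applies
  again.
\<close>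

subsection \<open>Powers of extended nonnegative reals and weighted Hoelder inequalities\<close>

text \<open>The factor \<open>1 - n / r\<close> in (a) has a single source. For smoothness
  \<open>n / r\<close> measured in \<open>L^r\<close>, a slice seen at a scale \<open>2 ^ m\<close>
  times finer than its own loses only \<open>w ^ m\<close> with
  \<open>w = 2 powr (- (r - n))\<close>, and \<open>w\<close> tends to 1 as r decreases to n. Every
  slice is therefore felt on about \<open>1 / (1 - w)\<close> finer scales and counted that often by
  the Besov norm, while \<open>1 - w\<close> is comparable to \<open>r - n\<close> near n. The
  constant \<open>c_n\<close> is fixed so that the exponent at the \<open>k\<close>-th level is at
  most \<open>k / 2\<close>; then \<open>exp (k / 2) \<le> 2 ^ k\<close> is beaten by the measure of
  the superlevel set, because n is at least 2. The obstacle in (b) is that the norms are real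
  numbers obtained by \<open>enn2real\<close>, which sends infinity to 0, and that division by 0
  yields 0: an infinite or vanishing Besov norm would turn the right side into 0. Powers and
  integrals are therefore estimated in \<open>ennreal\<close>, and finiteness and positivity of the
  norm are proved on their own, positivity by the level estimate behind (a).\<close>

definition epow :: "ennreal \<Rightarrow> real \<Rightarrow> ennreal" where
  "epow x p = (if x = \<infinity> then \<infinity> else ennreal (enn2real x powr p))"

lemma epow_ennreal: "x \<ge> 0 \<Longrightarrow> epow (ennreal x) p = ennreal (x powr p)"
  by (simp add: epow_def)

lemma epow_top [simp]: "epow \<infinity> p = \<infinity>" "epow top p = top"
  by (auto simp: epow_def)

text \<open>Valid for every \<open>p\<close>, including \<open>p = 0\<close>, because
  \<open>0 powr p\<close> is 0 in all cases.\<close>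

lemma epow_0 [simp]: "epow 0 p = 0"
  by (simp add: epow_def)

lemma epow_1 [simp]: "epow x 1 = x"
  by (cases x rule: ennreal_cases) (auto simp: epow_def)

lemma epow_one [simp]: "epow 1 p = 1"
  by (simp add: epow_def)

lemma epow_mono: "x \<le> y \<Longrightarrow> p \<ge> 0 \<Longrightarrow> epow x p \<le> epow y p"
  by (cases x rule: ennreal_cases; cases y rule: ennreal_cases)
     (auto simp: epow_def powr_mono2 top_unique)

lemma borel_measurable_epow [measurable (raw)]:
  assumes [measurable]: "f \<in> borel_measurable M"
  shows "(\<lambda>x. epow (f x) p) \<in> borel_measurable M"
  unfolding epow_def by measurable

lemma epow_eq_0_iff: "epow x p = 0 \<longleftrightarrow> x = 0"
  by (cases x rule: ennreal_cases) (auto simp: epow_def)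

lemma epow_eq_top_iff: "epow x p = \<infinity> \<longleftrightarrow> x = \<infinity>"
  by (cases x rule: ennreal_cases) (auto simp: epow_def)

lemma epow_mult: "p > 0 \<Longrightarrow> epow (x * y) p = epow x p * epow y p"
  by (cases x rule: ennreal_cases; cases y rule: ennreal_cases)
     (auto simp: epow_ennreal powr_mult ennreal_mult[symmetric] ennreal_mult_top ennreal_top_mult
      epow_eq_0_iff)

lemma epow_epow: "p > 0 \<Longrightarrow> epow (epow x p) q = epow x (p * q)"
  by (cases x rule: ennreal_cases) (auto simp: epow_ennreal powr_powr)

lemma epow_add: "epow x p * epow x q = epow x (p + q)"
  by (cases x rule: ennreal_cases)
     (auto simp: epow_ennreal powr_add ennreal_mult[symmetric] ennreal_mult_top)

text \<open>After division by \<open>x + y\<close> both fractions lie in [0, 1], where raising to a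
  power \<open>q \<le> 1\<close> can only increase a number.\<close>

lemma powr_subadditive:
  fixes x y q :: real
  assumes "x \<ge> 0" "y \<ge> 0" "0 < q" "q \<le> 1"
  shows "(x + y) powr q \<le> x powr q + y powr q"
proof (cases "x + y = 0")
  case False
  then have s: "x + y > 0" using assms by linarith
  have u: "a / (x + y) \<le> (a / (x + y)) powr q" if "0 \<le> a" "a \<le> x + y" for a
    using powr_mono'[of q 1 "a / (x+y)"] that s assms by (cases "a = 0") auto
  have "1 = x / (x + y) + y / (x + y)" using s by (simp add: add_divide_distrib[symmetric])
  also have "\<dots> \<le> (x / (x + y)) powr q + (y / (x + y)) powr q"
    using u[of x] u[of y] assms by auto
  also have "\<dots> = (x powr q + y powr q) / (x + y) powr q"
    using assms s by (simp add: powr_divide add_divide_distrib)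
  finally show ?thesis using s by (simp add: field_simps)
qed (use assms in auto)

lemma epow_add_le: "0 < q \<Longrightarrow> q \<le> 1 \<Longrightarrow> epow (x + y) q \<le> epow x q + epow y q"
  by (cases x rule: ennreal_cases; cases y rule: ennreal_cases)
     (auto simp: epow_ennreal powr_subadditive ennreal_plus[symmetric] simp del: ennreal_plus)

lemma epow_sum_le:
  assumes "0 < q" "q \<le> 1"
  shows "epow (\<Sum>i\<in>I. x i) q \<le> (\<Sum>i\<in>I. epow (x i) q)"
proof (induction I rule: infinite_finite_induct)
  case (insert a I)
  then show ?case
    using order_trans[OF epow_add_le[OF assms]] by (simp add: add_left_mono)
qed auto

text \<open>Taking the \<open>p\<close>-th root of the bound turns it into a bound on every
  \<open>x i\<close> and hence on the supremum. This replaces continuity of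
  \<open>epow\<close>.\<close>

lemma epow_SUP_le:
  assumes "p > 0" "\<And>i. x i \<le> x (Suc i)" "\<And>i. epow (x i) p \<le> B"
  shows "epow (SUP i. x i) p \<le> B"
proof -
  have "x i \<le> epow B (1/p)" for i
    using epow_mono[OF assms(3)[of i], of "1/p"] assms(1) by (simp add: epow_epow)
  then have "(SUP i. x i) \<le> epow B (1/p)" by (rule SUP_least)
  from epow_mono[OF this, of p] show ?thesis using assms(1) by (simp add: epow_epow)
qed

lemma epow_suminf_le:
  assumes "0 < q" "q \<le> 1"
  shows "epow (\<Sum>i. x i) q \<le> (\<Sum>i. epow (x i) q)"
  unfolding suminf_eq_SUP[of x]
proof (rule epow_SUP_le[OF assms(1)])
  show "epow (sum x {..<i}) q \<le> (\<Sum>i. epow (x i) q)" for i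
    using order_trans[OF epow_sum_le[OF assms] sum_le_suminf] by auto
qed auto

lemma epow_add_le2:
  assumes "p \<ge> 1"
  shows "epow (x + y) p \<le> ennreal (2 powr p) * (epow x p + epow y p)"
proof -
  have "x + y \<le> 2 * max x y"
    by (metis add_mono max.cobounded1 max.cobounded2 mult_2)
  then have "epow (x + y) p \<le> epow (2 * max x y) p" by (rule epow_mono) (use assms in auto)
  also have "\<dots> = ennreal (2 powr p) * epow (max x y) p"
    using assms epow_mult[of p 2] epow_ennreal[of 2 p] by simp
  also have "epow (max x y) p \<le> epow x p + epow y p"
    by (auto simp: max_def add_increasing add_increasing2)
  finally show ?thesis by (simp add: mult_left_mono)
qed

text \<open>Convexity: \<open>a powr p\<close> lies above its tangent at \<open>c\<close>. The point
  \<open>c\<close> stays free, since Hoelder's inequality is obtained from it by a choice of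
  \<open>c\<close>.\<close>

lemma powr_tangent:
  fixes a c p :: real
  assumes "a \<ge> 0" "c > 0" "p \<ge> 1"
  shows "p * c powr (p - 1) * a \<le> a powr p + (p - 1) * c powr p"
proof (cases "a = 0")
  case False
  have "a powr p - c powr p \<ge> (p * c powr (p - 1)) * (a - c)"
    using assms False
    by (intro convex_on_imp_above_tangent[where A = "{0<..}"] powr_convex)
       (auto intro!: derivative_eq_intros simp: interior_open)
  moreover have "c * (p * c powr (p - 1)) = p * c powr p"
    using assms by (simp add: powr_diff)
  ultimately show ?thesis by (simp add: algebra_simps)
qed (use assms in auto)

lemma epow_tangent:
  assumes "c > 0" "p \<ge> 1"
  shows "ennreal (p * c powr (p - 1)) * y \<le> epow y p + ennreal ((p - 1) * c powr p)"
proof (cases y rule: ennreal_cases)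
  case (real a)
  then show ?thesis
    using powr_tangent[of a c p] assms
    by (simp add: epow_ennreal ennreal_mult[symmetric] ennreal_plus[symmetric] del: ennreal_plus)
qed simp

text \<open>Hoelder's inequality, that is, Jensen's inequality for a weight of arbitrary mass. The
  tangent inequality is integrated against \<open>w\<close>, and the point of tangency is then
  placed at the weighted mean of \<open>f\<close>. The argument runs in \<open>ennreal\<close>
  without integrability conditions.\<close>

lemma epow_nn_integral_le:
  fixes f w :: "'x \<Rightarrow> ennreal"
  assumes [measurable]: "f \<in> borel_measurable M" "w \<in> borel_measurable M" and p: "p > 1"
  shows "epow (\<integral>\<^sup>+x. f x * w x \<partial>M) p
    \<le> (\<integral>\<^sup>+x. epow (f x) p * w x \<partial>M) * epow (\<integral>\<^sup>+x. w x \<partial>M) (p - 1)"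
proof -
  define S W Q where "S = (\<integral>\<^sup>+x. f x * w x \<partial>M)" and "W = (\<integral>\<^sup>+x. w x \<partial>M)"
    and "Q = (\<integral>\<^sup>+x. epow (f x) p * w x \<partial>M)"
  have tang: "ennreal (p * c powr (p - 1)) * S \<le> Q + ennreal ((p - 1) * c powr p) * W"
    if "c > 0" for c
  proof -
    have "ennreal (p * c powr (p - 1)) * S = (\<integral>\<^sup>+x. ennreal (p * c powr (p - 1)) * f x * w x \<partial>M)"
      unfolding S_def by (simp add: nn_integral_cmult mult.assoc)
    also have "\<dots> \<le> (\<integral>\<^sup>+x. (epow (f x) p + ennreal ((p - 1) * c powr p)) * w x \<partial>M)"
      using that p by (intro nn_integral_mono mult_right_mono epow_tangent) auto
    also have "\<dots> = Q + ennreal ((p - 1) * c powr p) * W"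
      unfolding Q_def W_def by (simp add: distrib_right nn_integral_add nn_integral_cmult)
    finally show ?thesis .
  qed
  have S0: "S = 0" if "Q = 0"
  proof -
    have "AE x in M. epow (f x) p * w x = 0"
      using that unfolding Q_def by (subst (asm) nn_integral_0_iff_AE) auto
    then have "AE x in M. f x * w x = 0" by (auto simp: epow_eq_0_iff)
    then show ?thesis unfolding S_def by (subst nn_integral_0_iff_AE) auto
  qed
  have S0': "S = 0" if "W = 0"
  proof -
    have "AE x in M. w x = 0"
      using that unfolding W_def by (subst (asm) nn_integral_0_iff_AE) auto
    then have "AE x in M. f x * w x = 0" by auto
    then show ?thesis unfolding S_def by (subst nn_integral_0_iff_AE) auto
  qed
  have "epow S p \<le> Q * epow W (p - 1)"
  \<comment> \<open>If \<open>Q\<close> or \<open>W\<close> vanishes then so does \<open>S\<close>,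
    so a product of 0 and infinity on the right does no harm.\<close>
  proof (cases "S = 0 \<or> Q = 0 \<or> W = 0 \<or> Q = \<infinity> \<or> W = \<infinity>")
    case True
    then show ?thesis
      using S0 S0' by (auto simp: ennreal_mult_top ennreal_top_mult epow_eq_0_iff)
  next
    case False
    then obtain q v where q: "Q = ennreal q" "q > 0" and v: "W = ennreal v" "v > 0"
      by (cases Q rule: ennreal_cases; cases W rule: ennreal_cases) (auto simp: less_le)
    \<comment> \<open>The tangent at the arbitrary point 1 already bounds \<open>S\<close> by finite
      quantities.\<close>
    have "S \<noteq> \<infinity>"
      using tang[of 1] q v p by (auto simp: ennreal_mult_top ennreal_mult[symmetric] top_unique
        ennreal_plus[symmetric] simp del: ennreal_plus)
    then obtain s where s: "S = ennreal s" "s > 0"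
      using False by (cases S rule: ennreal_cases) (auto simp: less_le)
    \<comment> \<open>The weighted mean of \<open>f\<close>, where the tangent inequality becomes
      Hoelder's inequality.\<close>
    define c where "c = s / v"
    have c: "c > 0" using s v by (simp add: c_def)
    have "p * c powr (p - 1) * s \<le> q + (p - 1) * c powr p * v"
      using tang[OF c] p unfolding s q v
      using s q v c by (simp add: ennreal_mult[symmetric] ennreal_plus[symmetric] del: ennreal_plus)
    moreover have "c powr (p - 1) * s = c powr p * v"
      using c s v by (simp add: c_def powr_diff field_simps)
    ultimately have "c powr p * v \<le> q" by (simp add: algebra_simps)
    moreover have "c powr p * v * v powr (p - 1) = s powr p"
      using s v by (simp add: c_def powr_divide powr_diff)
    ultimately have "s powr p \<le> q * v powr (p - 1)"
      by (metis mult_right_mono powr_ge_zero)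
    then show ?thesis
      using s q v by (simp add: epow_ennreal ennreal_mult[symmetric])
  qed
  then show ?thesis unfolding S_def Q_def W_def .
qed

lemma epow_suminf_weighted:
  fixes x w :: "nat \<Rightarrow> ennreal"
  assumes p: "p > 1"
  shows "epow (\<Sum>j. x j * w j) p \<le> (\<Sum>j. epow (x j) p * w j) * epow (\<Sum>j. w j) (p - 1)"
  using epow_nn_integral_le[of x "count_space UNIV" w p] p by (simp add: nn_integral_count_space_nat)

lemma powr_sum_weighted:
  fixes x w :: "nat \<Rightarrow> real"
  assumes p: "p > 1" and "\<And>j. j \<in> J \<Longrightarrow> x j \<ge> 0" "\<And>j. j \<in> J \<Longrightarrow> w j \<ge> 0" and "finite J"
  shows "(\<Sum>j\<in>J. x j * w j) powr p \<le> (\<Sum>j\<in>J. x j powr p * w j) * (\<Sum>j\<in>J. w j) powr (p - 1)"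
proof -
  have "epow (\<Sum>j\<in>J. ennreal (x j * w j)) p
      \<le> (\<Sum>j\<in>J. ennreal (x j powr p * w j)) * epow (\<Sum>j\<in>J. ennreal (w j)) (p - 1)"
    using epow_nn_integral_le[of "\<lambda>j. ennreal (x j)" "count_space J" "\<lambda>j. ennreal (w j)" p] assms
    by (simp add: nn_integral_count_space_finite epow_ennreal ennreal_mult[symmetric] cong: sum.cong)
  then show ?thesis
    using assms
    by (simp add: sum_ennreal epow_ennreal sum_nonneg ennreal_mult[symmetric])
qed

section \<open>Lebesgue integrals under translations and dilations\<close>

lemma nn_integral_lborel_translate:
  fixes f :: "'a::euclidean_space \<Rightarrow> ennreal"
  assumes [measurable]: "f \<in> borel_measurable borel"
  shows "(\<integral>\<^sup>+x. f (x + h) \<partial>lborel) = (\<integral>\<^sup>+x. f x \<partial>lborel)"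
proof -
  have "(\<integral>\<^sup>+x. f x \<partial>lborel) = (\<integral>\<^sup>+x. f x \<partial>distr lborel borel ((+) h))"
    by (simp only: lborel_distr_plus)
  also have "\<dots> = (\<integral>\<^sup>+x. f (x + h) \<partial>lborel)"
    by (subst nn_integral_distr) (auto simp: add.commute)
  finally show ?thesis by simp
qed

lemma nn_integral_lborel_scale:
  fixes f :: "'a::euclidean_space \<Rightarrow> ennreal"
  assumes [measurable]: "f \<in> borel_measurable borel" and c: "c \<noteq> 0"
  shows "(\<integral>\<^sup>+x. f x \<partial>lborel) = ennreal (\<bar>c\<bar> ^ DIM('a)) * (\<integral>\<^sup>+x. f (c *\<^sub>R x) \<partial>lborel)"
proof -
  have "(\<integral>\<^sup>+x. f x \<partial>lborel)
      = (\<integral>\<^sup>+x. f x \<partial>density (distr lborel borel (\<lambda>x. 0 + c *\<^sub>R x)) (\<lambda>_. \<bar>c\<bar>^DIM('a)))"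
    using lborel_affine[OF c, of "0::'a"] by simp
  also have "\<dots> = (\<integral>\<^sup>+x. ennreal (\<bar>c\<bar> ^ DIM('a)) * f (c *\<^sub>R x) \<partial>lborel)"
    by (subst nn_integral_density) (auto simp: nn_integral_distr)
  also have "\<dots> = ennreal (\<bar>c\<bar> ^ DIM('a)) * (\<integral>\<^sup>+x. f (c *\<^sub>R x) \<partial>lborel)"
    by (rule nn_integral_cmult) auto
  finally show ?thesis .
qed

lemma emeasure_lborel_ball_eq:
  assumes "t > 0"
  shows "emeasure lborel (ball (z::'a::euclidean_space) t) = ennreal (t ^ DIM('a) * ball_vol TYPE('a))"
proof -
  have "emeasure lborel (ball z t) = ennreal (measure lborel (ball z t))"
    using emeasure_lborel_ball_finite[of z t] by (simp add: emeasure_eq_ennreal_measure)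
  also have "measure lborel (ball z t) = t ^ DIM('a) * measure lborel (ball (0::'a) 1)"
    using content_ball_conv_unit_ball[of t z] assms by simp
  finally show ?thesis by (simp add: ball_vol_def)
qed

lemma ball_vol_pos: "ball_vol TYPE('a::euclidean_space) > 0"
  unfolding ball_vol_def using content_ball_pos[of 1 "0::'a"] by simp

lemma sets_borel_ball [measurable]: "ball (z::'a::euclidean_space) t \<in> sets borel"
  by simp

subsection \<open>Oscillation and slicing\<close>

definition diff_pow :: "real \<Rightarrow> ('a::euclidean_space \<Rightarrow> real) \<Rightarrow> 'a \<Rightarrow> ennreal" where
  "diff_pow r f h = (\<integral>\<^sup>+x. ennreal (\<bar>f (x + h) - f x\<bar> powr r) \<partial>lborel)"

text \<open>The \<open>r\<close>-th power of the modulus of continuity before normalisation by the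
  volume of the ball, kept in \<open>ennreal\<close> so that it can be estimated while possibly
  infinite.\<close>

definition osc :: "real \<Rightarrow> ('a::euclidean_space \<Rightarrow> real) \<Rightarrow> real \<Rightarrow> ennreal" where
  "osc r f t = (\<integral>\<^sup>+h. diff_pow r f h * indicator (ball 0 t) h \<partial>lborel)"

lemma borel_measurable_diff_pow:
  fixes f :: "'a::euclidean_space \<Rightarrow> real"
  assumes [measurable]: "f \<in> borel_measurable borel"
  shows "diff_pow r f \<in> borel_measurable borel"
  unfolding diff_pow_def by measurable

lemma osc_mono: "s \<le> t \<Longrightarrow> osc r f s \<le> osc r f t"
  unfolding osc_def by (intro nn_integral_mono) (auto simp: indicator_def)

lemma powr_add_le2:
  fixes x y r :: real
  assumes "x \<ge> 0" "y \<ge> 0" "r \<ge> 1"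
  shows "(x + y) powr r \<le> 2 powr (r - 1) * (x powr r + y powr r)"
proof -
  have "(\<Sum>j\<in>{0,1::nat}. (if j = 0 then x else y) * 1) powr r
     \<le> (\<Sum>j\<in>{0,1::nat}. (if j = 0 then x else y) powr r * 1) * (\<Sum>j\<in>{0,1::nat}. 1) powr (r - 1)"
    if "r > 1"
    using that assms by (intro powr_sum_weighted) auto
  then show ?thesis using assms by (cases "r = 1") (auto simp: mult.commute)
qed

lemma diff_pow_double:
  fixes f :: "'a::euclidean_space \<Rightarrow> real"
  assumes [measurable]: "f \<in> borel_measurable borel" and r: "r \<ge> 1"
  shows "diff_pow r f (2 *\<^sub>R h) \<le> ennreal (2 powr r) * diff_pow r f h"
proof -
  have pt: "\<bar>f (x + 2 *\<^sub>R h) - f x\<bar> powr r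
     \<le> 2 powr (r - 1) * (\<bar>f (x + h + h) - f (x + h)\<bar> powr r + \<bar>f (x + h) - f x\<bar> powr r)" for x
  proof -
    have e: "x + 2 *\<^sub>R h = x + h + h" by (simp add: scaleR_2)
    have "\<bar>f (x + 2 *\<^sub>R h) - f x\<bar> powr r \<le> (\<bar>f (x + h + h) - f (x + h)\<bar> + \<bar>f (x + h) - f x\<bar>) powr r"
      unfolding e using r by (intro powr_mono2) auto
    also have "\<dots> \<le> 2 powr (r - 1) * (\<bar>f (x + h + h) - f (x + h)\<bar> powr r + \<bar>f (x + h) - f x\<bar> powr r)"
      using r by (intro powr_add_le2) auto
    finally show ?thesis .
  qed
  have "diff_pow r f (2 *\<^sub>R h)
     \<le> (\<integral>\<^sup>+x. ennreal (2 powr (r - 1)) * (ennreal (\<bar>f (x + h + h) - f (x + h)\<bar> powr r) + ennreal (\<bar>f (x + h) - f x\<bar> powr r)) \<partial>lborel)"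
    unfolding diff_pow_def using pt
    by (intro nn_integral_mono)
       (simp add: ennreal_mult[symmetric] ennreal_plus[symmetric] ennreal_leI del: ennreal_plus)
  also have "\<dots> = ennreal (2 powr (r - 1)) *
     ((\<integral>\<^sup>+x. ennreal (\<bar>f (x + h + h) - f (x + h)\<bar> powr r) \<partial>lborel) + diff_pow r f h)"
    unfolding diff_pow_def by (simp add: nn_integral_cmult nn_integral_add)
  also have "(\<integral>\<^sup>+x. ennreal (\<bar>f (x + h + h) - f (x + h)\<bar> powr r) \<partial>lborel) = diff_pow r f h"
    unfolding diff_pow_def
    by (rule nn_integral_lborel_translate[where f = "\<lambda>y. ennreal (\<bar>f (y + h) - f y\<bar> powr r)"]) auto
  also have "ennreal (2 powr (r - 1)) * (diff_pow r f h + diff_pow r f h) = ennreal (2 powr r) * diff_pow r f h"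
    using ennreal_mult[of "2 powr (r - 1)" 2]
    by (simp add: mult_2[symmetric] mult.assoc[symmetric] powr_diff)
  finally show ?thesis .
qed

text \<open>The factor is \<open>2 powr n\<close> from substituting \<open>2 h\<close> for
  \<open>h\<close>, times \<open>2 powr r\<close> from dividing a double step into two translated
  single steps.\<close>

lemma osc_double:
  fixes f :: "'a::euclidean_space \<Rightarrow> real"
  assumes [measurable]: "f \<in> borel_measurable borel" and r: "r \<ge> 1"
  shows "osc r f (2 * t) \<le> ennreal (2 powr (real DIM('a) + r)) * osc r f t"
proof -
  have [measurable]: "diff_pow r f \<in> borel_measurable borel"
    by (rule borel_measurable_diff_pow) fact
  have "osc r f (2 * t)
     = ennreal (2 ^ DIM('a)) * (\<integral>\<^sup>+h. diff_pow r f (2 *\<^sub>R h) * indicator (ball 0 (2 * t)) (2 *\<^sub>R h :: 'a) \<partial>lborel)"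
    using nn_integral_lborel_scale[of "\<lambda>h. diff_pow r f h * indicator (ball 0 (2 * t)) h" 2]
    unfolding osc_def by simp
  also have "\<dots> \<le> ennreal (2 ^ DIM('a)) * (\<integral>\<^sup>+h. ennreal (2 powr r) * (diff_pow r f h * indicator (ball 0 t) h) \<partial>lborel)"
    using diff_pow_double[OF assms]
    by (intro mult_left_mono nn_integral_mono) (auto simp: indicator_def)
  also have "\<dots> = ennreal (2 powr (real DIM('a) + r)) * osc r f t"
    unfolding osc_def by (simp add: nn_integral_cmult powr_add powr_realpow ennreal_mult mult.assoc)
  finally show ?thesis .
qed

text \<open>Used as a lower bound for the right side: oscillation present at a coarse scale persists
  at a scale \<open>2 ^ j\<close> times finer, up to the stated factor.\<close>

lemma osc_pow2:
  fixes f :: "'a::euclidean_space \<Rightarrow> real"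
  assumes "f \<in> borel_measurable borel" and "r \<ge> 1"
  shows "osc r f (2 ^ j * t) \<le> ennreal (2 powr (real j * (real DIM('a) + r))) * osc r f t"
proof (induction j)
  case (Suc j)
  have "osc r f (2 ^ Suc j * t) \<le> ennreal (2 powr (real DIM('a) + r)) * osc r f (2 ^ j * t)"
    using osc_double[OF assms, of "2 ^ j * t"] by (simp add: mult.assoc)
  also have "\<dots> \<le> ennreal (2 powr (real DIM('a) + r)) * (ennreal (2 powr (real j * (real DIM('a) + r))) * osc r f t)"
    by (intro mult_left_mono Suc) auto
  also have "\<dots> = ennreal (2 powr (real (Suc j) * (real DIM('a) + r))) * osc r f t"
    by (simp add: mult.assoc[symmetric] ennreal_mult[symmetric] powr_add[symmetric] algebra_simps)
  finally show ?case .
qed simp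

text \<open>A point of the support has, within a ball of twice the volume of the support, at least half
  of its neighbours outside the support.\<close>

lemma osc_ge_of_small_support:
  fixes u :: "'a::euclidean_space \<Rightarrow> real"
  assumes [measurable]: "u \<in> borel_measurable borel"
    and b: "emeasure lborel (ball (0::'a) t) = ennreal b"
    and S: "emeasure lborel {x. u x \<noteq> 0} \<le> ennreal (b / 2)" and b0: "b \<ge> 0"
  shows "ennreal (b / 2) * (\<integral>\<^sup>+x. ennreal (\<bar>u x\<bar> powr r) \<partial>lborel) \<le> osc r u t"
proof -
  have half: "ennreal (b / 2) \<le> (\<integral>\<^sup>+h. indicator {h. u (x + h) = 0} h * indicator (ball 0 t) h \<partial>lborel)" for x
  proof -
    let ?m = "emeasure lborel ({h. u (x + h) = 0} \<inter> ball 0 t)"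
    have tr: "emeasure lborel {h. u (x + h) \<noteq> 0} = emeasure lborel {h. u h \<noteq> 0}"
    proof -
      have "emeasure lborel {h. u (x + h) \<noteq> 0} = (\<integral>\<^sup>+h. indicator {h. u (x + h) \<noteq> 0} h \<partial>lborel)"
        by simp
      also have "\<dots> = (\<integral>\<^sup>+h. indicator {y. u y \<noteq> 0} (h + x) \<partial>lborel)"
        by (intro nn_integral_cong) (simp add: indicator_def add.commute)
      also have "\<dots> = (\<integral>\<^sup>+h. indicator {y. u y \<noteq> 0} h \<partial>lborel)"
        by (rule nn_integral_lborel_translate) auto
      finally show ?thesis by simp
    qed
    have "ennreal b \<le> emeasure lborel (({h. u (x + h) = 0} \<inter> ball 0 t) \<union> {h. u (x + h) \<noteq> 0})"
      unfolding b[symmetric] by (intro emeasure_mono) auto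
    also have "\<dots> \<le> ?m + emeasure lborel {h. u (x + h) \<noteq> 0}"
      by (intro emeasure_subadditive) auto
    also have "\<dots> \<le> ?m + ennreal (b / 2)" using S tr by (simp add: add_left_mono)
    finally have "ennreal b \<le> ?m + ennreal (b / 2)" .
    moreover have "ennreal b = ennreal (b / 2) + ennreal (b / 2)"
      using b0 by (simp add: ennreal_plus[symmetric] del: ennreal_plus)
    ultimately have "ennreal (b / 2) + ennreal (b / 2) \<le> ennreal (b / 2) + ?m"
      by (simp only: add.commute)
    then have "ennreal (b / 2) \<le> ?m"
      by (simp only: ennreal_add_left_cancel_le) simp
    also have "?m = (\<integral>\<^sup>+h. indicator ({h. u (x + h) = 0} \<inter> ball 0 t) h \<partial>lborel)"
      by simp
    also have "\<dots> = (\<integral>\<^sup>+h. indicator {h. u (x + h) = 0} h * indicator (ball 0 t) h \<partial>lborel)"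
      by (simp only: indicator_inter_arith)
    finally show ?thesis .
  qed
  have "ennreal (b / 2) * (\<integral>\<^sup>+x. ennreal (\<bar>u x\<bar> powr r) \<partial>lborel)
      = (\<integral>\<^sup>+x. ennreal (\<bar>u x\<bar> powr r) * ennreal (b / 2) \<partial>lborel)"
    by (subst nn_integral_multc) (auto simp: mult.commute)
  also have "\<dots> \<le> (\<integral>\<^sup>+x. ennreal (\<bar>u x\<bar> powr r) * (\<integral>\<^sup>+h. indicator {h. u (x + h) = 0} h * indicator (ball 0 t) h \<partial>lborel) \<partial>lborel)"
    by (intro nn_integral_mono mult_left_mono half) auto
  also have "\<dots> = (\<integral>\<^sup>+x. \<integral>\<^sup>+h. ennreal (\<bar>u x\<bar> powr r) * (indicator {h. u (x + h) = 0} h * indicator (ball 0 t) h) \<partial>lborel \<partial>lborel)"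
    by (intro nn_integral_cong nn_integral_cmult[symmetric]) auto
  also have "\<dots> \<le> (\<integral>\<^sup>+x. \<integral>\<^sup>+h. ennreal (\<bar>u (x + h) - u x\<bar> powr r) * indicator (ball 0 t) h \<partial>lborel \<partial>lborel)"
    by (intro nn_integral_mono) (auto simp: indicator_def)
  also have "\<dots> = (\<integral>\<^sup>+h. \<integral>\<^sup>+x. ennreal (\<bar>u (x + h) - u x\<bar> powr r) * indicator (ball 0 t) h \<partial>lborel \<partial>lborel)"
    by (rule lborel_pair.Fubini') auto
  also have "\<dots> = osc r u t"
    unfolding osc_def diff_pow_def by (intro nn_integral_cong nn_integral_multc) auto
  finally show ?thesis .
qed

definition slice :: "real \<Rightarrow> real \<Rightarrow> real \<Rightarrow> real" where
  "slice a b x = min (max (\<bar>x\<bar> - a) 0) (b - a)"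

lemma borel_measurable_slice [measurable]: "slice a b \<in> borel_measurable borel"
  unfolding slice_def by measurable

text \<open>Superadditivity of the \<open>r\<close>-th power, obtained from subadditivity of the
  power \<open>1 / r\<close>.\<close>

lemma sum_powr_le_powr_sum:
  fixes x :: "nat \<Rightarrow> real"
  assumes "r \<ge> 1" "\<And>i. i \<in> I \<Longrightarrow> x i \<ge> 0" "finite I"
  shows "(\<Sum>i\<in>I. x i powr r) \<le> (\<Sum>i\<in>I. x i) powr r"
  using assms(3,2)
proof (induction I rule: finite_induct)
  case (insert a I)
  let ?s = "\<Sum>i\<in>I. x i"
  have s: "?s \<ge> 0" "x a \<ge> 0" using insert by (auto intro!: sum_nonneg)
  have "(x a powr r + ?s powr r) powr (1/r) \<le> (x a powr r) powr (1/r) + (?s powr r) powr (1/r)"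
    using assms by (intro powr_subadditive) auto
  also have "\<dots> = x a + ?s" using assms s by (simp add: powr_powr)
  finally have "((x a powr r + ?s powr r) powr (1/r)) powr r \<le> (x a + ?s) powr r"
    using assms by (intro powr_mono2) auto
  then have "x a powr r + ?s powr r \<le> (x a + ?s) powr r"
    using assms by (simp add: powr_powr)
  moreover have "(\<Sum>i\<in>I. x i powr r) \<le> ?s powr r" using insert by auto
  ultimately show ?case using insert by simp
qed simp

lemma sum_slice:
  assumes "mono l" "l 0 = 0"
  shows "(\<Sum>k<N. slice (l k) (l (Suc k)) a) = min \<bar>a\<bar> (l N)"
proof (induction N)
  case (Suc N)
  have "l N \<le> l (Suc N)" "0 \<le> l N" using assms monoD[OF assms(1), of 0 N] by (auto simp: mono_def)
  then show ?case unfolding sum.lessThan_Suc Suc.IH by (auto simp: slice_def min_def max_def)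
qed (use assms in auto)

lemma slice_mono: "\<bar>x\<bar> \<le> \<bar>y\<bar> \<Longrightarrow> slice a b x \<le> slice a b y"
  by (auto simp: slice_def min_def max_def)

text \<open>Every slice is monotone in the absolute value, so the increments of all slices between
  \<open>x\<close> and \<open>y\<close> have the same sign and telescope to an increment of the
  truncated absolute value. Superadditivity of the \<open>r\<close>-th power does the rest.\<close>

lemma sum_slice_diff_powr_le:
  assumes l: "mono l" "l 0 = 0" and r: "r \<ge> 1"
  shows "(\<Sum>k<N. \<bar>slice (l k) (l (Suc k)) x - slice (l k) (l (Suc k)) y\<bar> powr r) \<le> \<bar>x - y\<bar> powr r"
proof -
  have *: "(\<Sum>k<N. \<bar>slice (l k) (l (Suc k)) x - slice (l k) (l (Suc k)) y\<bar>) \<le> \<bar>x - y\<bar>"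
    if "\<bar>x\<bar> \<le> \<bar>y\<bar>" for x y
  proof -
    have "(\<Sum>k<N. \<bar>slice (l k) (l (Suc k)) x - slice (l k) (l (Suc k)) y\<bar>)
        = (\<Sum>k<N. slice (l k) (l (Suc k)) y - slice (l k) (l (Suc k)) x)"
      using slice_mono[OF that] by (intro sum.cong) auto
    also have "\<dots> = min \<bar>y\<bar> (l N) - min \<bar>x\<bar> (l N)"
      by (simp add: sum_subtractf sum_slice[OF l])
    also have "\<dots> \<le> \<bar>y\<bar> - \<bar>x\<bar>" using that by (simp add: min_def)
    also have "\<dots> \<le> \<bar>x - y\<bar>" by linarith
    finally show ?thesis .
  qed
  have **: "(\<Sum>k<N. \<bar>slice (l k) (l (Suc k)) x - slice (l k) (l (Suc k)) y\<bar>) \<le> \<bar>x - y\<bar>"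
    using *[of x y] *[of y x] by (cases "\<bar>x\<bar> \<le> \<bar>y\<bar>") (auto simp: abs_minus_commute)
  have "(\<Sum>k<N. \<bar>slice (l k) (l (Suc k)) x - slice (l k) (l (Suc k)) y\<bar> powr r)
      \<le> (\<Sum>k<N. \<bar>slice (l k) (l (Suc k)) x - slice (l k) (l (Suc k)) y\<bar>) powr r"
    using r by (intro sum_powr_le_powr_sum) auto
  also have "\<dots> \<le> \<bar>x - y\<bar> powr r" using ** r by (intro powr_mono2) (auto intro!: sum_nonneg)
  finally show ?thesis .
qed

text \<open>The reason for slicing: the oscillations of the slices add up without a constant, so
  lower bounds found for single slices may be summed.\<close>

lemma sum_osc_slice_le:
  fixes f :: "'a::euclidean_space \<Rightarrow> real"
  assumes [measurable]: "f \<in> borel_measurable borel" and l: "mono l" "l 0 = 0" and r: "r \<ge> 1"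
  shows "(\<Sum>k<N. osc r (\<lambda>x. slice (l k) (l (Suc k)) (f x)) t) \<le> osc r f t"
proof -
  have "(\<Sum>k<N. diff_pow r (\<lambda>x. slice (l k) (l (Suc k)) (f x)) h) \<le> diff_pow r f h" for h
  proof -
    have "(\<Sum>k<N. diff_pow r (\<lambda>x. slice (l k) (l (Suc k)) (f x)) h)
       = (\<integral>\<^sup>+x. (\<Sum>k<N. ennreal (\<bar>slice (l k) (l (Suc k)) (f (x + h)) - slice (l k) (l (Suc k)) (f x)\<bar> powr r)) \<partial>lborel)"
      unfolding diff_pow_def by (subst nn_integral_sum) auto
    also have "\<dots> \<le> diff_pow r f h"
      unfolding diff_pow_def using sum_slice_diff_powr_le[OF l r]
      by (intro nn_integral_mono) (simp add: sum_ennreal ennreal_leI)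
    finally show ?thesis .
  qed
  note * = this
  have [measurable]: "diff_pow r (\<lambda>x. slice (l k) (l (Suc k)) (f x)) \<in> borel_measurable borel" for k
    by (rule borel_measurable_diff_pow) measurable
  have "(\<Sum>k<N. osc r (\<lambda>x. slice (l k) (l (Suc k)) (f x)) t)
      = (\<integral>\<^sup>+h. (\<Sum>k<N. diff_pow r (\<lambda>x. slice (l k) (l (Suc k)) (f x)) h) * indicator (ball 0 t) h \<partial>lborel)"
    unfolding osc_def sum_distrib_right by (subst nn_integral_sum) measurable
  also have "\<dots> \<le> osc r f t"
    unfolding osc_def by (intro nn_integral_mono mult_right_mono *) auto
  finally show ?thesis .
qed

subsection \<open>Dyadic levels\<close>

text \<open>The decreasing rearrangement of \<open>f\<close> at \<open>m\<close>, written as the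
  generalised inverse of the distribution function.\<close>

definition level :: "('a::euclidean_space \<Rightarrow> real) \<Rightarrow> real \<Rightarrow> real" where
  "level f m = Inf {l. 0 \<le> l \<and> emeasure lborel {x. l < \<bar>f x\<bar>} \<le> ennreal m}"

context
  fixes f :: "'a::euclidean_space \<Rightarrow> real"
  assumes f [measurable]: "f \<in> borel_measurable borel"
    and fin: "emeasure lborel {x. f x \<noteq> 0} < \<infinity>"
begin

lemma emeasure_superlevel_finite:
  assumes "l \<ge> 0"
  shows "emeasure lborel {x. l < \<bar>f x\<bar>} < \<infinity>"
proof -
  have "emeasure lborel {x. l < \<bar>f x\<bar>} \<le> emeasure lborel {x. f x \<noteq> 0}"
    using assms by (intro emeasure_mono) auto
  then show ?thesis using fin by (rule le_less_trans)
qed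

text \<open>Superlevel sets have finite measure and shrink to the empty set; hence the infimum in
  \<open>level\<close> is taken over a nonempty set.\<close>

lemma level_set_nonempty:
  assumes "m > 0"
  shows "\<exists>l\<ge>0. emeasure lborel {x. l < \<bar>f x\<bar>} \<le> ennreal m"
proof -
  have "(INF i::nat. emeasure lborel {x. real i < \<bar>f x\<bar>}) = emeasure lborel (\<Inter>i::nat. {x. real i < \<bar>f x\<bar>})"
    using emeasure_superlevel_finite
    by (intro INF_emeasure_decseq) (auto simp: decseq_def less_top intro: le_less_trans)
  also have "(\<Inter>i::nat. {x. real i < \<bar>f x\<bar>}) = {}"
  proof -
    have "\<exists>i::nat. \<not> real i < \<bar>f x\<bar>" for x
      using reals_Archimedean2[of "\<bar>f x\<bar>"] less_asym by blast
    then show ?thesis by blast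
  qed
  finally have "(INF i::nat. emeasure lborel {x. real i < \<bar>f x\<bar>}) < ennreal m"
    using assms by simp
  then obtain i :: nat where "emeasure lborel {x. real i < \<bar>f x\<bar>} < ennreal m"
    unfolding INF_less_iff by blast
  then show ?thesis by (intro exI[of _ "real i"]) auto
qed

lemma level_lessD:
  assumes "m > 0" "level f m < z"
  shows "\<exists>l\<ge>0. emeasure lborel {x. l < \<bar>f x\<bar>} \<le> ennreal m \<and> l < z"
  using cInf_lessD[of "{l. 0 \<le> l \<and> emeasure lborel {x. l < \<bar>f x\<bar>} \<le> ennreal m}" z]
    level_set_nonempty[OF assms(1)] assms(2) unfolding level_def by auto

lemma level_le:
  "l \<ge> 0 \<Longrightarrow> emeasure lborel {x. l < \<bar>f x\<bar>} \<le> ennreal m \<Longrightarrow> level f m \<le> l"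
  unfolding level_def by (intro cInf_lower) (auto intro: bdd_belowI[of _ 0])

lemma level_nonneg: "m > 0 \<Longrightarrow> level f m \<ge> 0"
  unfolding level_def using level_set_nonempty by (intro cInf_greatest) auto

lemma level_antimono: "0 < m \<Longrightarrow> m \<le> m' \<Longrightarrow> level f m' \<le> level f m"
  unfolding level_def using level_set_nonempty[of m]
  by (intro cInf_superset_mono) (auto intro: bdd_belowI[of _ 0] order_trans ennreal_leI)

lemma level_eq_0:
  assumes "emeasure lborel {x. f x \<noteq> 0} \<le> ennreal m" "m > 0"
  shows "level f m = 0"
proof (rule antisym)
  show "level f m \<le> 0"
    unfolding level_def using assms by (intro cInf_lower) (auto intro: bdd_belowI[of _ 0])
qed (use assms level_nonneg in auto)

text \<open>The infimum in \<open>level\<close> is attained: the strict superlevel set is the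
  increasing union of those at \<open>level f m + 1 / Suc i\<close>, each of measure at most
  \<open>m\<close>.\<close>

lemma emeasure_superlevel_le:
  assumes m: "m > 0"
  shows "emeasure lborel {x. level f m < \<bar>f x\<bar>} \<le> ennreal m"
proof -
  have *: "emeasure lborel {x. level f m + 1 / Suc i < \<bar>f x\<bar>} \<le> ennreal m" for i
  proof -
    have "level f m < level f m + 1 / Suc i" by simp
    then obtain l where l: "0 \<le> l" "emeasure lborel {x. l < \<bar>f x\<bar>} \<le> ennreal m" "l < level f m + 1 / Suc i"
      using level_lessD[OF m] by blast
    have "emeasure lborel {x. level f m + 1 / Suc i < \<bar>f x\<bar>} \<le> emeasure lborel {x. l < \<bar>f x\<bar>}"
      using l by (intro emeasure_mono) auto
    with l show ?thesis by auto
  qed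
  have "incseq (\<lambda>i. {x. level f m + 1 / Suc i < \<bar>f x\<bar>})"
  proof (rule incseq_SucI, safe)
    fix i x assume "level f m + 1 / real (Suc i) < \<bar>f x\<bar>"
    moreover have "1 / real (Suc (Suc i)) \<le> 1 / real (Suc i)" by (simp add: frac_le)
    ultimately show "level f m + 1 / real (Suc (Suc i)) < \<bar>f x\<bar>" by linarith
  qed
  then have "(SUP i. emeasure lborel {x. level f m + 1 / Suc i < \<bar>f x\<bar>})
      = emeasure lborel (\<Union>i. {x. level f m + 1 / Suc i < \<bar>f x\<bar>})"
    by (intro SUP_emeasure_incseq) auto
  also have "(\<Union>i. {x. level f m + 1 / Suc i < \<bar>f x\<bar>}) = {x. level f m < \<bar>f x\<bar>}"
  proof safe
    fix i x assume "level f m + 1 / real (Suc i) < \<bar>f x\<bar>"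
    moreover have "1 / real (Suc i) > 0" by simp
    ultimately show "level f m < \<bar>f x\<bar>" by linarith
  next
    fix x assume "level f m < \<bar>f x\<bar>"
    then obtain i where "inverse (real (Suc i)) < \<bar>f x\<bar> - level f m"
      using reals_Archimedean[of "\<bar>f x\<bar> - level f m"] by auto
    then show "x \<in> (\<Union>i. {x. level f m + 1 / Suc i < \<bar>f x\<bar>})"
      by (intro UN_I[of i]) (auto simp: inverse_eq_divide algebra_simps)
  qed
  finally show ?thesis using * by (metis (no_types, lifting) SUP_least)
qed

text \<open>Strictly below the level the superlevel sets are too large by minimality, and continuity
  from above, available because these sets have finite measure, passes to the limit. With the
  preceding upper bound for the strict superlevel set this brackets \<open>m\<close>, so plateaus of
  \<open>f\<close> cause no loss.\<close>

lemma emeasure_level_ge: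
  assumes m: "m > 0" and pos: "level f m > 0"
  shows "ennreal m \<le> emeasure lborel {x. level f m \<le> \<bar>f x\<bar>}"
proof -
  let ?l = "\<lambda>i. level f m * (1 - 1 / Suc i)"
  have l0: "0 \<le> ?l i" "?l i < level f m" for i using pos by (auto simp: field_simps)
  have gt: "ennreal m \<le> emeasure lborel {x. ?l i < \<bar>f x\<bar>}" for i
  proof (rule ccontr)
    assume "\<not> ennreal m \<le> emeasure lborel {x. ?l i < \<bar>f x\<bar>}"
    then have "level f m \<le> ?l i" using l0[of i] by (intro level_le) auto
    with l0(2)[of i] show False by simp
  qed
  have "decseq (\<lambda>i. {x. ?l i < \<bar>f x\<bar>})"
  proof (rule decseq_SucI, safe)
    fix i x assume "?l (Suc i) < \<bar>f x\<bar>"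
    moreover have "?l i \<le> ?l (Suc i)" using pos by (intro mult_left_mono) (auto simp: frac_le)
    ultimately show "?l i < \<bar>f x\<bar>" by linarith
  qed
  then have "(INF i. emeasure lborel {x. ?l i < \<bar>f x\<bar>}) = emeasure lborel (\<Inter>i. {x. ?l i < \<bar>f x\<bar>})"
    using emeasure_superlevel_finite[OF l0(1)]
    by (intro INF_emeasure_decseq) (auto simp: less_top intro: less_imp_neq)
  also have "(\<Inter>i. {x. ?l i < \<bar>f x\<bar>}) = {x. level f m \<le> \<bar>f x\<bar>}"
  proof safe
    fix x assume x: "x \<in> (\<Inter>i. {x. ?l i < \<bar>f x\<bar>})"
    have "?l \<longlonglongrightarrow> level f m * (1 - 0)"
      by (intro tendsto_intros LIMSEQ_Suc[OF lim_1_over_n])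
    then show "level f m \<le> \<bar>f x\<bar>"
      using x by (intro LIMSEQ_le_const2[of ?l "level f m"]) (auto intro: less_imp_le)
  qed (use l0 in \<open>auto intro: less_le_trans\<close>)
  finally show ?thesis using gt by (metis (no_types, lifting) INF_greatest)
qed

end

text \<open>Dividing a measure by \<open>2 ^ n\<close> halves the radius of a ball having that
  measure, so \<open>k\<close> counts dyadic scales in space.\<close>

definition dyadic_level :: "('a::euclidean_space \<Rightarrow> real) \<Rightarrow> nat \<Rightarrow> real" where
  "dyadic_level f k = level f (measure lborel {x. f x \<noteq> 0} / 2 ^ (k * DIM('a)))"

text \<open>The radius of a ball of twice the volume of the support. Divided by \<open>2 ^ k\<close>
  it gives a ball of twice the measure allowed above the \<open>k\<close>-th level, which is the
  proportion required by \<open>osc_ge_of_small_support\<close>.\<close>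

definition supp_radius :: "('a::euclidean_space \<Rightarrow> real) \<Rightarrow> real" where
  "supp_radius f = (2 * measure lborel {x. f x \<noteq> 0} / ball_vol TYPE('a)) powr (1 / DIM('a))"

context
  fixes f :: "'a::euclidean_space \<Rightarrow> real" and V :: real
  assumes f [measurable]: "f \<in> borel_measurable borel"
    and V: "emeasure lborel {x. f x \<noteq> 0} = ennreal V" "V > 0"
begin

lemma meas_supp: "measure lborel {x. f x \<noteq> 0} = V"
  using V by (simp add: measure_def)

lemma supp_fin: "emeasure lborel {x. f x \<noteq> 0} < \<infinity>"
  using V by simp

lemma dyadic_level_0: "dyadic_level f 0 = 0"
  unfolding dyadic_level_def meas_supp using V by (intro level_eq_0[OF f supp_fin]) auto

lemma mono_dyadic_level: "mono (dyadic_level f)"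
  unfolding dyadic_level_def meas_supp using V
  by (intro monoI level_antimono[OF f supp_fin]) (auto simp: divide_simps)

lemma dyadic_level_nonneg: "dyadic_level f k \<ge> 0"
  using monoD[OF mono_dyadic_level, of 0 k] dyadic_level_0 by simp

lemma emeasure_gt_dyadic_level:
  "emeasure lborel {x. dyadic_level f k < \<bar>f x\<bar>} \<le> ennreal (V / 2 ^ (k * DIM('a)))"
  unfolding dyadic_level_def meas_supp using V by (intro emeasure_superlevel_le[OF f supp_fin]) auto

lemma supp_radius_pos: "supp_radius f > 0"
  unfolding supp_radius_def meas_supp using V ball_vol_pos[where 'a='a] by simp

lemma supp_radius_pow: "supp_radius f ^ DIM('a) * ball_vol TYPE('a) = 2 * V"
proof -
  have "supp_radius f ^ DIM('a) = supp_radius f powr real DIM('a)"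
    using supp_radius_pos by (simp add: powr_realpow)
  also have "\<dots> = 2 * V / ball_vol TYPE('a)"
    unfolding supp_radius_def meas_supp using V ball_vol_pos[where 'a='a] by (simp add: powr_powr)
  finally show ?thesis using ball_vol_pos[where 'a='a] by simp
qed

text \<open>The \<open>k\<close>-th slice vanishes off the set above level \<open>k\<close>, which
  fills at most half of the ball of radius \<open>supp_radius f / 2 ^ k\<close>, and it has its full
  height on the set above level \<open>k + 1\<close>, whose measure is bounded below by
  \<open>emeasure_level_ge\<close>.\<close>

lemma osc_slice_ge:
  assumes r: "r \<ge> 1"
  shows "ennreal (V / 2 ^ (k * DIM('a)) *
      ((dyadic_level f (Suc k) - dyadic_level f k) powr r * (V / 2 ^ (Suc k * DIM('a)))))
    \<le> osc r (\<lambda>x. slice (dyadic_level f k) (dyadic_level f (Suc k)) (f x)) (supp_radius f / 2 ^ k)"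
proof -
  define a b u where "a = dyadic_level f k" and "b = dyadic_level f (Suc k)" and "u = (\<lambda>x. slice a b (f x))"
  have ab: "a \<le> b" "a \<ge> 0" unfolding a_def b_def using monoD[OF mono_dyadic_level, of k "Suc k"] dyadic_level_nonneg by auto
  have [measurable]: "u \<in> borel_measurable borel" unfolding u_def by measurable
  have int: "ennreal ((b - a) powr r * (V / 2 ^ (Suc k * DIM('a)))) \<le> (\<integral>\<^sup>+x. ennreal (\<bar>u x\<bar> powr r) \<partial>lborel)"
  \<comment> \<open>For equal levels the left side is 0, since \<open>0 powr r = 0\<close>;
    otherwise \<open>b\<close> is positive, as \<open>emeasure_level_ge\<close> demands.\<close>
  proof (cases "a = b")
    case False
    then have "b > 0" using ab by simp
    then have "ennreal (V / 2 ^ (Suc k * DIM('a))) \<le> emeasure lborel {x. b \<le> \<bar>f x\<bar>}"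
      unfolding b_def dyadic_level_def meas_supp using V
      by (intro emeasure_level_ge[OF f supp_fin]) auto
    then have "ennreal ((b - a) powr r * (V / 2 ^ (Suc k * DIM('a)))) \<le> ennreal ((b - a) powr r) * emeasure lborel {x. b \<le> \<bar>f x\<bar>}"
      using V by (subst ennreal_mult) (auto intro!: mult_left_mono)
    also have "\<dots> = (\<integral>\<^sup>+x. ennreal ((b - a) powr r) * indicator {x. b \<le> \<bar>f x\<bar>} x \<partial>lborel)"
      by (subst nn_integral_cmult_indicator) auto
    also have "\<dots> \<le> (\<integral>\<^sup>+x. ennreal (\<bar>u x\<bar> powr r) \<partial>lborel)"
      using ab r by (intro nn_integral_mono) (auto simp: indicator_def u_def slice_def intro!: ennreal_leI powr_mono2)
    finally show ?thesis .
  qed simp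
  have "emeasure lborel {x. u x \<noteq> 0} \<le> emeasure lborel {x. a < \<bar>f x\<bar>}"
    using ab by (intro emeasure_mono) (auto simp: u_def slice_def)
  also have "\<dots> \<le> ennreal (2 * V / 2 ^ (k * DIM('a)) / 2)" using emeasure_gt_dyadic_level[of k] by (simp add: a_def)
  finally have S: "emeasure lborel {x. u x \<noteq> 0} \<le> ennreal (2 * V / 2 ^ (k * DIM('a)) / 2)" .
  have B: "emeasure lborel (ball (0::'a) (supp_radius f / 2 ^ k)) = ennreal (2 * V / 2 ^ (k * DIM('a)))"
    using supp_radius_pos supp_radius_pow
    by (subst emeasure_lborel_ball_eq) (auto simp: power_divide power_mult)
  have "ennreal (V / 2 ^ (k * DIM('a)) * ((b - a) powr r * (V / 2 ^ (Suc k * DIM('a)))))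
     = ennreal (2 * V / 2 ^ (k * DIM('a)) / 2) * ennreal ((b - a) powr r * (V / 2 ^ (Suc k * DIM('a))))"
    using V by (subst ennreal_mult[symmetric]) auto
  also have "\<dots> \<le> ennreal (2 * V / 2 ^ (k * DIM('a)) / 2) * (\<integral>\<^sup>+x. ennreal (\<bar>u x\<bar> powr r) \<partial>lborel)"
    by (intro mult_left_mono int) auto
  also have "\<dots> \<le> osc r u (supp_radius f / 2 ^ k)"
    using V by (intro osc_ge_of_small_support S B) auto
  finally show ?thesis unfolding a_def b_def u_def .
qed

text \<open>All slices \<open>k \<le> j\<close> are compared at the single scale \<open>j\<close>.
  Going down from scale \<open>k\<close> costs \<open>2 powr (- (j - k) (n + r))\<close>; the part
  with exponent n is absorbed by replacing \<open>V / 2 ^ (k n)\<close> with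
  \<open>V / 2 ^ (j n)\<close>, and the part with exponent r remains.\<close>

lemma osc_ge_sum:
  assumes r: "r \<ge> 1"
  shows "ennreal (\<Sum>k\<le>j. 2 powr (- (real (j - k) * r)) * (dyadic_level f (Suc k) - dyadic_level f k) powr r
      * (V / 2 ^ (Suc k * DIM('a))) * (V / 2 ^ (j * DIM('a)))) \<le> osc r f (supp_radius f / 2 ^ j)"
proof -
  let ?u = "\<lambda>k x. slice (dyadic_level f k) (dyadic_level f (Suc k)) (f x)"
  let ?d = "\<lambda>k. (dyadic_level f (Suc k) - dyadic_level f k) powr r * (V / 2 ^ (Suc k * DIM('a)))"
  let ?N = "real DIM('a)"
  have each: "ennreal (2 powr (- (real (j - k) * r)) * ?d k * (V / 2 ^ (j * DIM('a))))
      \<le> osc r (?u k) (supp_radius f / 2 ^ j)" if "k \<le> j" for k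
  proof -
    let ?q = "2 powr (real (j - k) * (?N + r))"
    have "ennreal (V / 2 ^ (k * DIM('a)) * ?d k) \<le> osc r (?u k) (supp_radius f / 2 ^ k)"
      by (rule osc_slice_ge[OF r])
    also have "supp_radius f / 2 ^ k = 2 ^ (j - k) * (supp_radius f / 2 ^ j)"
      using that by (simp add: power_diff)
    also have "osc r (?u k) \<dots> \<le> ennreal ?q * osc r (?u k) (supp_radius f / 2 ^ j)"
      by (intro osc_pow2 r) measurable
    finally have "ennreal (inverse ?q) * ennreal (V / 2 ^ (k * DIM('a)) * ?d k)
       \<le> ennreal (inverse ?q) * (ennreal ?q * osc r (?u k) (supp_radius f / 2 ^ j))"
      by (intro mult_left_mono) auto
    also have "\<dots> = osc r (?u k) (supp_radius f / 2 ^ j)"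
      by (simp add: mult.assoc[symmetric] ennreal_mult[symmetric])
    also have "ennreal (inverse ?q) * ennreal (V / 2 ^ (k * DIM('a)) * ?d k)
       = ennreal (2 powr (- (real (j - k) * r)) * ?d k * (V / 2 ^ (j * DIM('a))))"
    proof -
      have "inverse ?q * (V / 2 ^ (k * DIM('a))) = 2 powr (- (real (j - k) * r)) * (V / 2 ^ (j * DIM('a)))"
      proof -
        have "inverse ?q = 2 powr (- (real (j - k) * r)) * 2 powr (- (real (j - k) * ?N))"
          by (simp add: powr_minus[symmetric] powr_add[symmetric] algebra_simps)
        moreover have "2 powr (- (real (j - k) * ?N)) = 2 ^ (k * DIM('a)) / 2 ^ (j * DIM('a))"
          using that by (simp add: powr_realpow[symmetric] powr_diff[symmetric] of_nat_diff algebra_simps)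
        ultimately show ?thesis by simp
      qed
      then have "(inverse ?q * (V / 2 ^ (k * DIM('a)))) * ?d k = (2 powr (- (real (j - k) * r)) * (V / 2 ^ (j * DIM('a)))) * ?d k"
        by (rule arg_cong)
      then have "inverse ?q * (V / 2 ^ (k * DIM('a)) * ?d k) = 2 powr (- (real (j - k) * r)) * ?d k * (V / 2 ^ (j * DIM('a)))"
        by (simp only: mult_ac)
      then show ?thesis using V by (subst ennreal_mult[symmetric]) auto
    qed
    finally show ?thesis .
  qed
  have "ennreal (\<Sum>k\<le>j. 2 powr (- (real (j - k) * r)) * ?d k * (V / 2 ^ (j * DIM('a))))
     = (\<Sum>k<Suc j. ennreal (2 powr (- (real (j - k) * r)) * ?d k * (V / 2 ^ (j * DIM('a)))))"
    using V by (subst sum_ennreal) (auto simp: lessThan_Suc_atMost)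
  also have "\<dots> \<le> (\<Sum>k<Suc j. osc r (?u k) (supp_radius f / 2 ^ j))"
    by (intro sum_mono each) auto
  also have "\<dots> \<le> osc r f (supp_radius f / 2 ^ j)"
    by (intro sum_osc_slice_le mono_dyadic_level dyadic_level_0 r f)
  finally show ?thesis by (simp add: mult.assoc)
qed

end

section \<open>From the oscillation integral to the modulus of continuity\<close>

lemma Lp_pow_lborel: "Lp_pow p f = (\<integral>\<^sup>+x. ennreal (\<bar>f x\<bar> powr p) \<partial>lborel)"
  unfolding Lp_pow_def by (rule nn_integral_completion)

lemma Lp_pow_diff_op: "Lp_pow r (diff_op h f) = diff_pow r f h"
  unfolding Lp_pow_lborel diff_pow_def diff_op_def ..

lemma diff_pow_le:
  fixes f :: "'a::euclidean_space \<Rightarrow> real"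
  assumes [measurable]: "f \<in> borel_measurable borel" and r: "r \<ge> 1"
  shows "diff_pow r f h \<le> ennreal (2 powr r) * Lp_pow r f"
proof -
  have pt: "\<bar>f (x + h) - f x\<bar> powr r \<le> 2 powr (r - 1) * (\<bar>f (x + h)\<bar> powr r + \<bar>f x\<bar> powr r)" for x
  proof -
    have "\<bar>f (x + h) - f x\<bar> powr r \<le> (\<bar>f (x + h)\<bar> + \<bar>f x\<bar>) powr r"
      using r by (intro powr_mono2) auto
    also have "\<dots> \<le> 2 powr (r - 1) * (\<bar>f (x + h)\<bar> powr r + \<bar>f x\<bar> powr r)"
      using r by (intro powr_add_le2) auto
    finally show ?thesis .
  qed
  have "diff_pow r f h
     \<le> (\<integral>\<^sup>+x. ennreal (2 powr (r - 1)) * (ennreal (\<bar>f (x + h)\<bar> powr r) + ennreal (\<bar>f x\<bar> powr r)) \<partial>lborel)"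
    unfolding diff_pow_def using pt
    by (intro nn_integral_mono)
       (simp add: ennreal_mult[symmetric] ennreal_plus[symmetric] ennreal_leI del: ennreal_plus)
  also have "\<dots> = ennreal (2 powr (r - 1)) *
     ((\<integral>\<^sup>+x. ennreal (\<bar>f (x + h)\<bar> powr r) \<partial>lborel) + Lp_pow r f)"
    unfolding Lp_pow_lborel by (simp add: nn_integral_cmult nn_integral_add)
  also have "(\<integral>\<^sup>+x. ennreal (\<bar>f (x + h)\<bar> powr r) \<partial>lborel) = Lp_pow r f"
    unfolding Lp_pow_lborel
    by (rule nn_integral_lborel_translate[where f = "\<lambda>y. ennreal (\<bar>f y\<bar> powr r)"]) auto
  also have "ennreal (2 powr (r - 1)) * (Lp_pow r f + Lp_pow r f) = ennreal (2 powr r) * Lp_pow r f"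
    using ennreal_mult[of "2 powr (r - 1)" 2]
    by (simp add: mult_2[symmetric] mult.assoc[symmetric] powr_diff)
  finally show ?thesis .
qed

context
  fixes f :: "'a::euclidean_space \<Rightarrow> real" and r :: real
  assumes f [measurable]: "f \<in> borel_measurable borel" and r: "r \<ge> 1" and L: "Lp_pow r f < \<infinity>"
begin

lemma diff_pow_finite: "diff_pow r f h < \<infinity>"
  using diff_pow_le[OF f r, of h] L by (auto intro: le_less_trans simp: ennreal_mult_less_top)

lemma osc_finite: "osc r f t < \<infinity>"
proof -
  have "osc r f t \<le> (\<integral>\<^sup>+h. (ennreal (2 powr r) * Lp_pow r f) * indicator (ball (0::'a) t) h \<partial>lborel)"
    unfolding osc_def by (intro nn_integral_mono mult_right_mono diff_pow_le f r) auto
  also have "\<dots> = ennreal (2 powr r) * Lp_pow r f * emeasure lborel (ball (0::'a) t)"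
    by (subst nn_integral_cmult_indicator) auto
  also have "\<dots> < \<infinity>"
    using L emeasure_lborel_ball_finite[of "0::'a" t] by (auto simp: ennreal_mult_less_top)
  finally show ?thesis .
qed

text \<open>Finiteness of the \<open>L^r\<close> norm makes the \<open>enn2real\<close> inside
  \<open>Lp_norm\<close> lossless for every translation \<open>h\<close>.\<close>

lemma modulus_eq_osc:
  "modulus r f t = (enn2real (osc r f t) / (t ^ DIM('a) * ball_vol TYPE('a))) powr (1 / r)"
proof -
  have "ennreal (Lp_norm r (diff_op h f) powr r) = diff_pow r f h" for h
    unfolding Lp_norm_def Lp_pow_diff_op using diff_pow_finite[of h] r by (simp add: powr_powr)
  then show ?thesis
    unfolding modulus_def osc_def by (simp add: nn_integral_completion)
qed

end

subsection \<open>The Besov seminorm controls the gaps between levels\<close>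

text \<open>Hoelder with exponent \<open>r / n\<close> and the weights \<open>w ^ (j - k)\<close>,
  whose total is at most \<open>W = 1 / (1 - w)\<close>, bounds the weighted sum of
  \<open>d k powr n\<close> at scale \<open>j\<close> by the term in the hypothesis times
  \<open>W powr (1 - n / r)\<close>. Summed over \<open>j\<close>, each \<open>d k powr n\<close>
  collects the weight \<open>W\<close>. The surplus of \<open>W\<close> over
  \<open>W powr (1 - n / r)\<close> is the gain \<open>(1 - w) powr (n / r)\<close>.\<close>

lemma summation_by_scales:
  fixes d :: "nat \<Rightarrow> real"
  assumes d: "\<And>k. d k \<ge> 0" and w: "0 < w" "w < 1" and n: "0 < n" "n < r"
    and B: "\<And>J. (\<Sum>j<J. (\<Sum>k\<le>j. w ^ (j - k) * d k powr r) powr (n / r)) \<le> B"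
  shows "(\<Sum>k<K. d k powr n) \<le> B * (1 - w) powr (n / r)"
proof -
  define W where "W = 1 / (1 - w)"
  have W: "W > 0" using w by (simp add: W_def)
  have geo: "(\<Sum>i<m. w ^ i) \<le> W" for m
    using w unfolding W_def by (subst sum_gp_strict) (auto simp: divide_simps)
  have sumw: "(\<Sum>k\<le>j. w ^ (j - k)) \<le> W" for j
    using geo[of "Suc j"] sum.nat_diff_reindex[of "\<lambda>i. w ^ i" "Suc j"] by (simp add: lessThan_Suc_atMost)
  define p where "p = r / n"
  have p: "p > 1" "1 / p = n / r" "(p - 1) * (1 / p) = 1 - n / r"
    using n by (auto simp: p_def field_simps)
  have step: "(\<Sum>k\<le>j. d k powr n * w ^ (j - k)) \<le> (\<Sum>k\<le>j. w ^ (j - k) * d k powr r) powr (n / r) * W powr (1 - n / r)" for j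
  proof -
    let ?S = "\<Sum>k\<le>j. d k powr n * w ^ (j - k)"
    have S0: "?S \<ge> 0" using w by (intro sum_nonneg) auto
    have "?S powr p \<le> (\<Sum>k\<le>j. (d k powr n) powr p * w ^ (j - k)) * (\<Sum>k\<le>j. w ^ (j - k)) powr (p - 1)"
      using p w by (intro powr_sum_weighted) auto
    also have "\<dots> \<le> (\<Sum>k\<le>j. (d k powr n) powr p * w ^ (j - k)) * W powr (p - 1)"
      using p w sumw by (intro mult_left_mono powr_mono2 sum_nonneg) auto
    also have "(\<Sum>k\<le>j. (d k powr n) powr p * w ^ (j - k)) = (\<Sum>k\<le>j. w ^ (j - k) * d k powr r)"
      using n by (intro sum.cong) (auto simp: p_def powr_powr)
    finally have "(?S powr p) powr (1 / p) \<le> ((\<Sum>k\<le>j. w ^ (j - k) * d k powr r) * W powr (p - 1)) powr (1 / p)"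
      using p n by (intro powr_mono2) auto
    also have "\<dots> = (\<Sum>k\<le>j. w ^ (j - k) * d k powr r) powr (1 / p) * (W powr (p - 1)) powr (1 / p)"
      by (rule powr_mult)
    also have "(W powr (p - 1)) powr (1 / p) = W powr (1 - n / r)"
      by (simp only: powr_powr p(3))
    also have "(?S powr p) powr (1 / p) = ?S" using S0 p(1) by (simp add: powr_powr)
    finally show ?thesis by (simp only: p(2))
  qed
  have main: "(\<Sum>k<K. d k powr n) * (\<Sum>i<M. w ^ i) \<le> B * W powr (1 - n / r)" for M
  proof -
    \<comment> \<open>Every \<open>k < K\<close> must still see \<open>M\<close> scales
      \<open>k, ..., k + M - 1\<close>, all of them below \<open>K + M\<close>.\<close>
    let ?J = "K + M"
    have "(\<Sum>k<K. d k powr n) * (\<Sum>i<M. w ^ i) = (\<Sum>k<K. d k powr n * (\<Sum>i<M. w ^ i))"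
      by (rule sum_distrib_right)
    also have "\<dots> \<le> (\<Sum>k<K. d k powr n * (\<Sum>j\<in>{k..<?J}. w ^ (j - k)))"
    proof (intro sum_mono mult_left_mono)
      fix k assume "k \<in> {..<K}"
      have "(\<Sum>i<M. w ^ i) = (\<Sum>j\<in>{k..<k+M}. w ^ (j - k))"
        using sum.shift_bounds_nat_ivl[of "\<lambda>j. w ^ (j - k)" 0 k M] by (simp add: lessThan_atLeast0 add.commute)
      also have "\<dots> \<le> (\<Sum>j\<in>{k..<?J}. w ^ (j - k))"
        using \<open>k \<in> {..<K}\<close> w by (intro sum_mono2) auto
      finally show "(\<Sum>i<M. w ^ i) \<le> (\<Sum>j\<in>{k..<?J}. w ^ (j - k))" .
    qed auto
    also have "\<dots> \<le> (\<Sum>k<?J. d k powr n * (\<Sum>j\<in>{k..<?J}. w ^ (j - k)))"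
      using w by (intro sum_mono2) (auto intro!: mult_nonneg_nonneg sum_nonneg)
    also have "\<dots> = (\<Sum>k<?J. \<Sum>j\<in>{k..<?J}. d k powr n * w ^ (j - k))"
      by (simp add: sum_distrib_left)
    also have "\<dots> = (\<Sum>j<?J. \<Sum>k\<le>j. d k powr n * w ^ (j - k))"
      unfolding sum.Sigma[OF finite_lessThan ballI[OF finite_atLeastLessThan]] sum.Sigma[OF finite_lessThan ballI[OF finite_atMost]]
      by (rule sum.reindex_bij_witness[of _ "\<lambda>(a, b). (b, a)" "\<lambda>(a, b). (b, a)"]) auto
    also have "\<dots> \<le> (\<Sum>j<?J. (\<Sum>k\<le>j. w ^ (j - k) * d k powr r) powr (n / r) * W powr (1 - n / r))"
      by (intro sum_mono step)
    also have "\<dots> = (\<Sum>j<?J. (\<Sum>k\<le>j. w ^ (j - k) * d k powr r) powr (n / r)) * W powr (1 - n / r)"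
      by (simp add: sum_distrib_right)
    also have "\<dots> \<le> B * W powr (1 - n / r)"
      by (intro mult_right_mono B) auto
    finally show ?thesis .
  qed
  have "(\<lambda>M. (\<Sum>i<M. w ^ i)) \<longlonglongrightarrow> W"
    using geometric_sums[of w] w by (auto simp: sums_def W_def)
  then have "(\<lambda>M. (\<Sum>k<K. d k powr n) * (\<Sum>i<M. w ^ i)) \<longlonglongrightarrow> (\<Sum>k<K. d k powr n) * W"
    by (intro tendsto_intros)
  then have "(\<Sum>k<K. d k powr n) * W \<le> B * W powr (1 - n / r)"
    using main by (intro LIMSEQ_le_const2) auto
  also have "\<dots> = (B * W powr (- (n / r))) * W" using W by (simp add: powr_diff powr_minus_divide)
  finally have "(\<Sum>k<K. d k powr n) \<le> B * W powr (- (n / r))" using W by simp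
  also have "W powr (- (n / r)) = (1 - w) powr (n / r)"
    using w by (simp add: W_def powr_minus_divide powr_divide)
  finally show ?thesis .
qed

text \<open>With \<open>y = r - n\<close> one has \<open>1 - 2 powr (- y) \<le> y\<close>, and for
  \<open>y < 1\<close> the power \<open>y powr (n / r) = y * y powr (- (y / r))\<close> differs from
  \<open>y\<close> by at most a factor e, because \<open>y * ln (1 / y)\<close> is at most 1. This e
  is the 3 in the constant. For \<open>y \<ge> 1\<close> the left side is at most 1 and the right
  side at least 3.\<close>

lemma weight_power_le:
  fixes n r :: real
  assumes n: "n \<ge> 1" "n < r"
  shows "(1 - 2 powr (- (r - n))) powr (n / r) \<le> 3 * (n + 1) * (1 - n / r)"
proof -
  define y where "y = r - n"
  have y: "y > 0" "r = n + y" using n by (auto simp: y_def)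
  have *: "1 - 2 powr (- y) \<le> y"
  proof -
    have "exp (- (y * ln 2)) \<ge> 1 - y * ln 2" using exp_ge_add_one_self[of "- (y * ln 2)"] by simp
    moreover have "y * ln 2 \<le> y" using y ln_2_less_1 by (simp add: mult_left_le)
    ultimately show ?thesis by (simp add: powr_def)
  qed
  have pos: "0 \<le> 1 - 2 powr (- y)" using y ge_one_powr_ge_zero[of 2 y] by (simp add: powr_minus divide_simps)
  show ?thesis
  proof (cases "y \<ge> 1")
    case True
    have "(1 - 2 powr (- y)) powr (n / r) \<le> 1 powr (n / r)"
      using pos n by (intro powr_mono2) auto
    also have "\<dots> = 1" by simp
    also have "\<dots> \<le> 3 * ((n + 1) * (y / r))"
    proof -
      have "(n + 1) * (y / r) \<ge> 1" using y n True mult_left_mono[of 1 y n] by (simp add: field_simps)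
      then show ?thesis by linarith
    qed
    also have "\<dots> = 3 * (n + 1) * (1 - n / r)" using y n by (simp add: field_simps)
    finally show ?thesis by (simp add: y_def)
  next
    case False
    have "(1 - 2 powr (- y)) powr (n / r) \<le> y powr (n / r)"
      using pos n * by (intro powr_mono2) auto
    also have "\<dots> = y * y powr (- (y / r))"
    proof -
      have e: "n / r = 1 + - (y / r)" using y n by (simp add: field_simps)
      show ?thesis unfolding e powr_add using y by simp
    qed
    also have "y powr (- (y / r)) \<le> exp 1"
    proof -
      have "y * - ln y \<le> 1"
        using ln_le_minus_one[of "1 / y"] y by (simp add: ln_div field_simps)
      then have "(y * - ln y) / r \<le> 1 / r"
        using n by (intro divide_right_mono) auto
      then have "(y / r) * - ln y \<le> 1 / r" by simp
      also have "1 / r \<le> 1" using n by simp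
      finally show ?thesis using y by (simp add: powr_def)
    qed
    also have "exp (1::real) \<le> 3" by (rule exp_le)
    finally have "(1 - 2 powr (- y)) powr (n / r) \<le> 3 * y"
      using y by (simp add: mult.commute)
    also have "y \<le> (n + 1) * (1 - n / r)"
    proof -
      have "1 - n / r = y / r" using y n by (simp add: field_simps)
      moreover have "y * r \<le> (n + 1) * y" using False y by (simp add: mult.commute)
      ultimately show ?thesis using y n by (simp add: field_simps)
    qed
    finally show ?thesis by (simp only: y_def mult.assoc)
  qed
qed

lemma nn_integral_const_dyadic_interval:
  fixes T a :: real
  assumes "T > 0" "a \<ge> 0"
  shows "(\<integral>\<^sup>+t. ennreal (a / (2 * T)) * indicator {T<..2 * T} t \<partial>lborel) = ennreal (a / 2)"
proof -
  have "emeasure lborel {T<..2 * T} = ennreal T" using assms by simp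
  then show ?thesis
    using assms by (simp add: nn_integral_cmult_indicator ennreal_mult[symmetric])
qed

text \<open>Arises when the bound of \<open>osc_ge_sum\<close> at radius \<open>T\<close> is divided
  by \<open>t ^ (2 n) * ball_vol\<close> for t up to \<open>2 T\<close>: one factor
  \<open>2 ^ n\<close> comes from the measure above level \<open>k + 1\<close>, two more from
  \<open>t \<le> 2 T\<close>, and 4 from squaring \<open>2 V\<close>.\<close>

definition scale_const :: "'a::euclidean_space itself \<Rightarrow> real" where
  "scale_const T = ball_vol T / (4 * 2 ^ (3 * DIM('a)))"

lemma scale_const_pos: "scale_const TYPE('a::euclidean_space) > 0"
  unfolding scale_const_def using ball_vol_pos[where 'a='a] by simp

text \<open>The product of \<open>2 / min 1 (scale_const T)\<close> from
  \<open>besov_pow_ge_sum\<close> and \<open>3 * (n + 1)\<close> from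
  \<open>weight_power_le\<close>.\<close>

definition level_const :: "'a::euclidean_space itself \<Rightarrow> real" where
  "level_const T = 6 * (real DIM('a) + 1) / min 1 (scale_const T)"

lemma level_const_pos: "level_const TYPE('a::euclidean_space) > 0"
  unfolding level_const_def using scale_const_pos[where 'a='a] by simp

context
  fixes f :: "'a::euclidean_space \<Rightarrow> real" and V r :: real
  assumes f [measurable]: "f \<in> borel_measurable borel"
    and V: "emeasure lborel {x. f x \<noteq> 0} = ennreal V" "V > 0"
    and r: "r > real DIM('a)" and L: "Lp_pow r f < \<infinity>"
begin

lemma exponent_ge_1: "r \<ge> 1" "r > 0"
  using r DIM_positive[where 'a='a] by linarith+

abbreviation level_gap :: "nat \<Rightarrow> real" where "level_gap k \<equiv> dyadic_level f (Suc k) - dyadic_level f k"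

lemma level_gap_nonneg: "level_gap k \<ge> 0"
  using monoD[OF mono_dyadic_level[OF f V], of k "Suc k"] by simp

text \<open>The exponents of the Besov norm amount to dividing \<open>osc\<close> by
  \<open>t ^ (2 n) * ball_vol\<close> and raising to the power \<open>n / r\<close>. Of the decay
  rate \<open>n + r\<close> between dyadic scales this leaves only \<open>r - n\<close>, which is
  the ratio \<open>w\<close>.\<close>

lemma besov_integrand_ge:
  fixes j :: nat and t :: real
  defines "T \<equiv> supp_radius f / 2 ^ j" and "w \<equiv> 2 powr (- (r - real DIM('a)))"
  assumes t: "T < t" "t \<le> 2 * T"
  shows "min 1 (scale_const TYPE('a)) * (\<Sum>k\<le>j. w ^ (j - k) * level_gap k powr r) powr (real DIM('a) / r) / (2 * T)
    \<le> t powr (- (real DIM('a) / r) * real DIM('a)) * modulus r f t powr real DIM('a) / t"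
proof -
  let ?n = "real DIM('a)" and ?om = "ball_vol TYPE('a)" and ?N = "DIM('a)"
  let ?Y = "\<Sum>k\<le>j. w ^ (j - k) * level_gap k powr r" and ?O = "enn2real (osc r f t)"
  have om: "?om > 0" by (rule ball_vol_pos)
  have T: "T > 0" unfolding T_def using supp_radius_pos[OF f V] by simp
  have t0: "t > 0" using t T by simp
  have Y0: "?Y \<ge> 0" by (intro sum_nonneg) (auto simp: w_def)
  have TN: "T ^ ?N * ?om = 2 * V / 2 ^ (j * ?N)"
    using supp_radius_pow[OF f V] by (simp add: T_def power_divide power_mult)
  have O: "V\<^sup>2 / (2 ^ ?N * (2 ^ (j * ?N))\<^sup>2) * ?Y \<le> ?O"
  proof -
    have "V\<^sup>2 / (2 ^ ?N * (2 ^ (j * ?N))\<^sup>2) * ?Y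
       = (\<Sum>k\<le>j. 2 powr (- (real (j - k) * r)) * level_gap k powr r * (V / 2 ^ (Suc k * ?N)) * (V / 2 ^ (j * ?N)))"
      unfolding sum_distrib_left
    proof (intro sum.cong refl)
      fix k assume "k \<in> {..j}"
      then have kj: "k \<le> j" by simp
      have 1: "2 powr (- (real (j - k) * r)) = w ^ (j - k) * (2 ^ (k * ?N) / 2 ^ (j * ?N))"
      proof -
        have "w ^ (j - k) = 2 powr (- (real (j - k) * (r - ?n)))"
          unfolding w_def by (simp add: powr_realpow[symmetric] powr_powr algebra_simps)
        moreover have "2 ^ (k * ?N) / 2 ^ (j * ?N) = 2 powr (- (real (j - k) * ?n))"
          using kj by (simp add: powr_realpow[symmetric] powr_diff[symmetric] of_nat_diff algebra_simps)
        ultimately show ?thesis by (simp add: powr_add[symmetric] algebra_simps)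
      qed
      show "V\<^sup>2 / (2 ^ ?N * (2 ^ (j * ?N))\<^sup>2) * (w ^ (j - k) * level_gap k powr r)
         = 2 powr (- (real (j - k) * r)) * level_gap k powr r * (V / 2 ^ (Suc k * ?N)) * (V / 2 ^ (j * ?N))"
        unfolding 1 by (simp add: power2_eq_square power_add field_simps)
    qed
    also have "\<dots> \<le> ?O"
    proof -
      have "ennreal (\<Sum>k\<le>j. 2 powr (- (real (j - k) * r)) * level_gap k powr r * (V / 2 ^ (Suc k * ?N)) * (V / 2 ^ (j * ?N))) \<le> osc r f T"
        unfolding T_def by (rule osc_ge_sum[OF f V exponent_ge_1(1)])
      also have "\<dots> \<le> osc r f t" using t by (intro osc_mono) simp
      also have "\<dots> = ennreal ?O" using osc_finite[OF f exponent_ge_1(1) L, of t] by simp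
      finally show ?thesis by (simp add: ennreal_le_iff)
    qed
    finally show ?thesis .
  qed
  have tt: "t ^ ?N * (t ^ ?N * ?om) \<le> 2 ^ (2 * ?N) * (2 * V / 2 ^ (j * ?N))\<^sup>2 / ?om"
  proof -
    have "t ^ ?N \<le> (2 * T) ^ ?N" using t t0 by (intro power_mono) auto
    then have "t ^ ?N * (t ^ ?N * ?om) \<le> (2 * T) ^ ?N * ((2 * T) ^ ?N * ?om)"
      using t0 om T by (intro mult_mono) auto
    also have "\<dots> = 2 ^ (2 * ?N) * (T ^ ?N * ?om)\<^sup>2 / ?om"
    proof -
      have "(2::real) ^ (2 * ?N) = 2 ^ ?N * 2 ^ ?N" by (simp only: mult_2 power_add)
      moreover have "(a * b) * ((a * b) * om) = (a * a) * (b * om)\<^sup>2 / om" if "om > 0" for a b om :: real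
        using that by (simp add: power2_eq_square)
      ultimately show ?thesis using om by (simp only: power_mult_distrib)
    qed
    finally show ?thesis unfolding TN .
  qed
  have ratio: "scale_const TYPE('a) * ?Y \<le> ?O / (t ^ ?N * (t ^ ?N * ?om))"
  proof -
    have "scale_const TYPE('a) * ?Y
       = (V\<^sup>2 / (2 ^ ?N * (2 ^ (j * ?N))\<^sup>2) * ?Y) / (2 ^ (2 * ?N) * (2 * V / 2 ^ (j * ?N))\<^sup>2 / ?om)"
    proof -
      have "3 * ?N = ?N + ?N + ?N" "2 * ?N = ?N + ?N" by simp_all
      then have p: "(2::real) ^ (3 * ?N) = 2 ^ ?N * 2 ^ ?N * 2 ^ ?N" "(2::real) ^ (2 * ?N) = 2 ^ ?N * 2 ^ ?N"
        by (simp_all only: power_add)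
      have gen: "om / (4 * (a * a * a)) * y = (V\<^sup>2 / (a * b\<^sup>2) * y) / (a * a * (2 * V / b)\<^sup>2 / om)"
        if "a > 0" "b > 0" "om > 0" for a b om y :: real
        using that V by (simp add: field_simps power2_eq_square)
      show ?thesis unfolding scale_const_def p by (rule gen) (use om in auto)
    qed
    also have "\<dots> \<le> ?O / (2 ^ (2 * ?N) * (2 * V / 2 ^ (j * ?N))\<^sup>2 / ?om)"
      using om by (intro divide_right_mono O) auto
    also have "\<dots> \<le> ?O / (t ^ ?N * (t ^ ?N * ?om))"
      using t0 om by (intro frac_le tt) auto
    finally show ?thesis .
  qed
  have eq: "t powr (- (?n / r) * ?n) * modulus r f t powr ?n = (?O / (t ^ ?N * (t ^ ?N * ?om))) powr (?n / r)"
  proof -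
    have "t powr (- (?n / r) * ?n) = (t ^ ?N) powr (- (?n / r))"
      using t0 by (simp add: powr_realpow[symmetric] powr_powr mult.commute)
    moreover have "modulus r f t powr ?n = (?O / (t ^ ?N * ?om)) powr (?n / r)"
      unfolding modulus_eq_osc[OF f exponent_ge_1(1) L] by (simp add: powr_powr)
    ultimately show ?thesis
      using t0 om by (simp add: powr_divide powr_mult powr_minus divide_simps)
  qed
  have "min 1 (scale_const TYPE('a)) * ?Y powr (?n / r) \<le> (scale_const TYPE('a)) powr (?n / r) * ?Y powr (?n / r)"
  proof (intro mult_right_mono)
    \<comment> \<open>The exponent \<open>n / r\<close> varies with \<open>r\<close> in the interval
      (0, 1); the minimum with 1 gives a lower bound uniform in \<open>r\<close>.\<close>
    show "min 1 (scale_const TYPE('a)) \<le> scale_const TYPE('a) powr (?n / r)"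
    proof (cases "scale_const TYPE('a) \<ge> 1")
      case True
      then show ?thesis using exponent_ge_1 by (simp add: ge_one_powr_ge_zero)
    next
      case False
      have "scale_const TYPE('a) powr 1 \<le> scale_const TYPE('a) powr (?n / r)"
        using False scale_const_pos[where 'a='a] r exponent_ge_1 by (intro powr_mono') auto
      then show ?thesis using scale_const_pos[where 'a='a] by simp
    qed
  qed auto
  also have "\<dots> = (scale_const TYPE('a) * ?Y) powr (?n / r)"
    using Y0 scale_const_pos[where 'a='a] by (simp add: powr_mult)
  also have "\<dots> \<le> (?O / (t ^ ?N * (t ^ ?N * ?om))) powr (?n / r)"
    using ratio Y0 scale_const_pos[where 'a='a] exponent_ge_1 by (intro powr_mono2) auto
  also have "\<dots> = t powr (- (?n / r) * ?n) * modulus r f t powr ?n" by (rule eq[symmetric])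
  finally show ?thesis
    using t t0 by (intro frac_le) auto
qed

text \<open>The intervals from \<open>T j\<close> to \<open>2 * T j\<close> are pairwise disjoint,
  so every scale contributes its own share of the integral over t, half of the constant integrand
  times the length ratio.\<close>

lemma besov_pow_ge_sum:
  fixes w :: real
  defines "w \<equiv> 2 powr (- (r - real DIM('a)))"
  shows "ennreal (min 1 (scale_const TYPE('a)) / 2 *
     (\<Sum>j<J. (\<Sum>k\<le>j. w ^ (j - k) * level_gap k powr r) powr (real DIM('a) / r)))
    \<le> besov_pow (real DIM('a) / r) r (real DIM('a)) f"
proof -
  let ?n = "real DIM('a)" and ?T = "\<lambda>j. supp_radius f / 2 ^ j"
  let ?F = "\<lambda>t. ennreal (t powr (- (?n / r) * ?n) * modulus r f t powr ?n / t)"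
  let ?Y = "\<lambda>j. \<Sum>k\<le>j. w ^ (j - k) * level_gap k powr r"
  have R: "supp_radius f > 0" by (rule supp_radius_pos[OF f V])
  have mu: "0 \<le> min 1 (scale_const TYPE('a))" using scale_const_pos[where 'a='a] by simp
  have each: "ennreal (min 1 (scale_const TYPE('a)) / 2 * ?Y j powr (?n / r))
      \<le> (\<integral>\<^sup>+t. ennreal (min 1 (scale_const TYPE('a)) * ?Y j powr (?n / r) / (2 * ?T j)) * indicator {?T j<..2 * ?T j} t \<partial>lborel)" for j
    using nn_integral_const_dyadic_interval[of "?T j" "min 1 (scale_const TYPE('a)) * ?Y j powr (?n / r)"] R mu
    by (simp add: mult_nonneg_nonneg)
  have disj: "(\<Sum>j<J. indicator {?T j<..2 * ?T j} t :: ennreal) \<le> indicator {0<..} t" for t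
  proof (cases "\<exists>j<J. t \<in> {?T j<..2 * ?T j}")
    case True
    then obtain j where j: "j < J" "t \<in> {?T j<..2 * ?T j}" by blast
    have uniq: "i = j" if i: "t \<in> {?T i<..2 * ?T i}" for i
    proof (rule ccontr)
      assume "i \<noteq> j"
      have *: False if "a < b" "t \<in> {?T a<..2 * ?T a}" "t \<in> {?T b<..2 * ?T b}" for a b
      proof -
        have "(2::real) * 2 ^ a \<le> 2 ^ b" using power_increasing[of "Suc a" b "2::real"] that by simp
        then have "2 * ?T b \<le> ?T a" using R by (simp add: field_simps)
        then show False using that by auto
      qed
      show False using *[of i j] *[of j i] i j \<open>i \<noteq> j\<close> by (cases "i < j") auto
    qed
    have "(\<Sum>i<J. indicator {?T i<..2 * ?T i} t :: ennreal) = (\<Sum>i<J. if i = j then 1 else 0)"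
    proof (intro sum.cong refl)
      fix i
      show "(indicator {?T i<..2 * ?T i} t :: ennreal) = (if i = j then 1 else 0)"
      proof (cases "i = j")
        case True
        then show ?thesis using j(2) by (simp only: indicator_simps simp_thms if_True)
      next
        case False
        then have "t \<notin> {?T i<..2 * ?T i}" using uniq by blast
        then show ?thesis using False by (simp add: indicator_def del: greaterThanAtMost_iff)
      qed
    qed
    also have "\<dots> = 1" using j(1) by simp
    also have "\<dots> \<le> indicator {0<..} t"
    proof -
      have "0 < ?T j" "?T j < t" using R j(2) by auto
      then have "0 < t" by (rule less_trans)
      then show ?thesis by simp
    qed
    finally show ?thesis .
  next
    case False
    then have "(\<Sum>j<J. indicator {?T j<..2 * ?T j} t :: ennreal) = 0" by (intro sum.neutral) (auto simp: indicator_def)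
    then show ?thesis by simp
  qed
  have "ennreal (min 1 (scale_const TYPE('a)) / 2 * (\<Sum>j<J. ?Y j powr (?n / r)))
     = (\<Sum>j<J. ennreal (min 1 (scale_const TYPE('a)) / 2 * ?Y j powr (?n / r)))"
    using mu by (subst sum_ennreal) (auto simp: sum_distrib_left)
  also have "\<dots> \<le> (\<Sum>j<J. \<integral>\<^sup>+t. ennreal (min 1 (scale_const TYPE('a)) * ?Y j powr (?n / r) / (2 * ?T j)) * indicator {?T j<..2 * ?T j} t \<partial>lborel)"
    by (intro sum_mono each)
  also have "\<dots> = (\<integral>\<^sup>+t. (\<Sum>j<J. ennreal (min 1 (scale_const TYPE('a)) * ?Y j powr (?n / r) / (2 * ?T j)) * indicator {?T j<..2 * ?T j} t) \<partial>lborel)"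
    by (rule nn_integral_sum[symmetric]) auto
  also have "\<dots> \<le> (\<integral>\<^sup>+t. ?F t * (\<Sum>j<J. indicator {?T j<..2 * ?T j} t) \<partial>lborel)"
    unfolding sum_distrib_left using besov_integrand_ge
    by (intro nn_integral_mono sum_mono) (auto simp: indicator_def w_def intro!: ennreal_leI)
  also have "\<dots> \<le> (\<integral>\<^sup>+t. ?F t * indicator {0<..} t \<partial>lborel)"
    by (intro nn_integral_mono mult_left_mono disj) auto
  also have "\<dots> = besov_pow (?n / r) r ?n f"
    unfolding besov_pow_def by simp
  finally show ?thesis .
qed

lemma sum_level_gaps_le:
  assumes "besov_pow (real DIM('a) / r) r (real DIM('a)) f < \<infinity>"
  shows "(\<Sum>k<K. level_gap k powr real DIM('a))
    \<le> level_const TYPE('a) * (1 - real DIM('a) / r) * enn2real (besov_pow (real DIM('a) / r) r (real DIM('a)) f)"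
proof -
  let ?n = "real DIM('a)" and ?m = "min 1 (scale_const TYPE('a))"
  let ?B = "enn2real (besov_pow (?n / r) r ?n f)"
  define w where "w = 2 powr (- (r - ?n))"
  have mu: "?m > 0" using scale_const_pos[where 'a='a] by simp
  have n: "?n \<ge> 1" using DIM_positive[where 'a='a] by linarith
  have w: "0 < w" "w < 1" using r by (auto simp: w_def powr_less_one)
  have "(\<Sum>j<J. (\<Sum>k\<le>j. w ^ (j - k) * level_gap k powr r) powr (?n / r)) \<le> 2 / ?m * ?B" for J
  proof -
    have "ennreal (?m / 2 * (\<Sum>j<J. (\<Sum>k\<le>j. w ^ (j - k) * level_gap k powr r) powr (?n / r))) \<le> ennreal ?B"
      using besov_pow_ge_sum[of J] assms unfolding w_def by simp
    then have "?m / 2 * (\<Sum>j<J. (\<Sum>k\<le>j. w ^ (j - k) * level_gap k powr r) powr (?n / r)) \<le> ?B"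
      by (simp add: ennreal_le_iff)
    then show ?thesis using mu by (simp add: field_simps)
  qed
  then have "(\<Sum>k<K. level_gap k powr ?n) \<le> 2 / ?m * ?B * (1 - w) powr (?n / r)"
    using n r w by (intro summation_by_scales level_gap_nonneg) auto
  also have "\<dots> \<le> 2 / ?m * ?B * (3 * (?n + 1) * (1 - ?n / r))"
    using mu n r unfolding w_def by (intro mult_left_mono weight_power_le) auto
  also have "\<dots> = level_const TYPE('a) * (1 - ?n / r) * ?B"
    by (simp add: level_const_def)
  finally show ?thesis .
qed

text \<open>Hoelder applied to the telescoping sum of \<open>K\<close> gaps. The price
  \<open>K powr (n - 1)\<close> means that the level raised to the conjugate exponent grows at most
  linearly in \<open>K\<close>, which is what the exponential can bear.\<close>

lemma dyadic_level_powr_le: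
  assumes "besov_pow (real DIM('a) / r) r (real DIM('a)) f < \<infinity>" and n2: "DIM('a) \<ge> 2"
  shows "dyadic_level f K powr real DIM('a) \<le> real K powr (real DIM('a) - 1) *
    (level_const TYPE('a) * (1 - real DIM('a) / r) * enn2real (besov_pow (real DIM('a) / r) r (real DIM('a)) f))"
proof -
  let ?n = "real DIM('a)"
  have "dyadic_level f K = (\<Sum>k<K. level_gap k * 1)"
    using sum_lessThan_telescope[of "dyadic_level f" K] dyadic_level_0[OF f V] by simp
  then have "dyadic_level f K powr ?n = (\<Sum>k<K. level_gap k * 1) powr ?n" by simp
  also have "\<dots> \<le> (\<Sum>k<K. level_gap k powr ?n * 1) * (\<Sum>k<K. 1) powr (?n - 1)"
    using n2 level_gap_nonneg by (intro powr_sum_weighted) auto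
  also have "\<dots> = real K powr (?n - 1) * (\<Sum>k<K. level_gap k powr ?n)" by simp
  also have "\<dots> \<le> real K powr (?n - 1) * (level_const TYPE('a) * (1 - ?n / r) * enn2real (besov_pow (?n / r) r ?n f))"
    by (intro mult_left_mono sum_level_gaps_le assms) auto
  finally show ?thesis .
qed

end

lemma le_suminf_ennreal: "(f k :: ennreal) \<le> (\<Sum>k. f k)"
  using sum_le_suminf[of f "{k}"] by simp

section \<open>Invariance under changes on null sets\<close>

lemma AE_lborel_translate:
  fixes h :: "'a::euclidean_space"
  assumes "AE x in lborel. P x"
  shows "AE x in lborel. P (x + h)"
proof -
  have "AE x in distr lborel borel ((+) h). P x" using assms by (simp only: lborel_distr_plus)
  then have "AE x in lborel. P (h + x)" by (rule AE_distrD[rotated]) auto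
  then show ?thesis by (simp only: add.commute)
qed

context
  fixes f g :: "'a::euclidean_space \<Rightarrow> real"
  assumes fg: "AE x in lborel. f x = g x"
begin

lemma Lp_pow_cong: "Lp_pow p f = Lp_pow p g"
  unfolding Lp_pow_lborel using fg by (intro nn_integral_cong_AE) auto

lemma diff_pow_cong: "diff_pow p f h = diff_pow p g h"
  unfolding diff_pow_def using fg AE_lborel_translate[OF fg, of h]
  by (intro nn_integral_cong_AE) auto

lemma modulus_cong: "modulus p f t = modulus p g t"
  unfolding modulus_def Lp_norm_def Lp_pow_diff_op diff_pow_cong ..

lemma besov_pow_cong: "besov_pow s p q f = besov_pow s p q g"
  unfolding besov_pow_def modulus_cong ..

lemma besov_norm_cong: "besov_norm s p q f = besov_norm s p q g"
  unfolding besov_norm_def besov_pow_cong ..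

lemma besov_MT_cong: "besov_MT c r f = besov_MT c r g"
  unfolding besov_MT_def Let_def besov_norm_cong nn_integral_completion
  using fg by (intro nn_integral_cong_AE) auto

lemma emeasure_support_cong:
  assumes "f \<in> borel_measurable lebesgue" "g \<in> borel_measurable borel"
  shows "emeasure lebesgue {x. f x \<noteq> 0} = emeasure lborel {x. g x \<noteq> 0}"
proof -
  have 1: "{x \<in> space lebesgue. f x \<noteq> 0} \<in> sets lebesgue"
    using assms(1) by measurable
  have 2: "{x. g x \<noteq> 0} \<in> sets lborel" using assms(2) by measurable
  have "emeasure lebesgue {x. f x \<noteq> 0} = emeasure lebesgue {x. g x \<noteq> 0}"
    using AE_completion[OF fg] 1 2 by (intro emeasure_eq_AE) auto
  also have "\<dots> = emeasure lborel {x. g x \<noteq> 0}" using 2 by simp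
  finally show ?thesis .
qed

end

subsection \<open>Exponential integrability\<close>

text \<open>The root of \<open>level_const\<close> cancels the constant of the level estimate. The
  additional 2 becomes \<open>2 powr conj_exp n\<close>, which is at least 2, and brings the
  exponent at level \<open>K\<close> down to \<open>K / 2\<close>.\<close>

definition MT_const :: "'a::euclidean_space itself \<Rightarrow> real" where
  "MT_const T = 1 / (2 * level_const T powr (1 / real DIM('a)))"

lemma MT_const_pos: "MT_const TYPE('a::euclidean_space) > 0"
  unfolding MT_const_def using level_const_pos[where 'a='a] by simp

lemma exp_half_le: "exp (real k / 2) \<le> 2 ^ k"
proof -
  have "exp (1/2 :: real) \<le> 2"
  proof (rule power2_le_imp_le)
    have "(exp (1/2 :: real))\<^sup>2 = exp 1" by (simp add: power2_eq_square exp_add[symmetric])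
    also have "\<dots> \<le> 3" by (rule exp_le)
    finally show "(exp (1/2 :: real))\<^sup>2 \<le> 2\<^sup>2" by simp
  qed auto
  then have "exp (1/2 :: real) ^ k \<le> 2 ^ k" by (rule power_mono) simp
  then show ?thesis by (simp add: exp_of_nat_mult[symmetric])
qed

text \<open>Between the levels \<open>k\<close> and \<open>k + 1\<close> the integrand is at most
  \<open>2 ^ (k + 1)\<close>, on a set of measure at most \<open>V / 2 ^ (k n)\<close>. As n is at
  least 2 the products are at most \<open>2 * V / 2 ^ k\<close>, and their sum is
  \<open>4 * V\<close>.\<close>

lemma besov_MT_le:
  fixes f :: "'a::euclidean_space \<Rightarrow> real"
  assumes n2: "DIM('a) \<ge> 2" and f [measurable]: "f \<in> borel_measurable borel"
    and V: "emeasure lborel {x. f x \<noteq> 0} = ennreal V" "V > 0"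
    and r: "r > real DIM('a)" and L: "Lp_pow r f < \<infinity>"
    and B: "besov_pow (real DIM('a) / r) r (real DIM('a)) f < \<infinity>"
  shows "besov_MT (MT_const TYPE('a)) r f \<le> ennreal (4 * V)"
proof -
  let ?n = "real DIM('a)" and ?C = "level_const TYPE('a)" and ?c = "MT_const TYPE('a)"
  define N where "N = (1 - ?n / r) powr (1 / ?n) * besov_norm (?n / r) r ?n f"
  define F where "F x = exp ((?c * \<bar>f x\<bar> / N) powr conj_exp ?n) - 1" for x
  have MT: "besov_MT ?c r f = (\<integral>\<^sup>+x. ennreal (F x) \<partial>lborel)"
    unfolding besov_MT_def Let_def N_def F_def nn_integral_completion ..
  have n: "?n > 1" "?n \<ge> 2" using n2 by auto
  have C: "?C > 0" by (rule level_const_pos)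
  have c: "?c > 0" by (rule MT_const_pos)
  show ?thesis
  \<comment> \<open>Division by 0 gives 0, so the integrand \<open>exp 0 - 1\<close> vanishes in
    this case.\<close>
  proof (cases "N = 0")
    case True
    then show ?thesis unfolding MT F_def by simp
  next
    case False
    then have N: "N > 0" unfolding N_def besov_norm_def by (simp add: less_le)
    have Nn: "N powr ?n = (1 - ?n / r) * enn2real (besov_pow (?n / r) r ?n f)"
      unfolding N_def besov_norm_def using n r by (simp add: powr_mult powr_powr)
    \<comment> \<open>The n-th power of the base is at most
      \<open>K powr (n - 1) / 2 powr n\<close>; the power \<open>1 / (n - 1)\<close> of this is
      \<open>K\<close> divided by \<open>2 powr (n / (n - 1))\<close>, and that divisor is at least
      2.\<close>
    have lev: "(?c * dyadic_level f K / N) powr conj_exp ?n \<le> real K / 2" for K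
    proof -
      have l0: "dyadic_level f K \<ge> 0" by (rule dyadic_level_nonneg[OF f V])
      have "(?c * dyadic_level f K / N) powr ?n = ?c powr ?n * dyadic_level f K powr ?n / N powr ?n"
        using c l0 N by (simp add: powr_mult powr_divide)
      also have "\<dots> \<le> ?c powr ?n * (real K powr (?n - 1) * (?C * N powr ?n)) / N powr ?n"
        using dyadic_level_powr_le[OF f V r L B n2, of K, unfolded mult.assoc, folded Nn]
        by (intro divide_right_mono mult_left_mono) auto
      also have "\<dots> = (?c powr ?n * ?C) * real K powr (?n - 1)"
        using N by simp
      also have "?c powr ?n * ?C = 1 / 2 powr ?n"
        unfolding MT_const_def using C n by (simp add: powr_divide powr_mult powr_powr)
      finally have "((?c * dyadic_level f K / N) powr ?n) powr (1 / (?n - 1))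
          \<le> (1 / 2 powr ?n * real K powr (?n - 1)) powr (1 / (?n - 1))"
        using n by (intro powr_mono2) auto
      also have "((?c * dyadic_level f K / N) powr ?n) powr (1 / (?n - 1)) = (?c * dyadic_level f K / N) powr conj_exp ?n"
        by (simp add: powr_powr conj_exp_def)
      also have "(1 / 2 powr ?n * real K powr (?n - 1)) powr (1 / (?n - 1)) = (1 / 2 powr ?n) powr (1 / (?n - 1)) * real K"
        unfolding powr_mult powr_powr using n by simp
      also have "(1 / 2 powr ?n) powr (1 / (?n - 1)) = 1 / 2 powr (?n / (?n - 1))"
        by (simp add: powr_divide powr_powr)
      also have "\<dots> \<le> 1 / 2"
      proof -
        have "(2::real) powr 1 \<le> 2 powr (?n / (?n - 1))" using n by (intro powr_mono) auto
        then show ?thesis by (simp add: field_simps)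
      qed
      finally show ?thesis by (simp add: mult_right_mono)
    qed
    have pt: "ennreal (F x) \<le> (\<Sum>k. ennreal (2 ^ Suc k) * indicator {x. dyadic_level f k < \<bar>f x\<bar>} x)" for x
    proof (cases "f x = 0")
      case True
      then show ?thesis by (simp add: F_def)
    next
      case nz: False
      have "\<exists>k. dyadic_level f k < \<bar>f x\<bar> \<and> F x \<le> 2 ^ Suc k"
      proof (cases "\<exists>K. \<bar>f x\<bar> \<le> dyadic_level f K")
        case True
        define K where "K = (LEAST K. \<bar>f x\<bar> \<le> dyadic_level f K)"
        have K: "\<bar>f x\<bar> \<le> dyadic_level f K" unfolding K_def using True by (rule LeastI_ex)
        have "K \<noteq> 0" using K nz dyadic_level_0[OF f V] by (intro notI) simp
        then obtain k where k: "K = Suc k" by (cases K) auto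
        have "\<not> \<bar>f x\<bar> \<le> dyadic_level f k" using k not_less_Least[of k "\<lambda>K. \<bar>f x\<bar> \<le> dyadic_level f K"] by (auto simp: K_def)
        moreover have "F x \<le> 2 ^ Suc k"
        proof -
          have "F x \<le> exp ((?c * \<bar>f x\<bar> / N) powr conj_exp ?n)" by (simp add: F_def)
          also have "\<dots> \<le> exp ((?c * dyadic_level f K / N) powr conj_exp ?n)"
            unfolding exp_le_cancel_iff using K c N n
            by (intro powr_mono2 divide_right_mono mult_left_mono) (auto simp: conj_exp_def)
          also have "\<dots> \<le> exp (real K / 2)" using lev[of K] by simp
          also have "\<dots> \<le> 2 ^ K" by (rule exp_half_le)
          finally show ?thesis by (simp add: k)
        qed
        ultimately show ?thesis by (auto simp: not_le)
      next
        case False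
        \<comment> \<open>Here the value exceeds every level, so \<open>k\<close> is dictated by
          \<open>F x\<close> alone.\<close>
        obtain k where "F x < 2 ^ k" using real_arch_pow[of 2 "F x"] by auto
        moreover have "(0::real) \<le> 2 ^ k" by simp
        ultimately have "F x \<le> 2 ^ Suc k" unfolding power_Suc by linarith
        then show ?thesis using False by (auto simp: not_le)
      qed
      then obtain k where k: "dyadic_level f k < \<bar>f x\<bar>" "F x \<le> 2 ^ Suc k" by blast
      have "ennreal (F x) \<le> ennreal (2 ^ Suc k) * indicator {x. dyadic_level f k < \<bar>f x\<bar>} x"
        using k by (simp add: ennreal_leI)
      also have "\<dots> \<le> (\<Sum>k. ennreal (2 ^ Suc k) * indicator {x. dyadic_level f k < \<bar>f x\<bar>} x)"
        by (rule le_suminf_ennreal)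
      finally show ?thesis .
    qed
    have "(\<integral>\<^sup>+x. ennreal (F x) \<partial>lborel)
       \<le> (\<integral>\<^sup>+x. (\<Sum>k. ennreal (2 ^ Suc k) * indicator {x. dyadic_level f k < \<bar>f x\<bar>} x) \<partial>lborel)"
      by (intro nn_integral_mono pt)
    also have "\<dots> = (\<Sum>k. \<integral>\<^sup>+x. ennreal (2 ^ Suc k) * indicator {x. dyadic_level f k < \<bar>f x\<bar>} x \<partial>lborel)"
      by (rule nn_integral_suminf) measurable
    also have "\<dots> = (\<Sum>k. ennreal (2 ^ Suc k) * emeasure lborel {x. dyadic_level f k < \<bar>f x\<bar>})"
      by (intro suminf_cong nn_integral_cmult_indicator) measurable
    also have "\<dots> \<le> (\<Sum>k. ennreal (2 * V * (1/2) ^ k))"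
    proof (intro suminf_le)
      fix k
      have "ennreal (2 ^ Suc k) * emeasure lborel {x. dyadic_level f k < \<bar>f x\<bar>} \<le> ennreal (2 ^ Suc k) * ennreal (V / 2 ^ (k * DIM('a)))"
        by (intro mult_left_mono emeasure_gt_dyadic_level[OF f V]) auto
      also have "\<dots> = ennreal (2 ^ Suc k * (V / 2 ^ (k * DIM('a))))"
        using V by (subst ennreal_mult[symmetric]) auto
      also have "\<dots> \<le> ennreal (2 * V * (1/2) ^ k)"
      proof (rule ennreal_leI)
        have "(2::real) ^ (k * 2) \<le> 2 ^ (k * DIM('a))" using n2 by (intro power_increasing) auto
        then have "V / 2 ^ (k * DIM('a)) \<le> V / 2 ^ (k * 2)" using V by (intro divide_left_mono) auto
        then have "2 ^ Suc k * (V / 2 ^ (k * DIM('a))) \<le> 2 ^ Suc k * (V / 2 ^ (k * 2))"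
          by (rule mult_left_mono) simp
        also have "\<dots> = 2 * V * (1/2) ^ k"
        proof -
          have "(2::real) ^ (k * 2) = 2 ^ k * 2 ^ k" by (simp only: mult_2_right power_add)
          then show ?thesis by (simp add: power_divide)
        qed
        finally show "2 ^ Suc k * (V / 2 ^ (k * DIM('a))) \<le> 2 * V * (1/2) ^ k" .
      qed
      finally show "ennreal (2 ^ Suc k) * emeasure lborel {x. dyadic_level f k < \<bar>f x\<bar>} \<le> ennreal (2 * V * (1/2) ^ k)" .
    qed auto
    also have "\<dots> = ennreal (4 * V)"
    proof (rule suminf_ennreal_eq)
      have "(\<lambda>k. 2 * V * (1/2) ^ k) sums (2 * V * (1 / (1 - 1/2)))"
        by (intro sums_mult geometric_sums) auto
      then show "(\<lambda>k. 2 * V * (1/2) ^ k) sums (4 * V)" by simp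
    qed (use V in auto)
    finally show ?thesis unfolding MT .
  qed
qed

lemma lebesgue_borel_rep:
  fixes f :: "'a::euclidean_space \<Rightarrow> real"
  assumes "f \<in> borel_measurable lebesgue"
  obtains g where "g \<in> borel_measurable borel" "AE x in lborel. f x = g x"
  using completion_ex_borel_measurable_real[OF assms] by auto

lemma besov_MT_div_support_le:
  fixes f :: "'a::euclidean_space \<Rightarrow> real"
  assumes n2: "DIM('a) \<ge> 2" and r: "r > real DIM('a)"
    and B: "in_Besov (real DIM('a) / r) r (real DIM('a)) f"
    and S: "0 < emeasure lebesgue {x. f x \<noteq> 0}" "emeasure lebesgue {x. f x \<noteq> 0} < \<infinity>"
  shows "besov_MT (MT_const TYPE('a)) r f / emeasure lebesgue {x. f x \<noteq> 0} \<le> ennreal 4"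
proof -
  have fm: "f \<in> borel_measurable lebesgue" using B by (simp add: in_Besov_def in_Lp_def)
  obtain g where g: "g \<in> borel_measurable borel" "AE x in lborel. f x = g x"
    by (rule lebesgue_borel_rep[OF fm])
  have sup: "emeasure lebesgue {x. f x \<noteq> 0} = emeasure lborel {x. g x \<noteq> 0}"
    by (rule emeasure_support_cong[OF g(2) fm g(1)])
  obtain V where V: "emeasure lborel {x. g x \<noteq> 0} = ennreal V" "V > 0"
    using S unfolding sup by (cases "emeasure lborel {x. g x \<noteq> 0}" rule: ennreal_cases) auto
  have "besov_MT (MT_const TYPE('a)) r g \<le> ennreal (4 * V)"
    using B by (intro besov_MT_le n2 g V r)
      (simp_all add: in_Besov_def in_Lp_def besov_pow_cong[OF g(2)] Lp_pow_cong[OF g(2)])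
  then have "besov_MT (MT_const TYPE('a)) r f / ennreal V \<le> ennreal (4 * V) / ennreal V"
    unfolding besov_MT_cong[OF g(2)] by (rule divide_right_mono_ennreal)
  also have "\<dots> = ennreal 4" using V by (simp add: divide_ennreal)
  finally show ?thesis unfolding sup V .
qed

text \<open>A vanishing norm forces all levels to be 0; then the whole support would have measure at
  most \<open>V / 2 ^ n\<close>. Part (b) depends on this, because dividing by a zero norm would
  make the Besov integral 0.\<close>

lemma besov_norm_pos:
  fixes f :: "'a::euclidean_space \<Rightarrow> real"
  assumes n2: "DIM('a) \<ge> 2" and r: "r > real DIM('a)" and f: "f \<in> borel_measurable borel"
    and V: "emeasure lborel {x. f x \<noteq> 0} = ennreal V" "V > 0"
    and L: "Lp_pow r f < \<infinity>"
    and B: "besov_pow (real DIM('a) / r) r (real DIM('a)) f < \<infinity>"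
  shows "besov_norm (real DIM('a) / r) r (real DIM('a)) f > 0"
proof (rule ccontr)
  let ?n = "real DIM('a)"
  assume "\<not> ?thesis"
  then have 0: "enn2real (besov_pow (?n / r) r ?n f) = 0"
    unfolding besov_norm_def by (metis powr_gt_zero)
  have lev: "dyadic_level f K = 0" for K
    using dyadic_level_powr_le[OF f V r L B n2, of K] dyadic_level_nonneg[OF f V, of K] unfolding 0
    by simp
  have "ennreal V \<le> ennreal (V / 2 ^ (1 * DIM('a)))"
    using emeasure_gt_dyadic_level[OF f V, of 1] V unfolding lev by simp
  then have "V \<le> V / 2 ^ DIM('a)" using V by (simp add: ennreal_le_iff)
  moreover have "(2::real) ^ DIM('a) > 1" using n2 by (intro one_less_power) auto
  ultimately show False using V by (simp add: field_simps)
qed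

subsection \<open>Ball averages\<close>

text \<open>Convolution of \<open>g\<close> with the reflection of \<open>K\<close>, the form in
  which averages around \<open>x\<close> arise from increments.\<close>

definition wavg :: "('a::euclidean_space \<Rightarrow> ennreal) \<Rightarrow> ('a \<Rightarrow> ennreal) \<Rightarrow> 'a \<Rightarrow> ennreal" where
  "wavg K g x = (\<integral>\<^sup>+z. g (x + z) * K z \<partial>lborel)"

definition ball_kernel :: "real \<Rightarrow> 'a::euclidean_space \<Rightarrow> ennreal" where
  "ball_kernel t z = ennreal (1 / (t ^ DIM('a) * ball_vol TYPE('a))) * indicator (ball 0 t) z"

lemma borel_measurable_ball_kernel [measurable]: "ball_kernel t \<in> borel_measurable borel"
  unfolding ball_kernel_def by measurable

lemma nn_integral_ball_kernel:
  assumes "t > 0"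
  shows "(\<integral>\<^sup>+z. ball_kernel t (z::'a::euclidean_space) \<partial>lborel) = 1"
  using assms ball_vol_pos[where 'a='a] unfolding ball_kernel_def
  by (subst nn_integral_cmult_indicator) (auto simp: emeasure_lborel_ball_eq ennreal_mult[symmetric])

context
  fixes K g :: "'a::euclidean_space \<Rightarrow> ennreal"
  assumes K [measurable]: "K \<in> borel_measurable borel" and g [measurable]: "g \<in> borel_measurable borel"
begin

lemma borel_measurable_wavg: "wavg K g \<in> borel_measurable borel"
  unfolding wavg_def by measurable

lemma nn_integral_wavg: "(\<integral>\<^sup>+x. wavg K g x \<partial>lborel) = (\<integral>\<^sup>+x. g x \<partial>lborel) * (\<integral>\<^sup>+z. K z \<partial>lborel)"
proof -
  have "(\<integral>\<^sup>+x. wavg K g x \<partial>lborel) = (\<integral>\<^sup>+z. \<integral>\<^sup>+x. g (x + z) * K z \<partial>lborel \<partial>lborel)"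
    unfolding wavg_def by (rule lborel_pair.Fubini') measurable
  also have "\<dots> = (\<integral>\<^sup>+z. (\<integral>\<^sup>+x. g x \<partial>lborel) * K z \<partial>lborel)"
    by (intro nn_integral_cong) (simp add: nn_integral_multc nn_integral_lborel_translate)
  finally show ?thesis by (simp add: nn_integral_cmult)
qed

lemma wavg_le: "(\<And>z. K z \<le> k) \<Longrightarrow> wavg K g x \<le> (\<integral>\<^sup>+x. g x \<partial>lborel) * k"
proof -
  assume k: "\<And>z. K z \<le> k"
  have "wavg K g x \<le> (\<integral>\<^sup>+z. g (z + x) * k \<partial>lborel)"
    unfolding wavg_def by (intro nn_integral_mono) (auto simp: add.commute intro: mult_left_mono k)
  also have "\<dots> = (\<integral>\<^sup>+x. g x \<partial>lborel) * k"
    by (simp add: nn_integral_multc nn_integral_lborel_translate)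
  finally show ?thesis .
qed

end

text \<open>Jensen's inequality for the probability density \<open>K\<close>, followed by
  integration in \<open>x\<close>: averaging contracts \<open>L^r\<close>.\<close>

lemma nn_integral_epow_wavg_le:
  fixes K g :: "'a::euclidean_space \<Rightarrow> ennreal"
  assumes K [measurable]: "K \<in> borel_measurable borel" and g [measurable]: "g \<in> borel_measurable borel"
    and K1: "(\<integral>\<^sup>+z. K z \<partial>lborel) = 1" and r: "r > 1"
  shows "(\<integral>\<^sup>+x. epow (wavg K g x) r \<partial>lborel) \<le> (\<integral>\<^sup>+x. epow (g x) r \<partial>lborel)"
proof -
  have "epow (wavg K g x) r \<le> wavg K (\<lambda>x. epow (g x) r) x" for x
    using epow_nn_integral_le[of "\<lambda>z. g (x + z)" lborel K r] r K1 unfolding wavg_def by simp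
  then have "(\<integral>\<^sup>+x. epow (wavg K g x) r \<partial>lborel) \<le> (\<integral>\<^sup>+x. wavg K (\<lambda>x. epow (g x) r) x \<partial>lborel)"
    by (intro nn_integral_mono)
  also have "\<dots> = (\<integral>\<^sup>+x. epow (g x) r \<partial>lborel)"
    using K1 by (subst nn_integral_wavg) auto
  finally show ?thesis .
qed

text \<open>Of the \<open>r\<close> factors, \<open>r - 1\<close> are estimated by the supremum
  bound \<open>wavg_le\<close> and the last one is integrated, so the average maps L1 into
  \<open>L^r\<close> with a constant governed by the height \<open>k\<close> of the kernel.\<close>

lemma nn_integral_epow_wavg_le_L1:
  fixes K g :: "'a::euclidean_space \<Rightarrow> ennreal"
  assumes K [measurable]: "K \<in> borel_measurable borel" and g [measurable]: "g \<in> borel_measurable borel"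
    and K1: "(\<integral>\<^sup>+z. K z \<partial>lborel) = 1" and k: "\<And>z. K z \<le> k" and r: "r > 1"
  shows "(\<integral>\<^sup>+x. epow (wavg K g x) r \<partial>lborel) \<le> epow (\<integral>\<^sup>+x. g x \<partial>lborel) r * epow k (r - 1)"
proof -
  let ?I = "\<integral>\<^sup>+x. g x \<partial>lborel"
  note [measurable] = borel_measurable_wavg[OF K g]
  have "epow (wavg K g x) r \<le> epow (?I * k) (r - 1) * wavg K g x" for x
  proof -
    have "epow (wavg K g x) r = epow (wavg K g x) (r - 1) * wavg K g x"
      using epow_add[of "wavg K g x" "r - 1" 1] by simp
    also have "\<dots> \<le> epow (?I * k) (r - 1) * wavg K g x"
      using r by (intro mult_right_mono epow_mono wavg_le K g k) auto
    finally show ?thesis .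
  qed
  then have "(\<integral>\<^sup>+x. epow (wavg K g x) r \<partial>lborel) \<le> (\<integral>\<^sup>+x. epow (?I * k) (r - 1) * wavg K g x \<partial>lborel)"
    by (intro nn_integral_mono)
  also have "\<dots> = epow (?I * k) (r - 1) * ?I"
    using nn_integral_wavg[OF K g] K1 by (simp add: nn_integral_cmult)
  also have "\<dots> = epow ?I r * epow k (r - 1)"
  proof -
    have e: "epow ?I (r - 1) * ?I = epow ?I r" using epow_add[of ?I "r - 1" 1] by simp
    have "epow (?I * k) (r - 1) * ?I = (epow ?I (r - 1) * ?I) * epow k (r - 1)"
      using r by (simp only: epow_mult diff_gt_0_iff_gt mult_ac)
    then show ?thesis unfolding e .
  qed
  finally show ?thesis .
qed

text \<open>\<open>prank g x\<close> is the measure-theoretic position of \<open>g x\<close> in the decreasing rearrangement of \<open>g\<close>.\<close>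

definition prank :: "('a::euclidean_space \<Rightarrow> ennreal) \<Rightarrow> 'a \<Rightarrow> ennreal" where
  "prank g x = (\<integral>\<^sup>+y. indicator {y. g x \<le> g y} y \<partial>lborel)"

lemma borel_measurable_rank:
  assumes [measurable]: "g \<in> borel_measurable borel"
  shows "prank g \<in> borel_measurable borel"
  unfolding prank_def indicator_def mem_Collect_eq by measurable

lemma rank_eq:
  assumes [measurable]: "g \<in> borel_measurable borel"
  shows "prank g x = emeasure lborel {y. g x \<le> g y}"
  unfolding prank_def by simp

text \<open>The points of rank at most \<open>u\<close> occupy an upper part of the range of
  \<open>g\<close>. Each value \<open>a\<close> attained there has
  \<open>emeasure lborel {y. a \<le> g y} \<le> u\<close>, and a sequence of such values decreasing
  to their infimum exhausts the set. Ties let the rank jump, so equality cannot be expected.\<close>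

lemma emeasure_rank_le:
  fixes g :: "'a::euclidean_space \<Rightarrow> ennreal"
  assumes g [measurable]: "g \<in> borel_measurable borel"
  shows "emeasure lborel {x. prank g x \<le> u} \<le> u"
proof (cases "{x. prank g x \<le> u} = {}")
  case False
  let ?E = "{x. prank g x \<le> u}"
  note [measurable] = borel_measurable_rank[OF g]
  have sub: "emeasure lborel {y. a \<le> g y} \<le> u" if "a \<in> g ` ?E" for a
    using that by (auto simp: rank_eq)
  have "g ` ?E \<noteq> {}" using False by simp
  then obtain a :: "nat \<Rightarrow> ennreal" where a: "decseq a" "range a \<subseteq> g ` ?E" "Inf (g ` ?E) = (INF i. a i)"
    using ennreal_Inf_countable_INF[of "g ` ?E"] by blast
  show ?thesis
  \<comment> \<open>If the infimum is attained a single superlevel set contains everything.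
    Otherwise all points lie strictly above it and are caught by some \<open>a i\<close>.\<close>
  proof (cases "Inf (g ` ?E) \<in> g ` ?E")
    case True
    have "emeasure lborel ?E \<le> emeasure lborel {y. Inf (g ` ?E) \<le> g y}"
      by (intro emeasure_mono) (auto intro!: INF_lower)
    also have "\<dots> \<le> u" by (rule sub[OF True])
    finally show ?thesis .
  next
    case no: False
    have "?E \<subseteq> (\<Union>i. {y. a i \<le> g y})"
    proof
      fix x assume x: "x \<in> ?E"
      then have "Inf (g ` ?E) \<le> g x" by (intro INF_lower)
      moreover have "Inf (g ` ?E) \<noteq> g x" using no x by blast
      ultimately have "(INF i. a i) < g x" unfolding a(3) by simp
      then show "x \<in> (\<Union>i. {y. a i \<le> g y})" by (auto simp: INF_less_iff intro: less_imp_le)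
    qed
    then have "emeasure lborel ?E \<le> emeasure lborel (\<Union>i. {y. a i \<le> g y})"
      by (intro emeasure_mono) auto
    also have "\<dots> = (SUP i. emeasure lborel {y. a i \<le> g y})"
      using a(1) by (intro SUP_emeasure_incseq[symmetric])
        (auto simp: incseq_def decseq_def intro: order_trans)
    also have "\<dots> \<le> u" using a(2) by (intro SUP_least sub) auto
    finally show ?thesis .
  qed
qed simp

lemma suminf_half_powers_le:
  assumes "a \<ge> 1/2"
  shows "(\<Sum>l. ennreal (2 powr (- (real l * a)))) \<le> ennreal 4"
proof -
  have s: "2 powr (- (real l * (1/2))) = (1 / sqrt 2) ^ l" for l
    by (simp add: powr_minus_divide powr_half_sqrt[symmetric] powr_realpow[symmetric] powr_powr power_divide mult.commute)
  have le: "1 / (1 - 1 / sqrt 2) \<le> 4"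
  proof -
    have "sqrt 2 \<ge> 4/3" by (rule real_le_rsqrt) (simp add: power2_eq_square)
    then have "1 / sqrt 2 \<le> 3/4" by (simp add: field_simps)
    then show ?thesis by (simp add: field_simps)
  qed
  have "(\<Sum>l. ennreal (2 powr (- (real l * a)))) \<le> (\<Sum>l. ennreal (2 powr (- (real l * (1/2)))))"
  proof (intro suminf_le ennreal_leI powr_mono)
    fix l
    have "real l * (1/2) \<le> real l * a" using assms by (rule mult_left_mono) simp
    then show "- (real l * a) \<le> - (real l * (1/2))" by simp
  qed auto
  also have "\<dots> = (\<Sum>l. ennreal ((1 / sqrt 2) ^ l))" unfolding s ..
  also have "\<dots> = ennreal (1 / (1 - 1 / sqrt 2))"
    by (intro suminf_ennreal_eq geometric_sums) auto
  also have "\<dots> \<le> ennreal 4" by (rule ennreal_leI[OF le])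
  finally show ?thesis .
qed

section \<open>The largest values of the gradient, carried by small ranks\<close>

definition rank_shell :: "('a::euclidean_space \<Rightarrow> ennreal) \<Rightarrow> nat \<Rightarrow> real \<Rightarrow> 'a set" where
  "rank_shell g l \<tau> = {x. ennreal (\<tau> / 2 ^ Suc l) < prank g x \<and> prank g x \<le> ennreal (\<tau> / 2 ^ l)}"

lemma in_rank_shell:
  assumes "0 < prank g x" "prank g x \<le> ennreal \<tau>"
  shows "\<exists>l. x \<in> rank_shell g l \<tau>"
proof -
  obtain p where p: "prank g x = ennreal p" "0 < p"
    using assms by (cases "prank g x" rule: ennreal_cases) (auto simp: top_unique)
  have pt: "p \<le> \<tau>" using assms(2) p by (auto simp: ennreal_le_iff2)
  have "\<exists>l. \<tau> / 2 ^ Suc l < p"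
  proof -
    obtain l where "\<tau> / p < 2 ^ l" using real_arch_pow[of 2 "\<tau> / p"] by auto
    then have "\<tau> / 2 ^ l < p" using p by (simp add: field_simps)
    moreover have "\<tau> / 2 ^ Suc l \<le> \<tau> / 2 ^ l" using p pt by (simp add: field_simps)
    ultimately show ?thesis by (intro exI[of _ l]) linarith
  qed
  then have L: "\<tau> / 2 ^ Suc (LEAST l. \<tau> / 2 ^ Suc l < p) < p" by (rule LeastI_ex)
  define l where "l = (LEAST l. \<tau> / 2 ^ Suc l < p)"
  have "p \<le> \<tau> / 2 ^ l"
  proof (cases l)
    case (Suc j)
    then have "\<not> \<tau> / 2 ^ Suc j < p"
      using not_less_Least[of j "\<lambda>l. \<tau> / 2 ^ Suc l < p"] by (simp add: l_def)
    then show ?thesis unfolding Suc by simp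
  qed (use pt in simp)
  then show ?thesis using L p pt unfolding l_def[symmetric] rank_shell_def
    by (intro exI[of _ l]) (auto simp: ennreal_less_iff ennreal_leI simp del: power_Suc)
qed

context
  fixes g :: "'a::euclidean_space \<Rightarrow> ennreal"
  assumes g [measurable]: "g \<in> borel_measurable borel"
begin

lemma rank_measurable [measurable]: "prank g \<in> borel_measurable borel"
  by (rule borel_measurable_rank[OF g])

lemma rank_shell_measurable [measurable]: "rank_shell g l \<tau> \<in> sets borel"
  unfolding rank_shell_def by measurable

lemma emeasure_rank_shell_le: "emeasure lborel (rank_shell g l \<tau>) \<le> ennreal (\<tau> / 2 ^ l)"
proof -
  have "emeasure lborel (rank_shell g l \<tau>) \<le> emeasure lborel {x. prank g x \<le> ennreal (\<tau> / 2 ^ l)}"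
    by (intro emeasure_mono) (auto simp: rank_shell_def)
  then show ?thesis using emeasure_rank_le[OF g] order_trans by blast
qed

text \<open>On the \<open>l\<close>-th shell Hoelder yields
  \<open>(\<tau> / 2 ^ l) powr (p - 1)\<close>. Half of the decay in \<open>l\<close> pays for the
  summation over the shells, and the other half remains as the exponent \<open>(p - 1) / 2\<close>.
  Keeping the shells apart is what later allows integration in \<open>\<tau>\<close> without a
  logarithm.\<close>

lemma high_part_le:
  assumes p: "p \<ge> 2" and \<tau>: "\<tau> > 0"
  shows "epow (\<integral>\<^sup>+x. g x * indicator {x. prank g x \<le> ennreal \<tau>} x \<partial>lborel) p
    \<le> ennreal (4 powr (p - 1) * \<tau> powr (p - 1)) *
      (\<Sum>l. ennreal (2 powr (- (real l * ((p - 1) / 2)))) * (\<integral>\<^sup>+x. epow (g x) p * indicator (rank_shell g l \<tau>) x \<partial>lborel))"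
proof -
  let ?H = "\<lambda>l. rank_shell g l \<tau>"
  define a where "a l = (\<integral>\<^sup>+x. g x * indicator (?H l) x \<partial>lborel)" for l
  define b where "b l = (\<integral>\<^sup>+x. epow (g x) p * indicator (?H l) x \<partial>lborel)" for l
  \<comment> \<open>Hoelder weights for the sum over shells; \<open>v\<close> is their reciprocal
    and is moved to the terms.\<close>
  define w where "w l = ennreal (2 powr (- (real l * (1/2))))" for l
  define v where "v l = ennreal (2 powr (real l * (1/2)))" for l
  have vw: "v l * w l = 1" for l
    unfolding v_def w_def by (simp add: ennreal_mult[symmetric] powr_add[symmetric])
  \<comment> \<open>Points of rank 0 belong to no shell; they form a null set.\<close>
  have null: "AE x in lborel. 0 < prank g x"
  proof -
    have "emeasure lborel {x. prank g x \<le> 0} = 0" using emeasure_rank_le[OF g, of 0] by simp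
    then have "{x. prank g x \<le> 0} \<in> null_sets lborel" by (intro null_setsI) auto
    then have "AE x in lborel. x \<notin> {x. prank g x \<le> 0}" by (rule AE_not_in)
    then show ?thesis by eventually_elim (auto simp: not_le zero_less_iff_neq_zero)
  qed
  have "(\<integral>\<^sup>+x. g x * indicator {x. prank g x \<le> ennreal \<tau>} x \<partial>lborel)
     \<le> (\<integral>\<^sup>+x. (\<Sum>l. g x * indicator (?H l) x) \<partial>lborel)"
  proof (intro nn_integral_mono_AE, use null in eventually_elim)
    fix x assume x: "0 < prank g x"
    show "g x * indicator {x. prank g x \<le> ennreal \<tau>} x \<le> (\<Sum>l. g x * indicator (?H l) x)"
    proof (cases "prank g x \<le> ennreal \<tau>")
      case True
      then obtain l where l: "x \<in> ?H l" using in_rank_shell[OF x True] by blast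
      have "g x * indicator {x. prank g x \<le> ennreal \<tau>} x = g x * indicator (?H l) x" using l True by simp
      also have "\<dots> \<le> (\<Sum>l. g x * indicator (?H l) x)" by (rule le_suminf_ennreal)
      finally show ?thesis .
    qed simp
  qed
  also have "\<dots> = (\<Sum>l. a l)" unfolding a_def by (rule nn_integral_suminf) measurable
  also have "\<dots> = (\<Sum>l. (a l * v l) * w l)" by (simp only: mult.assoc vw mult_1_right)
  finally have "epow (\<integral>\<^sup>+x. g x * indicator {x. prank g x \<le> ennreal \<tau>} x \<partial>lborel) p \<le> epow (\<Sum>l. (a l * v l) * w l) p"
    using p by (intro epow_mono) auto
  also have "\<dots> \<le> (\<Sum>l. epow (a l * v l) p * w l) * epow (\<Sum>l. w l) (p - 1)"
    using p by (intro epow_suminf_weighted) auto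
  also have "\<dots> \<le> (\<Sum>l. ennreal (\<tau> powr (p - 1)) * (ennreal (2 powr (- (real l * ((p - 1) / 2)))) * b l)) * epow (ennreal 4) (p - 1)"
  proof (rule mult_mono, rule suminf_le)
    have "(\<Sum>l. w l) \<le> ennreal 4" unfolding w_def by (rule suminf_half_powers_le) simp
    then show "epow (\<Sum>l. w l) (p - 1) \<le> epow (ennreal 4) (p - 1)" using p by (intro epow_mono) auto
    fix l
    have "epow (a l) p \<le> b l * epow (\<integral>\<^sup>+x. indicator (?H l) x \<partial>lborel) (p - 1)"
      unfolding a_def b_def using p by (intro epow_nn_integral_le) auto
    also have "\<dots> \<le> b l * epow (ennreal (\<tau> / 2 ^ l)) (p - 1)"
      using emeasure_rank_shell_le[of l \<tau>] p by (intro mult_left_mono epow_mono) auto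
    finally have "epow (a l) p \<le> b l * ennreal ((\<tau> / 2 ^ l) powr (p - 1))"
      using \<tau> by (simp add: epow_ennreal)
    then have "epow (a l * v l) p * w l \<le> b l * ennreal ((\<tau> / 2 ^ l) powr (p - 1)) * epow (v l) p * w l"
      using p by (auto simp: epow_mult intro!: mult_right_mono)
    also have "\<dots> = b l * ennreal ((\<tau> / 2 ^ l) powr (p - 1) * (2 powr (real l * (1/2))) powr p * 2 powr (- (real l * (1/2))))"
      unfolding v_def w_def by (simp add: epow_ennreal ennreal_mult mult.assoc)
    also have "(\<tau> / 2 ^ l) powr (p - 1) * (2 powr (real l * (1/2))) powr p * 2 powr (- (real l * (1/2)))
       = \<tau> powr (p - 1) * 2 powr (- (real l * ((p - 1) / 2)))"
    proof -
      have "(\<tau> / 2 ^ l) powr (p - 1) = \<tau> powr (p - 1) * 2 powr (- (real l * (p - 1)))"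
        using \<tau> by (simp add: powr_divide powr_realpow[symmetric] powr_powr powr_minus_divide)
      moreover have "2 powr (- (real l * (p - 1))) * (2 powr (real l * (1/2))) powr p * 2 powr (- (real l * (1/2)))
          = 2 powr (- (real l * ((p - 1) / 2)))"
      proof -
        have "- (real l * (p - 1)) + real l * (1/2) * p + - (real l * (1/2)) = - (real l * ((p - 1) / 2))"
          by (simp add: field_simps)
        then show ?thesis by (simp only: powr_powr powr_add[symmetric])
      qed
      ultimately show ?thesis by (simp only: mult.assoc)
    qed
    finally show "epow (a l * v l) p * w l \<le> ennreal (\<tau> powr (p - 1)) * (ennreal (2 powr (- (real l * ((p - 1) / 2)))) * b l)"
      by (simp add: ennreal_mult mult_ac)
  qed (use p in auto)
  also have "\<dots> = ennreal (4 powr (p - 1) * \<tau> powr (p - 1)) *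
      (\<Sum>l. ennreal (2 powr (- (real l * ((p - 1) / 2)))) * b l)"
  proof -
    have "epow (ennreal 4) (p - 1) = ennreal (4 powr (p - 1))" by (simp only: epow_ennreal)
    then show ?thesis
      unfolding ennreal_suminf_cmult[of "ennreal (\<tau> powr (p - 1))"]
      by (simp only: ennreal_mult powr_ge_zero mult_ac)
  qed
  finally show ?thesis unfolding b_def .
qed

text \<open>For fixed \<open>x\<close> and \<open>l\<close> the admissible radii satisfy
  \<open>a \<le> t \<le> 2 * a\<close>, where \<open>a ^ n\<close> is the rank of \<open>x\<close>
  times \<open>2 ^ l\<close>, and the integrand there is at most \<open>1 / a\<close>. The bound
  depends neither on \<open>x\<close> nor on \<open>l\<close>.\<close>

lemma shell_time_le: "(\<integral>\<^sup>+t. ennreal (1 / t) * (indicator (rank_shell g l (t ^ DIM('a))) x * indicator {0<..} t) \<partial>lborel) \<le> 1"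
proof (cases "prank g x")
  case (real p)
  show ?thesis
  proof (cases "p = 0")
    case True
    then have "x \<notin> rank_shell g l (t ^ DIM('a))" for t
      using real by (auto simp: rank_shell_def)
    then show ?thesis by simp
  next
    case False
    with real have p: "p > 0" by simp
    define a where "a = (p * 2 ^ l) powr (1 / real DIM('a))"
    have a: "a > 0" using p by (simp add: a_def)
    have aN: "a ^ DIM('a) = p * 2 ^ l"
      using p a by (simp add: powr_realpow[symmetric]) (simp add: a_def powr_powr powr_realpow)
    have N0: "DIM('a) > 0" by simp
    have "ennreal (1 / t) * (indicator (rank_shell g l (t ^ DIM('a))) x * indicator {0<..} t)
       \<le> ennreal (1 / a) * indicator {a..2 * a} t" for t
    proof (cases "x \<in> rank_shell g l (t ^ DIM('a)) \<and> t > 0")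
      case True
      then have t: "t > 0" "t ^ DIM('a) / 2 ^ Suc l < p" "p \<le> t ^ DIM('a) / 2 ^ l"
        using real by (auto simp: rank_shell_def ennreal_less_iff simp del: power_Suc)
      have "a ^ DIM('a) \<le> t ^ DIM('a)" using t unfolding aN by (simp add: field_simps)
      then have at: "a \<le> t" using t a by (simp add: power_mono_iff)
      have "t ^ DIM('a) \<le> 2 * a ^ DIM('a)" using t unfolding aN by (simp add: field_simps)
      also have "\<dots> \<le> 2 ^ DIM('a) * a ^ DIM('a)"
        using a self_le_power[of "2::real" "DIM('a)"] by (intro mult_right_mono) auto
      also have "\<dots> = (2 * a) ^ DIM('a)" by (simp add: power_mult_distrib)
      finally have "t \<le> 2 * a" using t a N0 by (subst (asm) power_mono_iff) auto
      then show ?thesis using at a t by (auto simp: indicator_def frac_le intro!: ennreal_leI)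
    next
      case False
      then show ?thesis by (auto simp: indicator_def)
    qed
    then have "(\<integral>\<^sup>+t. ennreal (1 / t) * (indicator (rank_shell g l (t ^ DIM('a))) x * indicator {0<..} t) \<partial>lborel)
       \<le> (\<integral>\<^sup>+t. ennreal (1 / a) * indicator {a..2 * a} t \<partial>lborel)"
      by (rule nn_integral_mono)
    also have "\<dots> = ennreal (1 / a) * emeasure lborel {a..2 * a}"
      by (rule nn_integral_cmult_indicator) simp
    also have "\<dots> = 1" using a by (simp add: ennreal_mult[symmetric])
    finally show ?thesis .
  qed
next
  case top
  then have "x \<notin> rank_shell g l (t ^ DIM('a))" for t
    by (auto simp: rank_shell_def top_unique)
  then show ?thesis by simp
qed

text \<open>A Hardy inequality. The power of t cancels the factor from \<open>high_part_le\<close>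
  down to \<open>1 / t\<close>, so after Fubini each shell contributes at most the full integral of
  \<open>epow (g x) n\<close>. The shell weights have exponent
  \<open>(n - 1) / 2 \<ge> 1 / 2\<close> because n is at least 2, and they add up to at most
  4.\<close>

lemma high_integral_le:
  assumes n2: "DIM('a) \<ge> 2"
  shows "(\<integral>\<^sup>+t. ennreal (t powr (- 1 - real DIM('a) * (real DIM('a) - 1))) *
      epow (\<integral>\<^sup>+x. g x * indicator {x. prank g x \<le> ennreal (t ^ DIM('a))} x \<partial>lborel) (real DIM('a)) * indicator {0<..} t \<partial>lborel)
    \<le> ennreal (4 powr real DIM('a)) * (\<integral>\<^sup>+x. epow (g x) (real DIM('a)) \<partial>lborel)"
proof -
  let ?n = "real DIM('a)" and ?N = "DIM('a)"
  let ?c = "\<lambda>l. ennreal (2 powr (- (real l * ((?n - 1) / 2))))"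
  let ?P = "\<integral>\<^sup>+x. epow (g x) ?n \<partial>lborel"
  have n: "?n \<ge> 2" using n2 by simp
  have [measurable]: "(\<lambda>(t, x). indicator (rank_shell g l (t ^ ?N)) x :: ennreal) \<in> borel_measurable (borel \<Otimes>\<^sub>M borel)" for l
    unfolding rank_shell_def indicator_def mem_Collect_eq by measurable
  have [measurable]: "(\<lambda>(t, x). indicator (rank_shell g l (t ^ ?N)) x :: ennreal) \<in> borel_measurable (lborel \<Otimes>\<^sub>M lborel)" for l
    unfolding rank_shell_def indicator_def mem_Collect_eq by measurable
  have pt: "ennreal (t powr (- 1 - ?n * (?n - 1))) *
      epow (\<integral>\<^sup>+x. g x * indicator {x. prank g x \<le> ennreal (t ^ ?N)} x \<partial>lborel) ?n * indicator {0<..} t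
    \<le> ennreal (4 powr (?n - 1)) * (\<Sum>l. ?c l * (\<integral>\<^sup>+x. epow (g x) ?n * (ennreal (1 / t) * (indicator (rank_shell g l (t ^ ?N)) x * indicator {0<..} t)) \<partial>lborel))" for t
  proof (cases "t > 0")
    case True
    have tn: "t ^ ?N > 0" using True by simp
    let ?b = "\<lambda>l. \<integral>\<^sup>+x. epow (g x) ?n * indicator (rank_shell g l (t ^ ?N)) x \<partial>lborel"
    have e: "t powr (- 1 - ?n * (?n - 1)) * (4 powr (?n - 1) * (t ^ ?N) powr (?n - 1)) = 4 powr (?n - 1) * (1 / t)"
    proof -
      have "(t ^ ?N) powr (?n - 1) = t powr (?n * (?n - 1))"
        using True by (simp add: powr_realpow[symmetric] powr_powr)
      then have "t powr (- 1 - ?n * (?n - 1)) * (t ^ ?N) powr (?n - 1) = t powr (- 1)"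
        by (simp add: powr_add[symmetric])
      also have "\<dots> = 1 / t" using True by (simp add: powr_minus_divide)
      finally show ?thesis by (simp add: mult_ac)
    qed
    have "ennreal (t powr (- 1 - ?n * (?n - 1))) *
        epow (\<integral>\<^sup>+x. g x * indicator {x. prank g x \<le> ennreal (t ^ ?N)} x \<partial>lborel) ?n
      \<le> ennreal (t powr (- 1 - ?n * (?n - 1))) * (ennreal (4 powr (?n - 1) * (t ^ ?N) powr (?n - 1)) * (\<Sum>l. ?c l * ?b l))"
      by (intro mult_left_mono high_part_le n tn) auto
    also have "\<dots> = ennreal (4 powr (?n - 1) * (1 / t)) * (\<Sum>l. ?c l * ?b l)"
      unfolding e[symmetric] by (subst (2) ennreal_mult) (auto simp: mult.assoc)
    also have "\<dots> = ennreal (4 powr (?n - 1)) * (\<Sum>l. ?c l * (ennreal (1 / t) * ?b l))"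
    proof -
      have "(\<Sum>l. ?c l * (ennreal (1 / t) * ?b l)) = (\<Sum>l. ennreal (1 / t) * (?c l * ?b l))"
        by (simp only: mult_ac)
      also have "\<dots> = ennreal (1 / t) * (\<Sum>l. ?c l * ?b l)" by (rule ennreal_suminf_cmult)
      finally show ?thesis using True by (simp only: ennreal_mult powr_ge_zero mult.assoc divide_nonneg_pos zero_le_one)
    qed
    also have "\<dots> = ennreal (4 powr (?n - 1)) * (\<Sum>l. ?c l * (\<integral>\<^sup>+x. epow (g x) ?n * (ennreal (1 / t) * (indicator (rank_shell g l (t ^ ?N)) x * indicator {0<..} t)) \<partial>lborel))"
    proof -
      have "ennreal (1 / t) * ?b l = (\<integral>\<^sup>+x. epow (g x) ?n * (ennreal (1 / t) * (indicator (rank_shell g l (t ^ ?N)) x * indicator {0<..} t)) \<partial>lborel)" for l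
        using True by (subst nn_integral_cmult[symmetric]) (auto intro!: nn_integral_cong simp: mult_ac)
      then show ?thesis by presburger
    qed
    finally show ?thesis using True by simp
  qed simp
  have "(\<integral>\<^sup>+t. ennreal (t powr (- 1 - ?n * (?n - 1))) *
      epow (\<integral>\<^sup>+x. g x * indicator {x. prank g x \<le> ennreal (t ^ ?N)} x \<partial>lborel) ?n * indicator {0<..} t \<partial>lborel)
    \<le> (\<integral>\<^sup>+t. ennreal (4 powr (?n - 1)) * (\<Sum>l. ?c l * (\<integral>\<^sup>+x. epow (g x) ?n * (ennreal (1 / t) * (indicator (rank_shell g l (t ^ ?N)) x * indicator {0<..} t)) \<partial>lborel)) \<partial>lborel)"
    by (intro nn_integral_mono pt)
  also have "\<dots> = ennreal (4 powr (?n - 1)) * (\<Sum>l. ?c l * (\<integral>\<^sup>+t. \<integral>\<^sup>+x. epow (g x) ?n * (ennreal (1 / t) * (indicator (rank_shell g l (t ^ ?N)) x * indicator {0<..} t)) \<partial>lborel \<partial>lborel))"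
    by (subst nn_integral_cmult, measurable, subst nn_integral_suminf, measurable)
       (subst nn_integral_cmult, measurable)
  also have "\<dots> \<le> ennreal (4 powr (?n - 1)) * (\<Sum>l. ?c l * ?P)"
  proof (intro mult_left_mono suminf_le)
    fix l
    have "(\<integral>\<^sup>+t. \<integral>\<^sup>+x. epow (g x) ?n * (ennreal (1 / t) * (indicator (rank_shell g l (t ^ ?N)) x * indicator {0<..} t)) \<partial>lborel \<partial>lborel)
      = (\<integral>\<^sup>+x. \<integral>\<^sup>+t. epow (g x) ?n * (ennreal (1 / t) * (indicator (rank_shell g l (t ^ ?N)) x * indicator {0<..} t)) \<partial>lborel \<partial>lborel)"
      by (rule lborel_pair.Fubini') measurable
    also have "\<dots> = (\<integral>\<^sup>+x. epow (g x) ?n * (\<integral>\<^sup>+t. ennreal (1 / t) * (indicator (rank_shell g l (t ^ ?N)) x * indicator {0<..} t) \<partial>lborel) \<partial>lborel)"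
      by (intro nn_integral_cong nn_integral_cmult) measurable
    also have "\<dots> \<le> (\<integral>\<^sup>+x. epow (g x) ?n * 1 \<partial>lborel)"
      by (intro nn_integral_mono mult_left_mono shell_time_le) auto
    finally show "(\<integral>\<^sup>+t. \<integral>\<^sup>+x. epow (g x) ?n * (ennreal (1 / t) * (indicator (rank_shell g l (t ^ ?N)) x * indicator {0<..} t)) \<partial>lborel \<partial>lborel) \<le> ?P"
      by simp
  qed auto
  also have "\<dots> = ennreal (4 powr (?n - 1)) * ((\<Sum>l. ?c l) * ?P)" by simp
  also have "\<dots> \<le> ennreal (4 powr (?n - 1)) * (ennreal 4 * ?P)"
    using n by (intro mult_left_mono mult_right_mono suminf_half_powers_le) auto
  also have "\<dots> = ennreal (4 powr ?n) * ?P"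
  proof -
    have "ennreal (4 powr ?n) = ennreal (4 powr (?n - 1)) * ennreal 4"
      by (subst ennreal_mult[symmetric]) (auto simp: powr_diff)
    then show ?thesis by (simp only: mult.assoc)
  qed
  finally show ?thesis .
qed

end

text \<open>The dyadic scale indexed by all integers, enumerated by the naturals so that \<open>\<Sum>\<close> over \<open>nat\<close> applies.\<close>

definition dyad :: "nat \<Rightarrow> real" where "dyad k = 2 powr real_of_int (int_decode k)"

lemma dyad_pos: "dyad k > 0" by (simp add: dyad_def)

lemma ex_dyad:
  assumes "y > 0"
  shows "\<exists>k. dyad k < y \<and> y \<le> 2 * dyad k"
proof -
  define i where "i = \<lceil>log 2 y\<rceil> - 1"
  have "real_of_int i < log 2 y" "log 2 y \<le> real_of_int i + 1" unfolding i_def by linarith+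
  then have "2 powr real_of_int i < y" "y \<le> 2 powr (real_of_int i + 1)"
    using assms by (auto simp: less_log_iff log_le_iff)
  then have "2 powr real_of_int i < y" "y \<le> 2 * 2 powr real_of_int i" by (auto simp: powr_add)
  then show ?thesis by (intro exI[of _ "int_encode i"]) (simp add: dyad_def)
qed

text \<open>A geometric series running downwards from the largest power of 2 below \<open>y\<close>.
  As \<open>dyad\<close> is not monotone, the sum is transported through counting measures to the
  integers up to \<open>i0\<close> and from there to the naturals.\<close>

lemma suminf_dyad_less_le:
  assumes y: "y > 0" and p: "p \<ge> 1"
  shows "(\<Sum>k. ennreal (dyad k powr p) * (if dyad k < y then 1 else 0)) \<le> ennreal (2 * y powr p)"
proof -
  obtain k0 where k0: "dyad k0 < y" "y \<le> 2 * dyad k0" using ex_dyad[OF y] by blast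
  define i0 where "i0 = int_decode k0"
  define F where "F i = ennreal ((2 powr real_of_int i) powr p) * (if 2 powr real_of_int i < y then 1 else 0)" for i
  have F0: "F i = 0" if "i > i0" for i
  proof -
    have "2 powr real_of_int i \<ge> 2 powr (real_of_int i0 + 1)"
      using that by (intro powr_mono) auto
    then have "2 powr real_of_int i \<ge> y" using k0 by (simp add: dyad_def i0_def powr_add)
    then show ?thesis by (simp add: F_def)
  qed
  have bij: "bij_betw (\<lambda>j. i0 - int j) UNIV {..i0}"
    by (rule bij_betwI[where g = "\<lambda>i. nat (i0 - i)"]) auto
  have "(\<Sum>k. ennreal (dyad k powr p) * (if dyad k < y then 1 else 0)) = (\<Sum>k. F (int_decode k))"
    unfolding F_def dyad_def ..
  also have "\<dots> = (\<integral>\<^sup>+k. F (int_decode k) \<partial>count_space UNIV)"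
    by (rule nn_integral_count_space_nat[symmetric])
  also have "\<dots> = (\<integral>\<^sup>+i. F i \<partial>count_space UNIV)"
    by (rule nn_integral_bij_count_space) (rule bij_int_decode)
  also have "\<dots> = (\<integral>\<^sup>+i. F i * indicator {..i0} i \<partial>count_space UNIV)"
    using F0 by (intro nn_integral_cong) (auto simp: indicator_def not_le)
  also have "\<dots> = (\<integral>\<^sup>+i. F i \<partial>count_space {..i0})"
    by (simp add: nn_integral_count_space_indicator)
  also have "\<dots> = (\<integral>\<^sup>+j. F (i0 - int j) \<partial>count_space UNIV)"
    by (rule nn_integral_bij_count_space[symmetric]) (rule bij)
  also have "\<dots> = (\<Sum>j. F (i0 - int j))" by (rule nn_integral_count_space_nat)
  also have "\<dots> \<le> (\<Sum>j. ennreal (y powr p * (1/2) ^ j))"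
  proof (intro suminf_le)
    fix j
    have "(2 powr real_of_int (i0 - int j)) powr p = (2 powr real_of_int i0) powr p * 2 powr (- (real j * p))"
      by (simp add: powr_powr powr_add[symmetric] algebra_simps)
    also have "\<dots> \<le> y powr p * (1/2) ^ j"
    proof (intro mult_mono)
      show "(2 powr real_of_int i0) powr p \<le> y powr p"
        using k0 p by (intro powr_mono2) (auto simp: dyad_def i0_def)
      have "real j * 1 \<le> real j * p" using p by (intro mult_left_mono) auto
      then have "2 powr (- (real j * p)) \<le> 2 powr (- real j)" by (intro powr_mono) auto
      also have "\<dots> = (1/2) ^ j" by (simp add: powr_minus_divide powr_realpow power_divide)
      finally show "2 powr (- (real j * p)) \<le> (1/2) ^ j" .
    qed auto
    finally show "F (i0 - int j) \<le> ennreal (y powr p * (1/2) ^ j)"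
      unfolding F_def by (auto intro!: ennreal_leI)
  qed auto
  also have "\<dots> = ennreal (2 * y powr p)"
  proof (rule suminf_ennreal_eq)
    have "(\<lambda>j. y powr p * (1/2) ^ j) sums (y powr p * (1 / (1 - 1/2)))"
      by (intro sums_mult geometric_sums) auto
    then show "(\<lambda>j. y powr p * (1/2) ^ j) sums (2 * y powr p)" by (simp add: mult.commute)
  qed auto
  finally show ?thesis .
qed

section \<open>The remaining values of the gradient, carried by large ranks\<close>

context
  fixes g :: "'a::euclidean_space \<Rightarrow> ennreal"
  assumes g [measurable]: "g \<in> borel_measurable borel"
    and fin: "(\<integral>\<^sup>+x. epow (g x) (real DIM('a)) \<partial>lborel) < \<infinity>"
begin

lemma Lp_finite_AE_finite: "AE x in lborel. g x \<noteq> \<infinity>"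
proof -
  have "AE x in lborel. epow (g x) (real DIM('a)) \<noteq> \<infinity>"
    using fin by (intro nn_integral_noteq_infinite) auto
  then show ?thesis by (simp only: epow_eq_top_iff)
qed

abbreviation dyad_measure :: "nat \<Rightarrow> ennreal" where "dyad_measure k \<equiv> emeasure lborel {x. ennreal (dyad k) < g x}"

text \<open>A dyadic layer-cake formula: at each point the powers of 2 below \<open>g x\<close> form
  a geometric series dominated by its largest term.\<close>

lemma sum_dyad_measure_le: "(\<Sum>k. ennreal ((2 * dyad k) powr real DIM('a)) * dyad_measure k)
    \<le> ennreal (2 * 2 powr real DIM('a)) * (\<integral>\<^sup>+x. epow (g x) (real DIM('a)) \<partial>lborel)"
proof -
  let ?n = "real DIM('a)"
  have n: "?n \<ge> 1" using DIM_positive[where 'a='a] by linarith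
  have "(\<Sum>k. ennreal ((2 * dyad k) powr ?n) * dyad_measure k)
     = (\<Sum>k. \<integral>\<^sup>+x. ennreal ((2 * dyad k) powr ?n) * indicator {x. ennreal (dyad k) < g x} x \<partial>lborel)"
    by (intro suminf_cong nn_integral_cmult_indicator[symmetric]) measurable
  also have "\<dots> = (\<integral>\<^sup>+x. (\<Sum>k. ennreal ((2 * dyad k) powr ?n) * indicator {x. ennreal (dyad k) < g x} x) \<partial>lborel)"
    by (rule nn_integral_suminf[symmetric]) measurable
  also have "\<dots> \<le> (\<integral>\<^sup>+x. ennreal (2 * 2 powr ?n) * epow (g x) ?n \<partial>lborel)"
  proof (intro nn_integral_mono_AE, use Lp_finite_AE_finite in eventually_elim)
    fix x assume "g x \<noteq> \<infinity>"
    then obtain y where y: "g x = ennreal y" "y \<ge> 0" by (cases "g x" rule: ennreal_cases) auto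
    show "(\<Sum>k. ennreal ((2 * dyad k) powr ?n) * indicator {x. ennreal (dyad k) < g x} x) \<le> ennreal (2 * 2 powr ?n) * epow (g x) ?n"
    proof (cases "y = 0")
      case True
      then show ?thesis using y by (simp add: indicator_def)
    next
      case False
      have "(\<Sum>k. ennreal ((2 * dyad k) powr ?n) * indicator {x. ennreal (dyad k) < g x} x)
         = (\<Sum>k. ennreal (2 powr ?n) * (ennreal (dyad k powr ?n) * (if dyad k < y then 1 else 0)))"
        using y dyad_pos by (intro suminf_cong)
          (auto simp: powr_mult ennreal_mult indicator_def ennreal_less_iff less_imp_le mult.assoc)
      also have "\<dots> = ennreal (2 powr ?n) * (\<Sum>k. ennreal (dyad k powr ?n) * (if dyad k < y then 1 else 0))"
        by (rule ennreal_suminf_cmult)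
      also have "\<dots> \<le> ennreal (2 powr ?n) * ennreal (2 * y powr ?n)"
        using y False n by (intro mult_left_mono suminf_dyad_less_le) auto
      also have "\<dots> = ennreal (2 * 2 powr ?n) * epow (g x) ?n"
        unfolding y(1) using y by (simp add: epow_ennreal ennreal_mult[symmetric] mult_ac)
      finally show ?thesis .
    qed
  qed
  also have "\<dots> = ennreal (2 * 2 powr ?n) * (\<integral>\<^sup>+x. epow (g x) ?n \<partial>lborel)"
    by (rule nn_integral_cmult) measurable
  finally show ?thesis .
qed

lemma dyad_measure_finite: "dyad_measure k < \<infinity>"
proof (rule ccontr)
  assume "\<not> dyad_measure k < \<infinity>"
  then have "dyad_measure k = \<infinity>" using top.not_eq_extremum by fastforce
  moreover have "ennreal ((2 * dyad k) powr real DIM('a)) * dyad_measure k \<le> (\<Sum>k. ennreal ((2 * dyad k) powr real DIM('a)) * dyad_measure k)"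
    by (rule le_suminf_ennreal)
  moreover have "(\<Sum>k. ennreal ((2 * dyad k) powr real DIM('a)) * dyad_measure k) < \<infinity>"
    using sum_dyad_measure_le fin by (auto intro: le_less_trans simp: ennreal_mult_less_top)
  ultimately show False using dyad_pos[of k] by (simp add: ennreal_mult_top top_unique)
qed

text \<open>A point with \<open>dyad k < g x \<le> 2 * dyad k\<close> has rank at most
  \<open>dyad_measure k\<close>, so rank above \<open>u\<close> leaves only those \<open>k\<close>
  with \<open>u < dyad_measure k\<close>. The concave power \<open>n / r\<close>, taken termwise,
  turns \<open>r\<close>-th powers of the heights into n-th powers.\<close>

lemma low_part_le:
  assumes r: "r > real DIM('a)"
  shows "epow (\<integral>\<^sup>+x. epow (g x) r * indicator {x. u < prank g x} x \<partial>lborel) (real DIM('a) / r)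
    \<le> (\<Sum>k. ennreal ((2 * dyad k) powr real DIM('a)) * (if u < dyad_measure k then epow (dyad_measure k) (real DIM('a) / r) else 0))"
proof -
  let ?n = "real DIM('a)"
  have n: "?n > 0" by simp
  have r0: "r > 0" using r n by linarith
  note [measurable] = borel_measurable_rank[OF g]
  have "(\<integral>\<^sup>+x. epow (g x) r * indicator {x. u < prank g x} x \<partial>lborel)
     \<le> (\<integral>\<^sup>+x. (\<Sum>k. (ennreal ((2 * dyad k) powr r) * (if u < dyad_measure k then 1 else 0)) * indicator {x. ennreal (dyad k) < g x} x) \<partial>lborel)"
  proof (intro nn_integral_mono_AE, use Lp_finite_AE_finite in eventually_elim)
    fix x assume "g x \<noteq> \<infinity>"
    then obtain y where y: "g x = ennreal y" "y \<ge> 0" by (cases "g x" rule: ennreal_cases) auto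
    show "epow (g x) r * indicator {x. u < prank g x} x
       \<le> (\<Sum>k. (ennreal ((2 * dyad k) powr r) * (if u < dyad_measure k then 1 else 0)) * indicator {x. ennreal (dyad k) < g x} x)"
    proof (cases "y = 0 \<or> \<not> u < prank g x")
      case False
      then obtain k where k: "dyad k < y" "y \<le> 2 * dyad k" using ex_dyad[of y] y by auto
      have "prank g x \<le> dyad_measure k"
      proof -
        have "ennreal (dyad k) < g x" using k y dyad_pos[of k] by (simp add: ennreal_less_iff less_imp_le)
        then show ?thesis unfolding rank_eq[OF g] by (intro emeasure_mono) (auto intro: less_le_trans)
      qed
      then have u: "u < dyad_measure k" using False by (auto intro: less_le_trans)
      have gx: "ennreal (dyad k) < g x" using k y dyad_pos[of k] by (simp add: ennreal_less_iff less_imp_le)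
      have "epow (g x) r * indicator {x. u < prank g x} x \<le> ennreal (y powr r)"
        using y by (auto simp: epow_ennreal indicator_def)
      also have "\<dots> \<le> ennreal ((2 * dyad k) powr r)"
        using k y r0 by (intro ennreal_leI powr_mono2) auto
      also have "\<dots> = (ennreal ((2 * dyad k) powr r) * (if u < dyad_measure k then 1 else 0)) * indicator {x. ennreal (dyad k) < g x} x"
        using u gx by simp
      also have "\<dots> \<le> (\<Sum>k. (ennreal ((2 * dyad k) powr r) * (if u < dyad_measure k then 1 else 0)) * indicator {x. ennreal (dyad k) < g x} x)"
        by (rule le_suminf_ennreal)
      finally show ?thesis .
    qed (use y in auto)
  qed
  also have "\<dots> = (\<Sum>k. (ennreal ((2 * dyad k) powr r) * (if u < dyad_measure k then 1 else 0)) * dyad_measure k)"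
    by (subst nn_integral_suminf, measurable)
       (intro suminf_cong nn_integral_cmult_indicator, measurable)
  finally have "epow (\<integral>\<^sup>+x. epow (g x) r * indicator {x. u < prank g x} x \<partial>lborel) (?n / r)
     \<le> epow (\<Sum>k. (ennreal ((2 * dyad k) powr r) * (if u < dyad_measure k then 1 else 0)) * dyad_measure k) (?n / r)"
    using n r0 by (intro epow_mono) auto
  also have "\<dots> \<le> (\<Sum>k. epow ((ennreal ((2 * dyad k) powr r) * (if u < dyad_measure k then 1 else 0)) * dyad_measure k) (?n / r))"
    using n r r0 by (intro epow_suminf_le) auto
  also have "\<dots> = (\<Sum>k. ennreal ((2 * dyad k) powr ?n) * (if u < dyad_measure k then epow (dyad_measure k) (?n / r) else 0))"
  proof (intro suminf_cong)
    fix k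
    have "epow (ennreal ((2 * dyad k) powr r)) (?n / r) = ennreal ((2 * dyad k) powr ?n)"
      using r0 by (simp add: epow_ennreal powr_powr)
    then show "epow ((ennreal ((2 * dyad k) powr r) * (if u < dyad_measure k then 1 else 0)) * dyad_measure k) (?n / r)
       = ennreal ((2 * dyad k) powr ?n) * (if u < dyad_measure k then epow (dyad_measure k) (?n / r) else 0)"
      using n r0 by (simp add: epow_mult)
  qed
  finally show ?thesis .
qed

text \<open>The condition restricts t to the interval up to \<open>m powr (1 / n)\<close>. There the
  integral of the power is \<open>m powr (1 - n / r)\<close> divided by
  \<open>n * (1 - n / r)\<close>, and the power of \<open>m\<close> completes
  \<open>m powr (n / r)\<close> to \<open>m\<close>. This is the origin of the singular factor in
  the embedding.\<close>

lemma time_integral_le: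
  assumes r: "r > real DIM('a)" and m: "m < \<infinity>"
  shows "(\<integral>\<^sup>+t. ennreal (t powr (real DIM('a) * (1 - real DIM('a) / r) - 1)) *
      ((if ennreal (t ^ DIM('a)) < m then epow m (real DIM('a) / r) else 0) * indicator {0<..} t) \<partial>lborel)
    \<le> ennreal (1 / (real DIM('a) * (1 - real DIM('a) / r))) * m"
proof -
  let ?n = "real DIM('a)" and ?N = "DIM('a)"
  obtain y where y: "m = ennreal y" "y \<ge> 0" using m by (cases m rule: ennreal_cases) auto
  have n: "?n > 0" by simp
  have r0: "r > 0" using r n by linarith
  define \<alpha> where "\<alpha> = ?n * (1 - ?n / r)"
  have \<alpha>: "\<alpha> > 0" using r r0 n by (simp add: \<alpha>_def)
  define b where "b = y powr (1 / ?n)"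
  have "ennreal (t powr (\<alpha> - 1)) * ((if ennreal (t ^ ?N) < m then epow m (?n / r) else 0) * indicator {0<..} t)
     \<le> ennreal (y powr (?n / r)) * (ennreal (t powr (\<alpha> - 1)) * indicator {0..b} t)" for t
  proof (cases "t > 0 \<and> t ^ ?N < y")
    case True
    then have "t powr ?n \<le> y" by (simp add: powr_realpow)
    then have "(t powr ?n) powr (1 / ?n) \<le> b" unfolding b_def using n by (intro powr_mono2) auto
    then have "t \<le> b" using True n by (simp add: powr_powr)
    then show ?thesis using True y by (simp add: epow_ennreal mult.commute)
  next
    case False
    then show ?thesis using y by (auto simp: indicator_def ennreal_less_iff)
  qed
  then have "(\<integral>\<^sup>+t. ennreal (t powr (\<alpha> - 1)) * ((if ennreal (t ^ ?N) < m then epow m (?n / r) else 0) * indicator {0<..} t) \<partial>lborel)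
     \<le> (\<integral>\<^sup>+t. ennreal (y powr (?n / r)) * (ennreal (t powr (\<alpha> - 1)) * indicator {0..b} t) \<partial>lborel)"
    by (rule nn_integral_mono)
  also have "\<dots> = ennreal (y powr (?n / r)) * (\<integral>\<^sup>+t. ennreal (t powr (\<alpha> - 1)) * indicator {0..b} t \<partial>lborel)"
    by (rule nn_integral_cmult) measurable
  also have "(\<integral>\<^sup>+t. ennreal (t powr (\<alpha> - 1)) * indicator {0..b} t \<partial>lborel) = ennreal (b powr (\<alpha> - 1 + 1) / (\<alpha> - 1 + 1))"
    using \<alpha> by (intro nn_integral_has_integral_lebesgue' has_integral_powr_from_0) (auto simp: b_def)
  also have "ennreal (y powr (?n / r)) * \<dots> = ennreal (y powr (?n / r) * (b powr \<alpha> / \<alpha>))"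
    using \<alpha> by (subst ennreal_mult[symmetric]) auto
  also have "y powr (?n / r) * (b powr \<alpha> / \<alpha>) = 1 / \<alpha> * y"
  proof -
    have "b powr \<alpha> = y powr (1 - ?n / r)" unfolding b_def \<alpha>_def using n by (simp add: powr_powr)
    then have "y powr (?n / r) * b powr \<alpha> = y powr (?n / r + (1 - ?n / r))" by (simp only: powr_add)
    also have "\<dots> = y" using y by simp
    finally show ?thesis by simp
  qed
  also have "ennreal (1 / \<alpha> * y) = ennreal (1 / \<alpha>) * m"
    unfolding y(1) using \<alpha> y by (intro ennreal_mult) auto
  finally show ?thesis unfolding \<alpha>_def .
qed

lemma low_integral_le:
  assumes r: "r > real DIM('a)"
  shows "(\<integral>\<^sup>+t. ennreal (t powr (real DIM('a) * (1 - real DIM('a) / r) - 1)) *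
      epow (\<integral>\<^sup>+x. epow (g x) r * indicator {x. ennreal (t ^ DIM('a)) < prank g x} x \<partial>lborel) (real DIM('a) / r) * indicator {0<..} t \<partial>lborel)
    \<le> ennreal (1 / (real DIM('a) * (1 - real DIM('a) / r))) *
      (ennreal (2 * 2 powr real DIM('a)) * (\<integral>\<^sup>+x. epow (g x) (real DIM('a)) \<partial>lborel))"
proof -
  let ?n = "real DIM('a)" and ?N = "DIM('a)"
  let ?A = "\<lambda>t. ennreal (t powr (?n * (1 - ?n / r) - 1))"
  let ?B = "\<lambda>t k. (if ennreal (t ^ ?N) < dyad_measure k then epow (dyad_measure k) (?n / r) else 0) * indicator {0<..} t"
  let ?d = "\<lambda>k. ennreal ((2 * dyad k) powr ?n)"
  have "(\<integral>\<^sup>+t. ?A t * epow (\<integral>\<^sup>+x. epow (g x) r * indicator {x. ennreal (t ^ ?N) < prank g x} x \<partial>lborel) (?n / r) * indicator {0<..} t \<partial>lborel)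
    \<le> (\<integral>\<^sup>+t. (\<Sum>k. ?d k * (?A t * ?B t k)) \<partial>lborel)"
  proof (intro nn_integral_mono)
    fix t :: real
    have "?A t * epow (\<integral>\<^sup>+x. epow (g x) r * indicator {x. ennreal (t ^ ?N) < prank g x} x \<partial>lborel) (?n / r) * indicator {0<..} t
      \<le> ?A t * (\<Sum>k. ?d k * (if ennreal (t ^ ?N) < dyad_measure k then epow (dyad_measure k) (?n / r) else 0)) * indicator {0<..} t"
      by (intro mult_left_mono mult_right_mono low_part_le r) auto
    also have "\<dots> = (\<Sum>k. (?A t * indicator {0<..} t) * (?d k * (if ennreal (t ^ ?N) < dyad_measure k then epow (dyad_measure k) (?n / r) else 0)))"
      unfolding ennreal_suminf_cmult by (simp only: mult_ac)
    also have "\<dots> = (\<Sum>k. ?d k * (?A t * ?B t k))" by (simp only: mult_ac)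
    finally show "?A t * epow (\<integral>\<^sup>+x. epow (g x) r * indicator {x. ennreal (t ^ ?N) < prank g x} x \<partial>lborel) (?n / r) * indicator {0<..} t
      \<le> (\<Sum>k. ?d k * (?A t * ?B t k))" .
  qed
  also have "\<dots> = (\<Sum>k. ?d k * (\<integral>\<^sup>+t. ?A t * ?B t k \<partial>lborel))"
    by (subst nn_integral_suminf, measurable) (intro suminf_cong nn_integral_cmult, measurable)
  also have "\<dots> \<le> (\<Sum>k. ?d k * (ennreal (1 / (?n * (1 - ?n / r))) * dyad_measure k))"
    by (intro suminf_le mult_left_mono time_integral_le r dyad_measure_finite) auto
  also have "\<dots> = (\<Sum>k. ennreal (1 / (?n * (1 - ?n / r))) * (?d k * dyad_measure k))" by (simp only: mult_ac)
  also have "\<dots> = ennreal (1 / (?n * (1 - ?n / r))) * (\<Sum>k. ?d k * dyad_measure k)" by (rule ennreal_suminf_cmult)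
  also have "\<dots> \<le> ennreal (1 / (?n * (1 - ?n / r))) * (ennreal (2 * 2 powr ?n) * (\<integral>\<^sup>+x. epow (g x) ?n \<partial>lborel))"
    by (intro mult_left_mono sum_dyad_measure_le) auto
  finally show ?thesis .
qed

end

section \<open>Ball averages of the gradient at all radii\<close>

text \<open>\<open>2 powr n\<close> stems from separating the two parts, the maximum from the height
  of the ball kernel bounded uniformly in \<open>r\<close>, \<open>4 powr n\<close> from the high
  part, and \<open>2 * 2 powr n\<close> from the low part.\<close>

definition avg_const :: "'a::euclidean_space itself \<Rightarrow> real" where
  "avg_const T = 2 powr real DIM('a) * ((max 1 (1 / ball_vol T)) powr real DIM('a) * 4 powr real DIM('a)
     + 2 * 2 powr real DIM('a))"

lemma avg_const_pos: "avg_const TYPE('a::euclidean_space) > 0"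
  unfolding avg_const_def by (intro mult_pos_pos add_nonneg_pos) auto

context
  fixes g :: "'a::euclidean_space \<Rightarrow> ennreal" and r :: real
  assumes g [measurable]: "g \<in> borel_measurable borel" and n2: "DIM('a) \<ge> 2" and r: "r > real DIM('a)"
begin

text \<open>The threshold rank \<open>t ^ n\<close> is tied to the radius of the average. Values of
  small rank are averaged from L1 to \<open>L^r\<close>, the rest by contraction in
  \<open>L^r\<close>.\<close>

lemma epow_avg_split:
  assumes t: "t > 0"
  shows "ennreal (t powr (real DIM('a) * (1 - real DIM('a) / r) - 1)) *
     epow (\<integral>\<^sup>+x. epow (wavg (ball_kernel t) g x) r \<partial>lborel) (real DIM('a) / r)
   \<le> ennreal (2 powr real DIM('a)) * (ennreal ((max 1 (1 / ball_vol TYPE('a))) powr real DIM('a)) *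
       (ennreal (t powr (- 1 - real DIM('a) * (real DIM('a) - 1))) *
        epow (\<integral>\<^sup>+x. g x * indicator {x. prank g x \<le> ennreal (t ^ DIM('a))} x \<partial>lborel) (real DIM('a)))
     + ennreal (t powr (real DIM('a) * (1 - real DIM('a) / r) - 1)) *
        epow (\<integral>\<^sup>+x. epow (g x) r * indicator {x. ennreal (t ^ DIM('a)) < prank g x} x \<partial>lborel) (real DIM('a) / r))"
proof -
  let ?n = "real DIM('a)" and ?N = "DIM('a)" and ?om = "ball_vol TYPE('a)" and ?q = "real DIM('a) / r"
  note [measurable] = borel_measurable_rank[OF g]
  define k where "k = 1 / (t ^ ?N * ?om)"
  define gH where "gH x = g x * indicator {x. prank g x \<le> ennreal (t ^ ?N)} x" for x
  define gL where "gL x = g x * indicator {x. ennreal (t ^ ?N) < prank g x} x" for x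
  have [measurable]: "gH \<in> borel_measurable borel" "gL \<in> borel_measurable borel"
    unfolding gH_def gL_def by measurable
  note [measurable] = borel_measurable_wavg[OF borel_measurable_ball_kernel[of t]]
  have om: "?om > 0" by (rule ball_vol_pos)
  have k: "k > 0" using t om by (simp add: k_def)
  have n: "?n \<ge> 2" using n2 by simp
  have r1: "r > 1" "r > 0" using r n by linarith+
  have q: "0 < ?q" "?q \<le> 1" using r r1 n by auto
  let ?K = "ball_kernel t :: 'a \<Rightarrow> ennreal"
  have split: "wavg ?K g x = wavg ?K gH x + wavg ?K gL x" for x
  proof -
    have "g y = gH y + gL y" for y by (auto simp: gH_def gL_def indicator_def not_le)
    then have "wavg ?K g x = (\<integral>\<^sup>+z. gH (x + z) * ?K z + gL (x + z) * ?K z \<partial>lborel)"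
      unfolding wavg_def by (simp add: distrib_right)
    also have "\<dots> = wavg ?K gH x + wavg ?K gL x" unfolding wavg_def by (rule nn_integral_add) measurable
    finally show ?thesis .
  qed
  have K1: "(\<integral>\<^sup>+z. ?K z \<partial>lborel) = 1" by (rule nn_integral_ball_kernel[OF t])
  have Kk: "?K z \<le> ennreal k" for z unfolding ball_kernel_def k_def by (auto simp: indicator_def)
  have "(\<integral>\<^sup>+x. epow (wavg ?K g x) r \<partial>lborel)
     \<le> (\<integral>\<^sup>+x. ennreal (2 powr r) * (epow (wavg ?K gH x) r + epow (wavg ?K gL x) r) \<partial>lborel)"
    unfolding split using r1 by (intro nn_integral_mono epow_add_le2) auto
  also have "\<dots> = ennreal (2 powr r) * ((\<integral>\<^sup>+x. epow (wavg ?K gH x) r \<partial>lborel) + (\<integral>\<^sup>+x. epow (wavg ?K gL x) r \<partial>lborel))"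
    by (simp add: nn_integral_cmult nn_integral_add)
  also have "\<dots> \<le> ennreal (2 powr r) * (epow (\<integral>\<^sup>+x. gH x \<partial>lborel) r * epow (ennreal k) (r - 1) + (\<integral>\<^sup>+x. epow (gL x) r \<partial>lborel))"
    by (intro mult_left_mono add_mono nn_integral_epow_wavg_le nn_integral_epow_wavg_le_L1 K1 Kk r1) measurable
  finally have "epow (\<integral>\<^sup>+x. epow (wavg ?K g x) r \<partial>lborel) ?q
     \<le> epow (ennreal (2 powr r) * (epow (\<integral>\<^sup>+x. gH x \<partial>lborel) r * epow (ennreal k) (r - 1) + (\<integral>\<^sup>+x. epow (gL x) r \<partial>lborel))) ?q"
    using q by (intro epow_mono) auto
  also have "\<dots> = ennreal (2 powr ?n) * epow (epow (\<integral>\<^sup>+x. gH x \<partial>lborel) r * epow (ennreal k) (r - 1) + (\<integral>\<^sup>+x. epow (gL x) r \<partial>lborel)) ?q"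
    using q r1 by (simp add: epow_mult epow_ennreal powr_powr)
  also have "\<dots> \<le> ennreal (2 powr ?n) * (epow (epow (\<integral>\<^sup>+x. gH x \<partial>lborel) r * epow (ennreal k) (r - 1)) ?q + epow (\<integral>\<^sup>+x. epow (gL x) r \<partial>lborel) ?q)"
    using q by (intro mult_left_mono epow_add_le) auto
  also have "epow (epow (\<integral>\<^sup>+x. gH x \<partial>lborel) r * epow (ennreal k) (r - 1)) ?q = ennreal (k powr (?n - ?q)) * epow (\<integral>\<^sup>+x. gH x \<partial>lborel) ?n"
  proof -
    have "(r - 1) * ?q = ?n - ?q" using r1 by (simp add: field_simps)
    then have "epow (epow (ennreal k) (r - 1)) ?q = ennreal (k powr (?n - ?q))"
      using r1 k by (simp only: powr_powr epow_ennreal powr_ge_zero less_imp_le)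
    moreover have "epow (epow (\<integral>\<^sup>+x. gH x \<partial>lborel) r) ?q = epow (\<integral>\<^sup>+x. gH x \<partial>lborel) ?n"
      using r1 by (simp add: epow_epow)
    ultimately show ?thesis using q by (simp only: epow_mult mult.commute)
  qed
  also have "(\<lambda>x. epow (gL x) r) = (\<lambda>x. epow (g x) r * indicator {x. ennreal (t ^ ?N) < prank g x} x)"
    by (auto simp: gL_def fun_eq_iff indicator_def)
  finally have main: "epow (\<integral>\<^sup>+x. epow (wavg ?K g x) r \<partial>lborel) ?q
    \<le> ennreal (2 powr ?n) * (ennreal (k powr (?n - ?q)) * epow (\<integral>\<^sup>+x. gH x \<partial>lborel) ?n
        + epow (\<integral>\<^sup>+x. epow (g x) r * indicator {x. ennreal (t ^ ?N) < prank g x} x \<partial>lborel) ?q)" .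
  define A where "A = t powr (?n * (1 - ?q) - 1)"
  \<comment> \<open>The exponents of t add up to \<open>- 1 - n * (n - 1)\<close>, in which
    \<open>r\<close> no longer occurs, so the bound for the high part is uniform in
    \<open>r\<close>.\<close>
  have kA: "A * k powr (?n - ?q) \<le> (max 1 (1 / ?om)) powr ?n * t powr (- 1 - ?n * (?n - 1))"
  proof -
    have "k powr (?n - ?q) = (1 / ?om) powr (?n - ?q) * t powr (- (?n * (?n - ?q)))"
      unfolding k_def using t om
      by (simp add: powr_divide powr_mult powr_realpow[symmetric] powr_powr powr_minus_divide)
    then have "A * k powr (?n - ?q) = (1 / ?om) powr (?n - ?q) * (t powr (?n * (1 - ?q) - 1) * t powr (- (?n * (?n - ?q))))"
      unfolding A_def by (simp only: mult_ac)
    also have "t powr (?n * (1 - ?q) - 1) * t powr (- (?n * (?n - ?q))) = t powr (- 1 - ?n * (?n - 1))"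
    proof -
      have "(?n * (1 - ?q) - 1) + (- (?n * (?n - ?q))) = - 1 - ?n * (?n - 1)"
        by (simp add: right_diff_distrib)
      then show ?thesis by (simp only: powr_add[symmetric])
    qed
    also have "(1 / ?om) powr (?n - ?q) \<le> (max 1 (1 / ?om)) powr ?n"
    proof -
      have "(1 / ?om) powr (?n - ?q) \<le> (max 1 (1 / ?om)) powr (?n - ?q)"
        using om q n by (intro powr_mono2) auto
      also have "\<dots> \<le> (max 1 (1 / ?om)) powr ?n" using q by (intro powr_mono) auto
      finally show ?thesis .
    qed
    finally show ?thesis by (simp add: mult_right_mono)
  qed
  have "ennreal A * epow (\<integral>\<^sup>+x. epow (wavg ?K g x) r \<partial>lborel) ?q
     \<le> ennreal A * (ennreal (2 powr ?n) * (ennreal (k powr (?n - ?q)) * epow (\<integral>\<^sup>+x. gH x \<partial>lborel) ?n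
        + epow (\<integral>\<^sup>+x. epow (g x) r * indicator {x. ennreal (t ^ ?N) < prank g x} x \<partial>lborel) ?q))"
    by (intro mult_left_mono main) auto
  also have "\<dots> = ennreal (2 powr ?n) * (ennreal (A * k powr (?n - ?q)) * epow (\<integral>\<^sup>+x. gH x \<partial>lborel) ?n
        + ennreal A * epow (\<integral>\<^sup>+x. epow (g x) r * indicator {x. ennreal (t ^ ?N) < prank g x} x \<partial>lborel) ?q)"
    by (simp add: A_def ennreal_mult distrib_left mult_ac)
  also have "\<dots> \<le> ennreal (2 powr ?n) * (ennreal ((max 1 (1 / ?om)) powr ?n * t powr (- 1 - ?n * (?n - 1))) * epow (\<integral>\<^sup>+x. gH x \<partial>lborel) ?n
        + ennreal A * epow (\<integral>\<^sup>+x. epow (g x) r * indicator {x. ennreal (t ^ ?N) < prank g x} x \<partial>lborel) ?q)"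
    by (intro mult_left_mono add_right_mono mult_right_mono ennreal_leI kA) auto
  finally show ?thesis unfolding A_def gH_def by (simp add: ennreal_mult mult.assoc)
qed

text \<open>Only the low part is singular as r decreases to n; the constant of the high part is
  enlarged by \<open>1 / (1 - n / r)\<close>, which exceeds 1, to merge the two. An infinite
  gradient integral makes the right side infinite because the constant is positive.\<close>

lemma avg_integral_le:
  "(\<integral>\<^sup>+t. ennreal (t powr (real DIM('a) * (1 - real DIM('a) / r) - 1)) *
     epow (\<integral>\<^sup>+x. epow (wavg (ball_kernel t) g x) r \<partial>lborel) (real DIM('a) / r) * indicator {0<..} t \<partial>lborel)
   \<le> ennreal (avg_const TYPE('a) / (1 - real DIM('a) / r)) * (\<integral>\<^sup>+x. epow (g x) (real DIM('a)) \<partial>lborel)"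
proof (cases "(\<integral>\<^sup>+x. epow (g x) (real DIM('a)) \<partial>lborel) < \<infinity>")
  case fin: True
  let ?n = "real DIM('a)" and ?N = "DIM('a)" and ?om = "ball_vol TYPE('a)" and ?q = "real DIM('a) / r"
  let ?P = "\<integral>\<^sup>+x. epow (g x) ?n \<partial>lborel"
  let ?m = "(max 1 (1 / ?om)) powr ?n"
  note [measurable] = borel_measurable_rank[OF g]
  have n: "?n \<ge> 2" using n2 by simp
  have q: "?q < 1" using r n by simp
  define H where "H t = ennreal (t powr (- 1 - ?n * (?n - 1))) *
        epow (\<integral>\<^sup>+x. g x * indicator {x. prank g x \<le> ennreal (t ^ ?N)} x \<partial>lborel) ?n * indicator {0<..} t" for t
  define L where "L t = ennreal (t powr (?n * (1 - ?q) - 1)) *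
        epow (\<integral>\<^sup>+x. epow (g x) r * indicator {x. ennreal (t ^ ?N) < prank g x} x \<partial>lborel) ?q * indicator {0<..} t" for t
  have [measurable]: "H \<in> borel_measurable borel" "L \<in> borel_measurable borel"
    unfolding H_def L_def indicator_def mem_Collect_eq by measurable
  have "(\<integral>\<^sup>+t. ennreal (t powr (?n * (1 - ?q) - 1)) *
     epow (\<integral>\<^sup>+x. epow (wavg (ball_kernel t) g x) r \<partial>lborel) ?q * indicator {0<..} t \<partial>lborel)
    \<le> (\<integral>\<^sup>+t. ennreal (2 powr ?n) * (ennreal ?m * H t + L t) \<partial>lborel)"
  proof (intro nn_integral_mono)
    fix t
    show "ennreal (t powr (?n * (1 - ?q) - 1)) *
       epow (\<integral>\<^sup>+x. epow (wavg (ball_kernel t) g x) r \<partial>lborel) ?q * indicator {0<..} t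
      \<le> ennreal (2 powr ?n) * (ennreal ?m * H t + L t)"
      using epow_avg_split[of t] by (cases "t > 0") (simp_all add: H_def L_def)
  qed
  also have "\<dots> = ennreal (2 powr ?n) * (ennreal ?m * (\<integral>\<^sup>+t. H t \<partial>lborel) + (\<integral>\<^sup>+t. L t \<partial>lborel))"
    by (simp add: nn_integral_cmult nn_integral_add)
  also have "\<dots> \<le> ennreal (2 powr ?n) * (ennreal ?m * (ennreal (4 powr ?n) * ?P) +
      ennreal (1 / (?n * (1 - ?q))) * (ennreal (2 * 2 powr ?n) * ?P))"
    unfolding H_def L_def
    by (intro mult_left_mono add_mono high_integral_le low_integral_le g n2 r fin) auto
  also have "\<dots> = ennreal (2 powr ?n * (?m * 4 powr ?n + 1 / (?n * (1 - ?q)) * (2 * 2 powr ?n))) * ?P"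
  proof -
    have "ennreal (2 powr ?n * (?m * 4 powr ?n + 1 / (?n * (1 - ?q)) * (2 * 2 powr ?n)))
       = ennreal (2 powr ?n) * (ennreal ?m * ennreal (4 powr ?n) + ennreal (1 / (?n * (1 - ?q))) * ennreal (2 * 2 powr ?n))"
    proof -
      have nn: "0 \<le> 1 / (?n * (1 - ?q))" "0 \<le> 2 * 2 powr ?n" "0 \<le> ?m * 4 powr ?n"
        using n q by auto
      show ?thesis
        by (simp only: ennreal_mult ennreal_plus nn mult_nonneg_nonneg[OF nn(1,2)] powr_ge_zero add_nonneg_nonneg[OF nn(3) mult_nonneg_nonneg[OF nn(1,2)]])
    qed
    then show ?thesis by (simp only: distrib_left distrib_right mult.assoc)
  qed
  also have "\<dots> \<le> ennreal (avg_const TYPE('a) / (1 - ?q)) * ?P"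
  proof (intro mult_right_mono ennreal_leI)
    have 1: "?m * 4 powr ?n \<le> ?m * 4 powr ?n / (1 - ?q)"
    proof -
      have "0 < ?q" using n r by simp
      then have "(?m * 4 powr ?n) * (1 - ?q) \<le> (?m * 4 powr ?n) * 1"
        by (intro mult_left_mono) auto
      then show ?thesis using q by (simp only: pos_le_divide_eq diff_gt_0_iff_gt mult_1_right)
    qed
    have 2: "1 / (?n * (1 - ?q)) * (2 * 2 powr ?n) \<le> (2 * 2 powr ?n) / (1 - ?q)"
    proof -
      have "1 / (?n * (1 - ?q)) \<le> 1 / (1 - ?q)" using n q by (intro divide_left_mono mult_pos_pos) auto
      then have "1 / (?n * (1 - ?q)) * (2 * 2 powr ?n) \<le> 1 / (1 - ?q) * (2 * 2 powr ?n)"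
        by (rule mult_right_mono) simp
      then show ?thesis by simp
    qed
    have "2 powr ?n * (?m * 4 powr ?n + 1 / (?n * (1 - ?q)) * (2 * 2 powr ?n))
       \<le> 2 powr ?n * (?m * 4 powr ?n / (1 - ?q) + (2 * 2 powr ?n) / (1 - ?q))"
      by (intro mult_left_mono add_mono 1 2) auto
    also have "\<dots> = avg_const TYPE('a) / (1 - ?q)"
      unfolding avg_const_def by (simp only: add_divide_distrib[symmetric] times_divide_eq_right)
    finally show "2 powr ?n * (?m * 4 powr ?n + 1 / (?n * (1 - ?q)) * (2 * 2 powr ?n)) \<le> avg_const TYPE('a) / (1 - ?q)" .
  qed auto
  finally show ?thesis .
next
  case False
  then have "(\<integral>\<^sup>+x. epow (g x) (real DIM('a)) \<partial>lborel) = \<infinity>" using top.not_eq_extremum by fastforce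
  moreover have "avg_const TYPE('a) / (1 - real DIM('a) / r) > 0"
    using avg_const_pos[where 'a='a] r n2 by simp
  then have "ennreal (avg_const TYPE('a) / (1 - real DIM('a) / r)) \<noteq> 0"
    by (subst ennreal_eq_0_iff) linarith
  ultimately show ?thesis
    by (simp only: ennreal_mult_top infinity_ennreal_def if_False top_greatest)
qed

end

subsection \<open>Oscillation of functions with integrable gradient\<close>

definition mean_osc :: "('a::euclidean_space \<Rightarrow> real) \<Rightarrow> real \<Rightarrow> 'a \<Rightarrow> ennreal" where
  "mean_osc u t x = (\<integral>\<^sup>+z. ennreal \<bar>u (x + z) - u x\<bar> * ball_kernel t z \<partial>lborel)"

lemma ball_kernel_le_dilate:
  fixes z z' :: "'a::euclidean_space"
  assumes t: "0 < t" "t \<le> s" "s \<le> 2 * t" and zz: "z \<in> ball 0 t \<Longrightarrow> z' \<in> ball 0 s"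
  shows "ball_kernel t z \<le> ennreal (2 ^ DIM('a)) * ball_kernel s z'"
proof (cases "z \<in> ball 0 t")
  case True
  have "1 / (t ^ DIM('a) * ball_vol TYPE('a)) \<le> 2 ^ DIM('a) * (1 / (s ^ DIM('a) * ball_vol TYPE('a)))"
  proof -
    have "s ^ DIM('a) \<le> (2 * t) ^ DIM('a)" using t by (intro power_mono) auto
    then have "s ^ DIM('a) \<le> 2 ^ DIM('a) * t ^ DIM('a)" by (simp add: power_mult_distrib)
    then show ?thesis using t ball_vol_pos[where 'a='a] by (simp add: field_simps)
  qed
  then have "ennreal (1 / (t ^ DIM('a) * ball_vol TYPE('a))) \<le> ennreal (2 ^ DIM('a)) * ennreal (1 / (s ^ DIM('a) * ball_vol TYPE('a)))"
    using t ball_vol_pos[where 'a='a] by (subst ennreal_mult[symmetric]) (auto intro!: ennreal_leI)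
  then show ?thesis using True zz unfolding ball_kernel_def by simp
qed (simp add: ball_kernel_def)

lemma wavg_scale:
  fixes G :: "'a::euclidean_space \<Rightarrow> ennreal"
  assumes [measurable]: "G \<in> borel_measurable borel" and \<theta>: "\<theta> > 0" and t: "t > 0"
  shows "(\<integral>\<^sup>+z. G (x + \<theta> *\<^sub>R z) * ball_kernel t z \<partial>lborel) = wavg (ball_kernel (\<theta> * t)) G x"
proof -
  have k: "ennreal (\<theta> ^ DIM('a)) * ball_kernel (\<theta> * t) (\<theta> *\<^sub>R z) = ball_kernel t (z::'a)" for z
  proof -
    have "indicator (ball (0::'a) (\<theta> * t)) (\<theta> *\<^sub>R z) = (indicator (ball 0 t) z :: ennreal)"
      using \<theta> by (simp add: indicator_def)
    moreover have "ennreal (\<theta> ^ DIM('a)) * ennreal (1 / ((\<theta> * t) ^ DIM('a) * ball_vol TYPE('a)))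
       = ennreal (1 / (t ^ DIM('a) * ball_vol TYPE('a)))"
      using \<theta> t ball_vol_pos[where 'a='a]
      by (subst ennreal_mult[symmetric]) (auto simp: power_mult_distrib)
    ultimately show ?thesis unfolding ball_kernel_def by (simp only: mult.assoc[symmetric])
  qed
  have "wavg (ball_kernel (\<theta> * t)) G x = ennreal (\<theta> ^ DIM('a)) * (\<integral>\<^sup>+z. G (x + \<theta> *\<^sub>R z) * ball_kernel (\<theta> * t) (\<theta> *\<^sub>R z) \<partial>lborel)"
    unfolding wavg_def using \<theta>
    by (subst nn_integral_lborel_scale[of _ \<theta>]) simp_all
  also have "\<dots> = (\<integral>\<^sup>+z. G (x + \<theta> *\<^sub>R z) * (ennreal (\<theta> ^ DIM('a)) * ball_kernel (\<theta> * t) (\<theta> *\<^sub>R z)) \<partial>lborel)"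
    by (subst nn_integral_cmult[symmetric]) (simp_all add: mult_ac)
  finally show ?thesis unfolding k by simp
qed

lemma ex_dyadic_interval:
  assumes "0 < \<theta>" "\<theta> \<le> (1::real)"
  shows "\<exists>j. \<theta> \<in> {1 / 2 ^ Suc j<..1 / 2 ^ j}"
proof -
  have "\<exists>j. 1 / 2 ^ Suc j < \<theta>"
  proof -
    obtain j where "1 / \<theta> < 2 ^ j" using real_arch_pow[of 2 "1 / \<theta>"] by auto
    then have "1 / 2 ^ j < \<theta>" using assms by (simp add: field_simps)
    moreover have "1 / 2 ^ Suc j \<le> 1 / (2::real) ^ j" by (simp add: field_simps)
    ultimately show ?thesis by (intro exI[of _ j]) linarith
  qed
  then have L: "1 / 2 ^ Suc (LEAST j. 1 / 2 ^ Suc j < \<theta>) < \<theta>" by (rule LeastI_ex)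
  define j where "j = (LEAST j. 1 / 2 ^ Suc j < \<theta>)"
  have "\<theta> \<le> 1 / 2 ^ j"
  proof (cases j)
    case (Suc i)
    then have "\<not> 1 / 2 ^ Suc i < \<theta>"
      using not_less_Least[of i "\<lambda>j. 1 / 2 ^ Suc j < \<theta>"] by (simp add: j_def)
    then show ?thesis unfolding Suc by simp
  qed (use assms in simp)
  then show ?thesis using L unfolding j_def[symmetric] by (intro exI[of _ j]) simp
qed

section \<open>Functions whose increments are dominated by line integrals of
  \<open>G\<close>\<close>

context
  fixes u :: "'a::euclidean_space \<Rightarrow> real" and G :: "'a \<Rightarrow> ennreal"
  assumes u [measurable]: "u \<in> borel_measurable borel" and G [measurable]: "G \<in> borel_measurable borel"
    and grad_bound: "\<And>x z. ennreal \<bar>u (x + z) - u x\<bar> \<le> ennreal (norm z) * (\<integral>\<^sup>+\<theta>. G (x + \<theta> *\<^sub>R z) * indicator {0<..1} \<theta> \<partial>lborel)"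
begin

lemma borel_measurable_mean_osc: "mean_osc u t \<in> borel_measurable borel"
  unfolding mean_osc_def by measurable

text \<open>After exchanging the integrals, the point at fraction \<open>\<theta>\<close> of each
  segment runs through the ball of radius \<open>\<theta> * t\<close>. For \<open>\<theta>\<close>
  in a dyadic interval this average is at most \<open>2 ^ n\<close> times the one over the ball of
  radius \<open>t / 2 ^ j\<close>, and the length of the interval supplies the weight.\<close>

lemma mean_osc_le:
  assumes t: "t > 0"
  shows "mean_osc u t x \<le> ennreal (t * 2 ^ DIM('a)) * (\<Sum>j. ennreal (1 / 2 ^ j) * wavg (ball_kernel (t / 2 ^ j)) G x)"
proof -
  have "mean_osc u t x \<le> (\<integral>\<^sup>+z. ennreal t * (\<integral>\<^sup>+\<theta>. G (x + \<theta> *\<^sub>R z) * indicator {0<..1} \<theta> * ball_kernel t z \<partial>lborel) \<partial>lborel)"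
    unfolding mean_osc_def
  proof (intro nn_integral_mono)
    fix z :: 'a
    show "ennreal \<bar>u (x + z) - u x\<bar> * ball_kernel t z \<le> ennreal t * (\<integral>\<^sup>+\<theta>. G (x + \<theta> *\<^sub>R z) * indicator {0<..1} \<theta> * ball_kernel t z \<partial>lborel)"
    proof (cases "z \<in> ball 0 t")
      case True
      have "ennreal \<bar>u (x + z) - u x\<bar> * ball_kernel t z
        \<le> (ennreal (norm z) * (\<integral>\<^sup>+\<theta>. G (x + \<theta> *\<^sub>R z) * indicator {0<..1} \<theta> \<partial>lborel)) * ball_kernel t z"
        by (intro mult_right_mono grad_bound) auto
      also have "\<dots> \<le> (ennreal t * (\<integral>\<^sup>+\<theta>. G (x + \<theta> *\<^sub>R z) * indicator {0<..1} \<theta> \<partial>lborel)) * ball_kernel t z"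
        using True by (intro mult_right_mono ennreal_leI) auto
      also have "\<dots> = ennreal t * (\<integral>\<^sup>+\<theta>. G (x + \<theta> *\<^sub>R z) * indicator {0<..1} \<theta> * ball_kernel t z \<partial>lborel)"
        by (subst nn_integral_multc) (simp_all add: mult.assoc)
      finally show ?thesis .
    qed (simp add: ball_kernel_def)
  qed
  also have "\<dots> = ennreal t * (\<integral>\<^sup>+z. \<integral>\<^sup>+\<theta>. G (x + \<theta> *\<^sub>R z) * indicator {0<..1} \<theta> * ball_kernel t z \<partial>lborel \<partial>lborel)"
    by (rule nn_integral_cmult) measurable
  also have "(\<integral>\<^sup>+z. \<integral>\<^sup>+\<theta>. G (x + \<theta> *\<^sub>R z) * indicator {0<..1} \<theta> * ball_kernel t z \<partial>lborel \<partial>lborel)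
     = (\<integral>\<^sup>+\<theta>. \<integral>\<^sup>+z. G (x + \<theta> *\<^sub>R z) * indicator {0<..1} \<theta> * ball_kernel t z \<partial>lborel \<partial>lborel)"
    by (rule lborel_pair.Fubini') measurable
  also have "\<dots> \<le> (\<integral>\<^sup>+\<theta>. (\<Sum>j. (ennreal (2 ^ DIM('a)) * wavg (ball_kernel (t / 2 ^ j)) G x) * indicator {1 / 2 ^ Suc j<..1 / 2 ^ j :: real} \<theta>) \<partial>lborel)"
  proof (intro nn_integral_mono)
    fix \<theta> :: real
    show "(\<integral>\<^sup>+z. G (x + \<theta> *\<^sub>R z) * indicator {0<..1} \<theta> * ball_kernel t z \<partial>lborel)
      \<le> (\<Sum>j. (ennreal (2 ^ DIM('a)) * wavg (ball_kernel (t / 2 ^ j)) G x) * indicator {1 / 2 ^ Suc j<..1 / 2 ^ j :: real} \<theta>)"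
    proof (cases "0 < \<theta> \<and> \<theta> \<le> 1")
      case True
      then obtain j where j: "\<theta> \<in> {1 / 2 ^ Suc j<..1 / 2 ^ j}" using ex_dyadic_interval by blast
      have j2: "\<theta> * t \<le> t / 2 ^ j" "t / 2 ^ j \<le> 2 * (\<theta> * t)"
      proof -
        have th: "\<theta> \<le> 1 / 2 ^ j" "1 / 2 ^ j \<le> 2 * \<theta>" using j by auto
        have t': "0 \<le> t" using t by simp
        note mult_right_mono[OF th(1) t'] mult_right_mono[OF th(2) t']
        then show "\<theta> * t \<le> t / 2 ^ j" "t / 2 ^ j \<le> 2 * (\<theta> * t)" by auto
      qed
      have "(\<integral>\<^sup>+z. G (x + \<theta> *\<^sub>R z) * indicator {0<..1} \<theta> * ball_kernel t z \<partial>lborel) = wavg (ball_kernel (\<theta> * t)) G x"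
        using True t by (subst wavg_scale[symmetric]) simp_all
      also have "\<dots> \<le> (\<integral>\<^sup>+z. ennreal (2 ^ DIM('a)) * (G (x + z) * ball_kernel (t / 2 ^ j) z) \<partial>lborel)"
        unfolding wavg_def
      proof (intro nn_integral_mono)
        fix z :: 'a
        have "ball_kernel (\<theta> * t) z \<le> ennreal (2 ^ DIM('a)) * ball_kernel (t / 2 ^ j) z"
          using True t j2 by (intro ball_kernel_le_dilate) auto
        then have "G (x + z) * ball_kernel (\<theta> * t) z \<le> G (x + z) * (ennreal (2 ^ DIM('a)) * ball_kernel (t / 2 ^ j) z)"
          by (rule mult_left_mono) simp
        then show "G (x + z) * ball_kernel (\<theta> * t) z \<le> ennreal (2 ^ DIM('a)) * (G (x + z) * ball_kernel (t / 2 ^ j) z)"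
          by (simp only: mult_ac)
      qed
      also have "\<dots> = ennreal (2 ^ DIM('a)) * wavg (ball_kernel (t / 2 ^ j)) G x"
        unfolding wavg_def by (rule nn_integral_cmult) measurable
      also have "\<dots> = (ennreal (2 ^ DIM('a)) * wavg (ball_kernel (t / 2 ^ j)) G x) * indicator {1 / 2 ^ Suc j<..1 / 2 ^ j :: real} \<theta>"
        using j by (simp only: indicator_simps mult_1_right)
      also have "\<dots> \<le> (\<Sum>j. (ennreal (2 ^ DIM('a)) * wavg (ball_kernel (t / 2 ^ j)) G x) * indicator {1 / 2 ^ Suc j<..1 / 2 ^ j :: real} \<theta>)"
        by (rule le_suminf_ennreal)
      finally show ?thesis .
    qed auto
  qed
  also have "\<dots> = (\<Sum>j. (ennreal (2 ^ DIM('a)) * wavg (ball_kernel (t / 2 ^ j)) G x) * emeasure lborel {1 / 2 ^ Suc j<..1 / 2 ^ j :: real})"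
    by (subst nn_integral_suminf, measurable) (intro suminf_cong nn_integral_cmult_indicator, measurable)
  also have "\<dots> \<le> (\<Sum>j. ennreal (2 ^ DIM('a)) * (ennreal (1 / 2 ^ j) * wavg (ball_kernel (t / 2 ^ j)) G x))"
  proof (intro suminf_le)
    fix j
    have "(1::real) / 2 ^ Suc j \<le> 1 / 2 ^ j" by (intro divide_left_mono power_increasing) auto
    then have "emeasure lborel {1 / 2 ^ Suc j<..1 / 2 ^ j :: real} = ennreal (1 / 2 ^ j - 1 / 2 ^ Suc j)"
      by (rule emeasure_lborel_Ioc)
    also have "\<dots> \<le> ennreal (1 / 2 ^ j)"
    proof (rule ennreal_leI)
      have "0 \<le> 1 / (2::real) ^ Suc j" by (intro divide_nonneg_nonneg zero_le_power) auto
      then show "1 / 2 ^ j - 1 / 2 ^ Suc j \<le> (1 / 2 ^ j :: real)" by linarith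
    qed
    finally have "emeasure lborel {1 / 2 ^ Suc j<..1 / 2 ^ j :: real} \<le> ennreal (1 / 2 ^ j)" .
    then have "(ennreal (2 ^ DIM('a)) * wavg (ball_kernel (t / 2 ^ j)) G x) * emeasure lborel {1 / 2 ^ Suc j<..1 / 2 ^ j :: real}
      \<le> (ennreal (2 ^ DIM('a)) * wavg (ball_kernel (t / 2 ^ j)) G x) * ennreal (1 / 2 ^ j)"
      by (rule mult_left_mono) simp
    then show "(ennreal (2 ^ DIM('a)) * wavg (ball_kernel (t / 2 ^ j)) G x) * emeasure lborel {1 / 2 ^ Suc j<..1 / 2 ^ j :: real}
      \<le> ennreal (2 ^ DIM('a)) * (ennreal (1 / 2 ^ j) * wavg (ball_kernel (t / 2 ^ j)) G x)"
      by (simp only: mult_ac)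
  qed auto
  also have "\<dots> = ennreal (2 ^ DIM('a)) * (\<Sum>j. ennreal (1 / 2 ^ j) * wavg (ball_kernel (t / 2 ^ j)) G x)"
    by (rule ennreal_suminf_cmult)
  finally have "mean_osc u t x \<le> ennreal t * (ennreal (2 ^ DIM('a)) * (\<Sum>j. ennreal (1 / 2 ^ j) * wavg (ball_kernel (t / 2 ^ j)) G x))"
    by (simp add: mult_left_mono)
  then show ?thesis using t by (simp only: ennreal_mult mult.assoc less_imp_le zero_le_power zero_le_numeral)
qed

text \<open>Both \<open>x\<close> and \<open>x + h\<close> are compared with \<open>x + z\<close>
  for z in the ball of radius t; seen from \<open>x + h\<close> these points lie within
  \<open>2 * t\<close>. Averaging over \<open>z\<close> gives the two terms.\<close>

lemma diff_le_mean_osc: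
  fixes h :: 'a
  assumes h: "norm h < t"
  shows "ennreal \<bar>u (x + h) - u x\<bar> \<le> ennreal (2 ^ DIM('a)) * (mean_osc u (2 * t) (x + h) + mean_osc u (2 * t) x)"
proof -
  have t: "t > 0" using h norm_ge_zero[of h] by linarith
  have "ennreal \<bar>u (x + h) - u x\<bar> = (\<integral>\<^sup>+z. ennreal \<bar>u (x + h) - u x\<bar> * ball_kernel t (z::'a) \<partial>lborel)"
    using t by (simp add: nn_integral_cmult nn_integral_ball_kernel)
  also have "\<dots> \<le> (\<integral>\<^sup>+z. ennreal \<bar>u (x + z) - u (x + h)\<bar> * ball_kernel t z + ennreal \<bar>u (x + z) - u x\<bar> * ball_kernel t z \<partial>lborel)"
    unfolding distrib_right[symmetric]
    by (intro nn_integral_mono mult_right_mono) (auto simp: ennreal_plus[symmetric] simp del: ennreal_plus intro!: ennreal_leI)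
  also have "\<dots> = (\<integral>\<^sup>+z. ennreal \<bar>u (x + z) - u (x + h)\<bar> * ball_kernel t z \<partial>lborel) + (\<integral>\<^sup>+z. ennreal \<bar>u (x + z) - u x\<bar> * ball_kernel t z \<partial>lborel)"
    by (rule nn_integral_add) measurable
  also have "(\<integral>\<^sup>+z. ennreal \<bar>u (x + z) - u (x + h)\<bar> * ball_kernel t z \<partial>lborel)
     = (\<integral>\<^sup>+z. ennreal \<bar>u (x + h + z) - u (x + h)\<bar> * ball_kernel t (z + h) \<partial>lborel)"
    using nn_integral_lborel_translate[of "\<lambda>z. ennreal \<bar>u (x + z) - u (x + h)\<bar> * ball_kernel t z" h]
    by (simp add: add_ac)
  also have "\<dots> \<le> (\<integral>\<^sup>+z. ennreal (2 ^ DIM('a)) * (ennreal \<bar>u (x + h + z) - u (x + h)\<bar> * ball_kernel (2 * t) z) \<partial>lborel)"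
  proof (intro nn_integral_mono)
    fix z :: 'a
    have "ball_kernel t (z + h) \<le> ennreal (2 ^ DIM('a)) * ball_kernel (2 * t) z"
    proof (rule ball_kernel_le_dilate)
      assume "z + h \<in> ball 0 t"
      then show "z \<in> ball 0 (2 * t)" using h norm_triangle_ineq4[of "z + h" h] by simp
    qed (use t in auto)
    then have "ennreal \<bar>u (x + h + z) - u (x + h)\<bar> * ball_kernel t (z + h) \<le> ennreal \<bar>u (x + h + z) - u (x + h)\<bar> * (ennreal (2 ^ DIM('a)) * ball_kernel (2 * t) z)"
      by (rule mult_left_mono) simp
    then show "ennreal \<bar>u (x + h + z) - u (x + h)\<bar> * ball_kernel t (z + h) \<le> ennreal (2 ^ DIM('a)) * (ennreal \<bar>u (x + h + z) - u (x + h)\<bar> * ball_kernel (2 * t) z)"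
      by (simp only: mult_ac)
  qed
  also have "\<dots> = ennreal (2 ^ DIM('a)) * mean_osc u (2 * t) (x + h)"
    unfolding mean_osc_def by (rule nn_integral_cmult) measurable
  also have "(\<integral>\<^sup>+z. ennreal \<bar>u (x + z) - u x\<bar> * ball_kernel t z \<partial>lborel)
     \<le> (\<integral>\<^sup>+z. ennreal (2 ^ DIM('a)) * (ennreal \<bar>u (x + z) - u x\<bar> * ball_kernel (2 * t) z) \<partial>lborel)"
  proof (intro nn_integral_mono)
    fix z :: 'a
    have "ball_kernel t z \<le> ennreal (2 ^ DIM('a)) * ball_kernel (2 * t) z"
      using t by (intro ball_kernel_le_dilate) auto
    then have "ennreal \<bar>u (x + z) - u x\<bar> * ball_kernel t z \<le> ennreal \<bar>u (x + z) - u x\<bar> * (ennreal (2 ^ DIM('a)) * ball_kernel (2 * t) z)"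
      by (rule mult_left_mono) simp
    then show "ennreal \<bar>u (x + z) - u x\<bar> * ball_kernel t z \<le> ennreal (2 ^ DIM('a)) * (ennreal \<bar>u (x + z) - u x\<bar> * ball_kernel (2 * t) z)"
      by (simp only: mult_ac)
  qed
  also have "\<dots> = ennreal (2 ^ DIM('a)) * mean_osc u (2 * t) x"
    unfolding mean_osc_def by (rule nn_integral_cmult) measurable
  finally show ?thesis
    by (simp add: distrib_left add_mono)
qed

lemma diff_pow_le_mean_osc:
  assumes h: "norm h < t" and r: "r \<ge> 1"
  shows "diff_pow r u h \<le> ennreal (2 * (2 * 2 ^ DIM('a)) powr r) * (\<integral>\<^sup>+x. epow (mean_osc u (2 * t) x) r \<partial>lborel)"
proof -
  note [measurable] = borel_measurable_mean_osc
  let ?E = "mean_osc u (2 * t)"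
  let ?c = "ennreal ((2 ^ DIM('a)) powr r) * ennreal (2 powr r)"
  have "diff_pow r u h \<le> (\<integral>\<^sup>+x. ?c * (epow (?E (x + h)) r + epow (?E x) r) \<partial>lborel)"
    unfolding diff_pow_def
  proof (intro nn_integral_mono)
    fix x
    have "ennreal (\<bar>u (x + h) - u x\<bar> powr r) = epow (ennreal \<bar>u (x + h) - u x\<bar>) r" by (simp add: epow_ennreal)
    also have "\<dots> \<le> epow (ennreal (2 ^ DIM('a)) * (?E (x + h) + ?E x)) r"
      using r by (intro epow_mono diff_le_mean_osc h) auto
    also have "\<dots> = ennreal ((2 ^ DIM('a)) powr r) * epow (?E (x + h) + ?E x) r"
    proof -
      have "epow (ennreal (2 ^ DIM('a))) r = ennreal ((2 ^ DIM('a)) powr r)" by (rule epow_ennreal) simp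
      then show ?thesis using r by (subst epow_mult) simp_all
    qed
    also have "\<dots> \<le> ennreal ((2 ^ DIM('a)) powr r) * (ennreal (2 powr r) * (epow (?E (x + h)) r + epow (?E x) r))"
      using r by (intro mult_left_mono epow_add_le2) auto
    finally show "ennreal (\<bar>u (x + h) - u x\<bar> powr r) \<le> ?c * (epow (?E (x + h)) r + epow (?E x) r)"
      by (simp only: mult.assoc)
  qed
  also have "\<dots> = ?c * ((\<integral>\<^sup>+x. epow (?E (x + h)) r \<partial>lborel) + (\<integral>\<^sup>+x. epow (?E x) r \<partial>lborel))"
    by (subst nn_integral_cmult, measurable) (subst nn_integral_add, measurable)
  also have "(\<integral>\<^sup>+x. epow (?E (x + h)) r \<partial>lborel) = (\<integral>\<^sup>+x. epow (?E x) r \<partial>lborel)"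
    by (rule nn_integral_lborel_translate[where f = "\<lambda>x. epow (?E x) r"]) measurable
  also have "?c * ((\<integral>\<^sup>+x. epow (?E x) r \<partial>lborel) + (\<integral>\<^sup>+x. epow (?E x) r \<partial>lborel)) = ennreal (2 * (2 * 2 ^ DIM('a)) powr r) * (\<integral>\<^sup>+x. epow (?E x) r \<partial>lborel)"
  proof -
    have "ennreal (2 * (2 * 2 ^ DIM('a)) powr r) = 2 * ?c"
      by (simp add: powr_mult ennreal_mult mult_ac)
    then show ?thesis by (simp only: mult_2[symmetric] mult.assoc mult.left_commute)
  qed
  finally show ?thesis .
qed

text \<open>The weight \<open>2 ^ (- j)\<close> is split as \<open>2 powr (- j (1 - a))\<close>
  times \<open>2 powr (- j a)\<close>. The second factor serves as Hoelder weight with total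
  \<open>S\<close>, the first remains and has to absorb the growth caused later by rescaling t. The
  parameter \<open>a\<close> is left open because its right size depends on
  \<open>n / r\<close>.\<close>

lemma osc_le_avg_sum:
  assumes r: "r > 1" and a: "0 < a" and t: "t > 0"
  defines "S \<equiv> 1 / (1 - 2 powr (- a))"
  shows "osc r u t \<le> ennreal (t ^ DIM('a) * ball_vol TYPE('a) * (8 * 4 ^ DIM('a) * t * S) powr r) *
    (\<Sum>j. ennreal (2 powr (- (real j * (r * (1 - a))))) * (\<integral>\<^sup>+x. epow (wavg (ball_kernel (2 * t / 2 ^ j)) G x) r \<partial>lborel))"
proof -
  let ?E = "mean_osc u (2 * t)" and ?N = "DIM('a)" and ?om = "ball_vol TYPE('a)"
  define W where "W j x = wavg (ball_kernel (2 * t / 2 ^ j)) G x" for j x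
  note [measurable] = borel_measurable_mean_osc
  have [measurable]: "W j \<in> borel_measurable borel" for j
    unfolding W_def by (intro borel_measurable_wavg) measurable
  have om: "?om > 0" by (rule ball_vol_pos)
  have b1: "2 powr (- a) < 1" using a by (simp add: powr_less_one)
  have S1: "S \<ge> 1" unfolding S_def using b1 by simp
  have sumw: "(\<Sum>j. ennreal (2 powr (- (real j * a)))) = ennreal S"
  proof -
    have "2 powr (- (real j * a)) = (2 powr (- a)) ^ j" for j
      by (simp add: powr_realpow[symmetric] powr_powr mult.commute)
    moreover have "(\<Sum>j. ennreal ((2 powr (- a)) ^ j)) = ennreal S"
      unfolding S_def using b1 by (intro suminf_ennreal_eq geometric_sums) auto
    ultimately show ?thesis by simp
  qed
  let ?v = "\<lambda>j. ennreal (2 powr (- (real j * (r * (1 - a)))))"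
  have pt: "epow (?E x) r \<le> ennreal ((2 * t * 2 ^ ?N) powr r * S powr (r - 1)) * (\<Sum>j. ?v j * epow (W j x) r)" for x
  proof -
    have "?E x \<le> ennreal (2 * t * 2 ^ ?N) * (\<Sum>j. ennreal (1 / 2 ^ j) * W j x)"
      unfolding W_def using t by (intro mean_osc_le) auto
    also have "(\<Sum>j. ennreal (1 / 2 ^ j) * W j x) = (\<Sum>j. (ennreal (2 powr (- (real j * (1 - a)))) * W j x) * ennreal (2 powr (- (real j * a))))"
    proof (intro suminf_cong)
      fix j
      have "1 / 2 ^ j = 2 powr (- (real j * (1 - a))) * 2 powr (- (real j * a))"
        by (simp add: powr_add[symmetric] powr_realpow[symmetric] powr_minus_divide[symmetric] algebra_simps)
      then show "ennreal (1 / 2 ^ j) * W j x = (ennreal (2 powr (- (real j * (1 - a)))) * W j x) * ennreal (2 powr (- (real j * a)))"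
        by (simp add: ennreal_mult mult_ac)
    qed
    finally have "epow (?E x) r \<le> epow (ennreal (2 * t * 2 ^ ?N) * (\<Sum>j. (ennreal (2 powr (- (real j * (1 - a)))) * W j x) * ennreal (2 powr (- (real j * a))))) r"
      using r by (intro epow_mono) auto
    also have "\<dots> = ennreal ((2 * t * 2 ^ ?N) powr r) * epow (\<Sum>j. (ennreal (2 powr (- (real j * (1 - a)))) * W j x) * ennreal (2 powr (- (real j * a)))) r"
      using r t by (subst epow_mult) (auto simp: epow_ennreal)
    also have "\<dots> \<le> ennreal ((2 * t * 2 ^ ?N) powr r) *
       ((\<Sum>j. epow (ennreal (2 powr (- (real j * (1 - a)))) * W j x) r * ennreal (2 powr (- (real j * a)))) * epow (\<Sum>j. ennreal (2 powr (- (real j * a)))) (r - 1))"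
      by (intro mult_left_mono epow_suminf_weighted r) auto
    also have "\<dots> \<le> ennreal ((2 * t * 2 ^ ?N) powr r) * ((\<Sum>j. ?v j * epow (W j x) r) * ennreal (S powr (r - 1)))"
    proof (rule mult_left_mono, rule mult_mono, rule suminf_le)
      show "epow (\<Sum>j. ennreal (2 powr (- (real j * a)))) (r - 1) \<le> ennreal (S powr (r - 1))"
        unfolding sumw using S1 by (simp add: epow_ennreal)
    next
      fix j
      have "epow (ennreal (2 powr (- (real j * (1 - a)))) * W j x) r = ?v j * epow (W j x) r"
        using r by (simp add: epow_mult epow_ennreal powr_powr mult_ac)
      moreover have "ennreal (2 powr (- (real j * a))) \<le> 1"
      proof -
        have "2 powr (- (real j * a)) \<le> 2 powr 0" using a by (intro powr_mono) auto
        then show ?thesis by simp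
      qed
      ultimately show "epow (ennreal (2 powr (- (real j * (1 - a)))) * W j x) r * ennreal (2 powr (- (real j * a))) \<le> ?v j * epow (W j x) r"
        using mult_left_mono[of "ennreal (2 powr (- (real j * a)))" 1 "?v j * epow (W j x) r"] by simp
    qed auto
    also have "\<dots> = ennreal ((2 * t * 2 ^ ?N) powr r * S powr (r - 1)) * (\<Sum>j. ?v j * epow (W j x) r)"
      by (simp only: ennreal_mult powr_ge_zero mult_ac)
    finally show ?thesis .
  qed
  define I where "I = (\<Sum>j. ?v j * (\<integral>\<^sup>+x. epow (W j x) r \<partial>lborel))"
  have int: "(\<integral>\<^sup>+x. epow (?E x) r \<partial>lborel) \<le> ennreal ((2 * t * 2 ^ ?N) powr r * S powr (r - 1)) * I"
  proof -
    have "(\<integral>\<^sup>+x. epow (?E x) r \<partial>lborel) \<le> (\<integral>\<^sup>+x. ennreal ((2 * t * 2 ^ ?N) powr r * S powr (r - 1)) * (\<Sum>j. ?v j * epow (W j x) r) \<partial>lborel)"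
      by (intro nn_integral_mono pt)
    also have "\<dots> = ennreal ((2 * t * 2 ^ ?N) powr r * S powr (r - 1)) * (\<integral>\<^sup>+x. (\<Sum>j. ?v j * epow (W j x) r) \<partial>lborel)"
      by (rule nn_integral_cmult) measurable
    also have "(\<integral>\<^sup>+x. (\<Sum>j. ?v j * epow (W j x) r) \<partial>lborel) = I"
      unfolding I_def by (subst nn_integral_suminf, measurable) (intro suminf_cong nn_integral_cmult, measurable)
    finally show ?thesis .
  qed
  have "osc r u t \<le> (\<integral>\<^sup>+h. (ennreal (2 * (2 * 2 ^ ?N) powr r) * (\<integral>\<^sup>+x. epow (?E x) r \<partial>lborel)) * indicator (ball (0::'a) t) h \<partial>lborel)"
    unfolding osc_def using r diff_pow_le_mean_osc
    by (intro nn_integral_mono) (auto simp: indicator_def)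
  also have "\<dots> = (ennreal (2 * (2 * 2 ^ ?N) powr r) * (\<integral>\<^sup>+x. epow (?E x) r \<partial>lborel)) * ennreal (t ^ ?N * ?om)"
    by (subst nn_integral_cmult_indicator) (auto simp: emeasure_lborel_ball_eq[OF t])
  also have "\<dots> \<le> (ennreal (2 * (2 * 2 ^ ?N) powr r) * (ennreal ((2 * t * 2 ^ ?N) powr r * S powr (r - 1)) * I)) * ennreal (t ^ ?N * ?om)"
    by (intro mult_left_mono mult_right_mono int) auto
  also have "\<dots> = ennreal (t ^ ?N * ?om * (2 * (2 * 2 ^ ?N) powr r * ((2 * t * 2 ^ ?N) powr r * S powr (r - 1)))) * I"
  proof -
    have nn: "0 \<le> t ^ ?N * ?om" "0 \<le> 2 * (2 * 2 ^ ?N) powr r" "0 \<le> (2 * t * 2 ^ ?N) powr r * S powr (r - 1)"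
      using t om by auto
    show ?thesis
      unfolding ennreal_mult[OF nn(1) mult_nonneg_nonneg[OF nn(2,3)]] ennreal_mult[OF nn(2,3)]
      by (simp only: mult_ac)
  qed
  also have "\<dots> \<le> ennreal (t ^ ?N * ?om * (8 * 4 ^ ?N * t * S) powr r) * I"
  proof (intro mult_right_mono ennreal_leI mult_left_mono)
    \<comment> \<open>All constants are pushed inside the \<open>r\<close>-th power, at the cost of
      \<open>2 \<le> 2 powr r\<close> and one more factor \<open>S\<close>. A later power
      \<open>n / r\<close> then leaves an n-th power free of \<open>r\<close>.\<close>
    have "2 * (2 * 2 ^ ?N) powr r * ((2 * t * 2 ^ ?N) powr r * S powr (r - 1))
       \<le> 2 powr r * (2 * 2 ^ ?N) powr r * ((2 * t * 2 ^ ?N) powr r * S powr r)"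
    proof (intro mult_mono)
      show "2 \<le> 2 powr r" using powr_mono[of 1 r 2] r by simp
      show "S powr (r - 1) \<le> S powr r" using S1 by (intro powr_mono) auto
    qed (use t in auto)
    also have "\<dots> = (2 * (2 * 2 ^ ?N) * (2 * t * 2 ^ ?N) * S) powr r"
      by (simp only: powr_mult mult_ac)
    also have "2 * (2 * 2 ^ ?N) * (2 * t * 2 ^ ?N) * S = 8 * 4 ^ ?N * t * S"
    proof -
      have "(4::real) ^ ?N = 2 ^ ?N * 2 ^ ?N" by (simp flip: power_mult_distrib)
      then show ?thesis by simp
    qed
    finally show "2 * (2 * 2 ^ ?N) powr r * ((2 * t * 2 ^ ?N) powr r * S powr (r - 1)) \<le> (8 * 4 ^ ?N * t * S) powr r" .
  qed (use t om in auto)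
  finally show ?thesis unfolding I_def W_def .
qed

end

subsection \<open>Smooth functions\<close>

lemma grad_eqI:
  fixes f :: "'a::euclidean_space \<Rightarrow> real"
  assumes "(f has_derivative (\<lambda>h. v \<bullet> h)) (at x)"
  shows "grad f x = v"
proof -
  have "(f has_derivative (\<lambda>h. grad f x \<bullet> h)) (at x)"
    unfolding grad_def using assms by (rule someI)
  from has_derivative_unique[OF this assms] have "grad f x \<bullet> h = v \<bullet> h" for h by metis
  then show ?thesis by (metis euclidean_eqI)
qed

lemma has_derivative_grad:
  fixes f :: "'a::euclidean_space \<Rightarrow> real"
  assumes "f differentiable (at x)"
  shows "(f has_derivative (\<lambda>h. grad f x \<bullet> h)) (at x)"
proof -
  obtain D where D: "(f has_derivative D) (at x)" using assms by (auto simp: differentiable_def)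
  then have lin: "linear D" by (rule has_derivative_linear)
  define v where "v = (\<Sum>i\<in>Basis. D i *\<^sub>R i)"
  have "D h = v \<bullet> h" for h
  proof -
    have "D h = D (\<Sum>i\<in>Basis. (h \<bullet> i) *\<^sub>R i)" by (simp add: euclidean_representation)
    also have "\<dots> = (\<Sum>i\<in>Basis. (h \<bullet> i) * D i)" using lin by (simp add: linear_sum linear_scale)
    also have "\<dots> = (\<Sum>i\<in>Basis. D i * (i \<bullet> h))" by (intro sum.cong) (auto simp: inner_commute)
    also have "\<dots> = v \<bullet> h" by (simp add: v_def inner_sum_left)
    finally show ?thesis .
  qed
  then have "D = (\<lambda>h. v \<bullet> h)" by (rule ext)
  with D have "(f has_derivative (\<lambda>h. v \<bullet> h)) (at x)" by simp
  with grad_eqI[OF this] show ?thesis by simp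
qed

lemma Ck_Suc_subset: "f \<in> Ck (Suc k) \<Longrightarrow> f \<in> Ck k"
proof (induction k arbitrary: f)
  case 0
  then show ?case by (auto intro!: continuous_at_imp_continuous_on differentiable_imp_continuous_within)
next
  case (Suc k)
  then show ?case using Ck.simps(2) by blast
qed

lemma grad_add:
  fixes f g :: "'a::euclidean_space \<Rightarrow> real"
  assumes "f differentiable (at x)" "g differentiable (at x)"
  shows "grad (\<lambda>x. f x + g x) x = grad f x + grad g x"
  by (rule grad_eqI) (use has_derivative_add[OF has_derivative_grad[OF assms(1)] has_derivative_grad[OF assms(2)]] in \<open>simp add: inner_add_left\<close>)

lemma grad_mult:
  fixes f g :: "'a::euclidean_space \<Rightarrow> real"
  assumes "f differentiable (at x)" "g differentiable (at x)"
  shows "grad (\<lambda>x. f x * g x) x = f x *\<^sub>R grad g x + g x *\<^sub>R grad f x"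
  by (rule grad_eqI) (use has_derivative_mult[OF has_derivative_grad[OF assms(1)] has_derivative_grad[OF assms(2)]] in \<open>simp add: inner_add_left mult_ac\<close>)

lemma Ck_add: "f \<in> Ck k \<Longrightarrow> g \<in> Ck k \<Longrightarrow> (\<lambda>x. f x + g x) \<in> Ck k"
proof (induction k arbitrary: f g)
  case 0
  then show ?case by (auto intro: continuous_on_add)
next
  case (Suc k)
  then have d: "f differentiable (at x)" "g differentiable (at x)" for x by auto
  show ?case using Suc by (auto simp: grad_add[OF d] inner_add_left intro!: differentiable_add)
qed

lemma Ck_const: "(\<lambda>x. c) \<in> Ck k"
proof (induction k arbitrary: c)
  case (Suc k)
  have "grad (\<lambda>x::'a. c) x = 0" for x by (rule grad_eqI) simp
  with Suc show ?case by simp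
qed simp

lemma Ck_mult: "f \<in> Ck k \<Longrightarrow> g \<in> Ck k \<Longrightarrow> (\<lambda>x. f x * g x) \<in> Ck k"
proof (induction k arbitrary: f g)
  case 0
  then show ?case by (auto intro: continuous_on_mult)
next
  case (Suc k)
  then have d: "f differentiable (at x)" "g differentiable (at x)" for x by auto
  have "f \<in> Ck k" "g \<in> Ck k" using Suc.prems by (auto intro: Ck_Suc_subset)
  then have "(\<lambda>x. f x * (grad g x \<bullet> i) + g x * (grad f x \<bullet> i)) \<in> Ck k" if "i \<in> Basis" for i
    using Suc that by (intro Ck_add Suc.IH) auto
  then show ?case using d by (auto simp: grad_mult[OF d] inner_add_left intro!: differentiable_mult)
qed

lemma Ck_prod: "finite I \<Longrightarrow> (\<And>i. i \<in> I \<Longrightarrow> f i \<in> Ck k) \<Longrightarrow> (\<lambda>x. \<Prod>i\<in>I. f i x) \<in> Ck k"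
  by (induction I rule: finite_induct) (auto intro: Ck_const Ck_mult)

text \<open>Derivatives of \<open>exp (- 1 / x)\<close> stay in this family, which makes the smoothness of \<open>bump\<close> an induction.\<close>

definition flat :: "real poly \<Rightarrow> real \<Rightarrow> real" where
  "flat p x = (if x \<le> 0 then 0 else poly p (1 / x) * exp (- (1 / x)))"

lemma flat_tendsto_0: "((\<lambda>x. flat p x) \<longlongrightarrow> 0) (at_right 0)"
proof -
  have "((\<lambda>y. poly p y * exp (- y)) \<longlongrightarrow> 0) at_top"
  proof -
    have "((\<lambda>y. \<Sum>i\<le>degree p. coeff p i * (y ^ i / exp y)) \<longlongrightarrow> (\<Sum>i\<le>degree p. coeff p i * 0)) at_top"
      by (intro tendsto_intros tendsto_power_div_exp_0)
    then show ?thesis by (simp add: poly_altdef sum_divide_distrib exp_minus divide_inverse[symmetric])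
  qed
  then have "((\<lambda>x. poly p (inverse x) * exp (- inverse x)) \<longlongrightarrow> 0) (at_right 0)"
    by (rule filterlim_compose[OF _ filterlim_inverse_at_top_right])
  moreover have "\<forall>\<^sub>F x in at_right 0. flat p x = poly p (inverse x) * exp (- inverse x)"
    by (intro eventually_at_right_less[THEN eventually_mono]) (auto simp: flat_def inverse_eq_divide)
  ultimately show ?thesis by (simp add: filterlim_cong)
qed

text \<open>With \<open>X = 1 / x\<close> the derivative of \<open>p(X) exp (- X)\<close> is
  \<open>X^2 (p - p')(X) exp (- X)\<close>. At 0 from the right the difference quotient is
  \<open>flat (pCons 0 p)\<close>, since dividing by h multiplies the polynomial by
  \<open>X\<close>; it tends to 0.\<close>

lemma flat_has_derivative:
  "(flat p has_real_derivative flat ([:0, 0, 1:] * (p - pderiv p)) x) (at x)"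
proof -
  consider "x < 0" | "x = 0" | "x > 0" by linarith
  then show ?thesis
  proof cases
    case 1
    have "((\<lambda>x. 0) has_real_derivative 0) (at x)" by simp
    then have "(flat p has_real_derivative 0) (at x)"
      by (rule has_field_derivative_transform_within_open[where S = "{..<0}"]) (use 1 in \<open>auto simp: flat_def\<close>)
    then show ?thesis using 1 by (simp add: flat_def)
  next
    case 3
    have "((\<lambda>x. poly p (1 / x) * exp (- (1 / x))) has_real_derivative
        (poly (pderiv p) (1 / x) * (- 1 / x\<^sup>2)) * exp (- (1 / x)) + exp (- (1 / x)) * (1 / x\<^sup>2) * poly p (1 / x)) (at x)"
      using 3 by (auto intro!: derivative_eq_intros poly_DERIV[THEN DERIV_chain2] simp: power2_eq_square)
    then have "(flat p has_real_derivative
        (poly (pderiv p) (1 / x) * (- 1 / x\<^sup>2)) * exp (- (1 / x)) + exp (- (1 / x)) * (1 / x\<^sup>2) * poly p (1 / x)) (at x)"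
      by (rule has_field_derivative_transform_within_open[where S = "{0<..}"]) (use 3 in \<open>auto simp: flat_def\<close>)
    moreover have "(poly (pderiv p) (1 / x) * (- 1 / x\<^sup>2)) * exp (- (1 / x)) + exp (- (1 / x)) * (1 / x\<^sup>2) * poly p (1 / x)
       = flat ([:0, 0, 1:] * (p - pderiv p)) x"
      using 3 by (simp add: flat_def power2_eq_square field_simps)
    ultimately show ?thesis by simp
  next
    case 2
    have "((\<lambda>h. (flat p (0 + h) - flat p 0) / h) \<longlongrightarrow> 0) (at 0)"
    proof (rule filterlim_split_at)
      have "\<forall>\<^sub>F h in at_left 0. (flat p (0 + h) - flat p 0) / h = 0"
        by (intro eventually_at_leftI[of "-1"]) (auto simp: flat_def)
      then show "((\<lambda>h. (flat p (0 + h) - flat p 0) / h) \<longlongrightarrow> 0) (at_left 0)" by (simp add: tendsto_eventually)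
      have "\<forall>\<^sub>F h in at_right 0. (flat p (0 + h) - flat p 0) / h = flat (pCons 0 p) h"
        by (intro eventually_at_right_less[THEN eventually_mono]) (auto simp: flat_def)
      then show "((\<lambda>h. (flat p (0 + h) - flat p 0) / h) \<longlongrightarrow> 0) (at_right 0)"
        using flat_tendsto_0[of "pCons 0 p"] by (simp cong: filterlim_cong)
    qed
    then show ?thesis using 2 by (simp add: DERIV_def flat_def)
  qed
qed

lemma flat_Ck:
  fixes v :: "'a::euclidean_space"
  shows "(\<lambda>x. flat p (v \<bullet> x + d)) \<in> Ck k"
proof (induction k arbitrary: p)
  case 0
  have "continuous_on UNIV (flat p)"
    by (intro continuous_at_imp_continuous_on ballI DERIV_isCont[OF flat_has_derivative])
  then have "continuous_on UNIV (\<lambda>x. flat p (v \<bullet> x + d))"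
    by (rule continuous_on_compose2) (auto intro!: continuous_intros)
  then show ?case by simp
next
  case (Suc k)
  let ?q = "[:0, 0, 1:] * (p - pderiv p)"
  have der: "((\<lambda>x. flat p (v \<bullet> x + d)) has_derivative (\<lambda>h. (flat ?q (v \<bullet> x + d) *\<^sub>R v) \<bullet> h)) (at x)" for x
  proof -
    have "((\<lambda>x. v \<bullet> x + d) has_derivative (\<lambda>h. v \<bullet> h)) (at x)" by (auto intro!: derivative_eq_intros)
    moreover have "(flat p has_derivative (\<lambda>h. h * flat ?q (v \<bullet> x + d))) (at (v \<bullet> x + d))"
      using flat_has_derivative[of p "v \<bullet> x + d"] by (simp add: has_field_derivative_def mult.commute[of _ "flat _ _"] fun_eq_iff)
    ultimately have "((\<lambda>x. flat p (v \<bullet> x + d)) has_derivative (\<lambda>h. (v \<bullet> h) * flat ?q (v \<bullet> x + d))) (at x)"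
      by (rule has_derivative_compose)
    then show ?thesis by (simp add: mult.commute)
  qed
  have "grad (\<lambda>x. flat p (v \<bullet> x + d)) x = flat ?q (v \<bullet> x + d) *\<^sub>R v" for x by (rule grad_eqI[OF der])
  then show ?case using Suc[of ?q] der by (auto simp: differentiable_def intro!: Ck_mult Ck_const)
qed

text \<open>For c > 0 the value \<open>flat 1 (m * c)\<close> tends to 1 as m grows, so
  \<open>m\<close> controls how closely the bump approximates the indicator of the open box from
  below.\<close>

definition bump :: "'a::euclidean_space \<Rightarrow> 'a \<Rightarrow> real \<Rightarrow> 'a \<Rightarrow> real" where
  "bump a b m x = (\<Prod>i\<in>Basis. flat 1 (m * (x \<bullet> i - a \<bullet> i)) * flat 1 (m * (b \<bullet> i - x \<bullet> i)))"

lemma smooth_bump: "smooth (bump a b m)"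
  unfolding smooth_def
proof
  fix k
  have 1: "flat 1 (m * (x \<bullet> i - a \<bullet> i)) = flat 1 ((m *\<^sub>R i) \<bullet> x + (- m * (a \<bullet> i)))"
    "flat 1 (m * (b \<bullet> i - x \<bullet> i)) = flat 1 ((- m *\<^sub>R i) \<bullet> x + m * (b \<bullet> i))" for x i
    by (simp_all add: inner_commute algebra_simps)
  show "bump a b m \<in> Ck k"
    unfolding bump_def 1 by (intro Ck_prod Ck_mult flat_Ck) auto
qed

lemma flat_1_bounds: "0 \<le> flat 1 x" "flat 1 x \<le> 1"
  by (auto simp: flat_def)

lemma bump_nonneg: "0 \<le> bump a b m x"
  unfolding bump_def by (intro prod_nonneg) (auto simp: flat_1_bounds)

lemma bump_le_1: "bump a b m x \<le> 1"
  unfolding bump_def by (intro prod_le_1) (auto simp: flat_1_bounds mult_le_one)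

lemma bump_eq_0:
  assumes "m > 0" "x \<notin> box a b"
  shows "bump a b m x = 0"
proof -
  obtain i where i: "i \<in> Basis" "\<not> (a \<bullet> i < x \<bullet> i \<and> x \<bullet> i < b \<bullet> i)" using assms(2) by (auto simp: mem_box)
  then have "flat 1 (m * (x \<bullet> i - a \<bullet> i)) * flat 1 (m * (b \<bullet> i - x \<bullet> i)) = 0"
    using assms(1) by (auto simp: flat_def mult_le_0_iff)
  then show ?thesis unfolding bump_def using i(1) by (intro prod_zero) auto
qed

lemma bump_pos:
  assumes "m > 0" "x \<in> box a b"
  shows "bump a b m x > 0"
  unfolding bump_def using assms by (intro prod_pos) (auto simp: flat_def mem_box not_le)

lemma compact_supp_bump:
  assumes "m > 0" shows "compact_supp (bump a b m)"
proof -
  have "{x. bump a b m x \<noteq> 0} \<subseteq> cbox a b"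
    using bump_eq_0[OF assms] box_subset_cbox by blast
  then have "closure {x. bump a b m x \<noteq> 0} \<subseteq> cbox a b" by (intro closure_minimal) auto
  then show ?thesis unfolding compact_supp_def
    using compact_Int_closed[OF compact_cbox closed_closure] by (metis inf.absorb_iff2)
qed

lemma Ck_1_continuous_grad:
  fixes f :: "'a::euclidean_space \<Rightarrow> real"
  assumes "f \<in> Ck (Suc 0)"
  shows "continuous_on UNIV (grad f)"
proof -
  have "continuous_on UNIV (\<lambda>x. \<Sum>i\<in>Basis. (grad f x \<bullet> i) *\<^sub>R i)"
    using assms by (intro continuous_on_sum continuous_on_scaleR continuous_on_const) auto
  then show ?thesis by (simp add: euclidean_representation)
qed

lemma bump_tendsto:
  "(\<lambda>k. bump a b (real (Suc k)) x) \<longlonglongrightarrow> indicator (box a b) x"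
proof (cases "x \<in> box a b")
  case True
  have lim: "(\<lambda>k. flat 1 (real (Suc k) * c)) \<longlonglongrightarrow> 1" if "c > 0" for c
  proof -
    have "(\<lambda>k. exp (- (1 / real (Suc k) * (1 / c)))) \<longlonglongrightarrow> exp (- (0 * (1 / c)))"
      by (intro tendsto_intros LIMSEQ_Suc[OF lim_1_over_n])
    then show ?thesis using that by (simp add: flat_def mult_le_0_iff)
  qed
  have "(\<lambda>k. bump a b (real (Suc k)) x) \<longlonglongrightarrow> (\<Prod>i\<in>(Basis::'a set). 1 * 1)"
    unfolding bump_def using True by (intro tendsto_prod tendsto_mult lim) (auto simp: mem_box)
  then show ?thesis using True by simp
next
  case False
  then show ?thesis by (simp add: bump_eq_0)
qed

subsection \<open>Mollification\<close>

text \<open>Fatou's lemma twice, in \<open>x\<close> and in \<open>h\<close>. Bounds proved for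
  mollified functions pass in this way to the function itself.\<close>

lemma osc_le_of_AE_tendsto:
  fixes f :: "'a::euclidean_space \<Rightarrow> real"
  assumes [measurable]: "\<And>k. u k \<in> borel_measurable borel" "f \<in> borel_measurable borel"
    and lim: "AE x in lborel. (\<lambda>k. u k x) \<longlonglongrightarrow> f x" and r: "r > 0"
    and B: "\<And>k. osc r (u k) t \<le> B"
  shows "osc r f t \<le> B"
proof -
  have [measurable]: "diff_pow r (u k) \<in> borel_measurable borel" for k
    by (rule borel_measurable_diff_pow) measurable
  have 1: "diff_pow r f h \<le> liminf (\<lambda>k. diff_pow r (u k) h)" for h
  proof -
    have "diff_pow r f h \<le> (\<integral>\<^sup>+x. liminf (\<lambda>k. ennreal (\<bar>u k (x + h) - u k x\<bar> powr r)) \<partial>lborel)"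
      unfolding diff_pow_def
    proof (intro nn_integral_mono_AE, use lim AE_lborel_translate[OF lim, of h] in eventually_elim)
      fix x assume "(\<lambda>k. u k x) \<longlonglongrightarrow> f x" "(\<lambda>k. u k (x + h)) \<longlonglongrightarrow> f (x + h)"
      then have "(\<lambda>k. ennreal (\<bar>u k (x + h) - u k x\<bar> powr r)) \<longlonglongrightarrow> ennreal (\<bar>f (x + h) - f x\<bar> powr r)"
        using r by (intro tendsto_ennrealI tendsto_powr' tendsto_rabs tendsto_diff tendsto_const) auto
      then show "ennreal (\<bar>f (x + h) - f x\<bar> powr r) \<le> liminf (\<lambda>k. ennreal (\<bar>u k (x + h) - u k x\<bar> powr r))"
        using lim_imp_Liminf[OF trivial_limit_sequentially] by (metis order_refl)
    qed
    also have "\<dots> \<le> liminf (\<lambda>k. diff_pow r (u k) h)"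
      unfolding diff_pow_def by (rule nn_integral_liminf) measurable
    finally show ?thesis .
  qed
  have "osc r f t \<le> (\<integral>\<^sup>+h. liminf (\<lambda>k. diff_pow r (u k) h * indicator (ball 0 t) h) \<partial>lborel)"
    unfolding osc_def
  proof (intro nn_integral_mono)
    fix h :: 'a
    show "diff_pow r f h * indicator (ball 0 t) h \<le> liminf (\<lambda>k. diff_pow r (u k) h * indicator (ball 0 t) h)"
      using 1[of h] by (cases "h \<in> ball 0 t") (simp_all add: indicator_def)
  qed
  also have "\<dots> \<le> liminf (\<lambda>k. osc r (u k) t)"
    unfolding osc_def by (rule nn_integral_liminf) measurable
  also have "\<dots> \<le> limsup (\<lambda>k. osc r (u k) t)" by (rule Liminf_le_Limsup) simp
  also have "\<dots> \<le> B" by (intro Limsup_bounded always_eventually allI B)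
  finally show ?thesis .
qed

section \<open>Continuity of translations in L1\<close>

lemma diff_pow_1_add_le:
  fixes f g :: "'a::euclidean_space \<Rightarrow> real"
  assumes [measurable]: "f \<in> borel_measurable borel" "g \<in> borel_measurable borel"
  shows "diff_pow 1 (\<lambda>x. f x + g x) h \<le> diff_pow 1 f h + diff_pow 1 g h"
proof -
  have "diff_pow 1 (\<lambda>x. f x + g x) h \<le> (\<integral>\<^sup>+x. ennreal (\<bar>f (x + h) - f x\<bar> powr 1) + ennreal (\<bar>g (x + h) - g x\<bar> powr 1) \<partial>lborel)"
    unfolding diff_pow_def by (intro nn_integral_mono) (auto simp: ennreal_plus[symmetric] simp del: ennreal_plus intro!: ennreal_leI)
  also have "\<dots> = diff_pow 1 f h + diff_pow 1 g h"
    unfolding diff_pow_def by (rule nn_integral_add) measurable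
  finally show ?thesis .
qed

lemma diff_pow_1_le_L1:
  fixes f :: "'a::euclidean_space \<Rightarrow> real"
  assumes "f \<in> borel_measurable borel"
  shows "diff_pow 1 f h \<le> 2 * (\<integral>\<^sup>+x. ennreal \<bar>f x\<bar> \<partial>lborel)"
  using diff_pow_le[OF assms, of 1 h] by (simp add: Lp_pow_lborel)

text \<open>Outer regularity is applied to \<open>A\<close> and to its complement; the closed set
  obtained from the complement becomes compact by intersecting it with a large ball.\<close>

lemma compact_open_approx:
  fixes A :: "'a::euclidean_space set"
  assumes A [measurable]: "A \<in> sets borel" and fin: "emeasure lborel A < \<infinity>" and e: "e > 0"
  obtains K U where "compact K" "open U" "K \<subseteq> A" "A \<subseteq> U" "emeasure lborel (A - K) \<le> ennreal e" "emeasure lborel (U - A) \<le> ennreal e"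
proof -
  obtain U where U: "open U" "A \<subseteq> U" "emeasure lborel (U - A) < ennreal e"
    using outer_regular_lborel[OF A e] .
  have "- A \<in> sets borel" by measurable
  then obtain W where W: "open W" "- A \<subseteq> W" "emeasure lborel (W - - A) < ennreal (e / 2)"
    using outer_regular_lborel[of "- A" "e / 2"] e by (metis half_gt_zero)
  have "(INF k::nat. emeasure lborel (A - cball 0 (real k))) = emeasure lborel (\<Inter>k::nat. A - cball 0 (real k))"
  proof (rule INF_emeasure_decseq)
    show "decseq (\<lambda>k. A - cball 0 (real k))" unfolding decseq_def by auto
    show "emeasure lborel (A - cball 0 (real i)) \<noteq> \<infinity>" for i
      using fin emeasure_mono[of "A - cball 0 (real i)" A lborel] by (auto simp: top_unique)
  qed (auto simp: A)
  also have "(\<Inter>k::nat. A - cball 0 (real k)) = {}"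
  proof -
    have "\<exists>k::nat. norm x \<le> real k" for x :: 'a by (rule real_arch_simple)
    then show ?thesis by auto
  qed
  finally have "(INF k::nat. emeasure lborel (A - cball 0 (real k))) < ennreal (e / 2)" using e by simp
  then obtain k :: nat where k: "emeasure lborel (A - cball 0 (real k)) < ennreal (e / 2)"
    unfolding INF_less_iff by blast
  define K where "K = - W \<inter> cball 0 (real k)"
  have "closed (- W)" using W(1) by (rule closed_Compl)
  then have cK: "compact K" unfolding K_def by (intro closed_Int_compact) auto
  have [measurable]: "W \<in> sets borel" "cball (0::'a) (real k) \<in> sets borel" using W by auto
  have "emeasure lborel (A - K) \<le> emeasure lborel ((W - - A) \<union> (A - cball 0 (real k)))"
    by (intro emeasure_mono) (auto simp: K_def)
  also have "\<dots> \<le> emeasure lborel (W - - A) + emeasure lborel (A - cball 0 (real k))"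
    by (intro emeasure_subadditive) auto
  also have "\<dots> \<le> ennreal (e / 2) + ennreal (e / 2)" using W k by (intro add_mono) auto
  also have "\<dots> = ennreal e" using e by (simp add: ennreal_plus[symmetric] del: ennreal_plus)
  finally have "emeasure lborel (A - K) \<le> ennreal e" .
  moreover have "K \<subseteq> A" using W by (auto simp: K_def)
  ultimately show ?thesis using that[OF cK U(1) _ U(2)] U(3) by auto
qed

text \<open>The property holds for indicators of sets of finite measure and is preserved by sums and
  by L1 limits; the limit step uses that an increment costs at most twice the L1 norm.\<close>

lemma translation_continuous_L1:
  fixes f :: "'a::euclidean_space \<Rightarrow> real"
  assumes "integrable lborel f"
  shows "\<forall>e>0. \<exists>d>0. \<forall>h. norm h < d \<longrightarrow> diff_pow 1 f h \<le> ennreal e"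
  using assms
proof (induction f rule: integrable_induct)
  case (base A c)
  show ?case
  proof (intro allI impI)
    fix e :: real assume e: "e > 0"
    have A [measurable]: "A \<in> sets borel" using base by simp
    define e' where "e' = e / (4 * (\<bar>c\<bar> + 1))"
    have e': "e' > 0" using e by (simp add: e'_def)
    obtain K U where KU: "compact K" "open U" "K \<subseteq> A" "A \<subseteq> U"
      "emeasure lborel (A - K) \<le> ennreal e'" "emeasure lborel (U - A) \<le> ennreal e'"
      using compact_open_approx[OF A base(2) e'] .
    have [measurable]: "K \<in> sets borel" "U \<in> sets borel" using KU by (auto intro: borel_compact borel_open)
    have "K \<subseteq> U" using KU by auto
    then obtain d where d: "d > 0" "(\<Union>x\<in>K. ball x d) \<subseteq> U"
      using compact_subset_open_imp_ball_epsilon_subset[OF KU(1,2)] by blast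
    have nb: "x + h \<in> U" if "x \<in> K" "norm h < d" for x h
    proof -
      have "x + h \<in> ball x d" using that by (simp add: dist_norm)
      then show ?thesis using d(2) that by blast
    qed
    show "\<exists>d>0. \<forall>h. norm h < d \<longrightarrow> diff_pow 1 (\<lambda>x. indicator A x *\<^sub>R c) h \<le> ennreal e"
    proof (intro exI[of _ d] conjI d(1) allI impI)
      fix h :: 'a assume h: "norm h < d"
      let ?F = "\<lambda>x. indicator (A - K) x + indicator (U - A) x :: ennreal"
      \<comment> \<open>If a step shorter than \<open>d\<close> crosses the boundary of
        \<open>A\<close>, its endpoint inside \<open>A\<close> is outside \<open>K\<close>, or its
        endpoint outside \<open>A\<close> is still in \<open>U\<close>, since \<open>K\<close> has
        distance at least \<open>d\<close> from the complement of \<open>U\<close>.\<close>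
      have pt: "ennreal (\<bar>indicator A (x + h) *\<^sub>R c - indicator A x *\<^sub>R c\<bar> powr 1) \<le> ennreal \<bar>c\<bar> * (?F (x + h) + ?F x)" for x
      proof (cases "x + h \<in> A \<longleftrightarrow> x \<in> A")
        case False
        have "1 \<le> ?F (x + h) + ?F x"
        proof (cases "x \<in> A")
          case True
          then have "x + h \<in> U \<or> x \<notin> K" using nb[OF _ h] by blast
          then show ?thesis using True False by (auto simp: indicator_def)
        next
          case xA: False
          then have "x \<in> U \<or> x + h \<notin> K" using nb[of "x + h" "- h"] h by auto
          then show ?thesis using False xA by (auto simp: indicator_def)
        qed
        then have "ennreal \<bar>c\<bar> * 1 \<le> ennreal \<bar>c\<bar> * (?F (x + h) + ?F x)" by (rule mult_left_mono) simp
        moreover have "\<bar>indicator A (x + h) *\<^sub>R c - indicator A x *\<^sub>R c\<bar> powr 1 = \<bar>c\<bar>"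
          using False by (auto simp: indicator_def)
        ultimately show ?thesis by simp
      qed (auto simp: indicator_def)
      have FF: "(\<integral>\<^sup>+x. ?F x \<partial>lborel) \<le> ennreal (2 * e')"
      proof -
        have "(\<integral>\<^sup>+x. ?F x \<partial>lborel) = emeasure lborel (A - K) + emeasure lborel (U - A)"
          by (subst nn_integral_add) auto
        also have "\<dots> \<le> ennreal e' + ennreal e'" by (intro add_mono KU)
        also have "\<dots> = ennreal (2 * e')" using e' by (simp add: ennreal_plus[symmetric] del: ennreal_plus)
        finally show ?thesis .
      qed
      have "diff_pow 1 (\<lambda>x. indicator A x *\<^sub>R c) h \<le> (\<integral>\<^sup>+x. ennreal \<bar>c\<bar> * (?F (x + h) + ?F x) \<partial>lborel)"
        unfolding diff_pow_def by (intro nn_integral_mono pt)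
      also have "\<dots> = ennreal \<bar>c\<bar> * ((\<integral>\<^sup>+x. ?F (x + h) \<partial>lborel) + (\<integral>\<^sup>+x. ?F x \<partial>lborel))"
        by (subst nn_integral_cmult, measurable) (subst nn_integral_add, measurable)
      also have "(\<integral>\<^sup>+x. ?F (x + h) \<partial>lborel) = (\<integral>\<^sup>+x. ?F x \<partial>lborel)"
        by (rule nn_integral_lborel_translate) measurable
      also have "ennreal \<bar>c\<bar> * ((\<integral>\<^sup>+x. ?F x \<partial>lborel) + (\<integral>\<^sup>+x. ?F x \<partial>lborel)) \<le> ennreal \<bar>c\<bar> * (ennreal (2 * e') + ennreal (2 * e'))"
        by (intro mult_left_mono add_mono FF) auto
      also have "\<dots> = ennreal (\<bar>c\<bar> * (4 * e'))"
        using e' by (simp add: ennreal_plus[symmetric] ennreal_mult[symmetric] del: ennreal_plus)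
      also have "\<dots> \<le> ennreal e"
        using e by (intro ennreal_leI) (simp add: e'_def field_simps)
      finally show "diff_pow 1 (\<lambda>x. indicator A x *\<^sub>R c) h \<le> ennreal e" .
    qed
  qed
next
  case (add f g)
  show ?case
  proof (intro allI impI)
    fix e :: real assume "e > 0"
    then have e2: "e / 2 > 0" by simp
    obtain d1 where d1: "d1 > 0" "\<And>h. norm h < d1 \<Longrightarrow> diff_pow 1 f h \<le> ennreal (e / 2)" using add.IH(1) e2 by blast
    obtain d2 where d2: "d2 > 0" "\<And>h. norm h < d2 \<Longrightarrow> diff_pow 1 g h \<le> ennreal (e / 2)" using add.IH(2) e2 by blast
    have m: "f \<in> borel_measurable borel" "g \<in> borel_measurable borel" using add.hyps by auto
    show "\<exists>d>0. \<forall>h. norm h < d \<longrightarrow> diff_pow 1 (\<lambda>x. f x + g x) h \<le> ennreal e"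
    proof (intro exI[of _ "min d1 d2"] conjI allI impI)
      fix h :: 'a assume "norm h < min d1 d2"
      then have "diff_pow 1 f h + diff_pow 1 g h \<le> ennreal (e / 2) + ennreal (e / 2)"
        using d1 d2 by (intro add_mono) auto
      also have "\<dots> = ennreal e" using e2 by (simp add: ennreal_plus[symmetric] del: ennreal_plus)
      finally show "diff_pow 1 (\<lambda>x. f x + g x) h \<le> ennreal e"
        using diff_pow_1_add_le[OF m, of h] by (rule order_trans[rotated])
    qed (use d1 d2 in auto)
  qed
next
  case (lim f s)
  show ?case
  proof (intro allI impI)
    fix e :: real assume e: "e > 0"
    have m [measurable]: "f \<in> borel_measurable borel" "\<And>i. s i \<in> borel_measurable borel" using lim.hyps by auto
    have "(\<lambda>i. \<integral>\<^sup>+x. ennreal (norm (f x - s i x)) \<partial>lborel) \<longlonglongrightarrow> 0"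
    proof (rule nn_integral_dominated_convergence_norm[where w = "\<lambda>x. 2 * norm (f x)"])
      show "(\<integral>\<^sup>+x. ennreal (2 * norm (f x)) \<partial>lborel) < \<infinity>"
        using lim.hyps(4) unfolding integrable_iff_bounded
        by (simp add: nn_integral_cmult ennreal_mult ennreal_mult_less_top)
    qed (use lim.hyps in auto)
    then have "\<forall>\<^sub>F i in sequentially. (\<integral>\<^sup>+x. ennreal (norm (f x - s i x)) \<partial>lborel) < ennreal (e / 4)"
      using e by (intro order_tendstoD) auto
    then obtain i where i: "(\<integral>\<^sup>+x. ennreal \<bar>f x - s i x\<bar> \<partial>lborel) < ennreal (e / 4)"
      by (auto simp: eventually_sequentially)
    have "e / 2 > 0" using e by simp
    then obtain d where d: "d > 0" "\<And>h. norm h < d \<Longrightarrow> diff_pow 1 (s i) h \<le> ennreal (e / 2)" using lim.IH by blast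
    show "\<exists>d>0. \<forall>h. norm h < d \<longrightarrow> diff_pow 1 f h \<le> ennreal e"
    proof (intro exI[of _ d] conjI d(1) allI impI)
      fix h :: 'a assume h: "norm h < d"
      have "diff_pow 1 f h = diff_pow 1 (\<lambda>x. s i x + (f x - s i x)) h" by simp
      also have "\<dots> \<le> diff_pow 1 (s i) h + diff_pow 1 (\<lambda>x. f x - s i x) h"
        by (rule diff_pow_1_add_le) measurable
      also have "\<dots> \<le> ennreal (e / 2) + 2 * ennreal (e / 4)"
      proof (rule add_mono[OF d(2)[OF h]])
        have "diff_pow 1 (\<lambda>x. f x - s i x) h \<le> 2 * (\<integral>\<^sup>+x. ennreal \<bar>f x - s i x\<bar> \<partial>lborel)"
          by (rule diff_pow_1_le_L1) measurable
        also have "\<dots> \<le> 2 * ennreal (e / 4)" using i by (intro mult_left_mono) auto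
        finally show "diff_pow 1 (\<lambda>x. f x - s i x) h \<le> 2 * ennreal (e / 4)" .
      qed
      also have "\<dots> = ennreal e"
      proof -
        have "2 * ennreal (e / 4) = ennreal (e / 2)"
          using e ennreal_mult[of 2 "e / 4"] by simp
        then show ?thesis using e by (simp add: ennreal_plus[symmetric] del: ennreal_plus)
      qed
      finally show "diff_pow 1 f h \<le> ennreal e" .
    qed
  qed
qed

section \<open>The mollifier and its action on a weakly differentiable function\<close>

text \<open>The sharpness \<open>1 / e\<close> makes the profile a fixed function of
  \<open>(y - x) / e\<close>.\<close>

definition bump_cube :: "real \<Rightarrow> 'a::euclidean_space \<Rightarrow> 'a \<Rightarrow> real" where
  "bump_cube e x = bump (x - e *\<^sub>R One) (x + e *\<^sub>R One) (1 / e)"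

definition mollifier :: "real \<Rightarrow> 'a::euclidean_space \<Rightarrow> real" where
  "mollifier e z = bump_cube e 0 z / integral\<^sup>L lborel (bump_cube e (0::'a))"

lemma bump_cube_translate: "bump_cube e x y = bump_cube e 0 (y - x)"
  unfolding bump_cube_def bump_def by (intro prod.cong) (auto simp: inner_diff_left inner_add_left algebra_simps)

lemma continuous_smooth: "smooth f \<Longrightarrow> continuous_on UNIV f"
  unfolding smooth_def by (metis Ck.simps(1) mem_Collect_eq)

context
  fixes e :: real
  assumes e: "e > 0"
begin

lemma bump_cube_measurable [measurable]: "bump_cube e (x::'a::euclidean_space) \<in> borel_measurable borel"
  unfolding bump_cube_def by (intro borel_measurable_continuous_onI continuous_smooth smooth_bump)

lemma bump_cube_integrable: "integrable lborel (bump_cube e (x::'a::euclidean_space))"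
proof (rule Bochner_Integration.integrable_bound[where f = "indicator (cbox (x - e *\<^sub>R One) (x + e *\<^sub>R One)) :: 'a \<Rightarrow> real"])
  show "AE y in lborel. norm (bump_cube e x y) \<le> norm (indicator (cbox (x - e *\<^sub>R One) (x + e *\<^sub>R One)) y :: real)"
  proof (rule AE_I2)
    fix y
    show "norm (bump_cube e x y) \<le> norm (indicator (cbox (x - e *\<^sub>R One) (x + e *\<^sub>R One)) y :: real)"
    proof (cases "y \<in> box (x - e *\<^sub>R One) (x + e *\<^sub>R One)")
      case True
      then have "y \<in> cbox (x - e *\<^sub>R One) (x + e *\<^sub>R One)" using box_subset_cbox by blast
      then show ?thesis unfolding bump_cube_def by (simp add: bump_nonneg bump_le_1)
    next
      case False
      then show ?thesis unfolding bump_cube_def using e by (simp add: bump_eq_0)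
    qed
  qed
qed (auto simp: bump_cube_measurable emeasure_lborel_cbox_finite[simplified])

lemma bump_cube_integral_pos: "integral\<^sup>L lborel (bump_cube e (0::'a::euclidean_space)) > 0"
proof -
  have nn: "0 \<le> bump_cube e (0::'a) y" for y unfolding bump_cube_def by (rule bump_nonneg)
  have "integral\<^sup>L lborel (bump_cube e (0::'a)) \<noteq> 0"
  proof
    assume "integral\<^sup>L lborel (bump_cube e (0::'a)) = 0"
    then have ae: "AE y in lborel. bump_cube e (0::'a) y = 0"
      using integral_nonneg_eq_0_iff_AE[OF bump_cube_integrable[of 0]] nn by auto
    let ?B = "box (0 - e *\<^sub>R One) (0 + e *\<^sub>R One) :: 'a set"
    have "bump_cube e 0 y \<noteq> 0" if "y \<in> ?B" for y
      using bump_pos[of "1 / e" y] that e unfolding bump_cube_def by (metis less_numeral_extra(3) zero_less_divide_1_iff)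
    with ae have "AE y in lborel. y \<notin> ?B" by (auto elim: eventually_mono)
    then have "emeasure lborel ?B = 0" by (subst (asm) AE_iff_measurable[OF _ refl]) auto
    moreover have "emeasure lborel ?B \<noteq> 0"
      using e by (subst emeasure_lborel_box) (auto simp: prod_constant inner_simps)
    ultimately show False by simp
  qed
  moreover have "integral\<^sup>L lborel (bump_cube e (0::'a)) \<ge> 0" by (intro integral_nonneg_AE) (auto simp: nn)
  ultimately show ?thesis by linarith
qed

lemma mollifier_measurable [measurable]: "mollifier e \<in> borel_measurable (borel :: 'a::euclidean_space measure)"
  unfolding mollifier_def by measurable

lemma mollifier_nonneg: "mollifier e (z::'a::euclidean_space) \<ge> 0"
  unfolding mollifier_def bump_cube_def using bump_nonneg bump_cube_integral_pos[where 'a='a]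
  by (intro divide_nonneg_nonneg) (auto simp: bump_cube_def less_imp_le)

lemma mollifier_le: "mollifier e (z::'a::euclidean_space) \<le> 1 / integral\<^sup>L lborel (bump_cube e (0::'a))"
  unfolding mollifier_def using bump_le_1 bump_cube_integral_pos[where 'a='a]
  by (intro divide_right_mono) (auto simp: bump_cube_def less_imp_le)

lemma nn_integral_mollifier: "(\<integral>\<^sup>+z. ennreal (mollifier e (z::'a::euclidean_space)) \<partial>lborel) = 1"
proof -
  have "(\<integral>\<^sup>+z. ennreal (mollifier e (z::'a)) \<partial>lborel) = ennreal (integral\<^sup>L lborel (mollifier e :: 'a \<Rightarrow> real))"
  proof (rule nn_integral_eq_integral)
    have "integrable lborel (\<lambda>z::'a. bump_cube e 0 z / integral\<^sup>L lborel (bump_cube e (0::'a)))"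
      by (intro Bochner_Integration.integrable_divide bump_cube_integrable)
    then show "integrable lborel (mollifier e :: 'a \<Rightarrow> real)"
      by (simp add: mollifier_def[abs_def])
  qed (simp add: mollifier_nonneg)
  also have "integral\<^sup>L lborel (mollifier e :: 'a \<Rightarrow> real) = 1"
    unfolding mollifier_def using bump_cube_integral_pos[where 'a='a] by simp
  finally show ?thesis by simp
qed

lemma mollifier_eq_0:
  fixes z :: "'a::euclidean_space"
  assumes "e * real DIM('a) < norm z"
  shows "mollifier e z = 0"
proof -
  have "z \<notin> box (0 - e *\<^sub>R One) (0 + e *\<^sub>R One)"
  proof
    assume "z \<in> box (0 - e *\<^sub>R One) (0 + e *\<^sub>R One)"
    then have "\<bar>z \<bullet> i\<bar> \<le> e" if "i \<in> Basis" for i using that by (auto simp: mem_box inner_simps abs_le_iff dest!: bspec[of _ _ i])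
    then have "(\<Sum>i\<in>Basis. \<bar>z \<bullet> i\<bar>) \<le> (\<Sum>i\<in>(Basis::'a set). e)" by (intro sum_mono)
    then have "norm z \<le> e * real DIM('a)" using norm_le_l1[of z] by (simp add: mult.commute)
    with assms show False by simp
  qed
  then show ?thesis unfolding mollifier_def bump_cube_def using e by (simp add: bump_eq_0)
qed

lemma mollifier_translate:
  fixes p y :: "'a::euclidean_space"
  shows "mollifier e (y - p) = 1 / integral\<^sup>L lborel (bump_cube e (0::'a)) * bump_cube e p y"
  unfolding mollifier_def bump_cube_translate[of e p y] by simp

lemma smooth_mollifier: "smooth (\<lambda>y. mollifier e (y - p :: 'a::euclidean_space))"
  unfolding mollifier_translate smooth_def bump_cube_def
  using smooth_bump unfolding smooth_def by (intro allI Ck_mult Ck_const) auto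

lemma compact_supp_mollifier: "compact_supp (\<lambda>y. mollifier e (y - p :: 'a::euclidean_space))"
proof -
  have "{y. mollifier e (y - p) \<noteq> 0} = {y. bump (p - e *\<^sub>R One) (p + e *\<^sub>R One) (1 / e) y \<noteq> 0}"
    unfolding mollifier_translate bump_cube_def using bump_cube_integral_pos[where 'a='a] by (auto simp: bump_cube_def)
  then show ?thesis
    using compact_supp_bump[of "1 / e" "p - e *\<^sub>R One" "p + e *\<^sub>R One"] e unfolding compact_supp_def by simp
qed

end

lemma grad_eq_0_outside_support:
  fixes f :: "'a::euclidean_space \<Rightarrow> real"
  assumes "x \<notin> closure {x. f x \<noteq> 0}"
  shows "grad f x = 0"
proof (rule grad_eqI)
  have "((\<lambda>x. 0) has_derivative (\<lambda>h. 0)) (at x)" by simp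
  then have "(f has_derivative (\<lambda>h. 0)) (at x)"
  proof (rule has_derivative_transform_within_open)
    show "open (- closure {x. f x \<noteq> 0})" by (simp add: open_Compl)
    show "0 = f y" if "y \<in> - closure {x. f x \<noteq> 0}" for y
      using that closure_subset[of "{x. f x \<noteq> 0}"] by auto
  qed (use assms in auto)
  then show "(f has_derivative (\<lambda>h. 0 \<bullet> h)) (at x)" by simp
qed

lemma grad_bounded:
  fixes f :: "'a::euclidean_space \<Rightarrow> real"
  assumes "f \<in> Ck (Suc 0)" "compact_supp f"
  obtains C where "C \<ge> 0" "\<And>x. norm (grad f x) \<le> C"
proof -
  have "compact (grad f ` closure {x. f x \<noteq> 0})"
    using assms Ck_1_continuous_grad[OF assms(1)] unfolding compact_supp_def
    by (intro compact_continuous_image) (auto intro: continuous_on_subset)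
  then obtain C where C: "\<And>y. y \<in> grad f ` closure {x. f x \<noteq> 0} \<Longrightarrow> norm y \<le> C"
    using compact_imp_bounded bounded_iff by metis
  have "norm (grad f x) \<le> max C 0" for x
    using C[of "grad f x"] grad_eq_0_outside_support[of x f] by (cases "x \<in> closure {x. f x \<noteq> 0}") auto
  then show ?thesis using that[of "max C 0"] by auto
qed

lemma compact_supp_integrable_mult:
  fixes \<phi> w :: "'a::euclidean_space \<Rightarrow> real"
  assumes \<phi>: "continuous_on UNIV \<phi>" "compact_supp \<phi>"
    and w: "\<And>K. compact K \<Longrightarrow> set_integrable lborel K w" and [measurable]: "w \<in> borel_measurable borel"
  shows "integrable lborel (\<lambda>x. w x * \<phi> x)"
proof -
  let ?K = "closure {x. \<phi> x \<noteq> 0}"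
  have K: "compact ?K" using \<phi>(2) by (simp add: compact_supp_def)
  have [measurable]: "\<phi> \<in> borel_measurable borel" using \<phi>(1) by (rule borel_measurable_continuous_onI)
  have "compact (\<phi> ` ?K)" using K \<phi>(1) by (intro compact_continuous_image) (auto intro: continuous_on_subset)
  then obtain C where C: "\<And>y. y \<in> \<phi> ` ?K \<Longrightarrow> norm y \<le> C" using compact_imp_bounded bounded_iff by metis
  have "integrable lborel (\<lambda>x. C * (indicator ?K x *\<^sub>R w x))"
    using w[OF K] unfolding set_integrable_def by (rule integrable_mult_right)
  then show ?thesis
  proof (rule Bochner_Integration.integrable_bound)
    show "AE x in lborel. norm (w x * \<phi> x) \<le> norm (C * (indicator ?K x *\<^sub>R w x))"
    proof (rule AE_I2)
      fix x
      show "norm (w x * \<phi> x) \<le> norm (C * (indicator ?K x *\<^sub>R w x))"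
      proof (cases "x \<in> ?K")
        case True
        then have "\<bar>\<phi> x\<bar> \<le> \<bar>C\<bar>" using C[of "\<phi> x"] by force
        then have "\<bar>w x\<bar> * \<bar>\<phi> x\<bar> \<le> \<bar>w x\<bar> * \<bar>C\<bar>" by (rule mult_left_mono) simp
        then show ?thesis using True by (simp add: abs_mult mult.commute)
      next
        case False
        then have "\<phi> x = 0" using closure_subset[of "{x. \<phi> x \<noteq> 0}"] by auto
        then show ?thesis by simp
      qed
    qed
  qed measurable
qed

text \<open>Commutativity of the two convolutions. It places the mollifier outermost, where Jensen's
  inequality removes it.\<close>

lemma wavg_commute:
  fixes K L g :: "'a::euclidean_space \<Rightarrow> ennreal"
  assumes [measurable]: "K \<in> borel_measurable borel" "L \<in> borel_measurable borel" "g \<in> borel_measurable borel"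
  shows "wavg K (wavg L g) x = wavg L (wavg K g) x"
proof -
  have "wavg K (wavg L g) x = (\<integral>\<^sup>+z. \<integral>\<^sup>+w. g (x + z + w) * L w * K z \<partial>lborel \<partial>lborel)"
    unfolding wavg_def by (intro nn_integral_cong nn_integral_multc[symmetric]) measurable
  also have "\<dots> = (\<integral>\<^sup>+w. \<integral>\<^sup>+z. g (x + z + w) * L w * K z \<partial>lborel \<partial>lborel)"
    by (rule lborel_pair.Fubini') measurable
  also have "\<dots> = (\<integral>\<^sup>+w. \<integral>\<^sup>+z. g (x + w + z) * K z * L w \<partial>lborel \<partial>lborel)"
    by (simp only: add_ac mult_ac)
  also have "\<dots> = wavg L (wavg K g) x"
    unfolding wavg_def by (intro nn_integral_cong nn_integral_multc) measurable
  finally show ?thesis .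
qed

definition mollify :: "real \<Rightarrow> ('a::euclidean_space \<Rightarrow> real) \<Rightarrow> 'a \<Rightarrow> real" where
  "mollify e f x = (\<integral>y. f y * mollifier e (y - x) \<partial>lborel)"

context
  fixes f :: "'a::euclidean_space \<Rightarrow> real" and v :: "'a \<Rightarrow> 'a"
  assumes f: "integrable lborel f" and v [measurable]: "v \<in> borel_measurable borel"
    and loc: "\<And>i K. i \<in> Basis \<Longrightarrow> compact K \<Longrightarrow> set_integrable lborel K (\<lambda>x. v x \<bullet> i)"
    and wg: "\<And>\<phi> i. smooth \<phi> \<Longrightarrow> compact_supp \<phi> \<Longrightarrow> i \<in> Basis \<Longrightarrow>
      (\<integral>x. f x * (grad \<phi> x \<bullet> i) \<partial>lborel) = - (\<integral>x. (v x \<bullet> i) * \<phi> x \<partial>lborel)"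
begin

lemma f_borel: "f \<in> borel_measurable borel" using f by auto

lemma mollify_integrable: "e > 0 \<Longrightarrow> integrable lborel (\<lambda>y. f y * mollifier e (y - x))"
proof (rule Bochner_Integration.integrable_bound[OF integrable_mult_left[OF f, of "1 / integral\<^sup>L lborel (bump_cube e (0::'a))"]])
  assume e: "e > 0"
  note [measurable] = mollifier_measurable[OF e] f_borel
  show "(\<lambda>y. f y * mollifier e (y - x)) \<in> borel_measurable lborel" by measurable
  show "AE y in lborel. norm (f y * mollifier e (y - x)) \<le> norm (f y * (1 / integral\<^sup>L lborel (bump_cube e (0::'a))))"
  proof (rule AE_I2)
    fix y
    have "\<bar>mollifier e (y - x)\<bar> \<le> \<bar>1 / integral\<^sup>L lborel (bump_cube e (0::'a))\<bar>"
      using mollifier_nonneg[OF e, of "y - x"] mollifier_le[OF e, of "y - x"] by linarith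
    then have "\<bar>f y\<bar> * \<bar>mollifier e (y - x)\<bar> \<le> \<bar>f y\<bar> * \<bar>1 / integral\<^sup>L lborel (bump_cube e (0::'a))\<bar>"
      by (rule mult_left_mono) simp
    then show "norm (f y * mollifier e (y - x)) \<le> norm (f y * (1 / integral\<^sup>L lborel (bump_cube e (0::'a))))"
      by (simp only: real_norm_def abs_mult)
  qed
qed

lemma mollify_measurable: "e > 0 \<Longrightarrow> mollify e f \<in> borel_measurable borel"
  unfolding mollify_def using mollifier_measurable[of e, where 'a='a] f_borel by measurable

text \<open>The translated mollifier is an admissible test function; testing each coordinate of
  \<open>z\<close> with it moves the derivative onto \<open>v\<close>, and the Cauchy-Schwarz
  inequality leaves the mollified norm of \<open>v\<close>.\<close>

lemma weak_grad_directional: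
  fixes p z :: 'a
  assumes e: "e > 0"
  shows "ennreal \<bar>\<integral>y. f y * (grad (mollifier e) (y - p) \<bullet> z) \<partial>lborel\<bar>
    \<le> ennreal (norm z) * wavg (\<lambda>w. ennreal (mollifier e w)) (\<lambda>y. ennreal (norm (v y))) p"
proof -
  let ?\<phi> = "\<lambda>y. mollifier e (y - p)"
  note [measurable] = mollifier_measurable[OF e] f_borel
  have sm: "smooth ?\<phi>" and cs: "compact_supp ?\<phi>" by (rule smooth_mollifier[OF e], rule compact_supp_mollifier[OF e])
  have C1: "?\<phi> \<in> Ck (Suc 0)" using sm unfolding smooth_def by blast
  have sm0: "smooth (mollifier e :: 'a \<Rightarrow> real)" using smooth_mollifier[OF e, of "0::'a"] by simp
  then have d0: "mollifier e differentiable (at (y::'a))" for y unfolding smooth_def by (metis (no_types, lifting) Ck.simps(2) mem_Collect_eq)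
  have g\<phi>: "grad ?\<phi> y = grad (mollifier e) (y - p)" for y
  proof (rule grad_eqI)
    have "((\<lambda>y. y - p) has_derivative (\<lambda>h. h)) (at y)" by (auto intro!: derivative_eq_intros)
    from has_derivative_compose[OF this has_derivative_grad[OF d0]]
    show "(?\<phi> has_derivative (\<lambda>h. grad (mollifier e) (y - p) \<bullet> h)) (at y)" .
  qed
  have cont: "continuous_on UNIV (grad ?\<phi>)" by (rule Ck_1_continuous_grad[OF C1])
  then have [measurable]: "grad ?\<phi> \<in> borel_measurable borel" by (rule borel_measurable_continuous_onI)
  obtain C where C: "C \<ge> 0" "\<And>x. norm (grad ?\<phi> x) \<le> C" using grad_bounded[OF C1 cs] by blast
  have int1: "integrable lborel (\<lambda>y. f y * (grad ?\<phi> y \<bullet> i))" if i: "i \<in> Basis" for i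
  proof (rule Bochner_Integration.integrable_bound[OF integrable_mult_left[OF f, of C]])
    show "AE y in lborel. norm (f y * (grad ?\<phi> y \<bullet> i)) \<le> norm (f y * C)"
    proof (rule AE_I2)
      fix y
      have "\<bar>grad ?\<phi> y \<bullet> i\<bar> \<le> \<bar>C\<bar>" using Basis_le_norm[OF i, of "grad ?\<phi> y"] C(2)[of y] C(1) by linarith
      then have "\<bar>f y\<bar> * \<bar>grad ?\<phi> y \<bullet> i\<bar> \<le> \<bar>f y\<bar> * \<bar>C\<bar>" by (rule mult_left_mono) simp
      then show "norm (f y * (grad ?\<phi> y \<bullet> i)) \<le> norm (f y * C)" by (simp only: real_norm_def abs_mult)
    qed
  qed measurable
  have int2: "integrable lborel (\<lambda>y. (v y \<bullet> i) * ?\<phi> y)" if i: "i \<in> Basis" for i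
    using loc[OF i] by (intro compact_supp_integrable_mult continuous_smooth sm cs) auto
  have dec: "a \<bullet> z = (\<Sum>i\<in>Basis. (z \<bullet> i) * (a \<bullet> i))" for a :: 'a
    by (subst euclidean_inner) (simp add: mult.commute)
  have vz: "(\<Sum>i\<in>Basis. (z \<bullet> i) * ((v y \<bullet> i) * ?\<phi> y)) = (v y \<bullet> z) * ?\<phi> y" for y
    by (simp only: dec[of "v y"] sum_distrib_right mult.assoc)
  have "(\<integral>y. f y * (grad (mollifier e) (y - p) \<bullet> z) \<partial>lborel) = (\<integral>y. (\<Sum>i\<in>Basis. (z \<bullet> i) * (f y * (grad ?\<phi> y \<bullet> i))) \<partial>lborel)"
    unfolding g\<phi> dec[of "grad (mollifier e) (_ - p)"] by (simp add: sum_distrib_left mult_ac)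
  also have "\<dots> = (\<Sum>i\<in>Basis. (z \<bullet> i) * (\<integral>y. f y * (grad ?\<phi> y \<bullet> i) \<partial>lborel))"
    using int1 by (subst Bochner_Integration.integral_sum) auto
  also have "\<dots> = (\<Sum>i\<in>Basis. (z \<bullet> i) * (- (\<integral>y. (v y \<bullet> i) * ?\<phi> y \<partial>lborel)))"
    using wg[OF sm cs] by (intro sum.cong) auto
  also have "\<dots> = - (\<Sum>i\<in>Basis. (z \<bullet> i) * (\<integral>y. (v y \<bullet> i) * ?\<phi> y \<partial>lborel))"
    by (simp add: sum_negf)
  also have "(\<Sum>i\<in>Basis. (z \<bullet> i) * (\<integral>y. (v y \<bullet> i) * ?\<phi> y \<partial>lborel)) = (\<integral>y. (\<Sum>i\<in>Basis. (z \<bullet> i) * ((v y \<bullet> i) * ?\<phi> y)) \<partial>lborel)"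
    using int2 by (subst Bochner_Integration.integral_sum) auto
  also have "\<dots> = (\<integral>y. (v y \<bullet> z) * ?\<phi> y \<partial>lborel)" by (simp only: vz)
  finally have eq: "\<bar>\<integral>y. f y * (grad (mollifier e) (y - p) \<bullet> z) \<partial>lborel\<bar> = \<bar>\<integral>y. (v y \<bullet> z) * ?\<phi> y \<partial>lborel\<bar>" by simp
  have intv: "integrable lborel (\<lambda>y. (v y \<bullet> z) * ?\<phi> y)"
  proof -
    have "integrable lborel (\<lambda>y. \<Sum>i\<in>Basis. (z \<bullet> i) * ((v y \<bullet> i) * ?\<phi> y))"
      using int2 by (intro Bochner_Integration.integrable_sum integrable_mult_right) auto
    then show ?thesis by (simp only: vz)
  qed
  have "ennreal \<bar>\<integral>y. (v y \<bullet> z) * ?\<phi> y \<partial>lborel\<bar> \<le> (\<integral>\<^sup>+y. ennreal (norm ((v y \<bullet> z) * ?\<phi> y)) \<partial>lborel)"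
    using integral_norm_bound_ennreal[OF intv] by simp
  also have "\<dots> \<le> (\<integral>\<^sup>+y. ennreal (norm z) * (ennreal (norm (v y)) * ennreal (mollifier e (y - p))) \<partial>lborel)"
  proof (intro nn_integral_mono)
    fix y
    have "norm ((v y \<bullet> z) * ?\<phi> y) \<le> norm z * (norm (v y) * mollifier e (y - p))"
      using mollifier_nonneg[OF e, of "y - p"] Cauchy_Schwarz_ineq2[of "v y" z]
      by (simp add: abs_mult mult_right_mono mult_ac[of "norm z"] mult.assoc[symmetric])
    then show "ennreal (norm ((v y \<bullet> z) * ?\<phi> y)) \<le> ennreal (norm z) * (ennreal (norm (v y)) * ennreal (mollifier e (y - p)))"
      using mollifier_nonneg[OF e, of "y - p"] by (simp add: ennreal_mult[symmetric] ennreal_leI)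
  qed
  also have "\<dots> = ennreal (norm z) * (\<integral>\<^sup>+y. ennreal (norm (v y)) * ennreal (mollifier e (y - p)) \<partial>lborel)"
    by (rule nn_integral_cmult) measurable
  also have "(\<integral>\<^sup>+y. ennreal (norm (v y)) * ennreal (mollifier e (y - p)) \<partial>lborel) = wavg (\<lambda>w. ennreal (mollifier e w)) (\<lambda>y. ennreal (norm (v y))) p"
    unfolding wavg_def
    using nn_integral_lborel_translate[of "\<lambda>y. ennreal (norm (v y)) * ennreal (mollifier e (y - p))" p]
    by (simp add: add.commute)
  finally show ?thesis unfolding eq .
qed

text \<open>The fundamental theorem of calculus along the segment is applied to the mollifier, which
  is smooth, and not to \<open>f\<close>; after Fubini the inner integral is the one estimated by
  \<open>weak_grad_directional\<close>. The result is the increment bound required by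
  \<open>osc_le_avg_sum\<close>, with the mollified norm of \<open>v\<close> as
  \<open>G\<close>.\<close>

lemma mollify_grad_bound:
  fixes x z :: 'a
  assumes e: "e > 0"
  shows "ennreal \<bar>mollify e f (x + z) - mollify e f x\<bar>
    \<le> ennreal (norm z) * (\<integral>\<^sup>+\<theta>. wavg (\<lambda>w. ennreal (mollifier e w)) (\<lambda>y. ennreal (norm (v y))) (x + \<theta> *\<^sub>R z) * indicator {0<..1} \<theta> \<partial>lborel)"
proof -
  let ?m = "mollifier e :: 'a \<Rightarrow> real" and ?G = "wavg (\<lambda>w. ennreal (mollifier e w)) (\<lambda>y. ennreal (norm (v y)))"
  note [measurable] = mollifier_measurable[OF e] f_borel
  have sm0: "smooth ?m" using smooth_mollifier[OF e, of "0::'a"] by simp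
  have cs0: "compact_supp ?m" using compact_supp_mollifier[OF e, of "0::'a"] by simp
  have C1: "?m \<in> Ck (Suc 0)" using sm0 unfolding smooth_def by blast
  have d0: "?m differentiable (at y)" for y using C1 by simp
  have cont: "continuous_on UNIV (grad ?m)" by (rule Ck_1_continuous_grad[OF C1])
  then have [measurable]: "grad ?m \<in> borel_measurable borel" by (rule borel_measurable_continuous_onI)
  obtain C where C: "C \<ge> 0" "\<And>x. norm (grad ?m x) \<le> C" using grad_bounded[OF C1 cs0] by blast
  define h where "h y \<theta> = f y * (- (grad ?m (y - (x + \<theta> *\<^sub>R z)) \<bullet> z) * indicator {0..1} \<theta>)" for y and \<theta> :: real
  have ftc: "?m (y - (x + z)) - ?m (y - x) = (\<integral>\<theta>. - (grad ?m (y - (x + \<theta> *\<^sub>R z)) \<bullet> z) * indicator {0..1} \<theta> \<partial>lborel)" for y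
  proof -
    have "(\<integral>\<theta>. - (grad ?m (y - (x + \<theta> *\<^sub>R z)) \<bullet> z) * indicator {0..1} \<theta> \<partial>lborel)
       = ?m (y - (x + 1 *\<^sub>R z)) - ?m (y - (x + 0 *\<^sub>R z))"
    proof (rule integral_FTC_Icc_real)
      fix \<theta> :: real
      have "((\<lambda>\<theta>. y - (x + \<theta> *\<^sub>R z)) has_derivative (\<lambda>t. - (t *\<^sub>R z))) (at \<theta>)"
        by (auto intro!: derivative_eq_intros)
      from has_derivative_compose[OF this has_derivative_grad[OF d0]]
      have "((\<lambda>\<theta>. ?m (y - (x + \<theta> *\<^sub>R z))) has_derivative (\<lambda>t. grad ?m (y - (x + \<theta> *\<^sub>R z)) \<bullet> (- (t *\<^sub>R z)))) (at \<theta>)" .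
      moreover have "(\<lambda>t. grad ?m (y - (x + \<theta> *\<^sub>R z)) \<bullet> (- (t *\<^sub>R z))) = (*) (- (grad ?m (y - (x + \<theta> *\<^sub>R z)) \<bullet> z))"
        by (simp add: fun_eq_iff)
      ultimately show "((\<lambda>\<theta>. ?m (y - (x + \<theta> *\<^sub>R z))) has_real_derivative - (grad ?m (y - (x + \<theta> *\<^sub>R z)) \<bullet> z)) (at \<theta>)"
        by (simp add: has_field_derivative_def)
      have "continuous_on UNIV (\<lambda>\<theta>. - (grad ?m (y - (x + \<theta> *\<^sub>R z)) \<bullet> z))"
        by (intro continuous_intros continuous_on_compose2[OF cont]) auto
      then show "isCont (\<lambda>\<theta>. - (grad ?m (y - (x + \<theta> *\<^sub>R z)) \<bullet> z)) \<theta>"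
        by (simp add: continuous_on_eq_continuous_at)
    qed simp
    then show ?thesis by simp
  qed
  have hm [measurable]: "(\<lambda>(y, \<theta>). h y \<theta>) \<in> borel_measurable (lborel \<Otimes>\<^sub>M lborel)"
    unfolding h_def by measurable
  have hint: "integrable (lborel \<Otimes>\<^sub>M lborel) (\<lambda>(y, \<theta>). h y \<theta>)"
  proof (rule integrableI_bounded)
    have le: "ennreal (norm (h y \<theta>)) \<le> ennreal \<bar>f y\<bar> * (ennreal (C * norm z) * indicator {0..1} \<theta>)" for y \<theta>
    proof -
      have "\<bar>grad ?m (y - (x + \<theta> *\<^sub>R z)) \<bullet> z\<bar> \<le> C * norm z"
        using Cauchy_Schwarz_ineq2[of "grad ?m (y - (x + \<theta> *\<^sub>R z))" z] C(2)[of "y - (x + \<theta> *\<^sub>R z)"]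
        by (meson mult_right_mono norm_ge_zero order_trans)
      then have "\<bar>f y\<bar> * \<bar>grad ?m (y - (x + \<theta> *\<^sub>R z)) \<bullet> z\<bar> \<le> \<bar>f y\<bar> * (C * norm z)"
        by (rule mult_left_mono) simp
      then have "ennreal (\<bar>f y\<bar> * \<bar>grad ?m (y - (x + \<theta> *\<^sub>R z)) \<bullet> z\<bar>) \<le> ennreal \<bar>f y\<bar> * ennreal (C * norm z)"
        using C(1) by (subst ennreal_mult[symmetric]) (auto intro: ennreal_leI)
      then show ?thesis unfolding h_def by (cases "\<theta> \<in> {0..1}") (auto simp: abs_mult)
    qed
    have "(\<integral>\<^sup>+p. ennreal (norm (case p of (y, \<theta>) \<Rightarrow> h y \<theta>)) \<partial>(lborel \<Otimes>\<^sub>M lborel))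
       = (\<integral>\<^sup>+y. \<integral>\<^sup>+\<theta>. ennreal (norm (h y \<theta>)) \<partial>lborel \<partial>lborel)"
      using lborel.nn_integral_fst[of "\<lambda>p. ennreal (norm (case p of (y, \<theta>) \<Rightarrow> h y \<theta>))" lborel] by simp
    also have "\<dots> \<le> (\<integral>\<^sup>+y. \<integral>\<^sup>+\<theta>. ennreal \<bar>f y\<bar> * (ennreal (C * norm z) * indicator {0..1::real} \<theta>) \<partial>lborel \<partial>lborel)"
      by (rule nn_integral_mono, rule nn_integral_mono, rule le)
    also have "\<dots> = (\<integral>\<^sup>+y. ennreal \<bar>f y\<bar> * ennreal (C * norm z) \<partial>lborel)"
      by (intro nn_integral_cong) (simp add: nn_integral_cmult nn_integral_cmult_indicator)
    also have "\<dots> = (\<integral>\<^sup>+y. ennreal \<bar>f y\<bar> \<partial>lborel) * ennreal (C * norm z)"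
      by (rule nn_integral_multc) measurable
    also have "\<dots> < \<infinity>" using f unfolding integrable_iff_bounded by (simp add: ennreal_mult_less_top)
    finally show "(\<integral>\<^sup>+p. ennreal (norm (case p of (y, \<theta>) \<Rightarrow> h y \<theta>)) \<partial>(lborel \<Otimes>\<^sub>M lborel)) < \<infinity>" .
  qed measurable
  have "mollify e f (x + z) - mollify e f x = (\<integral>y. f y * ?m (y - (x + z)) - f y * ?m (y - x) \<partial>lborel)"
    unfolding mollify_def by (rule Bochner_Integration.integral_diff[symmetric]) (intro mollify_integrable e)+
  also have "\<dots> = (\<integral>y. (\<integral>\<theta>. h y \<theta> \<partial>lborel) \<partial>lborel)"
  proof (rule Bochner_Integration.integral_cong[OF refl])
    fix y
    have "f y * ?m (y - (x + z)) - f y * ?m (y - x) = f y * (?m (y - (x + z)) - ?m (y - x))"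
      by (simp only: right_diff_distrib)
    also have "\<dots> = (\<integral>\<theta>. h y \<theta> \<partial>lborel)"
      unfolding ftc h_def by (rule integral_mult_right_zero[symmetric])
    finally show "f y * ?m (y - (x + z)) - f y * ?m (y - x) = (\<integral>\<theta>. h y \<theta> \<partial>lborel)" .
  qed
  also have "\<dots> = (\<integral>\<theta>. (\<integral>y. h y \<theta> \<partial>lborel) \<partial>lborel)"
    by (rule lborel_pair.Fubini_integral[OF hint, symmetric])
  finally have "ennreal \<bar>mollify e f (x + z) - mollify e f x\<bar> = ennreal \<bar>\<integral>\<theta>. (\<integral>y. h y \<theta> \<partial>lborel) \<partial>lborel\<bar>" by simp
  also have "\<dots> \<le> (\<integral>\<^sup>+\<theta>. ennreal (norm (\<integral>y. h y \<theta> \<partial>lborel)) \<partial>lborel)"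
    using integral_norm_bound_ennreal[OF lborel_pair.integrable_snd[OF hint]] by simp
  also have "\<dots> = (\<integral>\<^sup>+\<theta>. ennreal (norm (\<integral>y. h y \<theta> \<partial>lborel)) * indicator {0<..1} \<theta> \<partial>lborel)"
  proof (rule nn_integral_cong_AE)
    have "AE \<theta> in lborel. \<theta> \<noteq> (0::real)" by (rule AE_lborel_singleton)
    then show "AE \<theta> in lborel. ennreal (norm (\<integral>y. h y \<theta> \<partial>lborel)) = ennreal (norm (\<integral>y. h y \<theta> \<partial>lborel)) * indicator {0<..1} \<theta>"
      by eventually_elim (auto simp: h_def indicator_def)
  qed
  also have "\<dots> \<le> (\<integral>\<^sup>+\<theta>. ennreal (norm z) * (?G (x + \<theta> *\<^sub>R z) * indicator {0<..1} \<theta>) \<partial>lborel)"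
  proof (intro nn_integral_mono)
    fix \<theta> :: real
    show "ennreal (norm (\<integral>y. h y \<theta> \<partial>lborel)) * indicator {0<..1} \<theta> \<le> ennreal (norm z) * (?G (x + \<theta> *\<^sub>R z) * indicator {0<..1} \<theta>)"
    proof (cases "\<theta> \<in> {0<..1}")
      case True
      then have "(\<integral>y. h y \<theta> \<partial>lborel) = - (\<integral>y. f y * (grad ?m (y - (x + \<theta> *\<^sub>R z)) \<bullet> z) \<partial>lborel)"
        unfolding h_def by simp
      then show ?thesis using weak_grad_directional[OF e, of "x + \<theta> *\<^sub>R z" z] True by simp
    qed simp
  qed
  also have "\<dots> = ennreal (norm z) * (\<integral>\<^sup>+\<theta>. ?G (x + \<theta> *\<^sub>R z) * indicator {0<..1} \<theta> \<partial>lborel)"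
  proof (rule nn_integral_cmult)
    have [measurable]: "?G \<in> borel_measurable borel" by (rule borel_measurable_wavg) measurable
    show "(\<lambda>\<theta>. ?G (x + \<theta> *\<^sub>R z) * indicator {0<..1} \<theta>) \<in> borel_measurable lborel" by measurable
  qed
  finally show ?thesis .
qed

text \<open>The mollification error is an average of increments of \<open>f\<close> over the support
  of the kernel, which lies in the ball of radius \<open>e\<close> times the dimension.\<close>

lemma mollify_L1_le:
  assumes e: "e > 0" and d: "\<And>z::'a. norm z \<le> e * real DIM('a) \<Longrightarrow> diff_pow 1 f z \<le> ennreal d"
  shows "(\<integral>\<^sup>+x. ennreal \<bar>mollify e f x - f x\<bar> \<partial>lborel) \<le> ennreal d"
proof -
  let ?m = "mollifier e :: 'a \<Rightarrow> real"
  note [measurable] = mollifier_measurable[OF e] f_borel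
  have mint: "integrable lborel (\<lambda>y. ?m (y - x))" for x
    unfolding mollifier_translate[OF e] by (intro integrable_mult_right bump_cube_integrable e)
  have m1: "(\<integral>y. ?m (y - x) \<partial>lborel) = 1" for x
  proof -
    have "ennreal (\<integral>y. ?m (y - x) \<partial>lborel) = (\<integral>\<^sup>+y. ennreal (?m (y - x)) \<partial>lborel)"
      by (rule nn_integral_eq_integral[symmetric, OF mint]) (auto simp: mollifier_nonneg[OF e])
    also have "\<dots> = 1"
      using nn_integral_lborel_translate[of "\<lambda>y. ennreal (?m y)" "- x"] nn_integral_mollifier[OF e, where 'a='a] by simp
    finally show ?thesis by (metis ennreal_eq_1)
  qed
  have pt: "ennreal \<bar>mollify e f x - f x\<bar> \<le> (\<integral>\<^sup>+z. ennreal \<bar>f (x + z) - f x\<bar> * ennreal (?m z) \<partial>lborel)" for x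
  proof -
    have i2: "integrable lborel (\<lambda>y. f x * ?m (y - x))" by (intro integrable_mult_right mint)
    have int: "integrable lborel (\<lambda>y. f y * ?m (y - x) - f x * ?m (y - x))"
      by (intro Bochner_Integration.integrable_diff mollify_integrable e i2)
    have "mollify e f x - f x = (\<integral>y. f y * ?m (y - x) \<partial>lborel) - (\<integral>y. f x * ?m (y - x) \<partial>lborel)"
      unfolding mollify_def using m1 by simp
    also have "\<dots> = (\<integral>y. f y * ?m (y - x) - f x * ?m (y - x) \<partial>lborel)"
      by (rule Bochner_Integration.integral_diff[symmetric]) (intro mollify_integrable e, rule i2)
    finally have "ennreal \<bar>mollify e f x - f x\<bar> \<le> (\<integral>\<^sup>+y. ennreal (norm (f y * ?m (y - x) - f x * ?m (y - x))) \<partial>lborel)"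
      using integral_norm_bound_ennreal[OF int] by simp
    also have "\<dots> = (\<integral>\<^sup>+y. ennreal \<bar>f y - f x\<bar> * ennreal (?m (y - x)) \<partial>lborel)"
    proof (intro nn_integral_cong)
      fix y
      have "norm (f y * ?m (y - x) - f x * ?m (y - x)) = \<bar>f y - f x\<bar> * ?m (y - x)"
        using mollifier_nonneg[OF e, of "y - x"] by (simp add: left_diff_distrib[symmetric] abs_mult)
      then show "ennreal (norm (f y * ?m (y - x) - f x * ?m (y - x))) = ennreal \<bar>f y - f x\<bar> * ennreal (?m (y - x))"
        using mollifier_nonneg[OF e, of "y - x"] by (simp add: ennreal_mult)
    qed
    also have "\<dots> = (\<integral>\<^sup>+z. ennreal \<bar>f (x + z) - f x\<bar> * ennreal (?m z) \<partial>lborel)"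
      using nn_integral_lborel_translate[of "\<lambda>y. ennreal \<bar>f y - f x\<bar> * ennreal (?m (y - x))" x] by (simp add: add.commute)
    finally show ?thesis .
  qed
  have "(\<integral>\<^sup>+x. ennreal \<bar>mollify e f x - f x\<bar> \<partial>lborel) \<le> (\<integral>\<^sup>+x. \<integral>\<^sup>+z. ennreal \<bar>f (x + z) - f x\<bar> * ennreal (?m z) \<partial>lborel \<partial>lborel)"
    by (intro nn_integral_mono pt)
  also have "\<dots> = (\<integral>\<^sup>+z. \<integral>\<^sup>+x. ennreal \<bar>f (x + z) - f x\<bar> * ennreal (?m z) \<partial>lborel \<partial>lborel)"
    by (rule lborel_pair.Fubini') measurable
  also have "\<dots> = (\<integral>\<^sup>+z. diff_pow 1 f z * ennreal (?m z) \<partial>lborel)"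
    unfolding diff_pow_def by (intro nn_integral_cong) (simp add: nn_integral_multc)
  also have "\<dots> \<le> (\<integral>\<^sup>+z. ennreal d * ennreal (?m z) \<partial>lborel)"
  proof (intro nn_integral_mono)
    fix z :: 'a
    show "diff_pow 1 f z * ennreal (?m z) \<le> ennreal d * ennreal (?m z)"
      using d[of z] mollifier_eq_0[OF e, of z] by (cases "norm z \<le> e * real DIM('a)") (auto intro: mult_right_mono)
  qed
  also have "\<dots> = ennreal d" using nn_integral_mollifier[OF e, where 'a='a] by (simp add: nn_integral_cmult)
  finally show ?thesis .
qed

lemma mollify_AE_subseq:
  obtains e :: "nat \<Rightarrow> real" where "\<And>k. e k > 0" "AE x in lborel. (\<lambda>k. mollify (e k) f x) \<longlonglongrightarrow> f x"
proof -
  define e0 where "e0 k = 1 / real (Suc k)" for k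
  have e0: "e0 k > 0" for k by (simp add: e0_def)
  note [measurable] = mollify_measurable[OF e0] f_borel
  have lim: "(\<lambda>k. \<integral>\<^sup>+x. ennreal \<bar>mollify (e0 k) f x - f x\<bar> \<partial>lborel) \<longlonglongrightarrow> 0"
  proof (rule order_tendstoI)
    fix y :: ennreal assume "0 < y"
    then obtain c where c: "0 < c" "c < y" using dense by blast
    then have "c \<noteq> top" by auto
    then obtain d where "c = ennreal d" by (cases c rule: ennreal_cases) auto
    with c have d: "0 < ennreal d" "ennreal d < y" by auto
    then have d0: "d > 0" by simp
    obtain \<delta> where \<delta>: "\<delta> > 0" "\<And>h::'a. norm h < \<delta> \<Longrightarrow> diff_pow 1 f h \<le> ennreal d"
      using translation_continuous_L1[OF f] d0 by blast
    have "(\<lambda>k. e0 k * real DIM('a)) \<longlonglongrightarrow> 0 * real DIM('a)"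
      unfolding e0_def by (intro tendsto_intros LIMSEQ_Suc[OF lim_1_over_n])
    then have "\<forall>\<^sub>F k in sequentially. e0 k * real DIM('a) < \<delta>"
      using \<delta>(1) by (intro order_tendstoD) auto
    then show "\<forall>\<^sub>F k in sequentially. (\<integral>\<^sup>+x. ennreal \<bar>mollify (e0 k) f x - f x\<bar> \<partial>lborel) < y"
    proof eventually_elim
      case (elim k)
      have "(\<integral>\<^sup>+x. ennreal \<bar>mollify (e0 k) f x - f x\<bar> \<partial>lborel) \<le> ennreal d"
        using elim by (intro mollify_L1_le e0 \<delta>(2)) auto
      then show ?case using d(2) by (rule le_less_trans)
    qed
  qed auto
  have ev: "\<forall>\<^sub>F k in sequentially. (\<integral>\<^sup>+x. ennreal \<bar>mollify (e0 k) f x - f x\<bar> \<partial>lborel) < 1"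
    using lim by (rule order_tendstoD) simp
  \<comment> \<open>From this index on the errors have finite integral and are integrable, as
    extracting an almost everywhere convergent subsequence from L1 convergence requires.\<close>
  then obtain k0 where k0: "\<And>k. k \<ge> k0 \<Longrightarrow> (\<integral>\<^sup>+x. ennreal \<bar>mollify (e0 k) f x - f x\<bar> \<partial>lborel) < 1"
    unfolding eventually_sequentially by blast
  define w where "w k x = mollify (e0 (k + k0)) f x - f x" for k x
  have [measurable]: "w k \<in> borel_measurable borel" for k unfolding w_def by measurable
  have wi: "integrable lborel (w k)" for k
  proof (rule integrableI_bounded)
    show "(\<integral>\<^sup>+x. ennreal (norm (w k x)) \<partial>lborel) < \<infinity>"
      using k0[of "k + k0"] unfolding w_def by (auto intro: less_trans)
  qed measurable
  have "(\<lambda>k. \<integral>x. norm (w k x) \<partial>lborel) \<longlonglongrightarrow> 0"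
  proof -
    have eq: "ennreal (\<integral>x. norm (w k x) \<partial>lborel) = (\<integral>\<^sup>+x. ennreal \<bar>mollify (e0 (k + k0)) f x - f x\<bar> \<partial>lborel)" for k
      using nn_integral_eq_integral[OF integrable_norm[OF wi[of k]]] unfolding w_def by simp
    have "(\<lambda>k. ennreal (\<integral>x. norm (w k x) \<partial>lborel)) \<longlonglongrightarrow> ennreal 0"
      unfolding eq using LIMSEQ_ignore_initial_segment[OF lim, of k0] by simp
    then show ?thesis
      by (subst (asm) tendsto_ennreal_iff) (auto intro!: always_eventually integral_nonneg_AE)
  qed
  from tendsto_L1_AE_subseq[OF wi this] obtain s where s: "strict_mono s" "AE x in lborel. (\<lambda>k. w (s k) x) \<longlonglongrightarrow> 0"
    by blast
  show ?thesis
  proof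
    show "e0 (s k + k0) > 0" for k by (rule e0)
    show "AE x in lborel. (\<lambda>k. mollify (e0 (s k + k0)) f x) \<longlonglongrightarrow> f x"
      using s(2) unfolding w_def by eventually_elim (simp add: LIM_zero_iff)
  qed
qed

text \<open>The bound for the mollified function involves averages of the mollified gradient norm.
  Exchanging the averages and contracting in \<open>L^r\<close> removes the mollifier, and the
  resulting bound, independent of the parameter, survives the limit.\<close>

lemma osc_le_weak_grad_avg:
  assumes r: "r > 1" and a: "0 < a" and t: "t > 0"
  shows "osc r f t \<le> ennreal (t ^ DIM('a) * ball_vol TYPE('a) * (8 * 4 ^ DIM('a) * t * (1 / (1 - 2 powr (- a)))) powr r) *
    (\<Sum>j. ennreal (2 powr (- (real j * (r * (1 - a))))) * (\<integral>\<^sup>+x. epow (wavg (ball_kernel (2 * t / 2 ^ j)) (\<lambda>y. ennreal (norm (v y))) x) r \<partial>lborel))"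
    (is "_ \<le> ?B")
proof -
  obtain e :: "nat \<Rightarrow> real" where e: "\<And>k. e k > 0" and ae: "AE x in lborel. (\<lambda>k. mollify (e k) f x) \<longlonglongrightarrow> f x"
    using mollify_AE_subseq by blast
  let ?g = "\<lambda>y. ennreal (norm (v y))"
  show ?thesis
  proof (rule osc_le_of_AE_tendsto[OF mollify_measurable[OF e] f_borel ae])
    fix k
    let ?m = "\<lambda>w::'a. ennreal (mollifier (e k) w)"
    note [measurable] = mollifier_measurable[OF e[of k]]
    have G [measurable]: "wavg ?m ?g \<in> borel_measurable borel" by (rule borel_measurable_wavg) measurable
    have "osc r (mollify (e k) f) t \<le> ennreal (t ^ DIM('a) * ball_vol TYPE('a) * (8 * 4 ^ DIM('a) * t * (1 / (1 - 2 powr (- a)))) powr r) *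
      (\<Sum>j. ennreal (2 powr (- (real j * (r * (1 - a))))) * (\<integral>\<^sup>+x. epow (wavg (ball_kernel (2 * t / 2 ^ j)) (wavg ?m ?g) x) r \<partial>lborel))"
      by (rule osc_le_avg_sum[OF mollify_measurable[OF e] G mollify_grad_bound[OF e] r a t])
    also have "\<dots> \<le> ?B"
    proof (intro mult_left_mono suminf_le)
      fix j
      let ?K = "ball_kernel (2 * t / 2 ^ j) :: 'a \<Rightarrow> ennreal"
      have [measurable]: "wavg ?K ?g \<in> borel_measurable borel" by (rule borel_measurable_wavg) measurable
      have "(\<integral>\<^sup>+x. epow (wavg ?K (wavg ?m ?g) x) r \<partial>lborel) = (\<integral>\<^sup>+x. epow (wavg ?m (wavg ?K ?g) x) r \<partial>lborel)"
        by (subst wavg_commute) measurable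
      also have "\<dots> \<le> (\<integral>\<^sup>+x. epow (wavg ?K ?g x) r \<partial>lborel)"
        by (rule nn_integral_epow_wavg_le[OF _ _ nn_integral_mollifier[OF e] r]) measurable
      finally show "(\<integral>\<^sup>+x. epow (wavg ?K (wavg ?m ?g) x) r \<partial>lborel) \<le> (\<integral>\<^sup>+x. epow (wavg ?K ?g x) r \<partial>lborel)" .
    qed auto
    finally show "osc r (mollify (e k) f) t \<le> ?B" .
  qed (use r in auto)
qed

end

subsection \<open>Embedding of the Sobolev space\<close>

text \<open>Substitution of \<open>l * t\<close> for t in a power-weighted integral over the half
  line; it reduces the averages at all radii \<open>2 * t / 2 ^ j\<close> to a single one.\<close>

lemma nn_integral_power_scale:
  fixes Q :: "real \<Rightarrow> ennreal"
  assumes [measurable]: "Q \<in> borel_measurable borel" and l: "l > 0"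
  shows "(\<integral>\<^sup>+t. ennreal (t powr (b - 1)) * Q (l * t) * indicator {0<..} t \<partial>lborel)
    = ennreal (l powr (- b)) * (\<integral>\<^sup>+t. ennreal (t powr (b - 1)) * Q t * indicator {0<..} t \<partial>lborel)"
proof -
  have "(\<integral>\<^sup>+t. ennreal (t powr (b - 1)) * Q t * indicator {0<..} t \<partial>lborel)
     = ennreal l * (\<integral>\<^sup>+t. ennreal ((l * t) powr (b - 1)) * Q (l * t) * indicator {0<..} (l * t) \<partial>lborel)"
    using l nn_integral_real_affine[of "\<lambda>t. ennreal (t powr (b - 1)) * Q t * indicator {0<..} t" l 0] by simp
  also have "(\<integral>\<^sup>+t. ennreal ((l * t) powr (b - 1)) * Q (l * t) * indicator {0<..} (l * t) \<partial>lborel)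
     = (\<integral>\<^sup>+t. ennreal (l powr (b - 1)) * (ennreal (t powr (b - 1)) * Q (l * t) * indicator {0<..} t) \<partial>lborel)"
    using l by (intro nn_integral_cong)
      (auto simp: powr_mult ennreal_mult indicator_def zero_less_mult_iff mult.assoc)
  also have "\<dots> = ennreal (l powr (b - 1)) * (\<integral>\<^sup>+t. ennreal (t powr (b - 1)) * Q (l * t) * indicator {0<..} t \<partial>lborel)"
    by (rule nn_integral_cmult) measurable
  finally have eq: "(\<integral>\<^sup>+t. ennreal (t powr (b - 1)) * Q t * indicator {0<..} t \<partial>lborel)
     = ennreal l * (ennreal (l powr (b - 1)) * (\<integral>\<^sup>+t. ennreal (t powr (b - 1)) * Q (l * t) * indicator {0<..} t \<partial>lborel))" .
  have "ennreal (l powr (- b)) * (ennreal l * ennreal (l powr (b - 1))) = 1"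
    using l by (simp add: ennreal_mult[symmetric] powr_diff powr_minus)
  then show ?thesis unfolding eq by (simp only: mult.assoc[symmetric] mult_1_left)
qed

text \<open>\<open>besov_pow\<close> without the junk value of \<open>enn2real\<close> at infinity, so that it can be estimated before finiteness is known.\<close>

definition besov_ext :: "real \<Rightarrow> ('a::euclidean_space \<Rightarrow> real) \<Rightarrow> ennreal" where
  "besov_ext r f = (\<integral>\<^sup>+t. ennreal (t powr (- (real DIM('a) / r) * real DIM('a) - 1)) *
     epow (osc r f t * ennreal (1 / (t ^ DIM('a) * ball_vol TYPE('a)))) (real DIM('a) / r) * indicator {0<..} t \<partial>lborel)"

lemma besov_pow_eq_ext:
  fixes f :: "'a::euclidean_space \<Rightarrow> real"
  assumes f: "f \<in> borel_measurable borel" and r: "r \<ge> 1" and L: "Lp_pow r f < \<infinity>"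
  shows "besov_pow (real DIM('a) / r) r (real DIM('a)) f = besov_ext r f"
  unfolding besov_pow_def besov_ext_def
proof (intro nn_integral_cong)
  fix t :: real
  let ?n = "real DIM('a)" and ?V = "t ^ DIM('a) * ball_vol TYPE('a)"
  show "ennreal (t powr (- (?n / r) * ?n) * modulus r f t powr ?n / t) * indicator {0<..} t
     = ennreal (t powr (- (?n / r) * ?n - 1)) * epow (osc r f t * ennreal (1 / ?V)) (?n / r) * indicator {0<..} t"
  proof (cases "t > 0")
    case True
    have V: "?V > 0" using True ball_vol_pos[where 'a='a] by simp
    obtain y where y: "osc r f t = ennreal y" "y \<ge> 0"
      using osc_finite[OF f r L, of t] by (cases "osc r f t" rule: ennreal_cases) auto
    have m: "modulus r f t powr ?n = (y / ?V) powr (?n / r)"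
      unfolding modulus_eq_osc[OF f r L] y(1) using y(2) by (simp add: powr_powr)
    have "epow (osc r f t * ennreal (1 / ?V)) (?n / r) = ennreal ((y / ?V) powr (?n / r))"
      unfolding y(1) using y(2) V by (simp add: ennreal_mult[symmetric] epow_ennreal)
    moreover have "t powr (- (?n / r) * ?n) * (y / ?V) powr (?n / r) / t = t powr (- (?n / r) * ?n - 1) * (y / ?V) powr (?n / r)"
      using True by (simp add: powr_diff)
    ultimately show ?thesis unfolding m using True by (simp add: ennreal_mult[symmetric])
  qed simp
qed

text \<open>The n-th power comes from the constant of \<open>osc_le_avg_sum\<close>, the second
  \<open>S\<close> from the sum over \<open>j\<close>, and \<open>avg_const\<close> from the
  averages at all radii.\<close>

definition embed_const :: "'a::euclidean_space itself \<Rightarrow> real \<Rightarrow> real" where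
  "embed_const T S = (8 * 4 ^ DIM('a) * S) powr real DIM('a) * S * avg_const T"

context
  fixes f :: "'a::euclidean_space \<Rightarrow> real" and v :: "'a \<Rightarrow> 'a" and r :: real
  assumes f: "integrable lborel f" and v [measurable]: "v \<in> borel_measurable borel"
    and loc: "\<And>i K. i \<in> Basis \<Longrightarrow> compact K \<Longrightarrow> set_integrable lborel K (\<lambda>x. v x \<bullet> i)"
    and wg: "\<And>\<phi> i. smooth \<phi> \<Longrightarrow> compact_supp \<phi> \<Longrightarrow> i \<in> Basis \<Longrightarrow>
      (\<integral>x. f x * (grad \<phi> x \<bullet> i) \<partial>lborel) = - (\<integral>x. (v x \<bullet> i) * \<phi> x \<partial>lborel)"
    and n2: "DIM('a) \<ge> 2" and r: "r > real DIM('a)"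
begin

text \<open>Each term of the sum over \<open>j\<close> is reduced to \<open>avg_integral_le\<close>
  by rescaling t. The rescaling costs \<open>2 powr (j \<beta>)\<close> with
  \<open>\<beta> = n (1 - n / r)\<close>, against the retained weight
  \<open>2 powr (- j n (1 - a))\<close>. What is left must decay in \<open>j\<close>.\<close>

lemma besov_ext_le:
  fixes S :: real
  defines "S \<equiv> 1 / (1 - 2 powr (- (real DIM('a) / (2 * r))))"
  shows "besov_ext r f \<le> ennreal (embed_const TYPE('a) S / (1 - real DIM('a) / r)) * (\<integral>\<^sup>+y. epow (ennreal (norm (v y))) (real DIM('a)) \<partial>lborel)"
proof -
  let ?n = "real DIM('a)" and ?N = "DIM('a)" and ?q = "real DIM('a) / r" and ?om = "ball_vol TYPE('a)"
  let ?D = "8 * 4 ^ DIM('a) :: real"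
  let ?g = "\<lambda>y. ennreal (norm (v y))"
  let ?P = "\<integral>\<^sup>+y. epow (?g y) ?n \<partial>lborel"
  \<comment> \<open>Half of \<open>n / r\<close>: rescaling then leaves the decay
    \<open>2 powr (- (j n a))\<close>, no worse than the Hoelder weight itself, so the same
    \<open>S\<close> bounds both sums.\<close>
  define a where "a = ?n / (2 * r)"
  define \<beta> where "\<beta> = ?n * (1 - ?q)"
  define J where "J \<tau> = (\<integral>\<^sup>+x. epow (wavg (ball_kernel \<tau>) ?g x) r \<partial>lborel)" for \<tau>
  define Q where "Q \<tau> = epow (J \<tau>) ?q" for \<tau>
  have n: "?n \<ge> 2" using n2 by simp
  have r1: "r > 1" "r > 0" using r n by linarith+
  have q: "0 < ?q" "?q < 1" using r r1 n by auto
  have a: "a > 0" "?q = 2 * a" using n r1 by (auto simp: a_def)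
  have om: "?om > 0" by (rule ball_vol_pos)
  have b1: "2 powr (- a) < 1" using a by (simp add: powr_less_one)
  have S: "S = 1 / (1 - 2 powr (- a))" unfolding S_def a_def ..
  have S1: "S \<ge> 1" unfolding S using b1 by simp
  have [measurable]: "J \<in> borel_measurable borel"
    unfolding J_def wavg_def ball_kernel_def indicator_def mem_ball dist_norm by measurable
  have [measurable]: "Q \<in> borel_measurable borel" unfolding Q_def by measurable
  let ?c = "\<lambda>j. ennreal (2 powr (- (real j * (?n * (1 - a)))))"
  have pt: "ennreal (t powr (- ?q * ?n - 1)) * epow (osc r f t * ennreal (1 / (t ^ ?N * ?om))) ?q * indicator {0<..} t
     \<le> ennreal ((?D * S) powr ?n) * (\<Sum>j. ?c j * (ennreal (t powr (\<beta> - 1)) * Q (2 / 2 ^ j * t) * indicator {0<..} t))" for t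
  proof (cases "t > 0")
    case t: True
    let ?V = "t ^ ?N * ?om"
    have V: "?V > 0" using t om by simp
    let ?Sum = "\<Sum>j. ennreal (2 powr (- (real j * (r * (1 - a))))) * J (2 * t / 2 ^ j)"
    have "osc r f t * ennreal (1 / ?V) \<le> (ennreal (?V * (?D * t * S) powr r) * ?Sum) * ennreal (1 / ?V)"
      unfolding J_def S using osc_le_weak_grad_avg[OF f v loc wg r1(1) a(1) t] by (intro mult_right_mono) auto
    also have "\<dots> = ennreal ((?D * t * S) powr r) * ?Sum"
    proof -
      have "ennreal (?V * (?D * t * S) powr r) * ennreal (1 / ?V) = ennreal ((?D * t * S) powr r)"
        using V by (subst ennreal_mult[symmetric]) auto
      moreover have "(x * y) * z = (x * z) * y" for x y z :: ennreal by (simp only: mult_ac)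
      ultimately show ?thesis by presburger
    qed
    finally have "epow (osc r f t * ennreal (1 / ?V)) ?q \<le> epow (ennreal ((?D * t * S) powr r) * ?Sum) ?q"
      using q by (intro epow_mono) auto
    also have "\<dots> = ennreal ((?D * t * S) powr ?n) * epow ?Sum ?q"
      using q r1 by (simp add: epow_mult epow_ennreal powr_powr)
    also have "\<dots> \<le> ennreal ((?D * t * S) powr ?n) * (\<Sum>j. epow (ennreal (2 powr (- (real j * (r * (1 - a))))) * J (2 * t / 2 ^ j)) ?q)"
      using q by (intro mult_left_mono epow_suminf_le) auto
    also have "(\<Sum>j. epow (ennreal (2 powr (- (real j * (r * (1 - a))))) * J (2 * t / 2 ^ j)) ?q) = (\<Sum>j. ?c j * Q (2 / 2 ^ j * t))"
    proof (intro suminf_cong)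
      fix j
      have "- (real j * (r * (1 - a))) * ?q = - (real j * (?n * (1 - a)))" using r1 by simp
      then have "epow (ennreal (2 powr (- (real j * (r * (1 - a)))))) ?q = ?c j"
        by (simp only: epow_ennreal powr_ge_zero powr_powr)
      then show "epow (ennreal (2 powr (- (real j * (r * (1 - a))))) * J (2 * t / 2 ^ j)) ?q = ?c j * Q (2 / 2 ^ j * t)"
        unfolding Q_def using q(1) by (simp add: epow_mult)
    qed
    finally have "ennreal (t powr (- ?q * ?n - 1)) * epow (osc r f t * ennreal (1 / ?V)) ?q
       \<le> ennreal (t powr (- ?q * ?n - 1)) * (ennreal ((?D * t * S) powr ?n) * (\<Sum>j. ?c j * Q (2 / 2 ^ j * t)))"
      by (rule mult_left_mono) simp
    also have "\<dots> = ennreal ((?D * S) powr ?n * t powr (\<beta> - 1)) * (\<Sum>j. ?c j * Q (2 / 2 ^ j * t))"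
    proof -
      have e1: "(?D * t * S) powr ?n = t powr ?n * (?D * S) powr ?n" by (simp add: powr_mult)
      have e2: "t powr (- ?q * ?n - 1) * t powr ?n = t powr (\<beta> - 1)"
        unfolding powr_add[symmetric] \<beta>_def by (simp add: algebra_simps)
      have "t powr (- ?q * ?n - 1) * (?D * t * S) powr ?n = (?D * S) powr ?n * t powr (\<beta> - 1)"
        unfolding e1 mult.assoc[symmetric] e2 by (rule mult.commute)
      then have "ennreal (t powr (- ?q * ?n - 1)) * ennreal ((?D * t * S) powr ?n) = ennreal ((?D * S) powr ?n * t powr (\<beta> - 1))"
        by (simp only: ennreal_mult[symmetric] powr_ge_zero)
      then show ?thesis by (simp only: mult.assoc[symmetric])
    qed
    also have "\<dots> = ennreal ((?D * S) powr ?n) * (\<Sum>j. ?c j * (ennreal (t powr (\<beta> - 1)) * Q (2 / 2 ^ j * t)))"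
    proof -
      have "(\<Sum>j. ?c j * (ennreal (t powr (\<beta> - 1)) * Q (2 / 2 ^ j * t))) = (\<Sum>j. ennreal (t powr (\<beta> - 1)) * (?c j * Q (2 / 2 ^ j * t)))"
        by (simp only: mult_ac)
      also have "\<dots> = ennreal (t powr (\<beta> - 1)) * (\<Sum>j. ?c j * Q (2 / 2 ^ j * t))" by (rule ennreal_suminf_cmult)
      finally show ?thesis by (simp only: ennreal_mult powr_ge_zero mult.assoc)
    qed
    finally show ?thesis using t by simp
  qed simp
  have "besov_ext r f \<le> (\<integral>\<^sup>+t. ennreal ((?D * S) powr ?n) * (\<Sum>j. ?c j * (ennreal (t powr (\<beta> - 1)) * Q (2 / 2 ^ j * t) * indicator {0<..} t)) \<partial>lborel)"
    unfolding besov_ext_def by (intro nn_integral_mono pt)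
  also have "\<dots> = ennreal ((?D * S) powr ?n) * (\<integral>\<^sup>+t. (\<Sum>j. ?c j * (ennreal (t powr (\<beta> - 1)) * Q (2 / 2 ^ j * t) * indicator {0<..} t)) \<partial>lborel)"
    by (rule nn_integral_cmult) measurable
  also have "(\<integral>\<^sup>+t. (\<Sum>j. ?c j * (ennreal (t powr (\<beta> - 1)) * Q (2 / 2 ^ j * t) * indicator {0<..} t)) \<partial>lborel)
     = (\<Sum>j. ?c j * (\<integral>\<^sup>+t. ennreal (t powr (\<beta> - 1)) * Q (2 / 2 ^ j * t) * indicator {0<..} t \<partial>lborel))"
    by (subst nn_integral_suminf, measurable) (intro suminf_cong nn_integral_cmult, measurable)
  also have "\<dots> \<le> (\<Sum>j. ennreal (2 powr (- (real j * a))) * (ennreal (avg_const TYPE('a) / (1 - ?q)) * ?P))"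
  proof (intro suminf_le)
    fix j
    have "(\<integral>\<^sup>+t. ennreal (t powr (\<beta> - 1)) * Q (2 / 2 ^ j * t) * indicator {0<..} t \<partial>lborel)
       = ennreal ((2 / 2 ^ j) powr (- \<beta>)) * (\<integral>\<^sup>+t. ennreal (t powr (\<beta> - 1)) * Q t * indicator {0<..} t \<partial>lborel)"
      by (rule nn_integral_power_scale) auto
    also have "\<dots> \<le> ennreal (2 powr (real j * \<beta>)) * (ennreal (avg_const TYPE('a) / (1 - ?q)) * ?P)"
    proof (intro mult_mono ennreal_leI)
      have \<beta>0: "\<beta> > 0" unfolding \<beta>_def using n q by simp
      have "(2 / 2 ^ j :: real) powr (- \<beta>) = 2 powr (- \<beta>) * 2 powr (real j * \<beta>)"
        by (simp add: powr_divide powr_realpow[symmetric] powr_powr powr_minus_divide)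
      also have "\<dots> \<le> 1 * 2 powr (real j * \<beta>)"
        using \<beta>0 powr_mono[of "- \<beta>" 0 2] by (intro mult_right_mono) auto
      finally show "(2 / 2 ^ j :: real) powr (- \<beta>) \<le> 2 powr (real j * \<beta>)" by simp
      show "(\<integral>\<^sup>+t. ennreal (t powr (\<beta> - 1)) * Q t * indicator {0<..} t \<partial>lborel) \<le> ennreal (avg_const TYPE('a) / (1 - ?q)) * ?P"
        unfolding Q_def J_def \<beta>_def by (intro avg_integral_le n2 r) measurable
    qed auto
    finally have "?c j * (\<integral>\<^sup>+t. ennreal (t powr (\<beta> - 1)) * Q (2 / 2 ^ j * t) * indicator {0<..} t \<partial>lborel)
       \<le> ?c j * (ennreal (2 powr (real j * \<beta>)) * (ennreal (avg_const TYPE('a) / (1 - ?q)) * ?P))"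
      by (rule mult_left_mono) simp
    also have "\<dots> = ennreal (2 powr (- (real j * (?n * (1 - a))) + real j * \<beta>)) * (ennreal (avg_const TYPE('a) / (1 - ?q)) * ?P)"
      by (simp only: powr_add ennreal_mult powr_ge_zero mult.assoc)
    also have "\<dots> \<le> ennreal (2 powr (- (real j * a))) * (ennreal (avg_const TYPE('a) / (1 - ?q)) * ?P)"
    proof (intro mult_right_mono ennreal_leI powr_mono)
      have "- (real j * (?n * (1 - a))) + real j * \<beta> = - (?n * (real j * a))"
        unfolding \<beta>_def a(2) by (simp add: algebra_simps)
      also have "\<dots> \<le> - (1 * (real j * a))"
        using n a mult_right_mono[of 1 ?n "real j * a"] by simp
      finally show "- (real j * (?n * (1 - a))) + real j * \<beta> \<le> - (real j * a)" by simp
    qed auto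
    finally show "?c j * (\<integral>\<^sup>+t. ennreal (t powr (\<beta> - 1)) * Q (2 / 2 ^ j * t) * indicator {0<..} t \<partial>lborel)
      \<le> ennreal (2 powr (- (real j * a))) * (ennreal (avg_const TYPE('a) / (1 - ?q)) * ?P)" .
  qed auto
  also have "\<dots> = (\<Sum>j. ennreal (2 powr (- (real j * a)))) * (ennreal (avg_const TYPE('a) / (1 - ?q)) * ?P)"
    by (rule ennreal_suminf_multc)
  also have "(\<Sum>j. ennreal (2 powr (- (real j * a)))) = ennreal S"
  proof -
    have "2 powr (- (real j * a)) = (2 powr (- a)) ^ j" for j
      by (simp add: powr_realpow[symmetric] powr_powr mult.commute)
    moreover have "(\<Sum>j. ennreal ((2 powr (- a)) ^ j)) = ennreal S"
      unfolding S using b1 by (intro suminf_ennreal_eq geometric_sums) auto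
    ultimately show ?thesis by simp
  qed
  finally have "besov_ext r f \<le> ennreal ((?D * S) powr ?n) * (ennreal S * (ennreal (avg_const TYPE('a) / (1 - ?q)) * ?P))"
    by (simp add: mult_left_mono)
  also have "\<dots> = ennreal (embed_const TYPE('a) S / (1 - ?q)) * ?P"
  proof -
    have nn: "0 \<le> (?D * S) powr ?n" "0 \<le> S" "0 \<le> avg_const TYPE('a) / (1 - ?q)"
      using S1 q avg_const_pos[where 'a='a] by auto
    have "embed_const TYPE('a) S / (1 - ?q) = (?D * S) powr ?n * (S * (avg_const TYPE('a) / (1 - ?q)))"
      unfolding embed_const_def by simp
    then have "ennreal (embed_const TYPE('a) S / (1 - ?q)) = ennreal ((?D * S) powr ?n) * (ennreal S * ennreal (avg_const TYPE('a) / (1 - ?q)))"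
      by (simp only: ennreal_mult[OF nn(1) mult_nonneg_nonneg[OF nn(2,3)]] ennreal_mult[OF nn(2,3)])
    then show ?thesis by (simp only: mult.assoc)
  qed
  finally show ?thesis .
qed

text \<open>Membership in the Sobolev space supplies only the n-th power of \<open>f\<close>. If
  \<open>osc r f\<close> were infinite at the support radius it would be infinite at all larger
  radii, contradicting the finite bound for \<open>besov_ext\<close>; and finite oscillation at that
  radius bounds the \<open>L^r\<close> norm by \<open>osc_ge_of_small_support\<close>.\<close>

lemma Lp_finite_of_weak_grad:
  assumes V: "emeasure lborel {x. f x \<noteq> 0} = ennreal V" "V > 0"
    and P: "(\<integral>\<^sup>+y. epow (ennreal (norm (v y))) (real DIM('a)) \<partial>lborel) < \<infinity>"
  shows "Lp_pow r f < \<infinity>"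
proof -
  let ?n = "real DIM('a)" and ?q = "real DIM('a) / r"
  have fm [measurable]: "f \<in> borel_measurable borel" using f by auto
  have n: "?n \<ge> 2" using n2 by simp
  have r1: "r > 0" using r n by linarith
  have q: "0 < ?q" using r1 n by auto
  have fin: "besov_ext r f < \<infinity>"
    using besov_ext_le P by (auto intro: le_less_trans simp: ennreal_mult_less_top)
  define R where "R = supp_radius f"
  have R: "R > 0" unfolding R_def by (rule supp_radius_pos[OF fm V])
  have "osc r f R < \<infinity>"
  proof (rule ccontr)
    assume "\<not> osc r f R < \<infinity>"
    then have "osc r f R = top" using top.not_eq_extremum by fastforce
    then have inf: "osc r f t = \<infinity>" if "t \<ge> R" for t using osc_mono[OF that, of r f] by (simp add: top_unique)
    have "(\<integral>\<^sup>+t. \<infinity> * indicator {R..2 * R} t \<partial>lborel) \<le> besov_ext r f"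
      unfolding besov_ext_def
    proof (intro nn_integral_mono)
      fix t
      show "\<infinity> * indicator {R..2 * R} t \<le> ennreal (t powr (- ?q * ?n - 1)) *
         epow (osc r f t * ennreal (1 / (t ^ DIM('a) * ball_vol TYPE('a)))) ?q * indicator {0<..} t"
      proof (cases "t \<in> {R..2 * R}")
        case True
        then have t: "t > 0" "t \<ge> R" using R by auto
        have V0: "1 / (t ^ DIM('a) * ball_vol TYPE('a)) > 0" using t ball_vol_pos[where 'a='a] by simp
        have "osc r f t * ennreal (1 / (t ^ DIM('a) * ball_vol TYPE('a))) = \<infinity>"
        proof -
          have "ennreal (1 / (t ^ DIM('a) * ball_vol TYPE('a))) \<noteq> 0"
            using V0 by (subst ennreal_eq_0_iff) linarith
          then show ?thesis unfolding inf[OF t(2)] by (simp only: ennreal_top_mult infinity_ennreal_def if_False)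
        qed
        then have "epow (osc r f t * ennreal (1 / (t ^ DIM('a) * ball_vol TYPE('a)))) ?q = \<infinity>" by (simp only: epow_top)
        then show ?thesis using t by (simp add: ennreal_mult_top)
      qed simp
    qed
    moreover have "(\<integral>\<^sup>+t. \<infinity> * indicator {R..2 * R} t \<partial>lborel) = \<infinity>"
      using R by (subst nn_integral_cmult_indicator) (auto simp: ennreal_top_mult)
    ultimately show False using fin by (simp add: top_unique)
  qed
  moreover have "ennreal V * Lp_pow r f \<le> osc r f R"
  proof -
    have "emeasure lborel (ball (0::'a) R) = ennreal (2 * V)"
      using supp_radius_pow[OF fm V] R by (subst emeasure_lborel_ball_eq) (auto simp: R_def)
    then have "ennreal (2 * V / 2) * (\<integral>\<^sup>+x. ennreal (\<bar>f x\<bar> powr r) \<partial>lborel) \<le> osc r f R"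
      using V by (intro osc_ge_of_small_support) auto
    then show ?thesis by (simp add: Lp_pow_lborel)
  qed
  ultimately have "ennreal V * Lp_pow r f < \<infinity>" by (rule le_less_trans[rotated])
  then show ?thesis using V(2) by (auto simp: ennreal_mult_less_top)
qed

end

lemma integral_lebesgue_eq_lborel:
  fixes f g :: "'a::euclidean_space \<Rightarrow> real"
  assumes "f \<in> borel_measurable lebesgue" "g \<in> borel_measurable borel" "AE x in lborel. f x = g x"
  shows "integral\<^sup>L lebesgue f = integral\<^sup>L lborel g"
proof -
  have "g \<in> borel_measurable lebesgue" using assms(2) by (intro measurable_completion) simp
  then have "integral\<^sup>L lebesgue f = integral\<^sup>L lebesgue g"
    using assms AE_completion[OF assms(3)] by (intro integral_cong_AE) auto
  also have "\<dots> = integral\<^sup>L lborel g" using assms(2) by (intro integral_completion) simp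
  finally show ?thesis .
qed

lemma integrable_lebesgue_iff_lborel:
  fixes f g :: "'a::euclidean_space \<Rightarrow> real"
  assumes "f \<in> borel_measurable lebesgue" "g \<in> borel_measurable borel" "AE x in lborel. f x = g x"
  shows "integrable lebesgue f \<longleftrightarrow> integrable lborel g"
proof -
  have "g \<in> borel_measurable lebesgue" using assms(2) by (intro measurable_completion) simp
  then have "integrable lebesgue f \<longleftrightarrow> integrable lebesgue g"
    using assms AE_completion[OF assms(3)] by (intro integrable_cong_AE) auto
  also have "\<dots> \<longleftrightarrow> integrable lborel g" using assms(2) by (intro integrable_completion) simp
  finally show ?thesis .
qed

text \<open>Replaces \<open>f\<close> and its weak gradient by Borel representatives, so that Fubini
  and translation arguments for \<open>lborel\<close> apply.\<close>

lemma weak_grad_borel: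
  fixes f f' :: "'a::euclidean_space \<Rightarrow> real"
  assumes wg: "weak_grad f g" and f: "f \<in> borel_measurable lebesgue" and f': "f' \<in> borel_measurable borel"
    and ff': "AE x in lborel. f x = f' x"
  obtains v where "v \<in> borel_measurable borel" "AE x in lborel. g x = v x"
    "\<And>i K. i \<in> Basis \<Longrightarrow> compact K \<Longrightarrow> set_integrable lborel K (\<lambda>x. v x \<bullet> i)"
    "\<And>\<phi> i. smooth \<phi> \<Longrightarrow> compact_supp \<phi> \<Longrightarrow> i \<in> Basis \<Longrightarrow>
      (\<integral>x. f' x * (grad \<phi> x \<bullet> i) \<partial>lborel) = - (\<integral>x. (v x \<bullet> i) * \<phi> x \<partial>lborel)"
proof -
  have loc: "set_integrable lebesgue K (\<lambda>x. g x \<bullet> i)" if "i \<in> Basis" "compact K" for i K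
    using wg that unfolding weak_grad_def by blast
  \<comment> \<open>\<open>weak_grad\<close> asserts only integrability on compact sets;
    measurability of a component is recovered as a pointwise limit of its restrictions to growing
    balls.\<close>
  have gm: "(\<lambda>x. g x \<bullet> i) \<in> borel_measurable lebesgue" if i: "i \<in> Basis" for i
  proof (rule borel_measurable_LIMSEQ_real)
    show "(\<lambda>x. indicator (cball 0 (real k)) x *\<^sub>R (g x \<bullet> i)) \<in> borel_measurable lebesgue" for k
      using loc[OF i compact_cball] unfolding set_integrable_def by (rule borel_measurable_integrable)
    fix x :: 'a
    obtain k0 :: nat where k0: "norm x \<le> real k0" using real_arch_simple by blast
    have "\<forall>\<^sub>F k in sequentially. indicator (cball 0 (real k)) x *\<^sub>R (g x \<bullet> i) = g x \<bullet> i"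
      unfolding eventually_sequentially using k0 by (intro exI[of _ k0]) (auto simp: indicator_def)
    then show "(\<lambda>k. indicator (cball 0 (real k)) x *\<^sub>R (g x \<bullet> i)) \<longlonglongrightarrow> g x \<bullet> i"
      by (rule tendsto_eventually)
  qed
  have "\<exists>w. w \<in> borel_measurable borel \<and> (AE x in lborel. g x \<bullet> i = w x)" if "i \<in> Basis" for i
    using lebesgue_borel_rep[OF gm[OF that]] by blast
  then obtain w where w: "\<And>i. i \<in> Basis \<Longrightarrow> w i \<in> borel_measurable borel" "\<And>i. i \<in> Basis \<Longrightarrow> AE x in lborel. g x \<bullet> i = w i x"
    by metis
  define v where "v x = (\<Sum>i\<in>Basis. w i x *\<^sub>R i)" for x
  have vi: "v x \<bullet> i = w i x" if "i \<in> Basis" for x i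
    unfolding v_def using that by (simp add: inner_sum_left inner_Basis if_distrib sum.delta cong: if_cong)
  have vm: "v \<in> borel_measurable borel"
    unfolding v_def using w(1) by (intro borel_measurable_sum borel_measurable_scaleR) auto
  have gv: "AE x in lborel. g x = v x"
  proof -
    have "AE x in lborel. \<forall>i\<in>Basis. g x \<bullet> i = w i x" using w(2) by (intro AE_finite_allI) auto
    then show ?thesis by eventually_elim (auto intro!: euclidean_eqI[where 'a='a] simp: vi)
  qed
  show ?thesis
  proof (rule that[OF vm gv])
    fix i :: 'a and K :: "'a set" assume i: "i \<in> Basis" and K: "compact K"
    have [measurable]: "K \<in> sets borel" using K by (rule borel_compact)
    have "integrable lborel (\<lambda>x. indicator K x *\<^sub>R (v x \<bullet> i))"
    proof (subst integrable_lebesgue_iff_lborel[symmetric, of "\<lambda>x. indicator K x *\<^sub>R (g x \<bullet> i)"])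
      show int: "integrable lebesgue (\<lambda>x. indicator K x *\<^sub>R (g x \<bullet> i))"
        using loc[OF i K] unfolding set_integrable_def .
      show "(\<lambda>x. indicator K x *\<^sub>R (g x \<bullet> i)) \<in> borel_measurable lebesgue" using int by (rule borel_measurable_integrable)
      show "(\<lambda>x. indicator K x *\<^sub>R (v x \<bullet> i)) \<in> borel_measurable borel" using vm by measurable
      show "AE x in lborel. indicator K x *\<^sub>R (g x \<bullet> i) = indicator K x *\<^sub>R (v x \<bullet> i)" using gv by eventually_elim simp
    qed
    then show "set_integrable lborel K (\<lambda>x. v x \<bullet> i)" unfolding set_integrable_def .
  next
    fix \<phi> :: "'a \<Rightarrow> real" and i :: 'a assume \<phi>: "smooth \<phi>" "compact_supp \<phi>" and i: "i \<in> Basis"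
    have "\<phi> \<in> Ck (Suc 0)" using \<phi>(1) unfolding smooth_def by blast
    then have [measurable]: "grad \<phi> \<in> borel_measurable borel"
      by (intro borel_measurable_continuous_onI Ck_1_continuous_grad)
    have [measurable]: "\<phi> \<in> borel_measurable borel"
      by (intro borel_measurable_continuous_onI continuous_smooth \<phi>)
    note [measurable] = f' vm
    have b1: "(\<lambda>x. grad \<phi> x \<bullet> i) \<in> borel_measurable lebesgue" "\<phi> \<in> borel_measurable lebesgue"
      by (intro measurable_completion, measurable)+
    have "(LINT x|lebesgue. f x * (grad \<phi> x \<bullet> i)) = - (LINT x|lebesgue. (g x \<bullet> i) * \<phi> x)"
      using wg \<phi> i unfolding weak_grad_def by blast
    moreover have "(LINT x|lebesgue. f x * (grad \<phi> x \<bullet> i)) = (\<integral>x. f' x * (grad \<phi> x \<bullet> i) \<partial>lborel)"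
    proof (rule integral_lebesgue_eq_lborel)
      show "(\<lambda>x. f x * (grad \<phi> x \<bullet> i)) \<in> borel_measurable lebesgue" by (intro borel_measurable_times f b1)
      show "AE x in lborel. f x * (grad \<phi> x \<bullet> i) = f' x * (grad \<phi> x \<bullet> i)" using ff' by eventually_elim simp
    qed measurable
    moreover have "(LINT x|lebesgue. (g x \<bullet> i) * \<phi> x) = (\<integral>x. (v x \<bullet> i) * \<phi> x \<partial>lborel)"
    proof (rule integral_lebesgue_eq_lborel)
      show "(\<lambda>x. g x \<bullet> i * \<phi> x) \<in> borel_measurable lebesgue" by (intro borel_measurable_times gm i b1)
      show "AE x in lborel. (g x \<bullet> i) * \<phi> x = (v x \<bullet> i) * \<phi> x" using gv by eventually_elim simp
    qed measurable
    ultimately show "(\<integral>x. f' x * (grad \<phi> x \<bullet> i) \<partial>lborel) = - (\<integral>x. (v x \<bullet> i) * \<phi> x \<partial>lborel)" by simp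
  qed
qed

text \<open>On the support \<open>norm (f x)\<close> is at most
  \<open>\<bar>f x\<bar> powr p\<close> or at most 1, according to whether it exceeds 1.\<close>

lemma integrable_of_Lp_finite_support:
  fixes f :: "'a::euclidean_space \<Rightarrow> real"
  assumes [measurable]: "f \<in> borel_measurable borel" and p: "p \<ge> 1" and L: "Lp_pow p f < \<infinity>"
    and S: "emeasure lborel {x. f x \<noteq> 0} < \<infinity>"
  shows "integrable lborel f"
proof (rule integrableI_bounded)
  have "(\<integral>\<^sup>+x. ennreal (norm (f x)) \<partial>lborel) \<le> (\<integral>\<^sup>+x. ennreal (\<bar>f x\<bar> powr p) + indicator {x. f x \<noteq> 0} x \<partial>lborel)"
  proof (intro nn_integral_mono)
    fix x
    show "ennreal (norm (f x)) \<le> ennreal (\<bar>f x\<bar> powr p) + indicator {x. f x \<noteq> 0} x"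
    proof (cases "f x = 0")
      case nz: False
      show ?thesis
      proof (cases "\<bar>f x\<bar> \<le> 1")
        case True
        then have "ennreal (norm (f x)) \<le> 1" by simp
        then show ?thesis using nz by (simp add: add_increasing)
      next
        case False
        then have "\<bar>f x\<bar> powr 1 \<le> \<bar>f x\<bar> powr p" using p by (intro powr_mono) auto
        then have "ennreal (norm (f x)) \<le> ennreal (\<bar>f x\<bar> powr p)" using False by (intro ennreal_leI) simp
        then show ?thesis by (simp add: add_increasing2)
      qed
    qed simp
  qed
  also have "\<dots> = Lp_pow p f + emeasure lborel {x. f x \<noteq> 0}"
    unfolding Lp_pow_lborel by (subst nn_integral_add) auto
  also have "\<dots> < \<infinity>" using L S by simp
  finally show "(\<integral>\<^sup>+x. ennreal (norm (f x)) \<partial>lborel) < \<infinity>" .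
qed measurable

lemma embed_const_mono:
  assumes "0 \<le> S" "S \<le> S'"
  shows "embed_const TYPE('a::euclidean_space) S \<le> embed_const TYPE('a) S'"
  unfolding embed_const_def using assms avg_const_pos[where 'a='a]
  by (intro mult_mono powr_mono2) auto

text \<open>The comparison is pointwise: the normalised Besov norm is at most the n-th root of
  \<open>embed_const\<close> times the gradient norm, and the integrands are monotone in the
  denominators. The constant depends on \<open>r0\<close> through \<open>S0\<close> alone.\<close>

lemma sobolev_MT_le_besov_MT:
  fixes f :: "'a::euclidean_space \<Rightarrow> real" and r0 :: real
  defines "S0 \<equiv> 1 / (1 - 2 powr (- (real DIM('a) / (2 * r0))))"
  assumes n2: "DIM('a) \<ge> 2" and r: "real DIM('a) < r" "r < r0"
    and W: "in_W1 (real DIM('a)) f"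
    and S: "0 < emeasure lebesgue {x. f x \<noteq> 0}" "emeasure lebesgue {x. f x \<noteq> 0} < \<infinity>"
  shows "sobolev_MT (MT_const TYPE('a) / embed_const TYPE('a) S0 powr (1 / real DIM('a))) f
    \<le> besov_MT (MT_const TYPE('a)) r f"
proof -
  let ?n = "real DIM('a)" and ?q = "real DIM('a) / r" and ?C = "embed_const TYPE('a) S0"
  define g where "g = (SOME g. weak_grad f g)"
  define P where "P = (\<integral>\<^sup>+x. ennreal (norm (g x) powr ?n) \<partial>lebesgue)"
  define G where "G = grad_norm ?n f"
  have G: "G = enn2real P powr (1 / ?n)" unfolding G_def grad_norm_def P_def g_def ..
  show ?thesis
  \<comment> \<open>Covers a vanishing gradient and also an infinite integral, which
    \<open>enn2real\<close> sends to 0; in both cases division by 0 makes the left integrand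
    0.\<close>
  proof (cases "G = 0")
    case True
    then show ?thesis unfolding sobolev_MT_def Let_def G_def[symmetric] by simp
  next
    case False
    then have "enn2real P \<noteq> 0" using G by (intro notI) simp
    then have Pn: "enn2real P > 0" using enn2real_nonneg[of P] by linarith
    have Pfin: "P < \<infinity>" and P0: "P = ennreal (enn2real P)"
    proof -
      have "P \<noteq> top" using Pn by auto
      then show "P < \<infinity>" "P = ennreal (enn2real P)" by (auto simp: less_top)
    qed
    have n: "?n \<ge> 2" using n2 by simp
    have r1: "r > 1" using r n by linarith
    have q: "0 < ?q" "?q < 1" using r r1 n by auto
    have fm: "f \<in> borel_measurable lebesgue" and fL: "Lp_pow ?n f < \<infinity>" using W unfolding in_W1_def in_Lp_def by auto
    obtain g0 where "weak_grad f g0" using W unfolding in_W1_def by blast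
    then have wg: "weak_grad f g" unfolding g_def by (rule someI[of "weak_grad f"])
    obtain f' where f': "f' \<in> borel_measurable borel" "AE x in lborel. f x = f' x"
      by (rule lebesgue_borel_rep[OF fm])
    have sup: "emeasure lebesgue {x. f x \<noteq> 0} = emeasure lborel {x. f' x \<noteq> 0}"
      by (rule emeasure_support_cong[OF f'(2) fm f'(1)])
    obtain V where V: "emeasure lborel {x. f' x \<noteq> 0} = ennreal V" "V > 0"
      using S unfolding sup by (cases "emeasure lborel {x. f' x \<noteq> 0}" rule: ennreal_cases) auto
    obtain v where v: "v \<in> borel_measurable borel" "AE x in lborel. g x = v x"
      "\<And>i K. i \<in> Basis \<Longrightarrow> compact K \<Longrightarrow> set_integrable lborel K (\<lambda>x. v x \<bullet> i)"
      "\<And>\<phi> i. smooth \<phi> \<Longrightarrow> compact_supp \<phi> \<Longrightarrow> i \<in> Basis \<Longrightarrow>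
        (\<integral>x. f' x * (grad \<phi> x \<bullet> i) \<partial>lborel) = - (\<integral>x. (v x \<bullet> i) * \<phi> x \<partial>lborel)"
      using weak_grad_borel[OF wg fm f'] by blast
    have int: "integrable lborel f'"
      using n fL V Lp_pow_cong[OF f'(2), of ?n] by (intro integrable_of_Lp_finite_support[OF f'(1), of ?n]) auto
    have PP: "(\<integral>\<^sup>+y. epow (ennreal (norm (v y))) ?n \<partial>lborel) = P"
      unfolding P_def nn_integral_completion using v(2) by (intro nn_integral_cong_AE) (auto simp: epow_ennreal)
    have Lr: "Lp_pow r f' < \<infinity>"
      by (rule Lp_finite_of_weak_grad[OF int v(1,3,4) n2 r(1) V]) (use PP Pfin in auto)
    define Sr where "Sr = 1 / (1 - 2 powr (- (?n / (2 * r))))"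
    \<comment> \<open>The geometric ratio \<open>2 powr (- (n / (2 * r)))\<close> increases with
      \<open>r\<close>, so \<open>r0\<close> gives the largest sum.\<close>
    have SS: "0 \<le> Sr" "Sr \<le> S0"
    proof -
      have "?n / (2 * r0) \<le> ?n / (2 * r)" using r r1 n by (intro divide_left_mono) auto
      then have le: "2 powr (- (?n / (2 * r))) \<le> 2 powr (- (?n / (2 * r0)))" by (intro powr_mono) auto
      have "?n / (2 * r0) > 0" using r r1 n by auto
      then have lt: "2 powr (- (?n / (2 * r0))) < 1" by (simp add: powr_less_one)
      have lt': "2 powr (- (?n / (2 * r))) < 1" using le lt by linarith
      show "0 \<le> Sr" unfolding Sr_def using lt' by simp
      show "Sr \<le> S0" unfolding Sr_def S0_def
      proof (intro divide_left_mono mult_pos_pos)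
        show "1 - 2 powr - (?n / (2 * r0)) \<le> 1 - 2 powr - (?n / (2 * r))" using le by linarith
      qed (use lt lt' in linarith)+
    qed
    have Cpos: "?C > 0"
    proof -
      have "S0 > 0"
      proof -
        have "?n / (2 * r0) > 0" using r r1 n by auto
        then have "2 powr (- (?n / (2 * r0))) < 1" by (simp add: powr_less_one)
        then show ?thesis unfolding S0_def by simp
      qed
      then show ?thesis unfolding embed_const_def using avg_const_pos[where 'a='a] by simp
    qed
    have "besov_pow ?q r ?n f' \<le> ennreal (embed_const TYPE('a) Sr / (1 - ?q)) * P"
      unfolding besov_pow_eq_ext[OF f'(1) less_imp_le[OF r1] Lr] Sr_def PP[symmetric]
      by (rule besov_ext_le[OF int v(1,3,4) n2 r(1)])
    also have "\<dots> \<le> ennreal (?C / (1 - ?q)) * P"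
      using q SS by (intro mult_right_mono ennreal_leI divide_right_mono embed_const_mono) auto
    also have "\<dots> = ennreal (?C / (1 - ?q) * enn2real P)"
      using Cpos q by (subst P0, subst ennreal_mult) auto
    finally have B: "besov_pow ?q r ?n f' \<le> ennreal (?C / (1 - ?q) * enn2real P)" .
    then have Bfin: "besov_pow ?q r ?n f' < \<infinity>" by (rule le_less_trans) simp
    have Bre: "enn2real (besov_pow ?q r ?n f') \<le> ?C / (1 - ?q) * enn2real P"
      using B Bfin Cpos q by (intro enn2real_leI) auto
    define N where "N = (1 - ?q) powr (1 / ?n) * besov_norm ?q r ?n f"
    \<comment> \<open>Without positivity the quotient on the Besov side would be 0 by the convention
      for division.\<close>
    have N0: "N > 0"
      unfolding N_def besov_norm_cong[OF f'(2)]
    proof (rule mult_pos_pos)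
      show "(1 - ?q) powr (1 / ?n) > 0" unfolding powr_gt_zero using q(2) by linarith
    qed (rule besov_norm_pos[OF n2 r(1) f'(1) V Lr Bfin])
    have NG: "N \<le> ?C powr (1 / ?n) * G"
    proof -
      have "N = ((1 - ?q) * enn2real (besov_pow ?q r ?n f')) powr (1 / ?n)"
        unfolding N_def besov_norm_def besov_pow_cong[OF f'(2)] by (rule powr_mult[symmetric])
      also have "\<dots> \<le> (?C * enn2real P) powr (1 / ?n)"
      proof (rule powr_mono2)
        have "(1 - ?q) * enn2real (besov_pow ?q r ?n f') \<le> (1 - ?q) * (?C / (1 - ?q) * enn2real P)"
          using Bre q by (intro mult_left_mono) auto
        also have "\<dots> = ?C * enn2real P" using r(1) by auto
        finally show "(1 - ?q) * enn2real (besov_pow ?q r ?n f') \<le> ?C * enn2real P" .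
        show "0 \<le> (1 - ?q) * enn2real (besov_pow ?q r ?n f')"
          using q by (intro mult_nonneg_nonneg) auto
      qed (use n in auto)
      also have "\<dots> = ?C powr (1 / ?n) * G" unfolding G by (simp add: powr_mult)
      finally show ?thesis .
    qed
    have G0: "G > 0" using G Pn by simp
    show ?thesis
      unfolding sobolev_MT_def besov_MT_def Let_def G_def[symmetric] N_def[symmetric]
    proof (intro nn_integral_mono ennreal_leI diff_right_mono)
      fix x
      have Cp: "?C powr (1 / ?n) > 0" using Cpos by simp
      have "MT_const TYPE('a) / ?C powr (1 / ?n) * \<bar>f x\<bar> / G = MT_const TYPE('a) * \<bar>f x\<bar> / (?C powr (1 / ?n) * G)"
        by simp
      also have "\<dots> \<le> MT_const TYPE('a) * \<bar>f x\<bar> / N"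
        using NG N0 MT_const_pos[where 'a='a] by (intro frac_le) auto
      finally show "exp ((MT_const TYPE('a) / ?C powr (1 / ?n) * \<bar>f x\<bar> / G) powr conj_exp ?n)
        \<le> exp ((MT_const TYPE('a) * \<bar>f x\<bar> / N) powr conj_exp ?n)"
        unfolding exp_le_cancel_iff using MT_const_pos[where 'a='a] Cp G0 n
        by (intro powr_mono2) (auto simp: conj_exp_def)
    qed
  qed
qed

subsection \<open>Rotation invariance and the constant \<open>alpha\<close>\<close>

text \<open>Uniqueness of Haar measure: both sides of the Fubini identity compute
  \<open>\<integral>\<integral> g (T x) b (y - T x)\<close>, where \<open>b\<close> is the indicator of the unit ball.\<close>

lemma nn_integral_linear_isometry:
  fixes T :: "'a::euclidean_space \<Rightarrow> 'a" and g :: "'a \<Rightarrow> ennreal"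
  assumes T: "linear T" "\<And>x. norm (T x) = norm x" "\<And>x. T (T x) = x" and g [measurable]: "g \<in> borel_measurable borel"
  shows "(\<integral>\<^sup>+x. g (T x) \<partial>lborel) = (\<integral>\<^sup>+x. g x \<partial>lborel)"
proof -
  let ?b = "indicator (ball (0::'a) 1) :: 'a \<Rightarrow> ennreal"
  have [measurable]: "T \<in> borel_measurable borel"
    using T(1) by (intro borel_measurable_continuous_onI linear_continuous_on linear_conv_bounded_linear[THEN iffD1])
  have add: "T (x + y) = T x + T y" for x y using T(1) by (rule linear_add)
  define B where "B = emeasure lborel (ball (0::'a) 1)"
  have B: "B \<noteq> 0" "B \<noteq> top"
    using ball_vol_pos[where 'a='a] unfolding B_def emeasure_lborel_ball_eq[OF zero_less_one] by auto
  have bB: "(\<integral>\<^sup>+y. ?b y \<partial>lborel) = B" by (simp add: B_def)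
  have "(\<integral>\<^sup>+x. g (T x) \<partial>lborel) * B = (\<integral>\<^sup>+x. g (T x) * (\<integral>\<^sup>+y. ?b (y + - T x) \<partial>lborel) \<partial>lborel)"
  proof -
    have "(\<integral>\<^sup>+y. ?b (y + - T x) \<partial>lborel) = B" for x
      unfolding bB[symmetric] by (rule nn_integral_lborel_translate) measurable
    then show ?thesis by (simp only: nn_integral_multc[of "\<lambda>x. g (T x)"]) (subst nn_integral_multc, measurable)
  qed
  also have "\<dots> = (\<integral>\<^sup>+x. \<integral>\<^sup>+y. g (T x) * ?b (y + - T x) \<partial>lborel \<partial>lborel)"
    by (intro nn_integral_cong nn_integral_cmult[symmetric]) measurable
  also have "\<dots> = (\<integral>\<^sup>+y. \<integral>\<^sup>+x. g (T x) * ?b (y + - T x) \<partial>lborel \<partial>lborel)"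
    by (rule lborel_pair.Fubini') measurable
  also have "\<dots> = (\<integral>\<^sup>+y. \<integral>\<^sup>+x. g (T x + y) * ?b x \<partial>lborel \<partial>lborel)"
  proof (rule nn_integral_cong)
    fix y :: 'a
    have "(\<integral>\<^sup>+x. g (T x) * ?b (y + - T x) \<partial>lborel) = (\<integral>\<^sup>+x. g (T (x + T y)) * ?b (y + - T (x + T y)) \<partial>lborel)"
      by (rule nn_integral_lborel_translate[symmetric, where f = "\<lambda>x. g (T x) * ?b (y + - T x)"]) measurable
    also have "\<dots> = (\<integral>\<^sup>+x. g (T x + y) * ?b x \<partial>lborel)"
      by (simp add: add T indicator_def)
    finally show "(\<integral>\<^sup>+x. g (T x) * ?b (y + - T x) \<partial>lborel) = (\<integral>\<^sup>+x. g (T x + y) * ?b x \<partial>lborel)" .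
  qed
  also have "\<dots> = (\<integral>\<^sup>+x. \<integral>\<^sup>+y. g (T x + y) * ?b x \<partial>lborel \<partial>lborel)"
    by (rule lborel_pair.Fubini') measurable
  also have "\<dots> = (\<integral>\<^sup>+x. (\<integral>\<^sup>+y. g y \<partial>lborel) * ?b x \<partial>lborel)"
  proof (intro nn_integral_cong)
    fix x :: 'a
    have "(\<integral>\<^sup>+y. g (T x + y) * ?b x \<partial>lborel) = (\<integral>\<^sup>+y. g (y + T x) \<partial>lborel) * ?b x"
      by (subst nn_integral_multc) (auto simp: add.commute)
    then show "(\<integral>\<^sup>+y. g (T x + y) * ?b x \<partial>lborel) = (\<integral>\<^sup>+y. g y \<partial>lborel) * ?b x"
      by (simp add: nn_integral_lborel_translate)
  qed
  also have "\<dots> = (\<integral>\<^sup>+y. g y \<partial>lborel) * B" by (simp add: nn_integral_cmult B_def)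
  finally have eq: "(\<integral>\<^sup>+x. g (T x) \<partial>lborel) * B = (\<integral>\<^sup>+y. g y \<partial>lborel) * B" .
  have "(\<integral>\<^sup>+x. g (T x) \<partial>lborel) = (\<integral>\<^sup>+x. g (T x) \<partial>lborel) * B / B"
    using B by (rule mult_divide_eq_ennreal[symmetric])
  also have "\<dots> = (\<integral>\<^sup>+y. g y \<partial>lborel)"
    unfolding eq using B by (rule mult_divide_eq_ennreal)
  finally show ?thesis .
qed

text \<open>The Householder reflection in the hyperplane orthogonal to \<open>a - b\<close>. It
  exchanges \<open>a\<close> and \<open>b\<close> when they have equal norm, and is the identity for
  \<open>a = b\<close>.\<close>

definition swap_reflection :: "'a::euclidean_space \<Rightarrow> 'a \<Rightarrow> 'a \<Rightarrow> 'a" where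
  "swap_reflection a b x = x - (2 * ((a - b) \<bullet> x) / ((a - b) \<bullet> (a - b))) *\<^sub>R (a - b)"

lemma swap_reflection:
  fixes a b :: "'a::euclidean_space"
  shows "linear (swap_reflection a b)" "norm (swap_reflection a b x) = norm x"
    "swap_reflection a b (swap_reflection a b x) = x" "y \<bullet> swap_reflection a b x = swap_reflection a b y \<bullet> x"
proof -
  define w where "w = a - b"
  have s: "swap_reflection a b x = x - (2 * (w \<bullet> x) / (w \<bullet> w)) *\<^sub>R w" for x
    unfolding swap_reflection_def w_def ..
  show "linear (swap_reflection a b)"
    unfolding s by (intro linearI) (auto simp: inner_add_right algebra_simps add_divide_distrib)
  show inv: "swap_reflection a b (swap_reflection a b x) = x" for x
    unfolding s by (cases "w = 0") (auto simp: inner_diff_right algebra_simps)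
  show adj: "y \<bullet> swap_reflection a b x = swap_reflection a b y \<bullet> x" for x y
    unfolding s by (simp add: inner_diff_right inner_diff_left inner_commute)
  show "norm (swap_reflection a b x) = norm x"
    unfolding norm_eq_sqrt_inner using adj[of "swap_reflection a b x" x] inv[of x] by simp
qed

lemma swap_reflection_swaps:
  fixes a b :: "'a::euclidean_space"
  assumes "norm a = norm b"
  shows "swap_reflection a b a = b"
proof (cases "a = b")
  case False
  have eq: "a \<bullet> a = b \<bullet> b" using assms by (simp add: norm_eq)
  have e: "2 * ((a - b) \<bullet> a) = (a - b) \<bullet> (a - b)"
    by (simp add: inner_diff_left inner_diff_right inner_commute eq)
  have "(a - b) \<bullet> (a - b) \<noteq> 0" using False by simp
  then have h: "2 * ((a - b) \<bullet> a) / ((a - b) \<bullet> (a - b)) = 1" unfolding e by (rule divide_self)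
  show ?thesis unfolding swap_reflection_def h by simp
qed (simp add: swap_reflection_def)

text \<open>A reflection carries \<open>v\<close> to \<open>norm v\<close> times \<open>e\<close>;
  it preserves the ball and Lebesgue measure and is its own adjoint.\<close>

lemma nn_integral_ball_inner:
  fixes v e :: "'a::euclidean_space"
  assumes e: "norm e = 1" and p: "p > 0"
  shows "(\<integral>\<^sup>+h. ennreal (\<bar>v \<bullet> h\<bar> powr p) * indicator (ball 0 1) h \<partial>lborel)
    = ennreal (norm v powr p) * (\<integral>\<^sup>+h. ennreal (\<bar>e \<bullet> h\<bar> powr p) * indicator (ball 0 1) h \<partial>lborel)"
proof -
  define T where "T = swap_reflection v (norm v *\<^sub>R e)"
  have Tv: "T v = norm v *\<^sub>R e" unfolding T_def using e by (intro swap_reflection_swaps) simp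
  have "(\<integral>\<^sup>+h. ennreal (\<bar>v \<bullet> h\<bar> powr p) * indicator (ball 0 1) h \<partial>lborel)
     = (\<integral>\<^sup>+h. ennreal (\<bar>v \<bullet> T h\<bar> powr p) * indicator (ball 0 1) (T h) \<partial>lborel)"
    unfolding T_def
    by (rule nn_integral_linear_isometry[symmetric, where g = "\<lambda>h. ennreal (\<bar>v \<bullet> h\<bar> powr p) * indicator (ball 0 1) h"])
       (simp_all add: swap_reflection)
  also have "\<dots> = (\<integral>\<^sup>+h. ennreal (norm v powr p) * (ennreal (\<bar>e \<bullet> h\<bar> powr p) * indicator (ball 0 1) h) \<partial>lborel)"
  proof (intro nn_integral_cong)
    fix h
    have "v \<bullet> T h = norm v * (e \<bullet> h)"
      using swap_reflection(4)[of v v "norm v *\<^sub>R e" h] Tv unfolding T_def by simp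
    then have "\<bar>v \<bullet> T h\<bar> powr p = norm v powr p * \<bar>e \<bullet> h\<bar> powr p" by (simp add: abs_mult powr_mult)
    moreover have "(indicator (ball 0 1) (T h) :: ennreal) = indicator (ball 0 1) h"
      unfolding T_def by (simp add: indicator_def swap_reflection)
    ultimately show "ennreal (\<bar>v \<bullet> T h\<bar> powr p) * indicator (ball 0 1) (T h)
      = ennreal (norm v powr p) * (ennreal (\<bar>e \<bullet> h\<bar> powr p) * indicator (ball 0 1) h)"
      by (simp add: ennreal_mult mult.assoc)
  qed
  also have "\<dots> = ennreal (norm v powr p) * (\<integral>\<^sup>+h. ennreal (\<bar>e \<bullet> h\<bar> powr p) * indicator (ball 0 1) h \<partial>lborel)"
    by (rule nn_integral_cmult) measurable
  finally show ?thesis .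
qed

text \<open>In polar coordinates this is the comparison of \<open>\<integral>\<^sub>0\<^sup>1 t\<^bsup>n-1\<^esup> dt\<close> with \<open>\<integral>\<^sub>0\<^sup>1 t\<^bsup>2n-1\<^esup> dt\<close>.\<close>

lemma ball_integral_homogeneous:
  fixes H :: "'a::euclidean_space \<Rightarrow> ennreal"
  assumes [measurable]: "H \<in> borel_measurable borel" and hom: "\<And>c x. c > 0 \<Longrightarrow> H (c *\<^sub>R x) = H x" and H1: "\<And>x. H x \<le> 1"
  shows "(\<integral>\<^sup>+x. H x * indicator (ball 0 1) x \<partial>lborel)
    = 2 * (\<integral>\<^sup>+x. ennreal (norm x ^ DIM('a)) * H x * indicator (ball 0 1) x \<partial>lborel)"
proof -
  let ?N = "DIM('a)"
  define A where "A = (\<integral>\<^sup>+x. H x * indicator (ball 0 1) x \<partial>lborel)"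
  define \<Phi> where "\<Phi> = (\<integral>\<^sup>+x. ennreal (norm x ^ ?N) * H x * indicator (ball 0 1) x \<partial>lborel)"
  define \<Psi> where "\<Psi> = (\<integral>\<^sup>+x. ennreal (1 - norm x ^ ?N) * H x * indicator (ball 0 1) x \<partial>lborel)"
  have Afin: "A < \<infinity>"
  proof -
    have "A \<le> (\<integral>\<^sup>+x. indicator (ball (0::'a) 1) x \<partial>lborel)"
      unfolding A_def using H1 by (intro nn_integral_mono) (auto simp: indicator_def)
    also have "\<dots> < \<infinity>" using emeasure_lborel_ball_finite[of "0::'a" 1] by simp
    finally show ?thesis .
  qed
  have le1: "norm x ^ ?N \<le> 1" if "x \<in> ball 0 1" for x :: 'a using that by (simp add: power_le_one)
  have "\<Phi> + \<Psi> = (\<integral>\<^sup>+x. ennreal (norm x ^ ?N) * H x * indicator (ball 0 1) x + ennreal (1 - norm x ^ ?N) * H x * indicator (ball 0 1) x \<partial>lborel)"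
    unfolding \<Phi>_def \<Psi>_def by (rule nn_integral_add[symmetric]) measurable
  also have "\<dots> = A"
    unfolding A_def
  proof (intro nn_integral_cong)
    fix x :: 'a
    show "ennreal (norm x ^ ?N) * H x * indicator (ball 0 1) x + ennreal (1 - norm x ^ ?N) * H x * indicator (ball 0 1) x = H x * indicator (ball 0 1) x"
    proof (cases "x \<in> ball 0 1")
      case True
      have "ennreal (norm x ^ ?N) + ennreal (1 - norm x ^ ?N) = 1"
        using le1[OF True] by (simp add: ennreal_plus[symmetric] del: ennreal_plus)
      then show ?thesis using True by (simp add: distrib_right[symmetric])
    qed simp
  qed
  finally have sum: "\<Phi> + \<Psi> = A" .
  have scaled: "(\<integral>\<^sup>+x. H x * indicator (ball 0 c) x \<partial>lborel) = ennreal (c ^ ?N) * A" if c: "c > 0" for c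
  proof -
    have "(\<integral>\<^sup>+x. H x * indicator (ball 0 c) x \<partial>lborel) = ennreal (\<bar>c\<bar> ^ ?N) * (\<integral>\<^sup>+x. H (c *\<^sub>R x) * indicator (ball 0 c) (c *\<^sub>R x) \<partial>lborel)"
      using c by (intro nn_integral_lborel_scale) auto
    also have "(\<integral>\<^sup>+x. H (c *\<^sub>R x) * indicator (ball 0 c) (c *\<^sub>R x) \<partial>lborel) = A"
      unfolding A_def hom[OF c] using c by (intro nn_integral_cong) (auto simp: indicator_def)
    finally show ?thesis using c by simp
  qed
  \<comment> \<open>A layer-cake argument instead of polar coordinates:
    \<open>1 - norm x ^ n\<close> is the length of the set of u between \<open>norm x ^ n\<close>
    and 1. After Fubini the inner integral runs over the ball of radius
    \<open>u powr (1 / n)\<close> and equals \<open>u * A\<close> by homogeneity.\<close>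
  have "\<Psi> = (\<integral>\<^sup>+x. (\<integral>\<^sup>+u. H x * indicator {y. norm y ^ ?N < u} x * indicator {0<..<1} u \<partial>lborel) \<partial>lborel)"
    unfolding \<Psi>_def
  proof (intro nn_integral_cong)
    fix x :: 'a
    show "ennreal (1 - norm x ^ ?N) * H x * indicator (ball 0 1) x = (\<integral>\<^sup>+u. H x * indicator {y. norm y ^ ?N < u} x * indicator {0<..<1} u \<partial>lborel)"
    proof (cases "x \<in> ball 0 1")
      case True
      have "(\<integral>\<^sup>+u. H x * indicator {y. norm y ^ ?N < u} x * indicator {0<..<1} u \<partial>lborel) = (\<integral>\<^sup>+u. H x * indicator {norm x ^ ?N<..<1} u \<partial>lborel)"
        by (intro nn_integral_cong) (auto simp: indicator_def intro: le_less_trans[of 0 "norm x ^ ?N"])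
      also have "\<dots> = H x * ennreal (1 - norm x ^ ?N)"
        using le1[OF True] by (subst nn_integral_cmult_indicator) auto
      finally show ?thesis using True by (simp add: mult.commute)
    next
      case False
      then have "1 \<le> norm x ^ ?N" by (simp add: one_le_power)
      then have z: "H x * indicator {y. norm y ^ ?N < u} x * indicator {0<..<1} u = (0::ennreal)" for u by (auto simp: indicator_def)
      show ?thesis using False unfolding z by simp
    qed
  qed
  also have "\<dots> = (\<integral>\<^sup>+u. (\<integral>\<^sup>+x. H x * indicator {y. norm y ^ ?N < u} x * indicator {0<..<1} u \<partial>lborel) \<partial>lborel)"
    by (rule lborel_pair.Fubini') (simp add: indicator_def[of "{y. _ y}"])
  also have "\<dots> = (\<integral>\<^sup>+u. ennreal u * indicator {0..1} u * A \<partial>lborel)"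
  proof (rule nn_integral_cong_AE)
    have "AE u in lborel. u \<noteq> (0::real)" "AE u in lborel. u \<noteq> (1::real)" by (rule AE_lborel_singleton)+
    then show "AE u in lborel. (\<integral>\<^sup>+x. H x * indicator {y. norm y ^ ?N < u} x * indicator {0<..<1} u \<partial>lborel) = ennreal u * indicator {0..1} u * A"
    proof eventually_elim
      fix u :: real assume u: "u \<noteq> 0" "u \<noteq> 1"
      show "(\<integral>\<^sup>+x. H x * indicator {y. norm y ^ ?N < u} x * indicator {0<..<1} u \<partial>lborel) = ennreal u * indicator {0..1} u * A"
      proof (cases "u \<in> {0<..<1}")
        case True
        define c where "c = u powr (1 / real ?N)"
        have c: "c > 0" using True by (simp add: c_def)
        have cN: "c ^ ?N = u" using True c by (simp add: powr_realpow[symmetric]) (simp add: c_def powr_powr)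
        have "norm y ^ ?N < u \<longleftrightarrow> norm y < c" for y :: 'a
          using power_mono_iff[of c "norm y" ?N] c by (simp only: cN[symmetric] not_le[symmetric]) simp
        then have "{y::'a. norm y ^ ?N < u} = ball 0 c" by (simp only: set_eq_iff mem_Collect_eq mem_ball_0 simp_thms)
        then show ?thesis using True scaled[OF c] cN by simp
      next
        case False
        then show ?thesis using u by (auto simp: indicator_def)
      qed
    qed
  qed
  also have "\<dots> = (\<integral>\<^sup>+u. ennreal u * indicator {0..1} u \<partial>lborel) * A"
    by (rule nn_integral_multc) measurable
  also have "(\<integral>\<^sup>+u. ennreal u * indicator {0..1} u \<partial>lborel) = ennreal (1 / 2)"
  proof -
    have "(\<integral>\<^sup>+u. ennreal u * indicator {0..1} u \<partial>lborel) = ennreal (1\<^sup>2 / 2 - 0\<^sup>2 / 2)"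
      by (rule nn_integral_FTC_Icc[where F = "\<lambda>u. u\<^sup>2 / 2"]) (auto intro!: derivative_eq_intros)
    then show ?thesis by simp
  qed
  finally have \<Psi>: "\<Psi> = ennreal (1 / 2) * A" .
  obtain a where a: "A = ennreal a" "a \<ge> 0" using Afin by (cases A rule: ennreal_cases) auto
  have "\<Phi> \<le> A" using sum by (metis le_iff_add)
  then obtain b where b: "\<Phi> = ennreal b" "b \<ge> 0" using Afin by (cases \<Phi> rule: ennreal_cases) (auto simp: top_unique)
  have "b + a / 2 = a"
  proof -
    have "ennreal (b + 1 / 2 * a) = ennreal b + ennreal (1 / 2) * ennreal a"
      using a(2) b(2) by (subst ennreal_plus, simp, simp) (subst ennreal_mult, simp_all)
    also have "\<dots> = ennreal a" using sum unfolding \<Psi> a(1) b(1) .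
    finally have "b + 1 / 2 * a = a" using a(2) b(2) by (subst (asm) ennreal_inj) auto
    then show ?thesis by simp
  qed
  then have "a = 2 * b" by simp
  then have "A = 2 * \<Phi>" unfolding a(1) b(1) using b(2) by (simp add: ennreal_mult)
  then show ?thesis unfolding A_def \<Phi>_def .
qed

text \<open>By the cone construction the sphere integral is n times the integral over the ball of
  the extension homogeneous of degree 0. Restoring the factor \<open>norm x ^ n\<close> halves that
  integral, whence the divisor \<open>2 * n\<close> in \<open>gamma_const\<close>.\<close>

lemma alpha_eq_ball_integral:
  fixes e :: "'a::euclidean_space"
  defines "e \<equiv> (SOME e. e \<in> Basis)"
  shows "(\<integral>\<^sup>+h. ennreal (\<bar>e \<bullet> h\<bar> powr real DIM('a)) * indicator (ball 0 1) h \<partial>lborel)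
      = ennreal (alpha TYPE('a) (real DIM('a)) / (2 * real DIM('a)))"
    and "alpha TYPE('a) (real DIM('a)) > 0"
proof -
  let ?n = "real DIM('a)" and ?N = "DIM('a)"
  define I0 where "I0 = (\<integral>\<^sup>+h. ennreal (\<bar>e \<bullet> h\<bar> powr ?n) * indicator (ball 0 1) h \<partial>lborel)"
  define H where "H x = ennreal (\<bar>e \<bullet> (x /\<^sub>R norm x)\<bar> powr ?n)" for x :: 'a
  have eB: "e \<in> Basis" unfolding e_def using nonempty_Basis some_in_eq by blast
  have e1: "norm e = 1" using eB by simp
  have n: "?n > 0" by simp
  have [measurable]: "H \<in> borel_measurable borel" unfolding H_def by measurable
  have H1: "H x \<le> 1" for x
  proof -
    have "\<bar>e \<bullet> (x /\<^sub>R norm x)\<bar> \<le> norm e * norm (x /\<^sub>R norm x)" by (rule Cauchy_Schwarz_ineq2)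
    also have "\<dots> \<le> 1" using e1 by (cases "x = 0") simp_all
    finally have "\<bar>e \<bullet> (x /\<^sub>R norm x)\<bar> powr ?n \<le> 1 powr ?n" by (intro powr_mono2) auto
    then show ?thesis unfolding H_def by simp
  qed
  have hom: "H (c *\<^sub>R x) = H x" if "c > 0" for c x
  proof -
    have "(c *\<^sub>R x) /\<^sub>R norm (c *\<^sub>R x) = x /\<^sub>R norm x" using that by simp
    then show ?thesis unfolding H_def by (simp only:)
  qed
  have HI: "ennreal (norm x ^ ?N) * H x = ennreal (\<bar>e \<bullet> x\<bar> powr ?n)" for x
  proof (cases "x = 0")
    case False
    have "norm x ^ ?N = norm x powr ?n" using False by (simp add: powr_realpow)
    moreover have "norm x powr ?n * \<bar>e \<bullet> (x /\<^sub>R norm x)\<bar> powr ?n = \<bar>e \<bullet> x\<bar> powr ?n"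
    proof -
      have "norm x * \<bar>e \<bullet> (x /\<^sub>R norm x)\<bar> = \<bar>e \<bullet> x\<bar>" using False by (simp add: abs_mult field_simps)
      then show ?thesis by (simp only: powr_mult[symmetric])
    qed
    ultimately show ?thesis unfolding H_def by (simp add: ennreal_mult[symmetric])
  qed (simp add: H_def)
  have A: "(\<integral>\<^sup>+x. H x * indicator (ball 0 1) x \<partial>lborel) = 2 * I0"
    using ball_integral_homogeneous[of H] hom H1 unfolding I0_def HI by auto
  have I0fin: "I0 < \<infinity>"
  proof -
    have "I0 \<le> 2 * I0" by (simp add: mult_2 add_increasing)
    also have "\<dots> \<le> (\<integral>\<^sup>+x. indicator (ball (0::'a) 1) x \<partial>lborel)"
      unfolding A[symmetric] using H1 by (intro nn_integral_mono) (auto simp: indicator_def)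
    also have "\<dots> < \<infinity>" using emeasure_lborel_ball_finite[of "0::'a" 1] by simp
    finally show ?thesis .
  qed
  have al: "alpha TYPE('a) ?n = enn2real (of_nat ?N * (2 * I0))"
  proof -
    let ?M = "restrict_space lebesgue (ball 0 1 - {0::'a})"
    have pm [measurable]: "(\<lambda>x::'a. x /\<^sub>R norm x) \<in> measurable ?M borel"
    proof -
      have "(\<lambda>x::'a. x /\<^sub>R norm x) \<in> borel_measurable borel" by measurable
      then have "(\<lambda>x::'a. x /\<^sub>R norm x) \<in> borel_measurable lebesgue" by (intro measurable_completion) simp
      then show ?thesis by (rule measurable_restrict_space1)
    qed
    have fm: "(\<lambda>\<xi>::'a. \<bar>e \<bullet> \<xi>\<bar> powr ?n) \<in> borel_measurable borel" by measurable
    have sm: "sets (sphere_measure :: 'a measure) = sets borel"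
      unfolding sphere_measure_def by simp
    have "alpha TYPE('a) ?n = enn2real (\<integral>\<^sup>+\<xi>. ennreal (\<bar>e \<bullet> \<xi>\<bar> powr ?n) \<partial>(sphere_measure :: 'a measure))"
      unfolding alpha_def e_def[symmetric]
    proof (rule integral_eq_nn_integral)
      show "(\<lambda>\<xi>. \<bar>e \<bullet> \<xi>\<bar> powr ?n) \<in> borel_measurable (sphere_measure :: 'a measure)"
        unfolding measurable_cong_sets[OF sm refl] by (rule fm)
    qed auto
    also have "(\<integral>\<^sup>+\<xi>. ennreal (\<bar>e \<bullet> \<xi>\<bar> powr ?n) \<partial>(sphere_measure :: 'a measure))
       = of_nat ?N * (\<integral>\<^sup>+\<xi>. ennreal (\<bar>e \<bullet> \<xi>\<bar> powr ?n) \<partial>distr ?M borel (\<lambda>x. x /\<^sub>R norm x))"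
      unfolding sphere_measure_def by (rule nn_integral_scale_measure) (use fm in auto)
    also have "(\<integral>\<^sup>+\<xi>. ennreal (\<bar>e \<bullet> \<xi>\<bar> powr ?n) \<partial>distr ?M borel (\<lambda>x. x /\<^sub>R norm x)) = (\<integral>\<^sup>+x. H x \<partial>?M)"
      unfolding H_def by (rule nn_integral_distr[OF pm]) (use fm in auto)
    also have "\<dots> = (\<integral>\<^sup>+x. H x * indicator (ball 0 1 - {0}) x \<partial>lebesgue)"
      by (rule nn_integral_restrict_space) auto
    also have "\<dots> = (\<integral>\<^sup>+x. H x * indicator (ball 0 1) x \<partial>lborel)"
      unfolding nn_integral_completion
    proof (rule nn_integral_cong_AE)
      have "AE x in lborel. x \<noteq> (0::'a)" by (rule AE_lborel_singleton)
      then show "AE x in lborel. H x * indicator (ball 0 1 - {0}) x = H x * indicator (ball 0 1) x"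
        by eventually_elim (auto simp: indicator_def)
    qed
    also have "\<dots> = 2 * I0" by (rule A)
    finally show ?thesis .
  qed
  obtain i where i: "I0 = ennreal i" "i \<ge> 0" using I0fin by (cases I0 rule: ennreal_cases) auto
  have al': "alpha TYPE('a) ?n = 2 * ?n * i"
  proof -
    have "of_nat ?N * (2 * I0) = ennreal (?n * (2 * i))"
      unfolding i(1) using i(2) by (simp add: ennreal_mult ennreal_of_nat_eq_real_of_nat)
    then show ?thesis unfolding al using i(2) by simp
  qed
  then show "(\<integral>\<^sup>+h. ennreal (\<bar>e \<bullet> h\<bar> powr ?n) * indicator (ball 0 1) h \<partial>lborel) = ennreal (alpha TYPE('a) ?n / (2 * ?n))"
    unfolding I0_def[symmetric] i(1) by simp
  \<comment> \<open>Otherwise almost every point of the open ball, hence by closedness every point,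
    would lie in the hyperplane orthogonal to \<open>e\<close>; half of \<open>e\<close> does
    not.\<close>
  have "I0 \<noteq> 0"
  proof
    assume "I0 = 0"
    then have "AE h in lborel. ennreal (\<bar>e \<bullet> h\<bar> powr ?n) * indicator (ball 0 1) h = 0"
      unfolding I0_def by (subst (asm) nn_integral_0_iff_AE) auto
    then have "AE h in lebesgue. h \<in> ball 0 1 \<longrightarrow> h \<in> {h. e \<bullet> h = 0}"
      by (intro AE_completion) (auto simp: indicator_def elim!: eventually_mono split: if_splits)
    then have "AE h\<in>ball 0 1 in lebesgue. h \<in> {h. e \<bullet> h = 0}" by simp
    from mem_closed_if_AE_lebesgue_open[OF open_ball closed_hyperplane this, of "(1/2) *\<^sub>R e"]
    show False using e1 eB by simp
  qed
  then have "i > 0" using i by (simp add: less_le)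
  then show "alpha TYPE('a) ?n > 0" unfolding al' by simp
qed

subsection \<open>The weak gradient of a C1 function\<close>

lemma C1_lipschitz:
  fixes f :: "'a::euclidean_space \<Rightarrow> real"
  assumes f: "f \<in> Ck (Suc 0)" and C: "\<And>x. norm (grad f x) \<le> C"
  shows "\<bar>f (x + h) - f x\<bar> \<le> C * norm h"
proof -
  have d: "f differentiable (at y)" for y using f by simp
  have "norm (f (x + h) - f x) \<le> C * norm (x + h - x)"
  proof (rule differentiable_bound[OF convex_UNIV])
    show "(f has_derivative (\<lambda>h. grad f y \<bullet> h)) (at y within UNIV)" for y
      using has_derivative_grad[OF d] by simp
    show "onorm (\<lambda>h. grad f y \<bullet> h) \<le> C" for y
    proof (rule onorm_le)
      fix h
      have "norm (grad f y \<bullet> h) \<le> norm (grad f y) * norm h" by (rule Cauchy_Schwarz_ineq2[folded real_norm_def])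
      also have "\<dots> \<le> C * norm h" by (intro mult_right_mono C) auto
      finally show "norm (grad f y \<bullet> h) \<le> C * norm h" .
    qed
  qed auto
  then show ?thesis by simp
qed

lemma compact_supp_bounded:
  assumes "compact_supp f"
  shows "\<exists>R>0. (\<forall>x. f x \<noteq> 0 \<longrightarrow> norm x \<le> R) \<and> (\<forall>x\<in>closure {x. f x \<noteq> 0}. norm x \<le> R)"
proof -
  obtain R where R: "\<And>x. x \<in> closure {x. f x \<noteq> 0} \<Longrightarrow> norm x \<le> R"
    using compact_imp_bounded[OF assms[unfolded compact_supp_def]] bounded_iff by metis
  have 1: "norm x \<le> max R 1" if "x \<in> closure {x. f x \<noteq> 0}" for x using R[OF that] by simp
  moreover have "norm x \<le> max R 1" if "f x \<noteq> 0" for x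
  proof -
    have "x \<in> closure {x. f x \<noteq> 0}" by (rule subsetD[OF closure_subset]) (simp add: that)
    then show ?thesis by (rule 1)
  qed
  ultimately show ?thesis by (intro exI[of _ "max R 1"]) auto
qed

lemma difference_quotient_tendsto:
  fixes f :: "'a::euclidean_space \<Rightarrow> real"
  assumes d: "f differentiable (at x)" and t: "t \<longlonglongrightarrow> 0" "\<And>k. t k > 0"
  shows "(\<lambda>k. (f (x + t k *\<^sub>R h) - f x) / t k) \<longlonglongrightarrow> grad f x \<bullet> h"
proof -
  have "((\<lambda>s. x + s *\<^sub>R h) has_derivative (\<lambda>s. s *\<^sub>R h)) (at 0)" by (auto intro!: derivative_eq_intros)
  moreover have "(f has_derivative (\<lambda>h. grad f x \<bullet> h)) (at (x + 0 *\<^sub>R h))" using has_derivative_grad[OF d] by simp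
  ultimately have "((\<lambda>s. f (x + s *\<^sub>R h)) has_derivative (\<lambda>s. grad f x \<bullet> (s *\<^sub>R h))) (at 0)"
    by (rule has_derivative_compose)
  moreover have "(\<lambda>s. grad f x \<bullet> (s *\<^sub>R h)) = (*) (grad f x \<bullet> h)" by (simp add: fun_eq_iff)
  ultimately have "((\<lambda>s. f (x + s *\<^sub>R h)) has_real_derivative (grad f x \<bullet> h)) (at 0)"
    by (simp add: has_field_derivative_def)
  then have lim: "((\<lambda>s. (f (x + s *\<^sub>R h) - f x) / s) \<longlongrightarrow> grad f x \<bullet> h) (at 0)"
    by (simp add: DERIV_def)
  have "filterlim t (at 0) sequentially"
    using t by (auto simp: filterlim_at less_imp_neq intro!: always_eventually) (metis less_irrefl)
  from filterlim_compose[OF lim this] show ?thesis .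
qed

text \<open>Difference quotients have integral 0 by translation invariance, and they converge
  dominatedly because \<open>w\<close> is Lipschitz with compact support.\<close>

lemma integral_partial_derivative_zero:
  fixes w :: "'a::euclidean_space \<Rightarrow> real"
  assumes w: "w \<in> Ck (Suc 0)" "compact_supp w" and i: "norm i = 1"
  shows "(\<integral>x. grad w x \<bullet> i \<partial>lborel) = 0"
proof -
  obtain C where C: "C \<ge> 0" "\<And>x. norm (grad w x) \<le> C" using grad_bounded[OF w] by blast
  obtain R where R: "R > 0" and R': "\<forall>x. w x \<noteq> 0 \<longrightarrow> norm x \<le> R"
    using compact_supp_bounded[OF w(2)] by blast
  define t where "t k = 1 / real (Suc k)" for k
  have t: "t k > 0" "t k \<le> 1" for k by (auto simp: t_def)
  have tl: "t \<longlonglongrightarrow> 0" unfolding t_def by (rule LIMSEQ_Suc[OF lim_1_over_n])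
  have cont: "continuous_on UNIV w" using Ck_Suc_subset[OF w(1)] by simp
  have [measurable]: "w \<in> borel_measurable borel" using cont by (rule borel_measurable_continuous_onI)
  have [measurable]: "grad w \<in> borel_measurable borel" by (intro borel_measurable_continuous_onI Ck_1_continuous_grad w)
  let ?D = "\<lambda>k x. (w (x + t k *\<^sub>R i) - w x) / t k"
  have wint: "integrable lborel w"
  proof -
    have "set_integrable lborel K (\<lambda>_::'a. 1::real)" if "compact K" for K
      unfolding set_integrable_def by (rule borel_integrable_compact[OF that continuous_on_const])
    then have "integrable lborel (\<lambda>x. 1 * w x)" by (intro compact_supp_integrable_mult[OF cont w(2)]) auto
    then show ?thesis by simp
  qed
  have D0: "(\<integral>x. ?D k x \<partial>lborel) = 0" for k
  proof -
    have wt: "integrable lborel (\<lambda>x. w (x + t k *\<^sub>R i))" "(\<integral>x. w (x + t k *\<^sub>R i) \<partial>lborel) = (\<integral>x. w x \<partial>lborel)"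
    proof -
      have "integrable (distr lborel borel ((+) (t k *\<^sub>R i))) w" using wint by (simp only: lborel_distr_plus)
      then show "integrable lborel (\<lambda>x. w (x + t k *\<^sub>R i))"
        by (subst (asm) integrable_distr_eq) (auto simp: add.commute)
      have "(\<integral>x. w x \<partial>lborel) = (\<integral>x. w x \<partial>distr lborel borel ((+) (t k *\<^sub>R i)))" by (simp only: lborel_distr_plus)
      also have "\<dots> = (\<integral>x. w (x + t k *\<^sub>R i) \<partial>lborel)" by (subst integral_distr) (auto simp: add.commute)
      finally show "(\<integral>x. w (x + t k *\<^sub>R i) \<partial>lborel) = (\<integral>x. w x \<partial>lborel)" by simp
    qed
    have "(\<integral>x. ?D k x \<partial>lborel) = (\<integral>x. w (x + t k *\<^sub>R i) - w x \<partial>lborel) / t k" by simp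
    also have "(\<integral>x. w (x + t k *\<^sub>R i) - w x \<partial>lborel) = 0"
      using wt wint by (subst Bochner_Integration.integral_diff) auto
    finally show ?thesis by simp
  qed
  have "(\<lambda>k. \<integral>x. ?D k x \<partial>lborel) \<longlonglongrightarrow> (\<integral>x. grad w x \<bullet> i \<partial>lborel)"
  proof (rule integral_dominated_convergence[where w = "\<lambda>x. C * indicator (cball (0::'a) (R + 1)) x"])
    show "integrable lborel (\<lambda>x. C * indicator (cball (0::'a) (R + 1)) x :: real)"
      using emeasure_lborel_cball_finite[of "0::'a" "R + 1"]
      by (intro integrable_mult_right integrable_real_indicator) auto
    show "AE x in lborel. (\<lambda>k. ?D k x) \<longlonglongrightarrow> grad w x \<bullet> i"
      using w(1) tl t by (intro AE_I2 difference_quotient_tendsto) auto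
    fix k
    show "AE x in lborel. norm (?D k x) \<le> C * indicator (cball (0::'a) (R + 1)) x"
    proof (rule AE_I2)
      fix x
      show "norm (?D k x) \<le> C * indicator (cball (0::'a) (R + 1)) x"
      proof (cases "norm x \<le> R + 1")
        case True
        have "\<bar>w (x + t k *\<^sub>R i) - w x\<bar> \<le> C * norm (t k *\<^sub>R i)" by (rule C1_lipschitz[OF w(1) C(2)])
        then have "\<bar>w (x + t k *\<^sub>R i) - w x\<bar> / t k \<le> C" using t[of k] i by (simp add: field_simps)
        then show ?thesis using True t[of k] by (simp add: abs_divide)
      next
        case False
        then have "w x = 0" using R' by force
        moreover have "w (x + t k *\<^sub>R i) = 0"
        proof (rule ccontr)
          assume "w (x + t k *\<^sub>R i) \<noteq> 0"
          then have "norm (x + t k *\<^sub>R i) \<le> R" using R' by blast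
          moreover have "norm x \<le> norm (x + t k *\<^sub>R i) + norm (t k *\<^sub>R i)"
            using norm_triangle_ineq4[of "x + t k *\<^sub>R i" "t k *\<^sub>R i"] by simp
          ultimately show False using False t[of k] i by simp
        qed
        ultimately show ?thesis using C(1) by simp
      qed
    qed
  qed measurable
  then show ?thesis unfolding D0 by (simp add: LIMSEQ_const_iff)
qed

lemma grad_measurable:
  fixes f :: "'a::euclidean_space \<Rightarrow> real"
  shows "f \<in> Ck (Suc 0) \<Longrightarrow> grad f \<in> borel_measurable borel"
  by (intro borel_measurable_continuous_onI Ck_1_continuous_grad)

text \<open>Integration by parts: the product \<open>f * \<phi>\<close> is again C1 with compact
  support, so its partial derivatives have integral 0.\<close>

lemma weak_grad_C1:
  fixes f :: "'a::euclidean_space \<Rightarrow> real"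
  assumes f: "f \<in> Ck (Suc 0)" "compact_supp f"
  shows "weak_grad f (grad f)"
  unfolding weak_grad_def
proof (intro conjI ballI allI impI)
  fix i :: 'a and K :: "'a set" assume i: "i \<in> Basis" and K: "compact K"
  have "continuous_on K (\<lambda>x. grad f x \<bullet> i)"
    using f i by (auto intro: continuous_on_subset)
  then have "integrable lborel (\<lambda>x. indicator K x *\<^sub>R (grad f x \<bullet> i))" by (rule borel_integrable_compact[OF K])
  then have "integrable lebesgue (\<lambda>x. indicator K x *\<^sub>R (grad f x \<bullet> i))"
    by (subst integrable_completion) auto
  then show "set_integrable lebesgue K (\<lambda>x. grad f x \<bullet> i)" unfolding set_integrable_def .
next
  fix \<phi> :: "'a \<Rightarrow> real" and i :: 'a assume \<phi>: "smooth \<phi> \<and> compact_supp \<phi>" and i: "i \<in> Basis"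
  have \<phi>1: "\<phi> \<in> Ck (Suc 0)" using \<phi> unfolding smooth_def by blast
  have cf: "continuous_on UNIV f" "continuous_on UNIV \<phi>" using Ck_Suc_subset[OF f(1)] Ck_Suc_subset[OF \<phi>1] by auto
  have df: "f differentiable (at x)" "\<phi> differentiable (at x)" for x using f(1) \<phi>1 by auto
  have cg: "continuous_on UNIV (\<lambda>x. grad f x \<bullet> i)" "continuous_on UNIV (\<lambda>x. grad \<phi> x \<bullet> i)"
    using f(1) \<phi>1 i by auto
  have loc: "set_integrable lborel K h" if "compact K" "continuous_on UNIV h" for K and h :: "'a \<Rightarrow> real"
    unfolding set_integrable_def using borel_integrable_compact[OF that(1) continuous_on_subset[OF that(2)]] by auto
  have bm: "h \<in> borel_measurable borel" if "continuous_on UNIV h" for h :: "'a \<Rightarrow> real"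
    using that by (rule borel_measurable_continuous_onI)
  have int1: "integrable lborel (\<lambda>x. (grad \<phi> x \<bullet> i) * f x)"
    by (rule compact_supp_integrable_mult[OF cf(1) f(2) loc[OF _ cg(2)] bm[OF cg(2)]])
  have int2: "integrable lborel (\<lambda>x. (grad f x \<bullet> i) * \<phi> x)"
    using \<phi> by (intro compact_supp_integrable_mult[OF cf(2) _ loc[OF _ cg(1)] bm[OF cg(1)]]) auto
  have prod: "(\<lambda>x. f x * \<phi> x) \<in> Ck (Suc 0)" by (intro Ck_mult f \<phi>1)
  have "compact_supp (\<lambda>x. f x * \<phi> x)"
  proof -
    have "closure {x. f x * \<phi> x \<noteq> 0} \<subseteq> closure {x. f x \<noteq> 0}" by (intro closure_mono) auto
    then have "closure {x. f x * \<phi> x \<noteq> 0} = closure {x. f x * \<phi> x \<noteq> 0} \<inter> closure {x. f x \<noteq> 0}" by blast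
    moreover have "compact (closure {x. f x * \<phi> x \<noteq> 0} \<inter> closure {x. f x \<noteq> 0})"
      using f(2) unfolding compact_supp_def by (intro closed_Int_compact closed_closure)
    ultimately show ?thesis unfolding compact_supp_def by argo
  qed
  then have "(\<integral>x. grad (\<lambda>x. f x * \<phi> x) x \<bullet> i \<partial>lborel) = 0"
    using i by (intro integral_partial_derivative_zero prod) auto
  moreover have "grad (\<lambda>x. f x * \<phi> x) x \<bullet> i = (grad \<phi> x \<bullet> i) * f x + (grad f x \<bullet> i) * \<phi> x" for x
    unfolding grad_mult[OF df] by (simp add: inner_add_left mult.commute)
  ultimately have "(\<integral>x. (grad \<phi> x \<bullet> i) * f x \<partial>lborel) + (\<integral>x. (grad f x \<bullet> i) * \<phi> x \<partial>lborel) = 0"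
    using int1 int2 by simp
  moreover have "(LINT x|lebesgue. f x * (grad \<phi> x \<bullet> i)) = (\<integral>x. (grad \<phi> x \<bullet> i) * f x \<partial>lborel)"
    using bm[OF cg(2)] bm[OF cf(1)] by (subst integral_completion) (auto simp: mult.commute)
  moreover have "(LINT x|lebesgue. (grad f x \<bullet> i) * \<phi> x) = (\<integral>x. (grad f x \<bullet> i) * \<phi> x \<partial>lborel)"
    using bm[OF cg(1)] bm[OF cf(2)] by (subst integral_completion) auto
  ultimately show "(LINT x|lebesgue. f x * (grad \<phi> x \<bullet> i)) = - (LINT x|lebesgue. (grad f x \<bullet> i) * \<phi> x)" by simp
qed

text \<open>Open boxes are stable under intersection and generate the Borel sets, so the vanishing
  of integrals extends to all Borel sets, once \<open>w\<close> is cut off to a bounded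
  cube.\<close>

lemma AE_eq_0_of_box_integrals:
  fixes w :: "'a::euclidean_space \<Rightarrow> real"
  assumes [measurable]: "w \<in> borel_measurable borel" and loc: "\<And>K. compact K \<Longrightarrow> set_integrable lborel K w"
    and box: "\<And>a b. (\<integral>x. indicator (box a b) x * w x \<partial>lborel) = 0"
  shows "AE x in lborel. w x = 0"
proof -
  have "AE x in lborel. indicator (box (- real k *\<^sub>R One) (real k *\<^sub>R One)) x * w x = 0" for k :: nat
  proof -
    let ?Q = "box (- real k *\<^sub>R One) (real k *\<^sub>R One) :: 'a set"
    \<comment> \<open>The cut-off makes the function globally integrable, as complements in the
      Dynkin argument require; boxes remain boxes when intersected with the cube.\<close>
    define f where "f x = indicator ?Q x * w x" for x
    have fint: "integrable lborel f"
      using loc[OF compact_cbox[of "- real k *\<^sub>R One" "real k *\<^sub>R One"]] unfolding set_integrable_def f_def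
      by (rule Bochner_Integration.integrable_bound) (auto simp: indicator_def box_subset_cbox[THEN subsetD])
    have fA: "integrable lborel (\<lambda>x. indicator A x * f x)" if "A \<in> sets borel" for A
      using fint that by (intro integrable_real_mult_indicator[unfolded mult.commute[of _ "indicator _ _"]]) auto
    let ?G = "range (\<lambda>(a, b). box a b) :: 'a set set"
    have zero: "(\<integral>x. indicator A x * f x \<partial>lborel) = 0" if A: "A \<in> sigma_sets UNIV ?G" for A
    proof (rule sigma_sets_induct_disjoint[of ?G UNIV A])
      show "Int_stable ?G" by (auto simp: Int_stable_def box_Int_box)
      have sb: "sigma_sets UNIV ?G = sets borel" by (subst borel_eq_box) simp
      show "(\<integral>x. indicator A x * f x \<partial>lborel) = 0" if AG: "A \<in> ?G" for A
      proof -
        obtain a b where A: "A = box a b" using AG by auto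
        obtain c d where cd: "box a b \<inter> ?Q = box c d" by (simp add: box_Int_box)
        have "indicator A x * f x = indicator (box c d) x * w x" for x
          unfolding f_def A cd[symmetric] by (simp add: indicator_inter_arith)
        then show ?thesis using box by simp
      qed
      show "(\<integral>x. indicator {} x * f x \<partial>lborel) = 0" by simp
      show "(\<integral>x. indicator (UNIV - A) x * f x \<partial>lborel) = 0"
        if "A \<in> sigma_sets UNIV ?G" "(\<integral>x. indicator A x * f x \<partial>lborel) = 0" for A
      proof -
        have "(\<integral>x. indicator (UNIV - A) x * f x \<partial>lborel) = (\<integral>x. f x - indicator A x * f x \<partial>lborel)"
          by (intro Bochner_Integration.integral_cong) (auto simp: indicator_def)
        also have "\<dots> = (\<integral>x. f x \<partial>lborel) - 0"
          using fint fA[of A] that sb by (subst Bochner_Integration.integral_diff) auto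
        also have "(\<integral>x. f x \<partial>lborel) = 0" unfolding f_def by (rule box)
        finally show ?thesis by simp
      qed
      show "(\<integral>x. indicator (\<Union>i. A i) x * f x \<partial>lborel) = 0"
        if d: "disjoint_family A" and A: "range A \<subseteq> sigma_sets UNIV ?G" "\<And>i. (\<integral>x. indicator (A i) x * f x \<partial>lborel) = 0"
        for A :: "nat \<Rightarrow> 'a set"
      proof -
        have Am: "A i \<in> sets lborel" for i using A(1) sb by auto
        have "(\<integral>x. indicator (\<Union>i. A i) x * f x \<partial>lborel) = (LINT x:(\<Union>i. A i)|lborel. f x)"
          unfolding set_lebesgue_integral_def by simp
        also have "\<dots> = (\<Sum>i. (LINT x:A i|lborel. f x))"
        proof (rule lebesgue_integral_countable_add[OF Am])
          show "A i \<inter> A j = {}" if "i \<noteq> j" for i j using d that by (auto simp: disjoint_family_on_def)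
          have "(\<Union>i. A i) \<in> sets borel" using Am by auto
          then show "set_integrable lborel (\<Union>i. A i) f" unfolding set_integrable_def using fA by simp
        qed
        also have "\<dots> = 0" using A(2) unfolding set_lebesgue_integral_def by simp
        finally show ?thesis .
      qed
    qed (use A in auto)
    have "sets lborel = sigma_sets UNIV ?G" by (subst sets_lborel, subst borel_eq_box) simp
    then have "AE x in lborel. f x = 0"
      using zero by (intro sigma_finite_measure.density_zero[OF sigma_finite_lborel fint]) (auto simp: set_lebesgue_integral_def)
    then show ?thesis unfolding f_def .
  qed
  then have "AE x in lborel. \<forall>k::nat. indicator (box (- real k *\<^sub>R One) (real k *\<^sub>R One)) x * w x = 0"
    unfolding AE_all_countable by blast
  then show ?thesis
  proof eventually_elim
    fix x assume x: "\<forall>k::nat. indicator (box (- real k *\<^sub>R One) (real k *\<^sub>R One)) x * w x = 0"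
    obtain k :: nat where k: "norm x < real k" using reals_Archimedean2 by blast
    have "x \<in> box (- real k *\<^sub>R One) (real k *\<^sub>R One)"
    proof (unfold mem_box, intro ballI conjI)
      fix i :: 'a assume i: "i \<in> Basis"
      then have "\<bar>x \<bullet> i\<bar> < real k" using Basis_le_norm[OF i, of x] k by linarith
      then show "- real k *\<^sub>R One \<bullet> i < x \<bullet> i" "x \<bullet> i < real k *\<^sub>R One \<bullet> i" using i by (auto simp: abs_less_iff)
    qed
    then show "w x = 0" using x by (auto simp: indicator_def)
  qed
qed

text \<open>Testing with bumps that converge to box indicators shows that the difference of the
  components integrates to 0 over every box. This gives meaning to \<open>grad_norm\<close>, which
  selects some weak gradient by choice.\<close>

lemma weak_grad_unique:
  fixes f :: "'a::euclidean_space \<Rightarrow> real"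
  assumes g: "weak_grad f g1" "weak_grad f g2" and f: "f \<in> borel_measurable borel"
  shows "AE x in lborel. g1 x = g2 x"
proof -
  have fl: "f \<in> borel_measurable lebesgue" using f by (intro measurable_completion) simp
  have ae: "AE x in lborel. f x = f x" by simp
  obtain v1 where v1: "v1 \<in> borel_measurable borel" "AE x in lborel. g1 x = v1 x"
    "\<And>i K. i \<in> Basis \<Longrightarrow> compact K \<Longrightarrow> set_integrable lborel K (\<lambda>x. v1 x \<bullet> i)"
    "\<And>\<phi> i. smooth \<phi> \<Longrightarrow> compact_supp \<phi> \<Longrightarrow> i \<in> Basis \<Longrightarrow>
      (\<integral>x. f x * (grad \<phi> x \<bullet> i) \<partial>lborel) = - (\<integral>x. (v1 x \<bullet> i) * \<phi> x \<partial>lborel)"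
    using weak_grad_borel[OF g(1) fl f ae] by blast
  obtain v2 where v2: "v2 \<in> borel_measurable borel" "AE x in lborel. g2 x = v2 x"
    "\<And>i K. i \<in> Basis \<Longrightarrow> compact K \<Longrightarrow> set_integrable lborel K (\<lambda>x. v2 x \<bullet> i)"
    "\<And>\<phi> i. smooth \<phi> \<Longrightarrow> compact_supp \<phi> \<Longrightarrow> i \<in> Basis \<Longrightarrow>
      (\<integral>x. f x * (grad \<phi> x \<bullet> i) \<partial>lborel) = - (\<integral>x. (v2 x \<bullet> i) * \<phi> x \<partial>lborel)"
    using weak_grad_borel[OF g(2) fl f ae] by blast
  have "AE x in lborel. v1 x \<bullet> i - v2 x \<bullet> i = 0" if i: "i \<in> Basis" for i
  proof (rule AE_eq_0_of_box_integrals)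
    let ?w = "\<lambda>x. v1 x \<bullet> i - v2 x \<bullet> i"
    note [measurable] = v1(1) v2(1)
    show wm: "?w \<in> borel_measurable borel" by measurable
    show loc: "set_integrable lborel K ?w" if "compact K" for K
      by (intro set_integral_diff v1 v2 i that)
    fix a b :: 'a
    have z: "(\<integral>x. ?w x * bump a b (real (Suc k)) x \<partial>lborel) = 0" for k
    proof -
      have m0: "real (Suc k) > 0" by simp
      let ?b = "bump a b (real (Suc k))"
      have cs: "compact_supp ?b" by (rule compact_supp_bump[OF m0])
      have cont: "continuous_on UNIV ?b" by (intro continuous_smooth smooth_bump)
      have "integrable lborel (\<lambda>x. (v1 x \<bullet> i) * ?b x)" "integrable lborel (\<lambda>x. (v2 x \<bullet> i) * ?b x)"
        using v1 v2 i by (intro compact_supp_integrable_mult[OF cont cs]; auto)+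
      then have "(\<integral>x. ?w x * ?b x \<partial>lborel) = (\<integral>x. (v1 x \<bullet> i) * ?b x \<partial>lborel) - (\<integral>x. (v2 x \<bullet> i) * ?b x \<partial>lborel)"
        unfolding left_diff_distrib by (rule Bochner_Integration.integral_diff)
      also have "\<dots> = 0" using v1(4)[OF smooth_bump cs i] v2(4)[OF smooth_bump cs i] by simp
      finally show ?thesis .
    qed
    have "(\<lambda>k. \<integral>x. ?w x * bump a b (real (Suc k)) x \<partial>lborel) \<longlonglongrightarrow> (\<integral>x. ?w x * indicator (box a b) x \<partial>lborel)"
    proof (rule integral_dominated_convergence[where w = "\<lambda>x. \<bar>indicator (cbox a b) x *\<^sub>R ?w x\<bar>"])
      show "integrable lborel (\<lambda>x. \<bar>indicator (cbox a b) x *\<^sub>R ?w x\<bar>)"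
        using loc[OF compact_cbox[of a b]] unfolding set_integrable_def by (rule integrable_abs)
      show "AE x in lborel. (\<lambda>k. ?w x * bump a b (real (Suc k)) x) \<longlonglongrightarrow> ?w x * indicator (box a b) x"
        by (intro AE_I2 tendsto_mult tendsto_const bump_tendsto)
      show "AE x in lborel. norm (?w x * bump a b (real (Suc k)) x) \<le> \<bar>indicator (cbox a b) x *\<^sub>R ?w x\<bar>" for k
      proof (rule AE_I2)
        fix x
        show "norm (?w x * bump a b (real (Suc k)) x) \<le> \<bar>indicator (cbox a b) x *\<^sub>R ?w x\<bar>"
        proof (cases "x \<in> box a b")
          case True
          then have "x \<in> cbox a b" using box_subset_cbox by blast
          moreover have "\<bar>?w x\<bar> * \<bar>bump a b (real (Suc k)) x\<bar> \<le> \<bar>?w x\<bar> * 1"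
            using bump_nonneg[of a b "real (Suc k)" x] bump_le_1[of a b "real (Suc k)" x] by (intro mult_left_mono) auto
          ultimately show ?thesis by (simp add: abs_mult)
        qed (simp add: bump_eq_0)
      qed
      show "(\<lambda>x. ?w x * bump a b (real (Suc k)) x) \<in> borel_measurable lborel" for k
        using borel_measurable_continuous_onI[OF continuous_smooth[OF smooth_bump[of a b "real (Suc k)"]]] by measurable
    qed measurable
    then have "(\<integral>x. ?w x * indicator (box a b) x \<partial>lborel) = 0" unfolding z by (simp add: LIMSEQ_const_iff)
    then show "(\<integral>x. indicator (box a b) x * ?w x \<partial>lborel) = 0" by (simp only: mult.commute)
  qed
  then have "AE x in lborel. \<forall>i\<in>Basis. v1 x \<bullet> i - v2 x \<bullet> i = 0" by (intro AE_finite_allI) auto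
  then show ?thesis using v1(2) v2(2)
  proof eventually_elim
    case (elim x)
    have "v1 x = v2 x" by (rule euclidean_eqI) (use elim(1) in auto)
    then show ?case using elim by simp
  qed
qed

subsection \<open>The limit as the exponent decreases to the dimension\<close>

text \<open>\<open>osc r f t\<close> after substituting \<open>t h\<close> for \<open>h\<close> and
  dividing by \<open>t powr (n + r)\<close>. The domain of \<open>h\<close> no longer depends on
  \<open>t\<close>, which makes dominated convergence applicable.\<close>

definition quot_pow :: "('a::euclidean_space \<Rightarrow> real) \<Rightarrow> real \<Rightarrow> real \<Rightarrow> ennreal" where
  "quot_pow f r t = (\<integral>\<^sup>+h. \<integral>\<^sup>+x. ennreal (\<bar>(f (x + t *\<^sub>R h) - f x) / t\<bar> powr r) * indicator (ball 0 1) h \<partial>lborel \<partial>lborel)"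

definition grad_pow :: "('a::euclidean_space \<Rightarrow> real) \<Rightarrow> ennreal" where
  "grad_pow f = (\<integral>\<^sup>+x. ennreal (norm (grad f x) powr real DIM('a)) \<partial>lborel)"

context
  fixes f :: "'a::euclidean_space \<Rightarrow> real"
  assumes f: "f \<in> Ck (Suc 0)" "compact_supp f" and n2: "DIM('a) \<ge> 2"
begin

lemma C1_compact_measurable: "f \<in> borel_measurable borel"
  using Ck_Suc_subset[OF f(1)] by (intro borel_measurable_continuous_onI) simp

lemma osc_eq_quot_pow:
  assumes t: "t > 0"
  shows "osc r f t = ennreal (t ^ DIM('a) * t powr r) * quot_pow f r t"
proof -
  note [measurable] = C1_compact_measurable borel_measurable_diff_pow[OF C1_compact_measurable]
  have "osc r f t = ennreal (\<bar>t\<bar> ^ DIM('a)) * (\<integral>\<^sup>+h. diff_pow r f (t *\<^sub>R h) * indicator (ball 0 t) (t *\<^sub>R h) \<partial>lborel)"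
    unfolding osc_def using t by (intro nn_integral_lborel_scale) auto
  also have "(\<integral>\<^sup>+h. diff_pow r f (t *\<^sub>R h) * indicator (ball 0 t) (t *\<^sub>R h) \<partial>lborel)
     = (\<integral>\<^sup>+h. ennreal (t powr r) * (\<integral>\<^sup>+x. ennreal (\<bar>(f (x + t *\<^sub>R h) - f x) / t\<bar> powr r) * indicator (ball 0 1) h \<partial>lborel) \<partial>lborel)"
  proof (rule nn_integral_cong)
    fix h :: 'a
    have "(indicator (ball 0 t) (t *\<^sub>R h) :: ennreal) = indicator (ball 0 1) h" using t by (simp add: indicator_def)
    moreover have "diff_pow r f (t *\<^sub>R h) = (\<integral>\<^sup>+x. ennreal (t powr r) * ennreal (\<bar>(f (x + t *\<^sub>R h) - f x) / t\<bar> powr r) \<partial>lborel)"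
      unfolding diff_pow_def
    proof (rule nn_integral_cong)
      fix x
      have "\<bar>f (x + t *\<^sub>R h) - f x\<bar> powr r = t powr r * \<bar>(f (x + t *\<^sub>R h) - f x) / t\<bar> powr r"
        using t by (simp add: abs_divide powr_divide)
      then show "ennreal (\<bar>f (x + t *\<^sub>R h) - f x\<bar> powr r) = ennreal (t powr r) * ennreal (\<bar>(f (x + t *\<^sub>R h) - f x) / t\<bar> powr r)"
        by (simp only: ennreal_mult powr_ge_zero)
    qed
    ultimately show "diff_pow r f (t *\<^sub>R h) * indicator (ball 0 t) (t *\<^sub>R h)
      = ennreal (t powr r) * (\<integral>\<^sup>+x. ennreal (\<bar>(f (x + t *\<^sub>R h) - f x) / t\<bar> powr r) * indicator (ball 0 1) h \<partial>lborel)"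
      by (simp add: nn_integral_cmult nn_integral_multc mult.assoc)
  qed
  also have "\<dots> = ennreal (t powr r) * quot_pow f r t"
    unfolding quot_pow_def by (rule nn_integral_cmult) measurable
  finally show ?thesis using t by (simp add: ennreal_mult mult.assoc)
qed

text \<open>Dominated convergence in \<open>(h, x)\<close> jointly: quotients are bounded by the
  Lipschitz constant and, for \<open>t \<le> 1\<close>, vanish outside a fixed ball. The limit is
  evaluated by integrating in \<open>h\<close> first. The sequences for \<open>r\<close> and
  \<open>t\<close> are independent, which later yields uniformity in both.\<close>

lemma quot_pow_tendsto:
  assumes r: "r \<longlonglongrightarrow> real DIM('a)" "\<And>k. real DIM('a) < r k" "\<And>k. r k \<le> real DIM('a) + 1"
    and t: "t \<longlonglongrightarrow> 0" "\<And>k. 0 < t k" "\<And>k. t k \<le> 1"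
  shows "(\<lambda>k. quot_pow f (r k) (t k)) \<longlonglongrightarrow> ennreal (alpha TYPE('a) (real DIM('a)) / (2 * real DIM('a))) * grad_pow f"
    and "ennreal (alpha TYPE('a) (real DIM('a)) / (2 * real DIM('a))) * grad_pow f < \<infinity>"
proof -
  let ?n = "real DIM('a)"
  note [measurable] = C1_compact_measurable grad_measurable[OF f(1)]
  obtain C where C: "C \<ge> 0" "\<And>x. norm (grad f x) \<le> C" using grad_bounded[OF f] by blast
  obtain R where R: "R > 0" and R': "\<forall>x. f x \<noteq> 0 \<longrightarrow> norm x \<le> R" "\<forall>x\<in>closure {x. f x \<noteq> 0}. norm x \<le> R"
    using compact_supp_bounded[OF f(2)] by blast
  \<comment> \<open>The maximum with 1 gives one bound for all exponents up to
    \<open>n + 1\<close>.\<close>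
  define M where "M = (max 1 C) powr (?n + 1)"
  define u where "u k p = (case p of (h, x) \<Rightarrow> ennreal (\<bar>(f (x + t k *\<^sub>R h) - f x) / t k\<bar> powr r k) * indicator (ball 0 1) h)" for k and p :: "'a \<times> 'a"
  define u' where "u' p = (case p of (h, x) \<Rightarrow> ennreal (\<bar>grad f x \<bullet> h\<bar> powr ?n) * indicator (ball 0 1) h)" for p :: "'a \<times> 'a"
  define W where "W p = (case p of (h, x) \<Rightarrow> ennreal M * indicator (ball 0 1) h * indicator (cball 0 (R + 1)) x)" for p :: "'a \<times> 'a"
  have [measurable]: "cball (0::'a) (R + 1) \<in> sets borel" by simp
  have um [measurable]: "u k \<in> borel_measurable (lborel \<Otimes>\<^sub>M lborel)" for k unfolding u_def by measurable
  have um' [measurable]: "u' \<in> borel_measurable (lborel \<Otimes>\<^sub>M lborel)" unfolding u'_def by measurable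
  have Wm [measurable]: "W \<in> borel_measurable (lborel \<Otimes>\<^sub>M lborel)" unfolding W_def by measurable
  have Wfin: "(\<integral>\<^sup>+p. W p \<partial>(lborel \<Otimes>\<^sub>M lborel)) < \<infinity>"
  proof -
    have "(\<integral>\<^sup>+p. W p \<partial>(lborel \<Otimes>\<^sub>M lborel)) = (\<integral>\<^sup>+h. \<integral>\<^sup>+x. W (h, x) \<partial>lborel \<partial>lborel)"
      by (rule lborel.nn_integral_fst[symmetric, OF Wm])
    also have "\<dots> = (\<integral>\<^sup>+h. ennreal M * emeasure lborel (cball (0::'a) (R + 1)) * indicator (ball (0::'a) 1) h \<partial>lborel)"
      unfolding W_def by (rule nn_integral_cong) (simp add: nn_integral_cmult mult_ac)
    also have "\<dots> = ennreal M * emeasure lborel (cball (0::'a) (R + 1)) * emeasure lborel (ball (0::'a) 1)"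
      by (rule nn_integral_cmult_indicator) simp
    also have "\<dots> < \<infinity>"
      using emeasure_lborel_cball_finite[of "0::'a" "R + 1"] emeasure_lborel_ball_finite[of "0::'a" 1]
      by (simp add: ennreal_mult_less_top)
    finally show ?thesis .
  qed
  have powM: "y powr q \<le> M" if "0 \<le> y" "y \<le> C" "0 \<le> q" "q \<le> ?n + 1" for y q
  proof -
    have "y powr q \<le> (max 1 C) powr q" using that by (intro powr_mono2) auto
    also have "\<dots> \<le> M" unfolding M_def using that by (intro powr_mono) auto
    finally show ?thesis .
  qed
  have bound: "u k p \<le> W p" for k p
  proof -
    obtain h x where p: "p = (h, x)" by (cases p)
    show ?thesis
    proof (cases "h \<in> ball 0 1")
      case h: True
      show ?thesis
      proof (cases "norm x \<le> R + 1")
        case True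
        have "\<bar>f (x + t k *\<^sub>R h) - f x\<bar> \<le> C * norm (t k *\<^sub>R h)" by (rule C1_lipschitz[OF f(1) C(2)])
        also have "\<dots> = t k * (C * norm h)" using t(2)[of k] by simp
        finally have "\<bar>f (x + t k *\<^sub>R h) - f x\<bar> / t k \<le> C * norm h" using t(2)[of k] by (simp add: field_simps)
        also have "\<dots> \<le> C * 1" using h C(1) by (intro mult_left_mono) auto
        finally have "\<bar>(f (x + t k *\<^sub>R h) - f x) / t k\<bar> \<le> C" using t(2)[of k] by (simp add: abs_divide)
        then have "\<bar>(f (x + t k *\<^sub>R h) - f x) / t k\<bar> powr r k \<le> M"
          using r(2,3)[of k] by (intro powM) auto
        then show ?thesis unfolding p u_def W_def using h True by (simp add: ennreal_leI)
      next
        case False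
        have "f x = 0" using R' False by force
        moreover have "f (x + t k *\<^sub>R h) = 0"
        proof (rule ccontr)
          assume "f (x + t k *\<^sub>R h) \<noteq> 0"
          then have "norm (x + t k *\<^sub>R h) \<le> R" using R' by blast
          moreover have "norm x \<le> norm (x + t k *\<^sub>R h) + norm (t k *\<^sub>R h)"
            using norm_triangle_ineq4[of "x + t k *\<^sub>R h" "t k *\<^sub>R h"] by simp
          moreover have "norm (t k *\<^sub>R h) \<le> 1 * 1" unfolding norm_scaleR using t(2,3)[of k] h by (intro mult_mono) auto
          ultimately show False using False by simp
        qed
        ultimately show ?thesis unfolding p u_def by simp
      qed
    next
      case False
      then show ?thesis unfolding p u_def by simp
    qed
  qed
  have lim: "(\<lambda>k. u k p) \<longlonglongrightarrow> u' p" for p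
  proof -
    obtain h x where p: "p = (h, x)" by (cases p)
    have "(\<lambda>k. (f (x + t k *\<^sub>R h) - f x) / t k) \<longlonglongrightarrow> grad f x \<bullet> h"
      using f(1) by (intro difference_quotient_tendsto t) auto
    then have "(\<lambda>k. \<bar>(f (x + t k *\<^sub>R h) - f x) / t k\<bar> powr r k) \<longlonglongrightarrow> \<bar>grad f x \<bullet> h\<bar> powr ?n"
      by (intro tendsto_powr' tendsto_rabs r(1)) auto
    then have "(\<lambda>k. ennreal (\<bar>(f (x + t k *\<^sub>R h) - f x) / t k\<bar> powr r k)) \<longlonglongrightarrow> ennreal (\<bar>grad f x \<bullet> h\<bar> powr ?n)"
      by (rule tendsto_ennrealI)
    then show ?thesis unfolding p u_def u'_def by (cases "h \<in> ball 0 1") simp_all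
  qed
  have conv: "(\<lambda>k. \<integral>\<^sup>+p. u k p \<partial>(lborel \<Otimes>\<^sub>M lborel)) \<longlonglongrightarrow> (\<integral>\<^sup>+p. u' p \<partial>(lborel \<Otimes>\<^sub>M lborel))"
    by (rule nn_integral_dominated_convergence[OF um um' Wm _ Wfin]) (auto simp: bound lim)
  have U: "(\<integral>\<^sup>+p. u k p \<partial>(lborel \<Otimes>\<^sub>M lborel)) = quot_pow f (r k) (t k)" for k
  proof -
    have "(\<integral>\<^sup>+p. u k p \<partial>(lborel \<Otimes>\<^sub>M lborel)) = (\<integral>\<^sup>+h. \<integral>\<^sup>+x. u k (h, x) \<partial>lborel \<partial>lborel)"
      by (rule lborel.nn_integral_fst[symmetric, OF um])
    also have "\<dots> = quot_pow f (r k) (t k)" unfolding quot_pow_def u_def prod.case ..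
    finally show ?thesis .
  qed
  have U': "(\<integral>\<^sup>+p. u' p \<partial>(lborel \<Otimes>\<^sub>M lborel)) = ennreal (alpha TYPE('a) ?n / (2 * ?n)) * grad_pow f"
  proof -
    let ?e = "SOME e::'a. e \<in> Basis"
    have e1: "norm ?e = 1" using nonempty_Basis some_in_eq norm_Basis by blast
    have "(\<integral>\<^sup>+p. u' p \<partial>(lborel \<Otimes>\<^sub>M lborel)) = (\<integral>\<^sup>+h. \<integral>\<^sup>+x. u' (h, x) \<partial>lborel \<partial>lborel)"
      by (rule lborel.nn_integral_fst[symmetric, OF um'])
    also have "\<dots> = (\<integral>\<^sup>+x. \<integral>\<^sup>+h. u' (h, x) \<partial>lborel \<partial>lborel)"
      by (rule lborel_pair.Fubini'[of "\<lambda>h x. u' (h, x)", symmetric]) simp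
    also have "\<dots> = (\<integral>\<^sup>+x. ennreal (norm (grad f x) powr ?n) * ennreal (alpha TYPE('a) ?n / (2 * ?n)) \<partial>lborel)"
    proof (rule nn_integral_cong)
      fix x
      show "(\<integral>\<^sup>+h. u' (h, x) \<partial>lborel) = ennreal (norm (grad f x) powr ?n) * ennreal (alpha TYPE('a) ?n / (2 * ?n))"
        unfolding u'_def using nn_integral_ball_inner[OF e1, of ?n "grad f x"] alpha_eq_ball_integral(1)[where 'a='a] by simp
    qed
    also have "\<dots> = ennreal (alpha TYPE('a) ?n / (2 * ?n)) * grad_pow f"
      unfolding grad_pow_def by (subst nn_integral_multc) (auto simp: mult.commute)
    finally show ?thesis .
  qed
  show "(\<lambda>k. quot_pow f (r k) (t k)) \<longlonglongrightarrow> ennreal (alpha TYPE('a) ?n / (2 * ?n)) * grad_pow f"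
    using conv unfolding U U' .
  have "ennreal (alpha TYPE('a) ?n / (2 * ?n)) * grad_pow f \<le> (\<integral>\<^sup>+p. W p \<partial>(lborel \<Otimes>\<^sub>M lborel))"
  proof (rule LIMSEQ_le_const2[OF conv[unfolded U']])
    show "\<exists>N. \<forall>k\<ge>N. (\<integral>\<^sup>+p. u k p \<partial>(lborel \<Otimes>\<^sub>M lborel)) \<le> (\<integral>\<^sup>+p. W p \<partial>(lborel \<Otimes>\<^sub>M lborel))"
      by (intro exI allI impI nn_integral_mono bound)
  qed
  then show "ennreal (alpha TYPE('a) ?n / (2 * ?n)) * grad_pow f < \<infinity>" using Wfin by (rule le_less_trans)
qed

lemma Lp_pow_bound: "\<exists>K\<ge>0. \<forall>r. 1 \<le> r \<and> r \<le> real DIM('a) + 1 \<longrightarrow> Lp_pow r f \<le> ennreal K"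
proof -
  let ?n = "real DIM('a)"
  have cont: "continuous_on UNIV f" using Ck_Suc_subset[OF f(1)] by simp
  obtain R where R: "R > 0" and R': "\<forall>x. f x \<noteq> 0 \<longrightarrow> norm x \<le> R"
    using compact_supp_bounded[OF f(2)] by blast
  have "compact (f ` cball 0 R)" using cont by (intro compact_continuous_image) (auto intro: continuous_on_subset)
  then obtain C where C: "\<And>y. y \<in> f ` cball 0 R \<Longrightarrow> norm y \<le> C" using compact_imp_bounded bounded_iff by metis
  define B where "B = (max 1 C) powr (?n + 1)"
  have B0: "B \<ge> 0" by (simp add: B_def)
  have "Lp_pow r f \<le> ennreal (B * measure lborel (cball (0::'a) R))" if r: "1 \<le> r" "r \<le> ?n + 1" for r
  proof -
    have "Lp_pow r f \<le> (\<integral>\<^sup>+x. ennreal B * indicator (cball (0::'a) R) x \<partial>lborel)"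
      unfolding Lp_pow_lborel
    proof (rule nn_integral_mono)
      fix x :: 'a
      show "ennreal (\<bar>f x\<bar> powr r) \<le> ennreal B * indicator (cball 0 R) x"
      proof (cases "x \<in> cball 0 R")
        case True
        then have "\<bar>f x\<bar> \<le> C" using C[of "f x"] by auto
        then have "\<bar>f x\<bar> powr r \<le> (max 1 C) powr r" using r by (intro powr_mono2) auto
        also have "\<dots> \<le> B" unfolding B_def using r by (intro powr_mono) auto
        finally show ?thesis using True by (simp add: ennreal_leI)
      next
        case False
        then have "f x = 0" using R' by auto
        then show ?thesis by simp
      qed
    qed
    also have "\<dots> = ennreal B * emeasure lborel (cball (0::'a) R)" by (rule nn_integral_cmult_indicator) simp
    also have "\<dots> = ennreal (B * measure lborel (cball (0::'a) R))"
      using B0 emeasure_lborel_cball_finite[of "0::'a" R] by (simp add: emeasure_eq_ennreal_measure ennreal_mult)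
    finally show ?thesis .
  qed
  then show ?thesis using B0 by (intro exI[of _ "B * measure lborel (cball (0::'a) R)"]) auto
qed

lemma C1_compact_Lp_finite: "1 \<le> r \<Longrightarrow> r \<le> real DIM('a) + 1 \<Longrightarrow> Lp_pow r f < \<infinity>"
  using Lp_pow_bound by (metis ennreal_less_top infinity_ennreal_def le_less_trans)

text \<open>A crude bound from the triangle inequality, used away from \<open>t = 0\<close>, where
  its contribution disappears after multiplication by \<open>1 - n / r\<close>.\<close>

lemma modulus_powr_bound:
  "\<exists>M\<ge>0. \<forall>r t. real DIM('a) < r \<and> r \<le> real DIM('a) + 1 \<and> 0 < t \<longrightarrow> modulus r f t powr real DIM('a) \<le> M"
proof -
  let ?n = "real DIM('a)" and ?om = "ball_vol TYPE('a)"
  obtain K where K: "K \<ge> 0" "\<And>r. 1 \<le> r \<Longrightarrow> r \<le> ?n + 1 \<Longrightarrow> Lp_pow r f \<le> ennreal K" using Lp_pow_bound by blast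
  \<comment> \<open>Being at least 1, \<open>M\<close> dominates its own power
    \<open>n / r\<close>.\<close>
  define M where "M = max 1 (2 powr (?n + 1) * K)"
  have "modulus r f t powr ?n \<le> M" if r: "?n < r" "r \<le> ?n + 1" and t: "0 < t" for r t
  proof -
    have n: "?n \<ge> 2" using n2 by simp
    have r1: "r \<ge> 1" using r n by linarith
    have V: "t ^ DIM('a) * ?om > 0" using t ball_vol_pos[where 'a='a] by simp
    have "osc r f t \<le> (\<integral>\<^sup>+h. (ennreal (2 powr r) * ennreal K) * indicator (ball (0::'a) t) h \<partial>lborel)"
      unfolding osc_def
      by (intro nn_integral_mono mult_right_mono order_trans[OF diff_pow_le[OF C1_compact_measurable r1]] mult_left_mono K r1 r) auto
    also have "\<dots> = (ennreal (2 powr r) * ennreal K) * ennreal (t ^ DIM('a) * ?om)"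
      by (subst nn_integral_cmult_indicator) (auto simp: emeasure_lborel_ball_eq[OF t])
    also have "\<dots> = ennreal (2 powr r * K * (t ^ DIM('a) * ?om))"
      using K V by (simp add: ennreal_mult)
    finally have "enn2real (osc r f t) \<le> 2 powr r * K * (t ^ DIM('a) * ?om)"
      using K V by (intro enn2real_leI) auto
    then have "enn2real (osc r f t) / (t ^ DIM('a) * ?om) \<le> 2 powr r * K" using V by (simp add: divide_le_eq)
    also have "\<dots> \<le> 2 powr (?n + 1) * K" using r K by (intro mult_right_mono powr_mono) auto
    also have "\<dots> \<le> M" by (simp add: M_def)
    finally have le: "enn2real (osc r f t) / (t ^ DIM('a) * ?om) \<le> M" .
    have "modulus r f t powr ?n = (enn2real (osc r f t) / (t ^ DIM('a) * ?om)) powr (?n / r)"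
      unfolding modulus_eq_osc[OF C1_compact_measurable r1 C1_compact_Lp_finite[OF r1 r(2)]] by (simp add: powr_powr)
    also have "\<dots> \<le> M powr (?n / r)" using le V r1 by (intro powr_mono2) auto
    also have "\<dots> \<le> M powr 1" using r r1 by (intro powr_mono) (auto simp: M_def)
    also have "\<dots> = M" by (simp add: M_def)
    finally show ?thesis .
  qed
  then show ?thesis by (intro exI[of _ M]) (auto simp: M_def)
qed

text \<open>The joint limit of \<open>(modulus r f t / t) powr n\<close> as r tends to n and t to 0;
  it is the n-th power of \<open>gamma_const\<close> times the gradient norm.\<close>

definition lim_const :: real where
  "lim_const = alpha TYPE('a) (real DIM('a)) / (2 * real DIM('a) * ball_vol TYPE('a)) * enn2real (grad_pow f)"

lemma modulus_powr_eq:
  assumes r: "real DIM('a) < r" "r \<le> real DIM('a) + 1" and t: "t > 0"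
  shows "modulus r f t powr real DIM('a) = t powr real DIM('a) * (enn2real (quot_pow f r t) / ball_vol TYPE('a)) powr (real DIM('a) / r)"
proof -
  let ?n = "real DIM('a)" and ?om = "ball_vol TYPE('a)"
  have n: "?n \<ge> 2" using n2 by simp
  have r1: "r \<ge> 1" "r > 0" using r n by linarith+
  have "enn2real (osc r f t) / (t ^ DIM('a) * ?om) = t powr r * (enn2real (quot_pow f r t) / ?om)"
    unfolding osc_eq_quot_pow[OF t] using t by (simp add: enn2real_mult)
  then have "modulus r f t powr ?n = (t powr r * (enn2real (quot_pow f r t) / ?om)) powr (?n / r)"
    unfolding modulus_eq_osc[OF C1_compact_measurable r1(1) C1_compact_Lp_finite[OF r1(1) r(2)]] by (simp add: powr_powr)
  also have "\<dots> = (t powr r) powr (?n / r) * (enn2real (quot_pow f r t) / ?om) powr (?n / r)" by (rule powr_mult)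
  also have "(t powr r) powr (?n / r) = t powr ?n" using r1 by (simp add: powr_powr)
  finally show ?thesis .
qed

text \<open>Uniformity in \<open>r\<close> and \<open>t\<close> together is derived from convergence
  along all pairs of sequences: a failure for every \<open>d = 1 / Suc k\<close> would produce
  sequences contradicting \<open>quot_pow_tendsto\<close>.\<close>

lemma ratio_close:
  assumes e: "e > 0"
  shows "\<exists>d>0. d \<le> 1 \<and> (\<forall>r t. real DIM('a) < r \<and> r < real DIM('a) + d \<and> 0 < t \<and> t \<le> d \<longrightarrow>
    \<bar>(enn2real (quot_pow f r t) / ball_vol TYPE('a)) powr (real DIM('a) / r) - lim_const\<bar> < e)"
proof (rule ccontr)
  let ?n = "real DIM('a)" and ?om = "ball_vol TYPE('a)"
  let ?y = "\<lambda>r t. (enn2real (quot_pow f r t) / ?om) powr (?n / r)"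
  assume neg: "\<not> ?thesis"
  have "\<exists>r t. ?n < r \<and> r < ?n + 1 / real (Suc k) \<and> 0 < t \<and> t \<le> 1 / real (Suc k) \<and> \<not> \<bar>?y r t - lim_const\<bar> < e" for k
  proof -
    have "1 / real (Suc k) > 0" "1 / real (Suc k) \<le> 1" by auto
    then show ?thesis using neg by blast
  qed
  then obtain r t where rt: "\<And>k. ?n < r k" "\<And>k. r k < ?n + 1 / real (Suc k)" "\<And>k. 0 < t k" "\<And>k. t k \<le> 1 / real (Suc k)"
    "\<And>k. \<not> \<bar>?y (r k) (t k) - lim_const\<bar> < e" by metis
  have n: "?n \<ge> 2" using n2 by simp
  have l0: "(\<lambda>k. 1 / real (Suc k)) \<longlonglongrightarrow> 0" by (rule LIMSEQ_Suc[OF lim_1_over_n])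
  have s1: "1 / real (Suc k) \<le> 1" for k by simp
  have ul: "(\<lambda>k. ?n + 1 / real (Suc k)) \<longlonglongrightarrow> ?n" using tendsto_add[OF tendsto_const l0, of ?n] by simp
  have rl: "r \<longlonglongrightarrow> ?n"
    by (rule tendsto_sandwich[OF _ _ tendsto_const ul]) (intro always_eventually allI less_imp_le[OF rt(1)] less_imp_le[OF rt(2)])+
  have tl: "t \<longlonglongrightarrow> 0"
    by (rule tendsto_sandwich[OF _ _ tendsto_const l0]) (intro always_eventually allI less_imp_le[OF rt(3)] rt(4))+
  have r1: "r k \<le> ?n + 1" for k using rt(2)[of k] s1[of k] by linarith
  have t1: "t k \<le> 1" for k using rt(4)[of k] s1[of k] by linarith
  note Q = quot_pow_tendsto[OF rl rt(1) r1 tl rt(3) t1]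
  have "(\<lambda>k. enn2real (quot_pow f (r k) (t k))) \<longlonglongrightarrow> enn2real (ennreal (alpha TYPE('a) ?n / (2 * ?n)) * grad_pow f)"
    using Q by (intro tendsto_enn2real) auto
  then have "(\<lambda>k. enn2real (quot_pow f (r k) (t k)) / ?om) \<longlonglongrightarrow> enn2real (ennreal (alpha TYPE('a) ?n / (2 * ?n)) * grad_pow f) / ?om"
    by (intro tendsto_divide tendsto_const) (use ball_vol_pos[where 'a='a] in auto)
  moreover have "enn2real (ennreal (alpha TYPE('a) ?n / (2 * ?n)) * grad_pow f) / ?om = lim_const"
    using alpha_eq_ball_integral(2)[where 'a='a] by (simp add: enn2real_mult lim_const_def)
  ultimately have yl: "(\<lambda>k. enn2real (quot_pow f (r k) (t k)) / ?om) \<longlonglongrightarrow> lim_const" by simp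
  have "(\<lambda>k. ?n / r k) \<longlonglongrightarrow> ?n / ?n" by (intro tendsto_divide tendsto_const rl) auto
  then have "(\<lambda>k. ?n / r k) \<longlonglongrightarrow> 1" by simp
  then have "(\<lambda>k. ?y (r k) (t k)) \<longlonglongrightarrow> lim_const powr 1"
    using ball_vol_pos[where 'a='a] by (intro tendsto_powr'[OF yl]) auto
  moreover have "lim_const powr 1 = lim_const"
    unfolding lim_const_def using alpha_eq_ball_integral(2)[where 'a='a] ball_vol_pos[where 'a='a] by simp
  ultimately have "(\<lambda>k. ?y (r k) (t k)) \<longlonglongrightarrow> lim_const" by simp
  then have "\<forall>\<^sub>F k in sequentially. \<bar>?y (r k) (t k) - lim_const\<bar> < e"
    using e by (simp add: tendsto_iff dist_real_def)
  then show False using rt(5) by (auto simp: eventually_sequentially)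
qed

end

section \<open>Concentration of the weight at t = 0 and passage to the limit\<close>

context
  fixes f :: "'a::euclidean_space \<Rightarrow> real"
  assumes f: "f \<in> Ck (Suc 0)" "compact_supp f" and n2: "DIM('a) \<ge> 2"
begin

text \<open>The integral is cut at \<open>d\<close>. Below \<open>d\<close> the integrand is a power
  of t times a factor within \<open>e\<close> of \<open>Y\<close>, and the power integrates to
  \<open>d powr b / b\<close> with \<open>b = n (1 - n / r)\<close>. Above \<open>d\<close> only the
  bound \<open>M\<close> enters, against an exponent integrable at infinity. The lower estimate
  drops the far part.\<close>

lemma besov_pow_bounds:
  fixes e d M r :: real
  defines "n \<equiv> real DIM('a)"
  assumes d: "0 < d" "d \<le> 1" and M: "M \<ge> 0" and r: "n < r" "r < n + d" and e: "e > 0"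
    and close: "\<And>t. 0 < t \<Longrightarrow> t \<le> d \<Longrightarrow> \<bar>(enn2real (quot_pow f r t) / ball_vol TYPE('a)) powr (n / r) - Y\<bar> < e"
    and bound: "\<And>t. 0 < t \<Longrightarrow> modulus r f t powr n \<le> M"
  shows "ennreal ((Y - e) * (d powr (n * (1 - n / r)) / (n * (1 - n / r)))) \<le> besov_pow (n / r) r n f"
    and "besov_pow (n / r) r n f \<le> ennreal ((Y + e) * (d powr (n * (1 - n / r)) / (n * (1 - n / r))) + M * (d powr (- (n / r * n)) / (n / r * n)))"
proof -
  let ?b = "n * (1 - n / r)" and ?s = "n / r * n"
  let ?y = "\<lambda>t. (enn2real (quot_pow f r t) / ball_vol TYPE('a)) powr (n / r)"
  have n: "n \<ge> 2" using n2 by (simp add: n_def)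
  have r0: "r > 0" and r1: "r \<le> n + 1" using r n d by linarith+
  have "n / r < 1" using r(1) r0 by simp
  then have b: "?b > 0" using n by simp
  have s: "?s > 0" using n r0 by simp
  have bs: "?b = n - ?s" by (simp add: algebra_simps)
  define I0 where "I0 = d powr ?b / ?b"
  define I1 where "I1 = d powr (- ?s) / ?s"
  have I0: "(\<integral>\<^sup>+t. ennreal (t powr (?b - 1)) * indicator {0..d} t \<partial>lborel) = ennreal I0"
    unfolding I0_def using has_integral_powr_from_0[of "?b - 1" d] b d
    by (intro nn_integral_has_integral_lebesgue') auto
  have I1: "(\<integral>\<^sup>+t. ennreal (t powr (- ?s - 1)) * indicator {d..} t \<partial>lborel) = ennreal I1"
    unfolding I1_def using has_integral_powr_to_inf[of "- ?s - 1" d] s d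
    by (intro nn_integral_has_integral_lebesgue') auto
  have nonneg: "I0 \<ge> 0" "I1 \<ge> 0" unfolding I0_def I1_def by (intro divide_nonneg_pos powr_ge_zero b s)+
  define g where "g t = t powr (- (n / r) * n) * modulus r f t powr n / t" for t
  have g_near: "g t = t powr (?b - 1) * ?y t" if t: "0 < t" for t
  proof -
    have "g t = (t powr (- ?s) * t powr n / t) * ?y t"
      unfolding g_def using modulus_powr_eq[OF f n2, of r t] r r1 t by (simp add: n_def)
    also have "t powr (- ?s) * t powr n / t = t powr (?b - 1)"
      using t unfolding bs powr_diff powr_minus by (simp add: field_simps)
    finally show ?thesis .
  qed
  have g_far: "g t \<le> M * t powr (- ?s - 1)" if t: "0 < t" for t
  proof -
    have "g t = modulus r f t powr n * t powr (- ?s - 1)"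
      unfolding g_def using t by (simp add: powr_diff)
    also have "\<dots> \<le> M * t powr (- ?s - 1)" by (intro mult_right_mono bound t) simp
    finally show ?thesis .
  qed
  have B: "besov_pow (n / r) r n f = (\<integral>\<^sup>+t. ennreal (g t) * indicator {0<..} t \<partial>lborel)"
    unfolding besov_pow_def g_def ..
  \<comment> \<open>The quantity close to \<open>Y\<close> is a nonnegative power; positivity
    permits splitting \<open>ennreal\<close> of the product.\<close>
  have Ye: "Y + e > 0"
    using close[of d] d powr_ge_zero[of "enn2real (quot_pow f r d) / ball_vol TYPE('a)" "n / r"] by linarith
  show "ennreal ((Y - e) * (d powr ?b / ?b)) \<le> besov_pow (n / r) r n f"
  proof (cases "Y - e \<ge> 0")
    case True
    have "ennreal ((Y - e) * I0) = ennreal (Y - e) * (\<integral>\<^sup>+t. ennreal (t powr (?b - 1)) * indicator {0..d} t \<partial>lborel)"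
      unfolding I0 using True nonneg by (simp add: ennreal_mult)
    also have "\<dots> = (\<integral>\<^sup>+t. ennreal (Y - e) * (ennreal (t powr (?b - 1)) * indicator {0..d} t) \<partial>lborel)"
      by (rule nn_integral_cmult[symmetric]) measurable
    also have "\<dots> \<le> (\<integral>\<^sup>+t. ennreal (g t) * indicator {0<..} t \<partial>lborel)"
    proof (rule nn_integral_mono)
      fix t :: real
      show "ennreal (Y - e) * (ennreal (t powr (?b - 1)) * indicator {0..d} t) \<le> ennreal (g t) * indicator {0<..} t"
      proof (cases "0 < t \<and> t \<le> d")
        case t: True
        then have "(Y - e) * t powr (?b - 1) \<le> t powr (?b - 1) * ?y t"
          using close[of t] by (subst mult.commute) (intro mult_left_mono, auto)
        then have "ennreal ((Y - e) * t powr (?b - 1)) \<le> ennreal (g t)"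
          unfolding g_near[OF conjunct1[OF t]] by (rule ennreal_leI)
        then show ?thesis using t True by (simp add: ennreal_mult)
      next
        case False
        then have "t = 0 \<or> t \<notin> {0..d}" by auto
        then show ?thesis by auto
      qed
    qed
    finally show ?thesis unfolding B I0_def .
  next
    case False
    then have "(Y - e) * (d powr ?b / ?b) \<le> 0" using nonneg(1) unfolding I0_def by (intro mult_nonpos_nonneg) auto
    then show ?thesis by (simp add: ennreal_neg)
  qed
  have "besov_pow (n / r) r n f \<le> (\<integral>\<^sup>+t. ennreal (Y + e) * (ennreal (t powr (?b - 1)) * indicator {0..d} t)
      + ennreal M * (ennreal (t powr (- ?s - 1)) * indicator {d..} t) \<partial>lborel)"
    unfolding B
  proof (rule nn_integral_mono)
    fix t :: real
    let ?A = "ennreal (Y + e) * (ennreal (t powr (?b - 1)) * indicator {0..d} t)"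
    let ?C = "ennreal M * (ennreal (t powr (- ?s - 1)) * indicator {d..} t)"
    consider "t \<le> 0" | "0 < t" "t \<le> d" | "0 < t" "d \<le> t" by linarith
    then show "ennreal (g t) * indicator {0<..} t \<le> ?A + ?C"
    proof cases
      case 1
      then show ?thesis by simp
    next
      case 2
      then have "t powr (?b - 1) * ?y t \<le> (Y + e) * t powr (?b - 1)"
        using close[of t] by (subst mult.commute) (intro mult_right_mono, auto)
      then have "ennreal (g t) \<le> ennreal ((Y + e) * t powr (?b - 1))"
        unfolding g_near[OF 2(1)] by (rule ennreal_leI)
      then have "ennreal (g t) * indicator {0<..} t \<le> ?A" using 2 Ye by (simp add: ennreal_mult)
      then show ?thesis by (rule order_trans) simp
    next
      case 3
      have "ennreal (g t) \<le> ennreal (M * t powr (- ?s - 1))" by (intro ennreal_leI g_far 3)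
      then have "ennreal (g t) * indicator {0<..} t \<le> ?C" using 3 M by (simp add: ennreal_mult)
      then show ?thesis by (rule order_trans) simp
    qed
  qed
  also have "\<dots> = ennreal (Y + e) * ennreal I0 + ennreal M * ennreal I1"
    by (simp add: nn_integral_add nn_integral_cmult I0[simplified] I1[simplified] I0 I1)
  also have "\<dots> = ennreal ((Y + e) * I0 + M * I1)"
    using Ye M nonneg by (simp add: ennreal_mult ennreal_plus)
  finally show "besov_pow (n / r) r n f \<le> ennreal ((Y + e) * (d powr ?b / ?b) + M * (d powr (- ?s) / ?s))"
    unfolding I0_def I1_def .
qed

text \<open>Multiplication by \<open>1 - n / r\<close> cancels the singular divisor of the near
  part, leaving \<open>(Y - e) / n\<close> and \<open>(Y + e) / n\<close> in the limit, and
  annihilates the far part. The order of choices is \<open>e\<close>, then \<open>d\<close>, then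
  \<open>r\<close> close to n.\<close>

lemma besov_pow_tendsto:
  "((\<lambda>r. (1 - real DIM('a) / r) * enn2real (besov_pow (real DIM('a) / r) r (real DIM('a)) f))
     \<longlongrightarrow> lim_const f / real DIM('a)) (at_right (real DIM('a)))"
proof -
  define n where "n = real DIM('a)"
  define Y where "Y = lim_const f"
  define L where "L r = (1 - n / r) * enn2real (besov_pow (n / r) r n f)" for r
  have n: "n \<ge> 2" using n2 by (simp add: n_def)
  obtain M where M: "M \<ge> 0" "\<And>r t. n < r \<Longrightarrow> r \<le> n + 1 \<Longrightarrow> 0 < t \<Longrightarrow> modulus r f t powr n \<le> M"
    using modulus_powr_bound[OF f n2] unfolding n_def by blast
  have lims: "((\<lambda>r. (Y + e) * (d powr (n * (1 - n / r)) / n) + (1 - n / r) * (M * (d powr (- (n / r * n)) / (n / r * n)))) \<longlongrightarrow> (Y + e) / n) (at_right n)"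
    "((\<lambda>r. (Y - e) * (d powr (n * (1 - n / r)) / n)) \<longlongrightarrow> (Y - e) / n) (at_right n)" if "d > 0" for d e
  proof -
    have id: "((\<lambda>r. r) \<longlongrightarrow> n) (at_right n)" by (rule tendsto_ident_at)
    have q: "((\<lambda>r. n / r) \<longlongrightarrow> n / n) (at_right n)" by (intro tendsto_divide tendsto_const id) (use n in simp)
    have q1: "((\<lambda>r. 1 - n / r) \<longlongrightarrow> 1 - n / n) (at_right n)" by (intro tendsto_diff tendsto_const q)
    have p: "((\<lambda>r. d powr (n * (1 - n / r))) \<longlongrightarrow> d powr (n * (1 - n / n))) (at_right n)"
      by (intro tendsto_powr tendsto_const tendsto_mult q1) (use that in simp)
    have p': "((\<lambda>r. d powr (- (n / r * n))) \<longlongrightarrow> d powr (- (n / n * n))) (at_right n)"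
      by (intro tendsto_powr tendsto_const tendsto_minus tendsto_mult q) (use that in simp)
    have "((\<lambda>r. (Y + e) * (d powr (n * (1 - n / r)) / n) + (1 - n / r) * (M * (d powr (- (n / r * n)) / (n / r * n))))
       \<longlongrightarrow> (Y + e) * (d powr (n * (1 - n / n)) / n) + (1 - n / n) * (M * (d powr (- (n / n * n)) / (n / n * n)))) (at_right n)"
      by (intro tendsto_add tendsto_mult tendsto_divide tendsto_const p p' q q1) (use n in simp_all)
    then show "((\<lambda>r. (Y + e) * (d powr (n * (1 - n / r)) / n) + (1 - n / r) * (M * (d powr (- (n / r * n)) / (n / r * n)))) \<longlongrightarrow> (Y + e) / n) (at_right n)"
      using n that by simp
    have "((\<lambda>r. (Y - e) * (d powr (n * (1 - n / r)) / n)) \<longlongrightarrow> (Y - e) * (d powr (n * (1 - n / n)) / n)) (at_right n)"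
      by (intro tendsto_mult tendsto_divide tendsto_const p) (use n in simp)
    then show "((\<lambda>r. (Y - e) * (d powr (n * (1 - n / r)) / n)) \<longlongrightarrow> (Y - e) / n) (at_right n)"
      using n that by simp
  qed
  have ev: "\<forall>\<^sub>F r in at_right n. a < L r \<and> L r < b" if ab: "a < Y / n" "Y / n < b" for a b
  proof -
    \<comment> \<open>Half the distance to the nearer end of the target interval, multiplied by n
      because the limits are divided by n.\<close>
    define e where "e = min (Y / n - a) (b - Y / n) * n / 2"
    have e: "e > 0" unfolding e_def using ab n by simp
    have "e / n \<le> (Y / n - a) / 2" "e / n \<le> (b - Y / n) / 2" unfolding e_def using n by simp_all
    then have eb: "a < (Y - e) / n" "(Y + e) / n < b" using ab by (simp_all add: diff_divide_distrib add_divide_distrib)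
    obtain d where d: "d > 0" "d \<le> 1" and close: "\<And>r t. n < r \<Longrightarrow> r < n + d \<Longrightarrow> 0 < t \<Longrightarrow> t \<le> d \<Longrightarrow>
      \<bar>(enn2real (quot_pow f r t) / ball_vol TYPE('a)) powr (n / r) - Y\<bar> < e"
      using ratio_close[OF f n2 e] unfolding n_def Y_def by blast
    have r_in: "\<forall>\<^sub>F r in at_right n. r \<in> {n<..<n + d}" by (rule eventually_at_right_real) (use d in simp)
    show ?thesis
      using r_in order_tendstoD(1)[OF lims(2)[OF d(1)] eb(1)] order_tendstoD(2)[OF lims(1)[OF d(1)] eb(2)]
    proof eventually_elim
      case (elim r)
      have r: "n < r" "r < n + d" "r \<le> n + 1" using elim(1) d by auto
      have q: "1 - n / r > 0" using r n by simp
      define b0 where "b0 = d powr (n * (1 - n / r)) / (n * (1 - n / r))"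
      define b1 where "b1 = M * (d powr (- (n / r * n)) / (n / r * n))"
      have b01: "b0 \<ge> 0" "b1 \<ge> 0" unfolding b0_def b1_def using q n M r by simp_all
      note bd = besov_pow_bounds[folded n_def, OF d M(1) r(1,2) e close[OF r(1,2)] M(2)[OF r(1,3)], folded b0_def b1_def]
      have fin: "besov_pow (n / r) r n f < top" by (rule le_less_trans[OF bd(2) ennreal_less_top])
      define B where "B = enn2real (besov_pow (n / r) r n f)"
      have qb: "(1 - n / r) * b0 = d powr (n * (1 - n / r)) / n" proof -
        have "x * (y / (n * x)) = y / n" if "x > 0" for x y :: real using that n by simp
        then show ?thesis unfolding b0_def using q by blast
      qed
      have "(Y - e) * b0 \<le> B"
      proof (cases "(Y - e) * b0 \<ge> 0")
        case True
        then show ?thesis unfolding B_def using enn2real_mono[OF bd(1)] fin by simp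
      next
        case False
        then show ?thesis unfolding B_def using enn2real_nonneg[of "besov_pow (n / r) r n f"] by linarith
      qed
      then have "(1 - n / r) * ((Y - e) * b0) \<le> L r" unfolding L_def B_def using q by (intro mult_left_mono) auto
      moreover have "(1 - n / r) * ((Y - e) * b0) = (Y - e) * (d powr (n * (1 - n / r)) / n)"
        unfolding qb[symmetric] by (rule mult.left_commute)
      ultimately have lo: "a < L r" using elim(2) by linarith
      have "Y + e > 0"
        using close[OF r(1,2), of d] d powr_ge_zero[of "enn2real (quot_pow f r d) / ball_vol TYPE('a)" "n / r"] by linarith
      then have "B \<le> (Y + e) * b0 + b1"
        unfolding B_def using b01 by (intro enn2real_leI bd(2)) auto
      then have "L r \<le> (1 - n / r) * ((Y + e) * b0 + b1)" unfolding L_def B_def using q by (intro mult_left_mono) auto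
      also have "\<dots> = (Y + e) * (d powr (n * (1 - n / r)) / n) + (1 - n / r) * b1"
        unfolding qb[symmetric] distrib_left by (simp only: mult.left_commute)
      also have "\<dots> < b" using elim(3) unfolding b1_def .
      finally show ?case using lo by blast
    qed
  qed
  show ?thesis
    unfolding n_def[symmetric] Y_def[symmetric] L_def[symmetric]
  proof (rule order_tendstoI)
    fix a assume "a < Y / n"
    then show "\<forall>\<^sub>F r in at_right n. a < L r" using ev[of a "Y / n + 1"] by (auto elim: eventually_mono)
  next
    fix b assume "Y / n < b"
    then show "\<forall>\<^sub>F r in at_right n. L r < b" using ev[of "Y / n - 1" b] by (auto elim: eventually_mono)
  qed
qed

lemma grad_pow_finite: "grad_pow f < \<infinity>"
proof -
  let ?n = "real DIM('a)"
  have l0: "(\<lambda>k. 1 / real (Suc k)) \<longlonglongrightarrow> 0" by (rule LIMSEQ_Suc[OF lim_1_over_n])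
  have ul: "(\<lambda>k. ?n + 1 / real (Suc k)) \<longlonglongrightarrow> ?n" using tendsto_add[OF tendsto_const l0, of ?n] by simp
  have "ennreal (alpha TYPE('a) ?n / (2 * ?n)) * grad_pow f < \<infinity>"
    by (rule quot_pow_tendsto(2)[OF f n2 ul _ _ l0]) auto
  moreover have "alpha TYPE('a) ?n / (2 * ?n) > 0" using alpha_eq_ball_integral(2)[where 'a='a] by simp
  ultimately show ?thesis by (auto simp: ennreal_mult_less_top)
qed

text \<open>A continuous gradient that vanishes almost everywhere vanishes everywhere, so
  \<open>f\<close> would be constant, contradicting compact support.\<close>

lemma grad_pow_pos:
  assumes nz: "\<exists>x. f x \<noteq> 0"
  shows "grad_pow f > 0"
proof (rule ccontr)
  note [measurable] = grad_measurable[OF f(1)]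
  assume "\<not> grad_pow f > 0"
  then have "grad_pow f = 0" by (simp add: zero_less_iff_neq_zero)
  then have "AE x in lborel. ennreal (norm (grad f x) powr real DIM('a)) = 0"
    unfolding grad_pow_def by (subst (asm) nn_integral_0_iff_AE) auto
  then have "AE x in lborel. x \<in> {x. grad f x = 0}"
    by (rule AE_mp) (auto intro!: AE_I2)
  then have ae: "AE x \<in> UNIV in lebesgue. x \<in> {x. grad f x = 0}" by (auto dest: AE_completion)
  have "closed {x. grad f x = 0}"
    using Ck_1_continuous_grad[OF f(1)] by (intro closed_Collect_eq continuous_on_const)
  then have g0: "grad f x = 0" for x
    using mem_closed_if_AE_lebesgue_open[OF open_UNIV _ ae] by auto
  have const: "f (x + h) = f x" for x h
    using C1_lipschitz[OF f(1), of 0 x h] g0 by simp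
  obtain x where x: "f x \<noteq> 0" using nz by blast
  obtain R where R: "R > 0" and R': "\<forall>x. f x \<noteq> 0 \<longrightarrow> norm x \<le> R"
    using compact_supp_bounded[OF f(2)] by blast
  obtain b :: 'a where b: "norm b = R + 1" using vector_choose_size[of "R + 1"] R by auto
  have "f b = f x" using const[of x "b - x"] by simp
  then have "norm b \<le> R" using x R' by metis
  then show False using b by simp
qed

lemma lim_const_pos: "\<exists>x. f x \<noteq> 0 \<Longrightarrow> lim_const f > 0"
  unfolding lim_const_def[OF f n2] using grad_pow_pos grad_pow_finite alpha_eq_ball_integral(2)[where 'a='a] ball_vol_pos[where 'a='a]
  by (intro mult_pos_pos divide_pos_pos) (auto simp: enn2real_positive_iff)

lemma grad_norm_C1: "grad_norm (real DIM('a)) f = enn2real (grad_pow f) powr (1 / real DIM('a))"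
proof -
  let ?g = "SOME g. weak_grad f g"
  have w: "weak_grad f (grad f)" by (rule weak_grad_C1[OF f])
  then have "weak_grad f ?g" by (rule someI[of "weak_grad f"])
  then have ae: "AE x in lborel. ?g x = grad f x" by (rule weak_grad_unique[OF _ w C1_compact_measurable[OF f n2]])
  have "(\<integral>\<^sup>+x. ennreal (norm (?g x) powr real DIM('a)) \<partial>lebesgue) = grad_pow f"
    unfolding grad_pow_def nn_integral_completion
    by (rule nn_integral_cong_AE) (use ae in eventually_elim, simp)
  then show ?thesis unfolding grad_norm_def by simp
qed

text \<open>Only the denominators vary. They stay above \<open>N0 / 2\<close> eventually, and
  \<open>f\<close> is bounded with bounded support, so one constant on a ball dominates.\<close>

lemma exp_integral_tendsto:
  assumes N: "N \<longlonglongrightarrow> N0" "N0 > (0::real)" and q: "q > 0" and c: "c > 0"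
  shows "(\<lambda>k. \<integral>\<^sup>+x. ennreal (exp ((c * \<bar>f x\<bar> / N k) powr q) - 1) \<partial>lebesgue)
     \<longlonglongrightarrow> (\<integral>\<^sup>+x. ennreal (exp ((c * \<bar>f x\<bar> / N0) powr q) - 1) \<partial>lebesgue)"
proof -
  note [measurable] = C1_compact_measurable[OF f n2]
  have cont: "continuous_on UNIV f" using Ck_Suc_subset[OF f(1)] by simp
  obtain R where R: "R > 0" and R': "\<forall>x. f x \<noteq> 0 \<longrightarrow> norm x \<le> R"
    using compact_supp_bounded[OF f(2)] by blast
  have "compact (f ` cball 0 R)" using cont by (intro compact_continuous_image) (auto intro: continuous_on_subset)
  then obtain C where C: "\<And>y. y \<in> f ` cball 0 R \<Longrightarrow> norm y \<le> C" using compact_imp_bounded bounded_iff by metis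
  have "\<forall>\<^sub>F k in sequentially. N0 / 2 < N k" by (rule order_tendstoD(1)[OF N(1)]) (use N(2) in simp)
  \<comment> \<open>Shifting the index by \<open>K\<close> makes the lower bound valid throughout
    without changing the limit.\<close>
  then obtain K where K: "\<And>k. k \<ge> K \<Longrightarrow> N0 / 2 < N k" by (auto simp: eventually_sequentially)
  have [measurable]: "cball (0::'a) R \<in> sets borel" by simp
  define W where "W = exp ((c * C / (N0 / 2)) powr q)"
  have "(\<lambda>k. \<integral>\<^sup>+x. ennreal (exp ((c * \<bar>f x\<bar> / N (k + K)) powr q) - 1) \<partial>lborel)
     \<longlonglongrightarrow> (\<integral>\<^sup>+x. ennreal (exp ((c * \<bar>f x\<bar> / N0) powr q) - 1) \<partial>lborel)"
  proof (rule nn_integral_dominated_convergence[where w = "\<lambda>x. ennreal W * indicator (cball 0 R) x"])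
    show "(\<integral>\<^sup>+x. ennreal W * indicator (cball (0::'a) R) x \<partial>lborel) < \<infinity>"
      using emeasure_lborel_cball_finite[of "0::'a" R] by (subst nn_integral_cmult_indicator) (auto simp: ennreal_mult_less_top)
    show "AE x in lborel. ennreal (exp ((c * \<bar>f x\<bar> / N (k + K)) powr q) - 1) \<le> ennreal W * indicator (cball 0 R) x" for k
    proof (rule AE_I2)
      fix x :: 'a
      show "ennreal (exp ((c * \<bar>f x\<bar> / N (k + K)) powr q) - 1) \<le> ennreal W * indicator (cball 0 R) x"
      proof (cases "x \<in> cball 0 R")
        case True
        have "\<bar>f x\<bar> \<le> C" using C[of "f x"] True by auto
        moreover have Nk: "N0 / 2 \<le> N (k + K)" using K[of "k + K"] by simp
        moreover have "0 < N (k + K)" using Nk N(2) by linarith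
        ultimately have "c * \<bar>f x\<bar> / N (k + K) \<le> c * C / (N0 / 2)" "0 \<le> c * \<bar>f x\<bar> / N (k + K)"
          using N(2) c by (auto intro!: frac_le mult_left_mono mult_nonneg_nonneg divide_nonneg_pos simp del: times_divide_eq_right divide_divide_eq_right divide_le_eq_numeral1)
        then have "exp ((c * \<bar>f x\<bar> / N (k + K)) powr q) \<le> W"
          unfolding W_def exp_le_cancel_iff using q by (intro powr_mono2) auto
        then have "exp ((c * \<bar>f x\<bar> / N (k + K)) powr q) - 1 \<le> W" by simp
        then show ?thesis using True by (simp add: ennreal_leI)
      next
        case False
        then have "f x = 0" using R' by auto
        then show ?thesis by simp
      qed
    qed
    show "AE x in lborel. (\<lambda>k. ennreal (exp ((c * \<bar>f x\<bar> / N (k + K)) powr q) - 1))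
      \<longlonglongrightarrow> ennreal (exp ((c * \<bar>f x\<bar> / N0) powr q) - 1)"
    proof (rule AE_I2)
      fix x :: 'a
      have "(\<lambda>k. exp ((c * \<bar>f x\<bar> / N k) powr q) - 1) \<longlonglongrightarrow> exp ((c * \<bar>f x\<bar> / N0) powr q) - 1"
        using N(2) q by (intro tendsto_diff tendsto_const tendsto_exp tendsto_powr' tendsto_divide N(1)) (auto intro: eventually_mono[OF order_tendstoD(1)[OF N]] simp: c less_imp_le)
      then show "(\<lambda>k. ennreal (exp ((c * \<bar>f x\<bar> / N (k + K)) powr q) - 1))
        \<longlonglongrightarrow> ennreal (exp ((c * \<bar>f x\<bar> / N0) powr q) - 1)"
        by (intro tendsto_ennrealI) (rule LIMSEQ_ignore_initial_segment)
    qed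
  qed measurable
  then show ?thesis unfolding nn_integral_completion by (rule LIMSEQ_offset)
qed

text \<open>The right limit is tested along sequences, the setting of dominated convergence; what
  remains is to identify the limit of the normalised norm.\<close>

lemma besov_MT_tendsto:
  assumes nz: "\<exists>x. f x \<noteq> 0" and c: "c > 0"
  shows "((\<lambda>r. besov_MT c r f) \<longlongrightarrow> sobolev_MT (real DIM('a) powr (1 / real DIM('a)) * c / gamma_const TYPE('a)) f)
    (at_right (real DIM('a)))"
proof -
  define n where "n = real DIM('a)"
  have n: "n \<ge> 2" using n2 by (simp add: n_def)
  define N where "N r = (1 - n / r) powr (1 / n) * besov_norm (n / r) r n f" for r
  define N0 where "N0 = (lim_const f / n) powr (1 / n)"
  let ?S = "\<integral>\<^sup>+x. ennreal (exp ((c * \<bar>f x\<bar> / N0) powr conj_exp n) - 1) \<partial>lebesgue"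
  have q: "conj_exp n > 0" unfolding conj_exp_def using n by simp
  have Y: "lim_const f > 0" by (rule lim_const_pos[OF nz])
  have N0: "N0 > 0" unfolding N0_def using Y n by simp
  have Nlim: "(N \<longlongrightarrow> N0) (at_right n)"
  proof -
    have "N r = ((1 - n / r) * enn2real (besov_pow (n / r) r n f)) powr (1 / n)" for r
      unfolding N_def besov_norm_def powr_mult ..
    moreover have "((\<lambda>r. ((1 - n / r) * enn2real (besov_pow (n / r) r n f)) powr (1 / n)) \<longlongrightarrow> N0) (at_right n)"
      unfolding N0_def using besov_pow_tendsto Y n unfolding n_def[symmetric] by (intro tendsto_powr tendsto_const) auto
    ultimately show ?thesis by presburger
  qed
  have "((\<lambda>r. besov_MT c r f) \<longlongrightarrow> ?S) (at_right n)"
    unfolding tendsto_at_iff_sequentially comp_def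
  proof (intro allI impI)
    fix X :: "nat \<Rightarrow> real" assume X: "\<forall>i. X i \<in> {n<..} - {n}" "X \<longlonglongrightarrow> n"
    have "(\<lambda>k. N (X k)) \<longlonglongrightarrow> N0"
      using Nlim X unfolding tendsto_at_iff_sequentially comp_def by blast
    then show "(\<lambda>k. besov_MT c (X k) f) \<longlonglongrightarrow> ?S"
      unfolding besov_MT_def Let_def n_def[symmetric] N_def[symmetric] by (rule exp_integral_tendsto[OF _ N0 q c])
  qed
  moreover have "?S = sobolev_MT (n powr (1 / n) * c / gamma_const TYPE('a)) f"
  proof -
    have a0: "alpha TYPE('a) n / (2 * n * ball_vol TYPE('a)) > 0"
      using alpha_eq_ball_integral(2)[where 'a='a] ball_vol_pos[where 'a='a] n by (simp add: n_def)
    have g: "grad_norm n f > 0" "gamma_const TYPE('a) > 0"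
      unfolding grad_norm_C1[folded n_def] gamma_const_def n_def[symmetric]
      using a0 grad_pow_pos[OF nz] grad_pow_finite by (auto simp: powr_gt_zero enn2real_eq_0_iff less_top)
    \<comment> \<open>The divisor \<open>n powr (1 / n)\<close> comes from the mass
      \<open>1 / n\<close> of the concentrating weight and reappears as a factor in the limiting
      constant.\<close>
    have "N0 = gamma_const TYPE('a) * grad_norm n f / n powr (1 / n)"
      unfolding N0_def lim_const_def[OF f n2] gamma_const_def grad_norm_C1[folded n_def] n_def[symmetric] powr_divide powr_mult ..
    then have N0_eq: "c * \<bar>f x\<bar> / N0 = n powr (1 / n) * c / gamma_const TYPE('a) * \<bar>f x\<bar> / grad_norm n f" for x
      by simp
    show ?thesis unfolding N0_eq sobolev_MT_def Let_def n_def[symmetric] ..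
  qed
  ultimately show ?thesis unfolding n_def by simp
qed

end

theorem theorem1p4:
  assumes "DIM('a::euclidean_space) \<ge> 2"
  shows "\<exists>c_n > 0.
    (\<exists>A::real. \<forall>r::real. \<forall>f::'a \<Rightarrow> real.
        r > real DIM('a) \<and> in_Besov (real DIM('a) / r) r (real DIM('a)) f \<and>
        0 < emeasure lebesgue {x. f x \<noteq> 0} \<and> emeasure lebesgue {x. f x \<noteq> 0} < \<infinity> \<longrightarrow>
        besov_MT c_n r f / emeasure lebesgue {x. f x \<noteq> 0} \<le> ennreal A)
  \<and> (\<forall>r0::real. r0 > real DIM('a) \<longrightarrow>
       (\<exists>c_tilde > 0. \<forall>r::real. \<forall>f::'a \<Rightarrow> real.
          real DIM('a) < r \<and> r < r0 \<and> in_W1 (real DIM('a)) f \<and>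
          0 < emeasure lebesgue {x. f x \<noteq> 0} \<and> emeasure lebesgue {x. f x \<noteq> 0} < \<infinity> \<longrightarrow>
          sobolev_MT c_tilde f \<le> besov_MT c_n r f))
  \<and> (\<forall>f::'a \<Rightarrow> real. f \<in> C2c \<and> (\<exists>x. f x \<noteq> 0) \<longrightarrow>
       ((\<lambda>r. besov_MT c_n r f) \<longlongrightarrow>
          sobolev_MT (real DIM('a) powr (1 / real DIM('a)) * c_n / gamma_const TYPE('a)) f)
       (at_right (real DIM('a))))"
proof -
  let ?n = "real DIM('a)"
  note c_pos = MT_const_pos[where 'a='a]
  show ?thesis
  proof (rule exI[of _ "MT_const TYPE('a)"], intro conjI)
    show "MT_const TYPE('a) > 0" by (rule c_pos)
    show "\<exists>A::real. \<forall>r::real. \<forall>f::'a \<Rightarrow> real.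
        r > ?n \<and> in_Besov (?n / r) r ?n f \<and>
        0 < emeasure lebesgue {x. f x \<noteq> 0} \<and> emeasure lebesgue {x. f x \<noteq> 0} < \<infinity> \<longrightarrow>
        besov_MT (MT_const TYPE('a)) r f / emeasure lebesgue {x. f x \<noteq> 0} \<le> ennreal A"
      \<comment> \<open>The constant \<open>A = 4\<close> is the total of the series in
        \<open>besov_MT_le\<close> divided by the measure of the support.\<close>
      by (intro exI[of _ 4] allI impI, elim conjE) (rule besov_MT_div_support_le[OF assms])
    show "\<forall>r0::real. r0 > ?n \<longrightarrow>
       (\<exists>c_tilde > 0. \<forall>r::real. \<forall>f::'a \<Rightarrow> real.
          ?n < r \<and> r < r0 \<and> in_W1 ?n f \<and>
          0 < emeasure lebesgue {x. f x \<noteq> 0} \<and> emeasure lebesgue {x. f x \<noteq> 0} < \<infinity> \<longrightarrow>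
          sobolev_MT c_tilde f \<le> besov_MT (MT_const TYPE('a)) r f)"
    proof (intro allI impI)
      fix r0 :: real assume r0: "r0 > ?n"
      \<comment> \<open>The geometric sum at the end point \<open>r0\<close>, which dominates those
        for all \<open>r < r0\<close> and is the only place where \<open>r0\<close> enters the
        constant.\<close>
      define S0 :: real where "S0 = 1 / (1 - 2 powr (- (?n / (2 * r0))))"
      have "r0 > 0" using r0 assms by linarith
      then have "- (?n / (2 * r0)) < 0" by simp
      then have "2 powr (- (?n / (2 * r0))) < (1::real)" by (rule powr_less_one[rotated]) simp
      then have "S0 > 0" unfolding S0_def by simp
      then have "MT_const TYPE('a) / embed_const TYPE('a) S0 powr (1 / ?n) > 0"
        using c_pos avg_const_pos[where 'a='a] ball_vol_pos[where 'a='a] unfolding embed_const_def by auto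
      then show "\<exists>c_tilde > 0. \<forall>r::real. \<forall>f::'a \<Rightarrow> real.
          ?n < r \<and> r < r0 \<and> in_W1 ?n f \<and>
          0 < emeasure lebesgue {x. f x \<noteq> 0} \<and> emeasure lebesgue {x. f x \<noteq> 0} < \<infinity> \<longrightarrow>
          sobolev_MT c_tilde f \<le> besov_MT (MT_const TYPE('a)) r f"
        by (intro exI[of _ "MT_const TYPE('a) / embed_const TYPE('a) S0 powr (1 / ?n)"] conjI allI impI; (elim conjE)?)
          (assumption, unfold S0_def, rule sobolev_MT_le_besov_MT[OF assms])
    qed
    show "\<forall>f::'a \<Rightarrow> real. f \<in> C2c \<and> (\<exists>x. f x \<noteq> 0) \<longrightarrow>
       ((\<lambda>r. besov_MT (MT_const TYPE('a)) r f) \<longlongrightarrow>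
          sobolev_MT (?n powr (1 / ?n) * MT_const TYPE('a) / gamma_const TYPE('a)) f) (at_right ?n)"
    proof (intro allI impI, elim conjE)
      fix f :: "'a \<Rightarrow> real" assume f: "f \<in> C2c" "\<exists>x. f x \<noteq> 0"
      have "f \<in> Ck (Suc (Suc 0))" "compact_supp f" using f(1) unfolding C2c_def numeral_2_eq_2 by blast+
      then show "((\<lambda>r. besov_MT (MT_const TYPE('a)) r f) \<longlongrightarrow>
          sobolev_MT (?n powr (1 / ?n) * MT_const TYPE('a) / gamma_const TYPE('a)) f) (at_right ?n)"
        using Ck_Suc_subset f(2) c_pos assms by (intro besov_MT_tendsto)
    qed
  qed
qed

end
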